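(* Let $k$ be a perfect field of characteristic $p>0$, let $G$ be a finite group with a local action $\rho\colon G\to\operatorname{Aut}_k k[[t]]$, and let $N$ be a normal subgroup of $G$ such that the order of $G/N$ is prime to $p$. Denote by $R_G$ and $R_N$ the versal deformation rings of the functors $D_G$ and $D_N$, and assume that $D_N$ is pro-representable. Then the restriction map $$\mathrm{res}\colon D_G\to D_N^{G/N}$$ is an isomorphism. In particular, $D_G$ is also pro-representable, and $$R_G\cong R_N/(\{gx-x\mid g\in G,\ x\in R_N\}).$$
   Context: $W(k)$ is the ring of Witt vectors of $k$; $\mathcal C$ is the category of local artinian $W(k)$-algebras with residue field $k$, with local $W(k)$-algebra homomorphisms; $\hat{\mathcal C}$ is the category of complete local noetherian $W(k)$-algebras with residue field $k$. Write $\Gamma_A=\operatorname{Aut}_A A[[t]]$. A local $G$-action is an injective homomorphism $\rho\colon G\to\Gamma_k$. A lift of $\rho$ to $A\in\mathcal C$ is a homomorphism $\rho_A\colon G\to\Gamma_A$ reducing to $\rho$ modulo $\mathfrak m_A$; two lifts are equivalent if conjugate by an element of $\ker(\Gamma_A\to\Gamma_k)$. $D_G\colon\mathcal C\to\mathbf{Sets}$ sends $A$ to the set of equivalence classes of lifts of $\rho$ to $A$; $D_N$ is the analogous functor for $\rho|_N$. $G/N$ acts on $D_N$: for $g\in G$ and $\kappa=[\rho_A]\in D_N(A)$, $g_*\kappa$ is the class of $n\mapsto r_g\rho_A(g^{-1}ng)r_g^{-1}$, where $r_g\in\Gamma_A$ is any lift of $\rho(g)$. $D_N^{G/N}$ is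 the subfunctor of invariants, and $\mathrm{res}$ is given by restricting lifts from $G$ to $N$. A functor $D\colon\mathcal C\to\mathbf{Sets}$ is pro-representable if it is isomorphic to $h_R=\operatorname{Hom}_{\hat{\mathcal C}}(R,\cdot)$ for some $R$ in $\hat{\mathcal C}$. A morphism $D\to E$ (with $D(k)$, $E(k)$ one-point sets) is smooth if $D(A')\to D(A)\times_{E(A)}E(A')$ is surjective for every surjection $A'\to A$ in $\mathcal C$. A versal hull of $D$ is a smooth morphism $h_R\to D$ inducing a bijection on values at $k[\varepsilon]=k[w]/w^2$; $R$ is then called a versal deformation ring of $D$ (unique up to non-unique isomorphism). The functors $D_G$, $D_N$ always have versal hulls, and if $D_N$ is pro-representable, then $R_N$ represents it. The action of $G/N$ on $D_N\cong h_{R_N}$ corresponds by Yoneda to an action of $G/N$ on $R_N$ (on the right) by ring automorphisms; $gx$ denotes the image of $x$ under the automorphism of $R_N$ corresponding to the class of $g$. *)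

theory Defs
  imports "HOL-Library.Poly_Mapping" "HOL-Algebra.Algebra"
begin

definition perfect_field_of_char :: "nat \<Rightarrow> 'k ring \<Rightarrow> bool" where
  "perfect_field_of_char p k \<longleftrightarrow>
     field k \<and> 0 < p \<and> (\<forall>n::nat. [n] \<cdot>\<^bsub>k\<^esub> \<one>\<^bsub>k\<^esub> = \<zero>\<^bsub>k\<^esub> \<longleftrightarrow> p dvd n) \<and>
     (\<lambda>x. x [^]\<^bsub>k\<^esub> p) ` carrier k = carrier k"

text \<open>Integer polynomials in the variables \<open>X\<^sub>i\<close> (index \<open>Inl i\<close>) and \<open>Y\<^sub>i\<close> (index \<open>Inr i\<close>);
  a monomial is a finitely supported exponent function.\<close>

type_synonym wpoly = "((nat + nat) \<Rightarrow>\<^sub>0 nat) \<Rightarrow>\<^sub>0 int"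

definition wvar :: "nat + nat \<Rightarrow> wpoly" where
  "wvar v = Poly_Mapping.single (Poly_Mapping.single v 1) 1"

definition wpoly_eval :: "'k ring \<Rightarrow> wpoly \<Rightarrow> (nat \<Rightarrow> 'k) \<Rightarrow> (nat \<Rightarrow> 'k) \<Rightarrow> 'k" where
  "wpoly_eval k P x y =
     (\<Oplus>\<^bsub>k\<^esub>m\<in>Poly_Mapping.keys P. [Poly_Mapping.lookup P m] \<cdot>\<^bsub>k\<^esub>
        (\<Otimes>\<^bsub>k\<^esub>v\<in>Poly_Mapping.keys m. case_sum x y v [^]\<^bsub>k\<^esub> Poly_Mapping.lookup m v))"

text \<open>The ghost polynomial \<open>w\<^sub>n(Z) = \<Sum>i\<le>n. p\<^sup>i Z\<^sub>i^(p^(n-i))\<close>.\<close>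

definition ghost :: "nat \<Rightarrow> (nat \<Rightarrow> wpoly) \<Rightarrow> nat \<Rightarrow> wpoly" where
  "ghost p Z n = (\<Sum>i\<le>n. of_nat (p ^ i) * Z i ^ (p ^ (n - i)))"

text \<open>The sequence \<open>S\<close> of polynomials with \<open>ghost p S n = \<Phi> n\<close> for all \<open>n\<close>, obtained by solving for
  \<open>S n\<close>. For the two right-hand sides used below, the coefficientwise division by \<open>p ^ n\<close> is exact
  by Witt's theorem.\<close>

function witt_solve :: "nat \<Rightarrow> (nat \<Rightarrow> wpoly) \<Rightarrow> nat \<Rightarrow> wpoly" where
  "witt_solve p \<Phi> n =
     Poly_Mapping.map (\<lambda>c. c div int (p ^ n))
       (\<Phi> n - (\<Sum>i\<in>{..<n}. of_nat (p ^ i) * witt_solve p \<Phi> i ^ (p ^ (n - i))))"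
  by pat_completeness auto
termination by (relation "measure (\<lambda>(p, \<Phi>, n). n)") auto

declare witt_solve.simps [simp del]

definition witt_add_poly :: "nat \<Rightarrow> nat \<Rightarrow> wpoly" where
  "witt_add_poly p =
     witt_solve p (\<lambda>n. ghost p (\<lambda>i. wvar (Inl i)) n + ghost p (\<lambda>i. wvar (Inr i)) n)"

definition witt_mult_poly :: "nat \<Rightarrow> nat \<Rightarrow> wpoly" where
  "witt_mult_poly p =
     witt_solve p (\<lambda>n. ghost p (\<lambda>i. wvar (Inl i)) n * ghost p (\<lambda>i. wvar (Inr i)) n)"

definition witt :: "nat \<Rightarrow> 'k ring \<Rightarrow> (nat \<Rightarrow> 'k) ring" where
  "witt p k =
     \<lparr>carrier = {x. \<forall>n. x n \<in> carrier k},
      monoid.mult = (\<lambda>x y n. wpoly_eval k (witt_mult_poly p n) x y),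
      monoid.one = (\<lambda>n. if n = 0 then \<one>\<^bsub>k\<^esub> else \<zero>\<^bsub>k\<^esub>),
      ring.zero = (\<lambda>n. \<zero>\<^bsub>k\<^esub>),
      ring.add = (\<lambda>x y n. wpoly_eval k (witt_add_poly p n) x y)\<rparr>"

text \<open>A ring with a structure map \<open>alg\<close> from \<open>W(k)\<close> and a residue map \<open>red\<close> to \<open>k\<close>. Since
  \<open>W(k) \<rightarrow> k\<close>, \<open>w \<mapsto> w 0\<close>, is surjective and \<open>red\<close> is \<open>W(k)\<close>-linear, \<open>red\<close> is
  determined by \<open>alg\<close>; it is recorded only to identify the residue field with \<open>k\<close>.\<close>

record ('a, 'k) walg = "'a ring" +
  alg :: "(nat \<Rightarrow> 'k) \<Rightarrow> 'a"
  red :: "'a \<Rightarrow> 'k"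

definition local_walg :: "nat \<Rightarrow> 'k ring \<Rightarrow> ('a, 'k) walg \<Rightarrow> bool" where
  "local_walg p k A \<longleftrightarrow>
     cring A \<and> (\<exists>!M. maximalideal M A) \<and>
     alg A \<in> ring_hom (witt p k) A \<and>
     red A \<in> ring_hom A k \<and> red A ` carrier A = carrier k \<and>
     (\<forall>w \<in> carrier (witt p k). red A (alg A w) = w 0)"

definition max_ideal :: "'k ring \<Rightarrow> ('a, 'k) walg \<Rightarrow> 'a set" where
  "max_ideal k A = a_kernel A k (red A)"

definition artinian :: "('a, 'm) ring_scheme \<Rightarrow> bool" where
  "artinian R \<longleftrightarrow>
     ring R \<and>
     (\<forall>I :: nat \<Rightarrow> 'a set. (\<forall>n. ideal (I n) R) \<and> (\<forall>n. I (Suc n) \<subseteq> I n) \<longrightarrow>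
        (\<exists>m. \<forall>n\<ge>m. I n = I m))"

text \<open>Bijectivity of \<open>A \<rightarrow> lim A/\<mm>\<^sup>n\<close>: every compatible sequence of residues modulo the powers of the
  maximal ideal comes from a unique element.\<close>

definition adically_complete :: "'k ring \<Rightarrow> ('a, 'k) walg \<Rightarrow> bool" where
  "adically_complete k A \<longleftrightarrow>
     (\<forall>x :: nat \<Rightarrow> 'a.
        (\<forall>n. x n \<in> carrier A) \<and>
        (\<forall>n. x (Suc n) \<ominus>\<^bsub>A\<^esub> x n \<in> max_ideal k A [^]\<^bsub>ideals_set A\<^esub> n) \<longrightarrow>
        (\<exists>!a. a \<in> carrier A \<and> (\<forall>n. a \<ominus>\<^bsub>A\<^esub> x n \<in> max_ideal k A [^]\<^bsub>ideals_set A\<^esub> n)))"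

definition Art :: "nat \<Rightarrow> 'k ring \<Rightarrow> ('a, 'k) walg set" where
  "Art p k = {A. local_walg p k A \<and> artinian A}"

definition Art_hat :: "nat \<Rightarrow> 'k ring \<Rightarrow> ('a, 'k) walg set" where
  "Art_hat p k = {A. local_walg p k A \<and> noetherian_ring A \<and> adically_complete k A}"

text \<open>Local homomorphisms of \<open>W(k)\<close>-algebras, extensional outside the carrier.\<close>

definition walg_hom ::
  "nat \<Rightarrow> 'k ring \<Rightarrow> ('a, 'k) walg \<Rightarrow> ('b, 'k) walg \<Rightarrow> ('a \<Rightarrow> 'b) set" where
  "walg_hom p k A B =
     {f \<in> extensional (carrier A).
        f \<in> ring_hom A B \<and>
        (\<forall>w \<in> carrier (witt p k). f (alg A w) = alg B w) \<and>
        f ` max_ideal k A \<subseteq> max_ideal k B}"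

definition walg_iso ::
  "nat \<Rightarrow> 'k ring \<Rightarrow> ('a, 'k) walg \<Rightarrow> ('b, 'k) walg \<Rightarrow> ('a \<Rightarrow> 'b) set" where
  "walg_iso p k A B = {f \<in> walg_hom p k A B. bij_betw f (carrier A) (carrier B)}"

text \<open>The quotient by an ideal contained in the maximal ideal.\<close>

definition quot_walg :: "('a, 'k) walg \<Rightarrow> 'a set \<Rightarrow> ('a set, 'k) walg" where
  "quot_walg R I =
     \<lparr>carrier = carrier (R Quot I), monoid.mult = monoid.mult (R Quot I),
      monoid.one = monoid.one (R Quot I),
      ring.zero = ring.zero (R Quot I), ring.add = ring.add (R Quot I),
      alg = (\<lambda>w. I +>\<^bsub>R\<^esub> alg R w),
      red = (\<lambda>c. the_elem (red R ` c))\<rparr>"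

text \<open>\<open>k[\<epsilon>]\<close>, with \<open>(a, b)\<close> standing for \<open>a + b\<epsilon>\<close>.\<close>

definition dual_numbers :: "'k ring \<Rightarrow> ('k \<times> 'k, 'k) walg" where
  "dual_numbers k =
     \<lparr>carrier = carrier k \<times> carrier k,
      monoid.mult = (\<lambda>(a, b) (c, d). (a \<otimes>\<^bsub>k\<^esub> c, (a \<otimes>\<^bsub>k\<^esub> d) \<oplus>\<^bsub>k\<^esub> (b \<otimes>\<^bsub>k\<^esub> c))),
      monoid.one = (\<one>\<^bsub>k\<^esub>, \<zero>\<^bsub>k\<^esub>), ring.zero = (\<zero>\<^bsub>k\<^esub>, \<zero>\<^bsub>k\<^esub>),
      ring.add = (\<lambda>(a, b) (c, d). (a \<oplus>\<^bsub>k\<^esub> c, b \<oplus>\<^bsub>k\<^esub> d)),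
      alg = (\<lambda>w. (w 0, \<zero>\<^bsub>k\<^esub>)), red = fst\<rparr>"

text \<open>Set-valued functors and their morphisms are given on the objects of \<^const>\<open>Art\<close> with elements
  in a type \<open>'u\<close>. Every object of \<^const>\<open>Art\<close> and \<^const>\<open>Art_hat\<close>, over any type, has at most the
  cardinality of \<open>W(k)\<close>, hence has an isomorphic copy in \<open>'u\<close> as soon as \<open>W(k)\<close> embeds into \<open>'u\<close>.\<close>

record ('u, 'k, 'x) set_functor =
  fobj :: "('u, 'k) walg \<Rightarrow> 'x set"
  fmap :: "('u, 'k) walg \<Rightarrow> ('u, 'k) walg \<Rightarrow> ('u \<Rightarrow> 'u) \<Rightarrow> 'x \<Rightarrow> 'x"

definition nat_trans :: "nat \<Rightarrow> 'k ring \<Rightarrow> ('u, 'k, 'x) set_functor \<Rightarrow> ('u, 'k, 'y) set_functor \<Rightarrow>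
    (('u, 'k) walg \<Rightarrow> 'x \<Rightarrow> 'y) \<Rightarrow> bool" where
  "nat_trans p k D E \<eta> \<longleftrightarrow>
     (\<forall>A \<in> Art p k. \<forall>x \<in> fobj D A. \<eta> A x \<in> fobj E A) \<and>
     (\<forall>A \<in> Art p k. \<forall>B \<in> Art p k. \<forall>f \<in> walg_hom p k A B. \<forall>x \<in> fobj D A.
        \<eta> B (fmap D A B f x) = fmap E A B f (\<eta> A x))"

definition nat_iso :: "nat \<Rightarrow> 'k ring \<Rightarrow> ('u, 'k, 'x) set_functor \<Rightarrow> ('u, 'k, 'y) set_functor \<Rightarrow>
    (('u, 'k) walg \<Rightarrow> 'x \<Rightarrow> 'y) \<Rightarrow> bool" where
  "nat_iso p k D E \<eta> \<longleftrightarrow>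
     nat_trans p k D E \<eta> \<and> (\<forall>A \<in> Art p k. bij_betw (\<eta> A) (fobj D A) (fobj E A))"

definition hom_functor ::
  "nat \<Rightarrow> 'k ring \<Rightarrow> ('r, 'k) walg \<Rightarrow> ('u, 'k, 'r \<Rightarrow> 'u) set_functor" where
  "hom_functor p k R =
     \<lparr>fobj = (\<lambda>A. walg_hom p k R A), fmap = (\<lambda>A B f h. compose (carrier R) f h)\<rparr>"

definition pro_representable :: "nat \<Rightarrow> 'k ring \<Rightarrow> ('u, 'k, 'x) set_functor \<Rightarrow> bool" where
  "pro_representable p k D \<longleftrightarrow>
     (\<exists>(R :: ('u, 'k) walg) \<in> Art_hat p k. \<exists>\<eta>. nat_iso p k (hom_functor p k R) D \<eta>)"

definition smooth_trans :: "nat \<Rightarrow> 'k ring \<Rightarrow> ('u, 'k, 'x) set_functor \<Rightarrow> ('u, 'k, 'y) set_functor \<Rightarrow>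
    (('u, 'k) walg \<Rightarrow> 'x \<Rightarrow> 'y) \<Rightarrow> bool" where
  "smooth_trans p k D E \<eta> \<longleftrightarrow>
     nat_trans p k D E \<eta> \<and>
     (\<forall>A' \<in> Art p k. \<forall>A \<in> Art p k. \<forall>f \<in> walg_hom p k A' A. f ` carrier A' = carrier A \<longrightarrow>
        (\<forall>x \<in> fobj D A. \<forall>y \<in> fobj E A'. \<eta> A x = fmap E A' A f y \<longrightarrow>
           (\<exists>z \<in> fobj D A'. fmap D A' A f z = x \<and> \<eta> A' z = y)))"

text \<open>Values at \<open>k[\<epsilon>]\<close> are values at any of its isomorphic copies in \<open>'u\<close>.\<close>

definition versal_hull :: "nat \<Rightarrow> 'k ring \<Rightarrow> ('r, 'k) walg \<Rightarrow>
    (('u, 'k) walg \<Rightarrow> ('r \<Rightarrow> 'u) \<Rightarrow> 'x) \<Rightarrow> ('u, 'k, 'x) set_functor \<Rightarrow> bool" where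
  "versal_hull p k R \<xi> D \<longleftrightarrow>
     R \<in> Art_hat p k \<and> smooth_trans p k (hom_functor p k R) D \<xi> \<and>
     (\<forall>A \<in> Art p k. walg_iso p k (dual_numbers k) A \<noteq> {} \<longrightarrow>
        bij_betw (\<xi> A) (fobj (hom_functor p k R) A) (fobj D A))"

definition ps_ring :: "('a, 'm) ring_scheme \<Rightarrow> (nat \<Rightarrow> 'a) ring" where
  "ps_ring A =
     \<lparr>carrier = {F. \<forall>n. F n \<in> carrier A},
      monoid.mult = (\<lambda>F H n. \<Oplus>\<^bsub>A\<^esub>i\<in>{..n}. F i \<otimes>\<^bsub>A\<^esub> H (n - i)),
      monoid.one = (\<lambda>n. if n = 0 then \<one>\<^bsub>A\<^esub> else \<zero>\<^bsub>A\<^esub>),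
      ring.zero = (\<lambda>n. \<zero>\<^bsub>A\<^esub>),
      ring.add = (\<lambda>F H n. F n \<oplus>\<^bsub>A\<^esub> H n)\<rparr>"

definition ps_const :: "('a, 'm) ring_scheme \<Rightarrow> 'a \<Rightarrow> nat \<Rightarrow> 'a" where
  "ps_const A a = (\<lambda>n. if n = 0 then a else \<zero>\<^bsub>A\<^esub>)"

definition Gam :: "('a, 'm) ring_scheme \<Rightarrow> ((nat \<Rightarrow> 'a) \<Rightarrow> (nat \<Rightarrow> 'a)) monoid" where
  "Gam A =
     \<lparr>carrier = {\<phi> \<in> extensional (carrier (ps_ring A)).
        \<phi> \<in> ring_iso (ps_ring A) (ps_ring A) \<and>
        (\<forall>a \<in> carrier A. \<phi> (ps_const A a) = ps_const A a)},
      monoid.mult = compose (carrier (ps_ring A)),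
      monoid.one = (\<lambda>F\<in>carrier (ps_ring A). F)\<rparr>"

text \<open>\<open>\<psi>\<close> is compatible with \<open>\<phi>\<close> along the map \<open>F \<mapsto> f \<circ> F\<close> of power series that applies \<open>f\<close> to
  the coefficients. For a morphism \<open>f\<close> of \<^const>\<open>Art\<close>, and for \<open>f = red A\<close>, there is exactly one \<open>\<psi>\<close> in the
  target group compatible with a given \<open>\<phi>\<close>, namely its base change along \<open>f\<close>.\<close>

definition lies_over :: "('a, 'm) ring_scheme \<Rightarrow> ('a \<Rightarrow> 'b) \<Rightarrow> ((nat \<Rightarrow> 'a) \<Rightarrow> (nat \<Rightarrow> 'a)) \<Rightarrow>
    ((nat \<Rightarrow> 'b) \<Rightarrow> (nat \<Rightarrow> 'b)) \<Rightarrow> bool" where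
  "lies_over A f \<phi> \<psi> \<longleftrightarrow> (\<forall>F \<in> carrier (ps_ring A). \<psi> (f \<circ> F) = f \<circ> \<phi> F)"

definition Gam_map :: "('a, 'm) ring_scheme \<Rightarrow> ('b, 'n) ring_scheme \<Rightarrow> ('a \<Rightarrow> 'b) \<Rightarrow>
    ((nat \<Rightarrow> 'a) \<Rightarrow> (nat \<Rightarrow> 'a)) \<Rightarrow> ((nat \<Rightarrow> 'b) \<Rightarrow> (nat \<Rightarrow> 'b))" where
  "Gam_map A B f \<phi> = (THE \<psi>. \<psi> \<in> carrier (Gam B) \<and> lies_over A f \<phi> \<psi>)"

definition Gam_ker :: "'k ring \<Rightarrow> ('a, 'k) walg \<Rightarrow> ((nat \<Rightarrow> 'a) \<Rightarrow> (nat \<Rightarrow> 'a)) set" where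
  "Gam_ker k A = {\<gamma> \<in> carrier (Gam A). lies_over A (red A) \<gamma> \<one>\<^bsub>Gam k\<^esub>}"

definition local_action ::
  "'k ring \<Rightarrow> 'g monoid \<Rightarrow> ('g \<Rightarrow> (nat \<Rightarrow> 'k) \<Rightarrow> (nat \<Rightarrow> 'k)) \<Rightarrow> bool" where
  "local_action k G \<rho> \<longleftrightarrow> \<rho> \<in> hom G (Gam k) \<and> inj_on \<rho> (carrier G)"

type_synonym ('g, 'a) lift = "'g \<Rightarrow> (nat \<Rightarrow> 'a) \<Rightarrow> (nat \<Rightarrow> 'a)"

definition lifts ::
  "'g monoid \<Rightarrow> ('g, 'k) lift \<Rightarrow> ('a, 'k) walg \<Rightarrow> ('g, 'a) lift set" where
  "lifts G \<rho> A =
     {\<sigma> \<in> extensional (carrier G).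
        \<sigma> \<in> hom G (Gam A) \<and> (\<forall>g \<in> carrier G. lies_over A (red A) (\<sigma> g) (\<rho> g))}"

definition lift_equiv ::
  "'k ring \<Rightarrow> 'g monoid \<Rightarrow> ('g, 'k) lift \<Rightarrow> ('a, 'k) walg \<Rightarrow> (('g, 'a) lift \<times> ('g, 'a) lift) set" where
  "lift_equiv k G \<rho> A =
     {(\<sigma>, \<tau>). \<sigma> \<in> lifts G \<rho> A \<and> \<tau> \<in> lifts G \<rho> A \<and>
        (\<exists>\<gamma> \<in> Gam_ker k A. \<forall>g \<in> carrier G.
           \<tau> g = \<gamma> \<otimes>\<^bsub>Gam A\<^esub> \<sigma> g \<otimes>\<^bsub>Gam A\<^esub> inv\<^bsub>Gam A\<^esub> \<gamma>)}"

text \<open>An operation on equivalence classes that is induced by an operation on representatives is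
  written as the union of the resulting classes, as in the library's treatment of quotients: by
  well-definedness all of these classes coincide.\<close>

definition def_functor ::
  "'k ring \<Rightarrow> 'g monoid \<Rightarrow> ('g, 'k) lift \<Rightarrow> ('u, 'k, ('g, 'u) lift set) set_functor" where
  "def_functor k G \<rho> =
     \<lparr>fobj = (\<lambda>A. lifts G \<rho> A // lift_equiv k G \<rho> A),
      fmap = (\<lambda>A B f \<kappa>. \<Union>\<sigma>\<in>\<kappa>.
        lift_equiv k G \<rho> B `` {\<lambda>g\<in>carrier G. Gam_map A B f (\<sigma> g)})\<rparr>"

abbreviation sub_group :: "'g monoid \<Rightarrow> 'g set \<Rightarrow> 'g monoid" where
  "sub_group G N \<equiv> G\<lparr>carrier := N\<rparr>"

text \<open>The action of the class of \<open>g\<close> on deformations of \<open>\<rho>\<close> restricted to \<open>N\<close>.\<close>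

definition conj_act :: "'k ring \<Rightarrow> 'g monoid \<Rightarrow> 'g set \<Rightarrow> ('g, 'k) lift \<Rightarrow> ('u, 'k) walg \<Rightarrow> 'g \<Rightarrow>
    ('g, 'u) lift set \<Rightarrow> ('g, 'u) lift set" where
  "conj_act k G N \<rho> A g \<kappa> =
     (\<Union>\<sigma>\<in>\<kappa>. \<Union>r\<in>{r \<in> carrier (Gam A). lies_over A (red A) r (\<rho> g)}.
        lift_equiv k (sub_group G N) \<rho> A ``
          {\<lambda>n\<in>N. r \<otimes>\<^bsub>Gam A\<^esub> \<sigma> (inv\<^bsub>G\<^esub> g \<otimes>\<^bsub>G\<^esub> n \<otimes>\<^bsub>G\<^esub> g) \<otimes>\<^bsub>Gam A\<^esub> inv\<^bsub>Gam A\<^esub> r})"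

definition inv_functor :: "'k ring \<Rightarrow> 'g monoid \<Rightarrow> 'g set \<Rightarrow> ('g, 'k) lift \<Rightarrow>
    ('u, 'k, ('g, 'u) lift set) set_functor" where
  "inv_functor k G N \<rho> =
     \<lparr>fobj = (\<lambda>A. {\<kappa> \<in> fobj (def_functor k (sub_group G N) \<rho>) A.
        \<forall>g \<in> carrier G. conj_act k G N \<rho> A g \<kappa> = \<kappa>}),
      fmap = fmap (def_functor k (sub_group G N) \<rho>)\<rparr>"

definition res_map :: "'k ring \<Rightarrow> 'g monoid \<Rightarrow> 'g set \<Rightarrow> ('g, 'k) lift \<Rightarrow> ('u, 'k) walg \<Rightarrow>
    ('g, 'u) lift set \<Rightarrow> ('g, 'u) lift set" where
  "res_map k G N \<rho> A \<kappa> = (\<Union>\<sigma>\<in>\<kappa>. lift_equiv k (sub_group G N) \<rho> A `` {restrict \<sigma> N})"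

text \<open>If \<open>\<xi>\<close> is an isomorphism from \<open>h\<^sub>R\<close> to the deformation functor of \<open>\<rho>\<close> restricted to \<open>N\<close>, this is
  the automorphism \<open>x \<mapsto> gx\<close> of \<open>R\<close> that corresponds to \<open>g\<^sub>*\<close> by Yoneda: precomposition with it
  is the action of \<open>g\<^sub>*\<close> on \<open>h\<^sub>R\<close>. This gives a right action on \<open>R\<close>.\<close>

definition yoneda_aut :: "nat \<Rightarrow> 'k ring \<Rightarrow> 'g monoid \<Rightarrow> 'g set \<Rightarrow> ('g, 'k) lift \<Rightarrow> ('r, 'k) walg \<Rightarrow>
    (('u, 'k) walg \<Rightarrow> ('r \<Rightarrow> 'u) \<Rightarrow> ('g, 'u) lift set) \<Rightarrow> 'g \<Rightarrow> 'r \<Rightarrow> 'r" where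
  "yoneda_aut p k G N \<rho> R \<xi> g =
     (THE \<alpha>. \<alpha> \<in> walg_iso p k R R \<and>
        (\<forall>A \<in> Art p k. \<forall>f \<in> walg_hom p k R A.
           \<xi> A (compose (carrier R) f \<alpha>) = conj_act k G N \<rho> A g (\<xi> A f)))"

definition coinv_ideal :: "nat \<Rightarrow> 'k ring \<Rightarrow> 'g monoid \<Rightarrow> 'g set \<Rightarrow> ('g, 'k) lift \<Rightarrow> ('r, 'k) walg \<Rightarrow>
    (('u, 'k) walg \<Rightarrow> ('r \<Rightarrow> 'u) \<Rightarrow> ('g, 'u) lift set) \<Rightarrow> 'r set" where
  "coinv_ideal p k G N \<rho> R \<xi> =
     Idl\<^bsub>R\<^esub> {yoneda_aut p k G N \<rho> R \<xi> g x \<ominus>\<^bsub>R\<^esub> x | g x. g \<in> carrier G \<and> x \<in> carrier R}"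

end

theory Submission
  imports Defs
begin

text \<open>The kernel of \<open>\<Gamma>\<^sub>A \<rightarrow> \<Gamma>\<^sub>k\<close> has a finite filtration by congruence subgroups, normal in
  \<open>\<Gamma>\<^sub>A\<close>, whose successive quotients are abelian and killed by \<open>p\<close>. Given a lift \<open>\<sigma>\<close> of
  \<open>\<rho>|\<^sub>N\<close> with invariant class, the elements \<open>s\<close> over \<open>\<rho> g\<close> with \<open>s (\<sigma> n) s\<inverse> = \<sigma> (g n g\<inverse>)\<close>
  are the fibres of an extension of \<open>G\<close> that is split over \<open>N\<close>; as the index of \<open>N\<close> is prime to
  \<open>p\<close>, averaging over cosets along the filtration extends the splitting to \<open>G\<close>, uniquely up to
  conjugation. So restriction is bijective.

  If \<open>R\<close> represents \<open>D\<^sub>N\<close>, a homomorphism on \<open>R\<close> is invariant iff it kills all \<open>gx - x\<close>, so the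
  invariants are represented by the quotient. A versal hull \<open>R'\<close> of a functor represented by \<open>S\<close> is
  isomorphic to \<open>S\<close>: smoothness yields a retraction of the comparison map \<open>S \<rightarrow> R'\<close>, and this retraction
  is injective because \<open>S\<close> and \<open>R'\<close> have the same tangent vectors. In particular the given hull of
  \<open>D\<^sub>N\<close> represents \<open>D\<^sub>N\<close>.\<close>

section \<open>Extensions by groups of exponent prime to the quotient\<close>

text \<open>The obstacle: only the index of N is assumed prime to p, while p may divide the order of
  N, so averages have to run over cosets. They make sense because the kernel of the extension
  centralises the image of N: N acts trivially on each graded piece, and every cocycle that occurs
  is constant on cosets of N. The prime p enters through the filtration: if \<gamma> moves t by a
  series d with coefficients in m^i, i \<ge> 1, then its p-th power moves t by p d up to m^(2i), and
  p lies in m. Automorphisms of A[[t]] are handled through the image of t alone. This rests on two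
  facts: every automorphism sends t to a series with constant term in m, and substitution of such a
  series converges (m,t)-adically, where nilpotency of m makes each coefficient stabilise. On the
  ring side, the representing rings lie in general outside the category on which the functors live,
  so no identity morphism can be inserted into them. Yoneda arguments run over the quotients
  R/m^(n+1) and return to R by completeness, with Krull's intersection theorem for
  separatedness.\<close>

lemma (in group) inv_mult_cancel:
  assumes "x \<in> carrier G" "y \<in> carrier G"
  shows "inv x \<otimes> (x \<otimes> y) = y" "x \<otimes> (inv x \<otimes> y) = y"
  using assms by (simp_all flip: m_assoc)

text \<open>\<open>E g\<close> is the fibre over \<open>g\<close> of an extension of \<open>G\<close> that is already split over \<open>N\<close> by \<open>\<nu>\<close>;
  its kernel \<open>E \<one>\<close> has the filtration \<open>C\<close>.\<close>

locale coprime_extension =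
  G: group G + N: normal N G + group H
  for G :: "('g, 'm) monoid_scheme" (structure) and N and H :: "('h, 'n) monoid_scheme" (structure) +
  fixes E :: "'g \<Rightarrow> 'h set" and \<nu> :: "'g \<Rightarrow> 'h" and C :: "nat \<Rightarrow> 'h set" and p l :: nat
  assumes finG: "finite (carrier G)"
    and cop: "coprime (order (G Mod N)) p"
    and E_carrier: "g \<in> carrier G \<Longrightarrow> s \<in> E g \<Longrightarrow> s \<in> carrier H"
    and E_mult: "\<lbrakk>g \<in> carrier G; h \<in> carrier G; s \<in> E g; t \<in> E h\<rbrakk> \<Longrightarrow> s \<otimes>\<^bsub>H\<^esub> t \<in> E (g \<otimes> h)"
    and E_inv: "\<lbrakk>g \<in> carrier G; s \<in> E g\<rbrakk> \<Longrightarrow> inv\<^bsub>H\<^esub> s \<in> E (inv g)"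
    and E_nu: "n \<in> N \<Longrightarrow> \<nu> n \<in> E n"
    and nu_mult: "\<lbrakk>m \<in> N; n \<in> N\<rbrakk> \<Longrightarrow> \<nu> (m \<otimes> n) = \<nu> m \<otimes>\<^bsub>H\<^esub> \<nu> n"
    and nu_conj: "\<lbrakk>g \<in> carrier G; n \<in> N; s \<in> E g\<rbrakk> \<Longrightarrow> s \<otimes>\<^bsub>H\<^esub> \<nu> n = \<nu> (g \<otimes> n \<otimes> inv g) \<otimes>\<^bsub>H\<^esub> s"
    and C_0: "C 0 = E \<one>" and C_l: "C l = {\<one>\<^bsub>H\<^esub>}"
    and C_subgroup: "subgroup (C i) H"
    and C_Suc: "C (Suc i) \<subseteq> C i"
    and C_conj: "\<lbrakk>g \<in> carrier G; s \<in> E g; c \<in> C i\<rbrakk> \<Longrightarrow> s \<otimes>\<^bsub>H\<^esub> c \<otimes>\<^bsub>H\<^esub> inv\<^bsub>H\<^esub> s \<in> C i"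
    and C_comm: "\<lbrakk>x \<in> C i; y \<in> C i\<rbrakk> \<Longrightarrow> x \<otimes>\<^bsub>H\<^esub> y \<otimes>\<^bsub>H\<^esub> inv\<^bsub>H\<^esub> (y \<otimes>\<^bsub>H\<^esub> x) \<in> C (Suc i)"
    and C_pow: "x \<in> C i \<Longrightarrow> x [^]\<^bsub>H\<^esub> p \<in> C (Suc i)"
begin

abbreviation hmult (infixl \<open>\<bullet>\<close> 70) where "x \<bullet> y \<equiv> x \<otimes>\<^bsub>H\<^esub> y"

abbreviation hinv (\<open>\<iota> _\<close> [81] 80) where "\<iota> x \<equiv> inv\<^bsub>H\<^esub> x"

lemma N_mult_iff: "\<lbrakk>n \<in> N; g \<in> carrier G\<rbrakk> \<Longrightarrow> n \<otimes> g \<in> N \<longleftrightarrow> g \<in> N"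
  using N.m_closed N.m_inv_closed by (metis G.inv_solve_left' N.mem_carrier)

lemma C_le_0: "C i \<subseteq> C 0"
  by (induction i) (use C_Suc in auto)

lemma C_carrier: "c \<in> C i \<Longrightarrow> c \<in> carrier H"
  using subgroup.mem_carrier[OF C_subgroup] .

lemma C_E: "c \<in> C i \<Longrightarrow> c \<in> E \<one>"
  using C_le_0 C_0 by auto

lemma E_nonempty_mult: "\<lbrakk>g \<in> carrier G; s \<in> E g; c \<in> C i\<rbrakk> \<Longrightarrow> c \<bullet> s \<in> E g"
  using E_mult[of "\<one>" g c s] C_E by simp

lemma C_mult: "\<lbrakk>x \<in> C i; y \<in> C i\<rbrakk> \<Longrightarrow> x \<bullet> y \<in> C i"
  by (rule subgroup.m_closed[OF C_subgroup])

lemma C_inv: "x \<in> C i \<Longrightarrow> \<iota> x \<in> C i"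
  by (rule subgroup.m_inv_closed[OF C_subgroup])

lemma C_one: "\<one>\<^bsub>H\<^esub> \<in> C i"
  by (rule subgroup.one_closed[OF C_subgroup])

lemma nu_carrier: "n \<in> N \<Longrightarrow> \<nu> n \<in> carrier H"
  using E_nu E_carrier N.mem_carrier by blast

lemma nu_one: "\<nu> \<one> = \<one>\<^bsub>H\<^esub>"
  using nu_mult[of "\<one>" "\<one>"] nu_carrier[of "\<one>"] N.one_closed by (simp add: r_cancel_one)

text \<open>The case g = \<one> of \<open>nu_conj\<close>. This is why N acts trivially on the
  graded pieces, so that the defects of a section depend on cosets of N only.\<close>

lemma C_nu_commute: "\<lbrakk>c \<in> C i; n \<in> N\<rbrakk> \<Longrightarrow> c \<bullet> \<nu> n = \<nu> n \<bullet> c"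
  using nu_conj[of "\<one>" n c] C_E N.mem_carrier by simp

lemma C_conj_nu: "\<lbrakk>n \<in> N; c \<in> C i\<rbrakk> \<Longrightarrow> \<nu> n \<bullet> c \<bullet> \<iota> (\<nu> n) = c"
  using nu_carrier[of n] C_carrier[of c i] by (simp add: m_assoc flip: C_nu_commute)

lemma conj_closed: "\<lbrakk>g \<in> carrier G; n \<in> N\<rbrakk> \<Longrightarrow> g \<otimes> n \<otimes> inv g \<in> N"
  by (rule N.inv_op_closed2)

section \<open>Representatives of the cosets of N\<close>

definition transversal :: "'g \<Rightarrow> 'g" where
  "transversal g = (if g \<in> N then \<one> else (SOME x. x \<in> N #> g))"

lemma transversal_coset: "g \<in> carrier G \<Longrightarrow> transversal g \<in> N #> g"
  using someI[of "\<lambda>x. x \<in> N #> g" g] G.coset_join2[of g N] N.one_closed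
  by (auto simp: transversal_def G.rcos_self N.subgroup_axioms)

lemma transversal_closed: "g \<in> carrier G \<Longrightarrow> transversal g \<in> carrier G"
  using transversal_coset G.r_coset_subset_G[OF N.subset] by blast

lemma transversal_left: "\<lbrakk>g \<in> carrier G; n \<in> N\<rbrakk> \<Longrightarrow> transversal (n \<otimes> g) = transversal g"
proof -
  assume a: "g \<in> carrier G" "n \<in> N"
  have "N #> (n \<otimes> g) = N #> g"
    using a G.coset_mult_assoc[of N n g] G.coset_join2[of n N] N.mem_carrier N.subset N.subgroup_axioms by simp
  moreover have "n \<otimes> g \<in> N \<longleftrightarrow> g \<in> N"
    using a by (intro N_mult_iff)
  ultimately show ?thesis by (simp add: transversal_def)
qed

lemma transversal_diff: "g \<in> carrier G \<Longrightarrow> g \<otimes> inv (transversal g) \<in> N"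
proof -
  assume a: "g \<in> carrier G"
  obtain n where n: "n \<in> N" "transversal g = n \<otimes> g"
    using transversal_coset[OF a] by (auto simp: r_coset_def)
  have "g \<otimes> inv (n \<otimes> g) = inv n"
    using a n N.mem_carrier by (simp add: G.inv_mult_group flip: G.m_assoc)
  then show ?thesis using n N.m_inv_closed by simp
qed

lemma transversal_decomp:
  assumes "g \<in> carrier G"
  obtains n where "n \<in> N" "g = n \<otimes> transversal g"
proof
  show "g \<otimes> inv (transversal g) \<in> N" by (rule transversal_diff[OF assms])
  show "g = g \<otimes> inv (transversal g) \<otimes> transversal g"
    using assms transversal_closed by (simp add: G.m_assoc)
qed

lemma transversal_eqD:
  assumes "g \<in> carrier G" "h \<in> carrier G" "transversal g = transversal h"
  shows "g \<otimes> inv h \<in> N"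
proof -
  have "g \<otimes> inv h = (g \<otimes> inv (transversal g)) \<otimes> inv (h \<otimes> inv (transversal h))"
    using assms transversal_closed by (simp add: G.inv_mult_group G.m_assoc G.inv_solve_left)
  then show ?thesis
    using transversal_diff[OF assms(1)] transversal_diff[OF assms(2)] by (simp add: N.m_closed N.m_inv_closed)
qed

lemma transversal_idem: "g \<in> carrier G \<Longrightarrow> transversal (transversal g) = transversal g"
  using transversal_decomp[of g] transversal_left[OF transversal_closed, of g] by metis

abbreviation "L \<equiv> transversal ` carrier G"

lemma finL: "finite L" and L_closed: "L \<subseteq> carrier G"
  using finG transversal_closed by auto

lemma card_L: "card L = order (G Mod N)"
proof -
  have "bij_betw (\<lambda>x. N #> x) L (rcosets N)"
    unfolding bij_betw_def
  proof
    show "inj_on (\<lambda>x. N #> x) L"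
    proof (rule inj_onI)
      fix x y assume xy: "x \<in> L" "y \<in> L" "N #> x = N #> y"
      then have "y \<in> N #> x" using L_closed G.rcos_self[OF _ N.subgroup_axioms] by auto
      then obtain n where "n \<in> N" "y = n \<otimes> x" by (auto simp: r_coset_def)
      then have "transversal y = transversal x" using transversal_left[of x n] xy L_closed by blast
      then show "x = y" using xy transversal_idem by fastforce
    qed
    have "N #> transversal g = N #> g" if "g \<in> carrier G" for g
      using G.repr_independence[OF transversal_coset[OF that] that N.subgroup_axioms] by simp
    then show "(\<lambda>x. N #> x) ` L = rcosets N"
      unfolding RCOSETS_def by (auto simp: image_iff)
  qed
  then show ?thesis by (simp add: bij_betw_same_card order_def FactGroup_def)
qed

text \<open>Since N is normal, left multiplication by h is compatible with right cosets; injectivity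
  on L follows by conjugating with h, and finiteness does the rest. Reindexing a mean along this
  permutation is what makes it equivariant.\<close>

lemma transversal_perm:
  assumes "h \<in> carrier G" shows "bij_betw (\<lambda>x. transversal (h \<otimes> x)) L L"
proof -
  have "inj_on (\<lambda>x. transversal (h \<otimes> x)) L"
  proof (rule inj_onI)
    fix x y assume xy: "x \<in> L" "y \<in> L" "transversal (h \<otimes> x) = transversal (h \<otimes> y)"
    then have c: "x \<in> carrier G" "y \<in> carrier G" using L_closed by auto
    have "h \<otimes> x \<otimes> inv (h \<otimes> y) \<in> N" using transversal_eqD xy c assms by simp
    then have "inv h \<otimes> (h \<otimes> x \<otimes> inv (h \<otimes> y)) \<otimes> h \<in> N" using N.inv_op_closed1 assms by simp
    moreover have "inv h \<otimes> (h \<otimes> x \<otimes> inv (h \<otimes> y)) \<otimes> h = x \<otimes> inv y"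
      using c assms by (simp add: G.inv_mult_group G.m_assoc G.inv_solve_left')
    ultimately have "x \<otimes> inv y \<in> N" by simp
    then have "transversal ((x \<otimes> inv y) \<otimes> y) = transversal y" using transversal_left c by blast
    then have "transversal x = transversal y" using c by (simp add: G.m_assoc)
    then show "x = y" using xy transversal_idem by auto
  qed
  moreover have "(\<lambda>x. transversal (h \<otimes> x)) ` L \<subseteq> L"
    using L_closed assms by auto
  ultimately show ?thesis
    using endo_inj_surj[OF finL] by (simp add: bij_betw_def)
qed

section \<open>The abelian pieces C i / C (i+1)\<close>

definition V :: "nat \<Rightarrow> 'h set monoid" where "V i = (H\<lparr>carrier := C i\<rparr>) Mod (C (Suc i))"

definition cls :: "nat \<Rightarrow> 'h \<Rightarrow> 'h set" where "cls i x = C (Suc i) #>\<^bsub>H\<lparr>carrier := C i\<rparr>\<^esub> x"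

text \<open>Elements of C i lie in the fibre over \<one>, so stability of the filtration under
  conjugation by the fibres contains normality.\<close>

lemma C_normal: "C (Suc i) \<lhd> H\<lparr>carrier := C i\<rparr>"
proof -
  interpret K: group "H\<lparr>carrier := C i\<rparr>" by (rule subgroup.subgroup_is_group[OF C_subgroup is_group])
  show ?thesis
  proof (rule K.normal_invI)
    show "subgroup (C (Suc i)) (H\<lparr>carrier := C i\<rparr>)"
      by (rule subgroup_incl[OF C_subgroup C_subgroup C_Suc])
    show "x \<otimes>\<^bsub>H\<lparr>carrier := C i\<rparr>\<^esub> h \<otimes>\<^bsub>H\<lparr>carrier := C i\<rparr>\<^esub> inv\<^bsub>H\<lparr>carrier := C i\<rparr>\<^esub> x \<in> C (Suc i)"
      if "h \<in> C (Suc i)" "x \<in> carrier (H\<lparr>carrier := C i\<rparr>)" for x h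
      using that m_inv_consistent[OF C_subgroup] C_conj[of "\<one>" x h "Suc i"] C_E by auto
  qed
qed

lemma cls_hom: "cls i \<in> hom (H\<lparr>carrier := C i\<rparr>) (V i)"
  using normal.r_coset_hom_Mod[OF C_normal, of i]
  unfolding V_def cls_def[abs_def] .

lemma cls_mult: "\<lbrakk>x \<in> C i; y \<in> C i\<rbrakk> \<Longrightarrow> cls i (x \<bullet> y) = cls i x \<otimes>\<^bsub>V i\<^esub> cls i y"
  using hom_mult[OF cls_hom[of i]] by simp

lemma cls_closed: "x \<in> C i \<Longrightarrow> cls i x \<in> carrier (V i)"
  using cls_hom[of i] by (auto simp: hom_def Pi_iff)

lemma cls_surj: "v \<in> carrier (V i) \<Longrightarrow> \<exists>x\<in>C i. v = cls i x"
  by (auto simp: V_def cls_def FactGroup_def RCOSETS_def)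

lemma V_group: "group (V i)"
  unfolding V_def by (rule normal.factorgroup_is_group[OF C_normal])

lemma cls_eq_iff: "\<lbrakk>x \<in> C i; y \<in> C i\<rbrakk> \<Longrightarrow> cls i x = cls i y \<longleftrightarrow> x \<bullet> \<iota> y \<in> C (Suc i)"
proof -
  assume xy: "x \<in> C i" "y \<in> C i"
  interpret K: group "H\<lparr>carrier := C i\<rparr>" by (rule subgroup.subgroup_is_group[OF C_subgroup is_group])
  have "subgroup (C (Suc i)) (H\<lparr>carrier := C i\<rparr>)"
    using C_normal normal_imp_subgroup by blast
  then show ?thesis
    using subgroup.rcos_module[OF _ K.is_group, of "C (Suc i)" y x] xy m_inv_consistent[OF C_subgroup xy(2)]
      K.rcos_self[of x "C (Suc i)"] K.repr_independence[of x "C (Suc i)" y] by (auto simp: cls_def)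
qed

lemma V_comm_group: "comm_group (V i)"
proof (rule group.group_comm_groupI[OF V_group])
  fix v w assume "v \<in> carrier (V i)" "w \<in> carrier (V i)"
  then obtain x y where xy: "x \<in> C i" "v = cls i x" "y \<in> C i" "w = cls i y" using cls_surj by metis
  then have "cls i (x \<bullet> y) = cls i (y \<bullet> x)"
    using cls_eq_iff[of "x \<bullet> y" i "y \<bullet> x"] C_mult C_comm by auto
  then show "v \<otimes>\<^bsub>V i\<^esub> w = w \<otimes>\<^bsub>V i\<^esub> v" using cls_mult xy by metis
qed

lemma cls_pow: "x \<in> C i \<Longrightarrow> cls i x [^]\<^bsub>V i\<^esub> (n::nat) = cls i (x [^]\<^bsub>H\<^esub> n) \<and> x [^]\<^bsub>H\<^esub> n \<in> C i"
proof (induction n)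
  case 0
  interpret V: comm_group "V i" by (rule V_comm_group)
  have "cls i \<one>\<^bsub>H\<^esub> \<otimes>\<^bsub>V i\<^esub> cls i \<one>\<^bsub>H\<^esub> = cls i \<one>\<^bsub>H\<^esub>"
    using cls_mult[OF C_one C_one] by simp
  then show ?case using cls_closed[OF C_one] C_one by simp
next
  case (Suc n)
  then show ?case using cls_mult[of "x [^]\<^bsub>H\<^esub> n" i x] C_mult by simp
qed

lemma cls_one: "cls i \<one>\<^bsub>H\<^esub> = \<one>\<^bsub>V i\<^esub>"
  using cls_pow[OF C_one, of i 0] by simp

lemma V_pow_p:
  assumes "v \<in> carrier (V i)"
  shows "v [^]\<^bsub>V i\<^esub> p = \<one>\<^bsub>V i\<^esub>"
proof -
  obtain x where x: "x \<in> C i" "v = cls i x" using cls_surj[OF assms] by auto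
  have "cls i (x [^]\<^bsub>H\<^esub> p) = cls i \<one>\<^bsub>H\<^esub>"
    using cls_eq_iff[of "x [^]\<^bsub>H\<^esub> p" i "\<one>\<^bsub>H\<^esub>"] C_pow[OF x(1)] cls_pow[OF x(1)] C_one C_carrier by simp
  then show ?thesis using x cls_pow[of x i p] cls_one by simp
qed

section \<open>Averages over coset representatives\<close>

definition mroot :: nat where "mroot = (SOME m. \<exists>q. m * card L = Suc (q * p))"

text \<open>An inverse of \<open>card L\<close> modulo p: \<open>card L\<close> is the index of N,
  which is prime to p, so Bezout applies.\<close>

lemma mroot: "\<exists>q. mroot * card L = Suc (q * p)"
proof -
  have "card L \<noteq> 0" using finL by auto
  then obtain x y where "card L * x = p * y + gcd (card L) p"
    using bezout_nat[of "card L" p] by blast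
  then have "x * card L = Suc (y * p)" using cop card_L by (simp add: mult.commute)
  then have "\<exists>m q. m * card L = Suc (q * p)" by blast
  then show ?thesis unfolding mroot_def by (rule someI_ex)
qed

lemma V_pow_mroot:
  assumes "v \<in> carrier (V i)"
  shows "v [^]\<^bsub>V i\<^esub> (mroot * card L) = v"
proof -
  interpret V: comm_group "V i" by (rule V_comm_group)
  obtain q where "mroot * card L = Suc (q * p)" using mroot by blast
  moreover have "v [^]\<^bsub>V i\<^esub> (q * p) = \<one>\<^bsub>V i\<^esub>"
    using V.nat_pow_pow[OF assms, of p q] V_pow_p[OF assms] by (simp add: mult.commute)
  ultimately show ?thesis using assms by simp
qed

text \<open>Raising to the power \<open>mroot\<close> divides by \<open>card L\<close>, because \<open>C i / C (i+1)\<close> is killed by \<open>p\<close>.\<close>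

definition mean :: "nat \<Rightarrow> ('g \<Rightarrow> 'h) \<Rightarrow> 'h set" where
  "mean i f = (\<Otimes>\<^bsub>V i\<^esub>x\<in>L. cls i (f x)) [^]\<^bsub>V i\<^esub> mroot"

lemma prod_closed: "f ` L \<subseteq> C i \<Longrightarrow> (\<Otimes>\<^bsub>V i\<^esub>x\<in>L. cls i (f x)) \<in> carrier (V i)"
  using cls_closed by (intro comm_monoid.finprod_closed[OF comm_group.axioms(1)[OF V_comm_group]]) auto

lemma mean_closed: "f ` L \<subseteq> C i \<Longrightarrow> mean i f \<in> carrier (V i)"
  unfolding mean_def
  using monoid.nat_pow_closed[OF group.is_monoid[OF V_group] prod_closed] .

lemma mean_mult:
  assumes "f ` L \<subseteq> C i" "f' ` L \<subseteq> C i"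
  shows "mean i (\<lambda>x. f x \<bullet> f' x) = mean i f \<otimes>\<^bsub>V i\<^esub> mean i f'"
proof -
  interpret V: comm_group "V i" by (rule V_comm_group)
  have "(\<Otimes>\<^bsub>V i\<^esub>x\<in>L. cls i (f x \<bullet> f' x)) = (\<Otimes>\<^bsub>V i\<^esub>x\<in>L. cls i (f x) \<otimes>\<^bsub>V i\<^esub> cls i (f' x))"
    using assms cls_mult cls_closed by (intro V.finprod_cong') (auto simp: image_subset_iff intro!: V.m_closed)
  also have "\<dots> = (\<Otimes>\<^bsub>V i\<^esub>x\<in>L. cls i (f x)) \<otimes>\<^bsub>V i\<^esub> (\<Otimes>\<^bsub>V i\<^esub>x\<in>L. cls i (f' x))"
    using assms cls_closed by (intro V.finprod_multf) (auto simp: image_subset_iff)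
  finally show ?thesis
    using V.nat_pow_distrib[OF prod_closed[OF assms(1)] prod_closed[OF assms(2)]] by (simp add: mean_def)
qed

lemma mean_const:
  assumes "c \<in> C i"
  shows "mean i (\<lambda>x. c) = cls i c"
proof -
  interpret V: comm_group "V i" by (rule V_comm_group)
  have "(\<Otimes>\<^bsub>V i\<^esub>x\<in>L. cls i c) = cls i c [^]\<^bsub>V i\<^esub> card L"
    using V.finprod_const[OF cls_closed[OF assms], of L] by simp
  then show ?thesis
    using V.nat_pow_pow[OF cls_closed[OF assms], of "card L" mroot] V_pow_mroot[OF cls_closed[OF assms]]
    by (simp add: mean_def mult.commute)
qed

lemma mean_perm:
  assumes "f ` L \<subseteq> C i" "h \<in> carrier G"
  shows "mean i (\<lambda>x. f (transversal (h \<otimes> x))) = mean i f"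
proof -
  interpret V: comm_group "V i" by (rule V_comm_group)
  have "(\<Otimes>\<^bsub>V i\<^esub>x\<in>L. cls i (f (transversal (h \<otimes> x)))) = (\<Otimes>\<^bsub>V i\<^esub>x\<in>L. cls i (f x))"
    using V.finprod_reindex[of "\<lambda>x. cls i (f x)" "\<lambda>x. transversal (h \<otimes> x)" L]
      transversal_perm[OF assms(2)] assms(1) cls_closed
    by (auto simp: bij_betw_def image_subset_iff)
  then show ?thesis by (simp add: mean_def)
qed

text \<open>Conjugation by s is multiplicative and preserves both C i and C (i+1), so it commutes
  with products and powers of classes. It is not set up as a map on V i; a representative is carried
  along instead.\<close>

lemma mean_conj:
  assumes f: "f ` L \<subseteq> C i" and s: "g \<in> carrier G" "s \<in> E g" and a: "a \<in> C i" "cls i a = mean i f"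
  shows "cls i (s \<bullet> a \<bullet> \<iota> s) = mean i (\<lambda>x. s \<bullet> f x \<bullet> \<iota> s)"
proof -
  interpret V: comm_group "V i" by (rule V_comm_group)
  have sH: "s \<in> carrier H" using s E_carrier by blast
  have conj: "s \<bullet> c \<bullet> \<iota> s \<in> C j" if "c \<in> C j" for c j using C_conj s that by blast
  have conj_mult: "(s \<bullet> c \<bullet> \<iota> s) \<bullet> (s \<bullet> d \<bullet> \<iota> s) = s \<bullet> (c \<bullet> d) \<bullet> \<iota> s"
    if "c \<in> C j" "d \<in> C j" for c d j
    using sH C_carrier[OF that(1)] C_carrier[OF that(2)] by (simp add: m_assoc inv_solve_left')
  \<comment> \<open>One and the same b represents the partial product while its conjugate represents
    the product of the conjugates; the induction needs both at once.\<close>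
  have ex: "\<exists>b\<in>C i. cls i b = (\<Otimes>\<^bsub>V i\<^esub>x\<in>K. cls i (f x)) \<and>
      cls i (s \<bullet> b \<bullet> \<iota> s) = (\<Otimes>\<^bsub>V i\<^esub>x\<in>K. cls i (s \<bullet> f x \<bullet> \<iota> s))" if "finite K" "K \<subseteq> L" for K
    using that
  proof (induction K rule: finite_induct)
    case empty
    then show ?case using cls_one C_one[of i] sH by (auto intro!: bexI[of _ "\<one>\<^bsub>H\<^esub>"])
  next
    case (insert y K)
    then obtain b where b: "b \<in> C i" "cls i b = (\<Otimes>\<^bsub>V i\<^esub>x\<in>K. cls i (f x))"
      "cls i (s \<bullet> b \<bullet> \<iota> s) = (\<Otimes>\<^bsub>V i\<^esub>x\<in>K. cls i (s \<bullet> f x \<bullet> \<iota> s))" by auto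
    have y: "f y \<in> C i" "\<And>x. x \<in> K \<Longrightarrow> f x \<in> C i" using insert.prems f by blast+
    have "cls i (f y \<bullet> b) = (\<Otimes>\<^bsub>V i\<^esub>x\<in>insert y K. cls i (f x))"
      using insert y b cls_closed by (subst V.finprod_insert) (auto simp: cls_mult)
    moreover have "cls i (s \<bullet> (f y \<bullet> b) \<bullet> \<iota> s) = (\<Otimes>\<^bsub>V i\<^esub>x\<in>insert y K. cls i (s \<bullet> f x \<bullet> \<iota> s))"
      using insert y b(1,3) cls_closed conj conj_mult[OF y(1) b(1)] cls_mult[OF conj[OF y(1)] conj[OF b(1)]]
      by (subst V.finprod_insert) auto
    ultimately show ?case using C_mult y b by blast
  qed
  obtain b where b: "b \<in> C i" "cls i b = (\<Otimes>\<^bsub>V i\<^esub>x\<in>L. cls i (f x))"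
      "cls i (s \<bullet> b \<bullet> \<iota> s) = (\<Otimes>\<^bsub>V i\<^esub>x\<in>L. cls i (s \<bullet> f x \<bullet> \<iota> s))" using ex[OF finL] by auto
  have conj_pow: "(s \<bullet> b \<bullet> \<iota> s) [^]\<^bsub>H\<^esub> (n::nat) = s \<bullet> (b [^]\<^bsub>H\<^esub> n) \<bullet> \<iota> s" for n
    by (induction n) (use sH C_carrier[OF b(1)] in \<open>auto simp: m_assoc inv_solve_left'\<close>)
  \<comment> \<open>This power of b represents the mean, so it differs from the given a by an
    element of C (i+1), and conjugation keeps the difference there.\<close>
  define d where "d = b [^]\<^bsub>H\<^esub> mroot"
  have d: "d \<in> C i" "cls i d = cls i a"
    using cls_pow[OF b(1), of mroot] b(2) a by (auto simp: d_def mean_def)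
  have "a \<bullet> \<iota> d \<in> C (Suc i)" using cls_eq_iff[OF a(1) d(1)] d by simp
  from conj[OF this] have "(s \<bullet> a \<bullet> \<iota> s) \<bullet> \<iota> (s \<bullet> d \<bullet> \<iota> s) \<in> C (Suc i)"
    using sH C_carrier[OF a(1)] C_carrier[OF d(1)] by (simp add: inv_mult_group m_assoc inv_mult_cancel)
  then have "cls i (s \<bullet> a \<bullet> \<iota> s) = cls i (s \<bullet> d \<bullet> \<iota> s)"
    using cls_eq_iff conj a d by blast
  also have "\<dots> = mean i (\<lambda>x. s \<bullet> f x \<bullet> \<iota> s)"
    using cls_pow[OF conj[OF b(1)], of mroot] b(3) conj_pow by (simp add: mean_def d_def)
  finally show ?thesis .
qed

section \<open>Splitting the extension along the filtration\<close>

definition section_mod :: "nat \<Rightarrow> ('g \<Rightarrow> 'h) \<Rightarrow> bool" where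
  "section_mod i s \<longleftrightarrow> (\<forall>g\<in>carrier G. s g \<in> E g) \<and>
     (\<forall>n\<in>N. \<forall>g\<in>carrier G. s (n \<otimes> g) = \<nu> n \<bullet> s g) \<and> s \<one> = \<one>\<^bsub>H\<^esub> \<and>
     (\<forall>g\<in>carrier G. \<forall>h\<in>carrier G. s g \<bullet> s h \<bullet> \<iota> (s (g \<otimes> h)) \<in> C i)"

text \<open>Left equivariance under N and the value at \<one> are demanded exactly, only
  multiplicativity up to C i; exactness on N makes the final section extend \<nu>. At the start
  every defect is allowed, since it lies in the fibre over \<one>, which is C 0.\<close>

lemma section_mod_0:
  assumes "\<And>g. g \<in> carrier G \<Longrightarrow> E g \<noteq> {}"
  shows "\<exists>s. section_mod 0 s"
proof -
  define s\<^sub>0 where "s\<^sub>0 g = (if g = \<one> then \<one>\<^bsub>H\<^esub> else (SOME x. x \<in> E g))" for g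
  have s\<^sub>0: "s\<^sub>0 g \<in> E g" if "g \<in> carrier G" for g
    using assms[OF that] C_one[of 0] C_0 by (auto simp: s\<^sub>0_def some_in_eq)
  \<comment> \<open>Free values are chosen on representatives only and transported by \<nu>. As N is
    represented by \<one>, where the chosen value is \<one>, the section agrees with \<nu> on
    N.\<close>
  define s where "s g = \<nu> (g \<otimes> inv (transversal g)) \<bullet> s\<^sub>0 (transversal g)" for g
  have s: "s g \<in> E g" if "g \<in> carrier G" for g
    using E_mult[OF _ _ E_nu[OF transversal_diff[OF that]] s\<^sub>0[OF transversal_closed[OF that]]] that
      transversal_closed[OF that] by (simp add: s_def G.m_assoc)
  have "s (n \<otimes> g) = \<nu> n \<bullet> s g" if "n \<in> N" "g \<in> carrier G" for n g
  proof -
    have "\<nu> (n \<otimes> g \<otimes> inv (transversal g)) = \<nu> n \<bullet> \<nu> (g \<otimes> inv (transversal g))"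
      using nu_mult[OF that(1) transversal_diff[OF that(2)]] that transversal_closed[OF that(2)]
      by (simp add: G.m_assoc N.mem_carrier)
    then show ?thesis
      using transversal_left[OF that(2,1)] nu_carrier[OF that(1)] nu_carrier[OF transversal_diff[OF that(2)]]
        E_carrier[OF _ s\<^sub>0] transversal_closed[OF that(2)] by (simp add: s_def m_assoc)
  qed
  moreover have "s \<one> = \<one>\<^bsub>H\<^esub>"
    using N.one_closed by (simp add: s_def transversal_def s\<^sub>0_def nu_one)
  moreover have "s g \<bullet> s h \<bullet> \<iota> (s (g \<otimes> h)) \<in> C 0" if gh: "g \<in> carrier G" "h \<in> carrier G" for g h
  proof -
    have "s g \<bullet> s h \<bullet> \<iota> (s (g \<otimes> h)) \<in> E (g \<otimes> h \<otimes> inv (g \<otimes> h))"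
      using gh by (intro E_mult E_inv s) auto
    then show ?thesis using gh C_0 by simp
  qed
  ultimately show ?thesis using s unfolding section_mod_def by blast
qed

text \<open>The defect f is a 2-cocycle modulo C (i+1) that depends on cosets only. Averaging the
  cocycle identity over its last variable exhibits f as the coboundary of a, the mean of f in its
  second argument; dividing s by a pushes the defect into C (i+1).\<close>

lemma section_mod_Suc:
  assumes "section_mod i s"
  shows "\<exists>s'. section_mod (Suc i) s'"
proof -
  have sE: "\<And>g. g \<in> carrier G \<Longrightarrow> s g \<in> E g"
    and sN: "\<And>n g. \<lbrakk>n \<in> N; g \<in> carrier G\<rbrakk> \<Longrightarrow> s (n \<otimes> g) = \<nu> n \<bullet> s g" and s1: "s \<one> = \<one>\<^bsub>H\<^esub>"
    and sC: "\<And>g h. \<lbrakk>g \<in> carrier G; h \<in> carrier G\<rbrakk> \<Longrightarrow> s g \<bullet> s h \<bullet> \<iota> (s (g \<otimes> h)) \<in> C i"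
    using assms by (auto simp: section_mod_def)
  have sH: "\<And>g. g \<in> carrier G \<Longrightarrow> s g \<in> carrier H" using sE E_carrier by blast
  define f where "f g h = s g \<bullet> s h \<bullet> \<iota> (s (g \<otimes> h))" for g h
  have fC: "f g h \<in> C i" if "g \<in> carrier G" "h \<in> carrier G" for g h using sC that by (simp add: f_def)
  have fH: "f g h \<in> carrier H" if "g \<in> carrier G" "h \<in> carrier G" for g h using fC C_carrier that by blast
  have f_s: "f g h \<bullet> s (g \<otimes> h) = s g \<bullet> s h" if "g \<in> carrier G" "h \<in> carrier G" for g h
    using that sH by (simp add: f_def m_assoc)
  have f_left: "f (n \<otimes> g) h = f g h" if "n \<in> N" "g \<in> carrier G" "h \<in> carrier G" for n g h
  proof -
    have "f (n \<otimes> g) h = \<nu> n \<bullet> f g h \<bullet> \<iota> (\<nu> n)"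
      using that sH nu_carrier[OF that(1)] N.mem_carrier[OF that(1)]
      by (simp add: f_def sN G.m_assoc m_assoc inv_mult_group)
    then show ?thesis using C_conj_nu[OF that(1) fC[OF that(2,3)]] by simp
  qed
  \<comment> \<open>Passing \<nu> n to the left of s g replaces n by its conjugate n'; the factors
    \<nu> n' then surround the defect and cancel, because they commute with C i.\<close>
  have f_right: "f g (n \<otimes> h) = f g h" if "n \<in> N" "g \<in> carrier G" "h \<in> carrier G" for n g h
  proof -
    define n' where "n' = g \<otimes> n \<otimes> inv g"
    have n': "n' \<in> N" using conj_closed that by (simp add: n'_def)
    have "g \<otimes> (n \<otimes> h) = n' \<otimes> (g \<otimes> h)"
      using that N.mem_carrier[OF that(1)] by (simp add: n'_def G.m_assoc G.inv_mult_cancel)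
    then have eq: "s (g \<otimes> (n \<otimes> h)) = \<nu> n' \<bullet> s (g \<otimes> h)" using sN[OF n'] that by simp
    have "s g \<bullet> \<nu> n = \<nu> n' \<bullet> s g" using nu_conj[OF that(2,1) sE[OF that(2)]] unfolding n'_def .
    then have "(s g \<bullet> \<nu> n) \<bullet> s h = (\<nu> n' \<bullet> s g) \<bullet> s h" by simp
    then have "s g \<bullet> s (n \<otimes> h) = \<nu> n' \<bullet> (s g \<bullet> s h)"
      using that sH nu_carrier[OF that(1)] nu_carrier[OF n'] sN[OF that(1,3)] by (simp add: m_assoc)
    then have "f g (n \<otimes> h) = \<nu> n' \<bullet> f g h \<bullet> \<iota> (\<nu> n')"
      using that sH nu_carrier[OF n'] eq by (simp add: f_def m_assoc inv_mult_group)
    then show ?thesis using C_conj_nu[OF n' fC[OF that(2,3)]] by simp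
  qed
  \<comment> \<open>The product of h with a representative is rarely one itself; this replaces it by
    one, so that \<open>mean_perm\<close> applies.\<close>
  have f_transversal: "f g (transversal h) = f g h" if gh: "g \<in> carrier G" "h \<in> carrier G" for g h
  proof -
    obtain n where "n \<in> N" "h = n \<otimes> transversal h" using transversal_decomp[OF gh(2)] .
    then show ?thesis using f_right[of n g "transversal h"] gh transversal_closed by metis
  qed
  have fL: "f g ` L \<subseteq> C i" if "g \<in> carrier G" for g using fC that L_closed by blast
  \<comment> \<open>Outside N the choice depends on g only through its mean, so a is constant on
    cosets as a function into C i and not merely modulo C (i+1). The value \<one> on N keeps s'
    \<one> equal to \<one>.\<close>
  define a where "a g = (if g \<in> N then \<one>\<^bsub>H\<^esub> else (SOME x. x \<in> C i \<and> cls i x = mean i (f g)))" for g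
  have mean_N: "mean i (f n) = cls i \<one>\<^bsub>H\<^esub>" if "n \<in> N" for n
  proof -
    have "f n x = \<one>\<^bsub>H\<^esub>" if "x \<in> carrier G" for x
    proof -
      have "s n = \<nu> n" using sN[OF \<open>n \<in> N\<close> G.one_closed] \<open>n \<in> N\<close> nu_carrier s1 N.mem_carrier by simp
      then show ?thesis using sN[OF \<open>n \<in> N\<close> that] sH that nu_carrier[OF \<open>n \<in> N\<close>] by (simp add: f_def)
    qed
    then have "mean i (f n) = mean i (\<lambda>x. \<one>\<^bsub>H\<^esub>)"
      unfolding mean_def using L_closed
      by (intro arg_cong[where f="\<lambda>v. v [^]\<^bsub>V i\<^esub> mroot"] comm_monoid.finprod_cong'[OF comm_group.axioms(1)[OF V_comm_group]])
         (auto simp: cls_closed[OF C_one])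
    then show ?thesis using mean_const[OF C_one] by simp
  qed
  have a: "a g \<in> C i \<and> cls i (a g) = mean i (f g)" if g: "g \<in> carrier G" for g
  proof (cases "g \<in> N")
    case False
    have "\<exists>x. x \<in> C i \<and> cls i x = mean i (f g)" using cls_surj[OF mean_closed[OF fL[OF g]]] by auto
    from someI_ex[OF this] show ?thesis using False by (simp add: a_def)
  qed (use mean_N C_one in \<open>auto simp: a_def\<close>)
  have aC: "\<And>g. g \<in> carrier G \<Longrightarrow> a g \<in> C i" and acls: "\<And>g. g \<in> carrier G \<Longrightarrow> cls i (a g) = mean i (f g)"
    using a by auto
  have aH: "\<And>g. g \<in> carrier G \<Longrightarrow> a g \<in> carrier H" using aC C_carrier by blast
  have a_left: "a (n \<otimes> g) = a g" if "n \<in> N" "g \<in> carrier G" for n g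
  proof -
    have "mean i (f (n \<otimes> g)) = mean i (f g)"
      unfolding mean_def using f_left[OF that] L_closed fC[OF that(2)] cls_closed
      by (intro arg_cong[where f="\<lambda>v. v [^]\<^bsub>V i\<^esub> mroot"] comm_monoid.finprod_cong'[OF comm_group.axioms(1)[OF V_comm_group]])
         (auto simp: image_subset_iff)
    moreover have "n \<otimes> g \<in> N \<longleftrightarrow> g \<in> N"
      using that by (rule N_mult_iff)
    ultimately show ?thesis by (simp add: a_def)
  qed
  define s' where "s' g = \<iota> (a g) \<bullet> s g" for g
  have "s' g \<in> E g" if "g \<in> carrier G" for g
    using E_nonempty_mult[OF that sE[OF that] C_inv[OF aC[OF that]]] by (simp add: s'_def)
  moreover have "s' (n \<otimes> g) = \<nu> n \<bullet> s' g" if ng: "n \<in> N" "g \<in> carrier G" for n g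
    using C_nu_commute[OF C_inv[OF aC[OF ng(2)]] ng(1)] sN[OF ng] a_left[OF ng] nu_carrier[OF ng(1)]
      sH[OF ng(2)] aH[OF ng(2)]
    by (simp add: s'_def flip: m_assoc)
  moreover have "s' \<one> = \<one>\<^bsub>H\<^esub>" using N.one_closed s1 by (simp add: s'_def a_def)
  moreover have "s' g \<bullet> s' h \<bullet> \<iota> (s' (g \<otimes> h)) \<in> C (Suc i)" if gh: "g \<in> carrier G" "h \<in> carrier G" for g h
  proof -
    interpret V: comm_group "V i" by (rule V_comm_group)
    have gh': "g \<otimes> h \<in> carrier G" using gh by simp
    define b where "b = s g \<bullet> a h \<bullet> \<iota> (s g)"
    have b: "b \<in> C i" using C_conj[OF gh(1) sE[OF gh(1)] aC[OF gh(2)]] by (simp add: b_def)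
    \<comment> \<open>Associativity of s g, s h, s x. It holds on the nose; only after averaging
      over x are classes needed.\<close>
    have cocycle: "f g h \<bullet> f (g \<otimes> h) x = (s g \<bullet> f h x \<bullet> \<iota> (s g)) \<bullet> f g (h \<otimes> x)" if x: "x \<in> carrier G" for x
      using gh x sH by (simp add: f_def m_assoc G.m_assoc inv_mult_group inv_mult_cancel)
    have "cls i (f g h) \<otimes>\<^bsub>V i\<^esub> cls i (a (g \<otimes> h)) = mean i (\<lambda>x. f g h \<bullet> f (g \<otimes> h) x)"
      using mean_mult[of "\<lambda>x. f g h" i "f (g \<otimes> h)"] mean_const[OF fC[OF gh]] fC[OF gh] fL[OF gh'] acls[OF gh']
      by (auto simp: image_subset_iff)
    also have "\<dots> = mean i (\<lambda>x. (s g \<bullet> f h x \<bullet> \<iota> (s g)) \<bullet> f g (transversal (h \<otimes> x)))"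
      unfolding mean_def using cocycle gh L_closed f_transversal fC gh' C_mult cls_closed
      by (intro arg_cong[where f="\<lambda>v. v [^]\<^bsub>V i\<^esub> mroot"] V.finprod_cong')
         (auto simp: subset_iff intro!: cls_closed C_mult C_conj[OF gh(1) sE[OF gh(1)]])
    also have "\<dots> = mean i (\<lambda>x. s g \<bullet> f h x \<bullet> \<iota> (s g)) \<otimes>\<^bsub>V i\<^esub> mean i (\<lambda>x. f g (transversal (h \<otimes> x)))"
      using gh L_closed transversal_closed
      by (intro mean_mult) (auto simp: subset_iff intro!: C_conj[OF gh(1) sE[OF gh(1)]] fC)
    also have "\<dots> = cls i b \<otimes>\<^bsub>V i\<^esub> cls i (a g)"
      using mean_conj[OF fL[OF gh(2)] gh(1) sE[OF gh(1)] aC[OF gh(2)] acls[OF gh(2)]]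
        mean_perm[OF fL[OF gh(1)] gh(2)] acls[OF gh(1)] by (simp add: b_def)
    finally have eq: "cls i (f g h) \<otimes>\<^bsub>V i\<^esub> cls i (a (g \<otimes> h)) = cls i b \<otimes>\<^bsub>V i\<^esub> cls i (a g)" .
    have "cls i (f g h \<bullet> a (g \<otimes> h)) = cls i (b \<bullet> a g)"
      using eq cls_mult[OF fC[OF gh] aC[OF gh']] cls_mult[OF b aC[OF gh(1)]] by simp
    then have "(f g h \<bullet> a (g \<otimes> h)) \<bullet> \<iota> (b \<bullet> a g) \<in> C (Suc i)"
      using cls_eq_iff C_mult fC[OF gh] aC[OF gh'] aC[OF gh(1)] b by blast
    \<comment> \<open>The relation has the form x y^-1 with y = b a(g). Conjugating by y^-1 turns it
      into y^-1 x, the shape taken by the defect of s'.\<close>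
    moreover have "b \<bullet> a g \<in> C 0" using C_mult aC[OF gh(1)] b C_le_0 by blast
    ultimately have "\<iota> (b \<bullet> a g) \<bullet> ((f g h \<bullet> a (g \<otimes> h)) \<bullet> \<iota> (b \<bullet> a g)) \<bullet> \<iota> (\<iota> (b \<bullet> a g)) \<in> C (Suc i)"
      using C_conj[OF G.one_closed] C_inv C_0 by blast
    then have X: "\<iota> (b \<bullet> a g) \<bullet> (f g h \<bullet> a (g \<otimes> h)) \<in> C (Suc i)"
      using C_carrier[OF b] aH[OF gh(1)] aH[OF gh'] fH[OF gh] by (simp add: m_assoc)
    have "s' g \<bullet> s' h \<bullet> \<iota> (s' (g \<otimes> h)) = \<iota> (b \<bullet> a g) \<bullet> (f g h \<bullet> a (g \<otimes> h))"
      using sH[OF gh(1)] sH[OF gh(2)] sH[OF gh'] aH[OF gh(1)] aH[OF gh(2)] aH[OF gh']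
      by (simp add: s'_def f_def b_def m_assoc inv_mult_group inv_mult_cancel)
    then show ?thesis using X by simp
  qed
  ultimately show ?thesis unfolding section_mod_def by blast
qed

text \<open>The filtration is trivial at level l, so multiplicativity up to C l is
  multiplicativity.\<close>

theorem split_section:
  assumes "\<And>g. g \<in> carrier G \<Longrightarrow> E g \<noteq> {}"
  obtains s where "\<And>g. g \<in> carrier G \<Longrightarrow> s g \<in> E g" "\<And>n. n \<in> N \<Longrightarrow> s n = \<nu> n"
    "\<And>g h. \<lbrakk>g \<in> carrier G; h \<in> carrier G\<rbrakk> \<Longrightarrow> s (g \<otimes> h) = s g \<bullet> s h"
proof -
  have "\<exists>s. section_mod i s" for i
    by (induction i) (use section_mod_0[OF assms] section_mod_Suc in auto)
  then obtain s where s: "section_mod l s" by blast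
  then have E: "\<And>g. g \<in> carrier G \<Longrightarrow> s g \<in> E g"
    and sN: "\<And>n g. \<lbrakk>n \<in> N; g \<in> carrier G\<rbrakk> \<Longrightarrow> s (n \<otimes> g) = \<nu> n \<bullet> s g" and s1: "s \<one> = \<one>\<^bsub>H\<^esub>"
    and sC: "\<And>g h. \<lbrakk>g \<in> carrier G; h \<in> carrier G\<rbrakk> \<Longrightarrow> s g \<bullet> s h \<bullet> \<iota> (s (g \<otimes> h)) \<in> C l"
    unfolding section_mod_def by blast+
  then have H: "\<And>g. g \<in> carrier G \<Longrightarrow> s g \<in> carrier H" using E_carrier by blast
  show thesis
  proof (rule that[of s])
    show "s n = \<nu> n" if "n \<in> N" for n
      using sN[OF that G.one_closed] s1 nu_carrier[OF that] N.mem_carrier[OF that] by simp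
    show "s (g \<otimes> h) = s g \<bullet> s h" if "g \<in> carrier G" "h \<in> carrier G" for g h
    proof -
      have "s g \<bullet> s h \<bullet> \<iota> (s (g \<otimes> h)) = \<one>\<^bsub>H\<^esub>" using sC[OF that] C_l by simp
      then show ?thesis using H that inv_equality[of "s g \<bullet> s h" "\<iota> (s (g \<otimes> h))"] by simp
    qed
  qed (use E in auto)
qed

text \<open>After conjugation by \<gamma> the two sections differ by a 1-cocycle c. It is trivial on
  N and so depends on cosets only; averaging c over translates by g makes it the coboundary of its
  mean modulo the next step, and \<gamma> is multiplied by a representative of that mean.\<close>

theorem sections_conjugate:
  assumes s: "\<And>g. g \<in> carrier G \<Longrightarrow> s g \<in> E g" "\<And>n. n \<in> N \<Longrightarrow> s n = \<nu> n"
      "\<And>g h. \<lbrakk>g \<in> carrier G; h \<in> carrier G\<rbrakk> \<Longrightarrow> s (g \<otimes> h) = s g \<bullet> s h"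
    and t: "\<And>g. g \<in> carrier G \<Longrightarrow> t g \<in> E g" "\<And>n. n \<in> N \<Longrightarrow> t n = \<nu> n"
      "\<And>g h. \<lbrakk>g \<in> carrier G; h \<in> carrier G\<rbrakk> \<Longrightarrow> t (g \<otimes> h) = t g \<bullet> t h"
  obtains \<gamma> where "\<gamma> \<in> E \<one>" "\<And>g. g \<in> carrier G \<Longrightarrow> t g = \<gamma> \<bullet> s g \<bullet> \<iota> \<gamma>"
proof -
  have sH: "\<And>g. g \<in> carrier G \<Longrightarrow> s g \<in> carrier H" and tH: "\<And>g. g \<in> carrier G \<Longrightarrow> t g \<in> carrier H"
    using s(1) t(1) E_carrier by blast+
  have "\<exists>\<gamma>\<in>C 0. \<forall>g\<in>carrier G. \<iota> \<gamma> \<bullet> t g \<bullet> \<gamma> \<bullet> \<iota> (s g) \<in> C i" for i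
  proof (induction i)
    case 0
    have "t g \<bullet> \<iota> (s g) \<in> C 0" if "g \<in> carrier G" for g
      using E_mult[OF _ _ t(1)[OF that] E_inv[OF that s(1)[OF that]]] that by (simp add: C_0)
    then show ?case using C_one[of 0] tH by (intro bexI[of _ "\<one>\<^bsub>H\<^esub>"]) auto
  next
    case (Suc i)
    then obtain \<gamma> where \<gamma>: "\<gamma> \<in> C 0" "\<And>g. g \<in> carrier G \<Longrightarrow> \<iota> \<gamma> \<bullet> t g \<bullet> \<gamma> \<bullet> \<iota> (s g) \<in> C i" by blast
    have \<gamma>H: "\<gamma> \<in> carrier H" using C_carrier \<gamma>(1) .
    define c where "c g = \<iota> \<gamma> \<bullet> t g \<bullet> \<gamma> \<bullet> \<iota> (s g)" for g
    have cC: "c g \<in> C i" if "g \<in> carrier G" for g using \<gamma>(2)[OF that] by (simp add: c_def)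
    have cH: "c g \<in> carrier H" if "g \<in> carrier G" for g using cC[OF that] C_carrier by blast
    have cocycle: "c (g \<otimes> h) = c g \<bullet> (s g \<bullet> c h \<bullet> \<iota> (s g))" if "g \<in> carrier G" "h \<in> carrier G" for g h
      using that sH tH \<gamma>H by (simp add: c_def s(3) t(3) m_assoc inv_mult_group inv_mult_cancel)
    \<comment> \<open>Both sections equal \<nu> on N, and \<gamma> commutes with the values of \<nu>
      because it lies in C 0.\<close>
    have c_N: "c n = \<one>\<^bsub>H\<^esub>" if "n \<in> N" for n
    proof -
      have "c n = \<iota> \<gamma> \<bullet> (\<nu> n \<bullet> \<gamma>) \<bullet> \<iota> (\<nu> n)"
        using that \<gamma>H nu_carrier[OF that] by (simp add: c_def s(2) t(2) m_assoc)
      also have "\<dots> = \<iota> \<gamma> \<bullet> (\<gamma> \<bullet> \<nu> n) \<bullet> \<iota> (\<nu> n)" using C_nu_commute[OF \<gamma>(1) that] by simp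
      finally show ?thesis using \<gamma>H nu_carrier[OF that] by (simp add: m_assoc inv_mult_cancel)
    qed
    have c_left: "c (n \<otimes> g) = c g" if "n \<in> N" "g \<in> carrier G" for n g
      using cocycle[of n g] that c_N C_conj_nu[OF that(1) cC[OF that(2)]] cH N.mem_carrier[OF that(1)]
      by (simp add: s(2))
    have c_transversal: "c (transversal g) = c g" if g: "g \<in> carrier G" for g
    proof -
      obtain n where "n \<in> N" "g = n \<otimes> transversal g" using transversal_decomp[OF g] .
      then show ?thesis using c_left[of n "transversal g"] g transversal_closed by metis
    qed
    have cL: "c ` L \<subseteq> C i" using cC L_closed by blast
    obtain a where a: "a \<in> C i" "cls i a = mean i c" using cls_surj[OF mean_closed[OF cL]] by metis
    have aH: "a \<in> carrier H" using a(1) C_carrier by blast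
    have "\<iota> (\<gamma> \<bullet> a) \<bullet> t g \<bullet> (\<gamma> \<bullet> a) \<bullet> \<iota> (s g) \<in> C (Suc i)" if g: "g \<in> carrier G" for g
    proof -
      interpret V: comm_group "V i" by (rule V_comm_group)
      define b where "b = s g \<bullet> a \<bullet> \<iota> (s g)"
      have b: "b \<in> C i" using C_conj[OF g s(1)[OF g] a(1)] by (simp add: b_def)
      \<comment> \<open>Reindexing by g and expanding with the cocycle rule compares the mean with
        its own conjugate; the discrepancy is c g.\<close>
      have "cls i a = mean i (\<lambda>x. c (transversal (g \<otimes> x)))" using mean_perm[OF cL g] a by simp
      also have "\<dots> = mean i (\<lambda>x. c g \<bullet> (s g \<bullet> c x \<bullet> \<iota> (s g)))"
        unfolding mean_def using cocycle g L_closed c_transversal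
        by (intro arg_cong[where f="\<lambda>v. v [^]\<^bsub>V i\<^esub> mroot"] V.finprod_cong')
           (auto simp: subset_iff intro!: cls_closed C_mult C_conj[OF g s(1)[OF g]] cC)
      also have "\<dots> = mean i (\<lambda>x. c g) \<otimes>\<^bsub>V i\<^esub> mean i (\<lambda>x. s g \<bullet> c x \<bullet> \<iota> (s g))"
        using g L_closed by (intro mean_mult) (auto simp: subset_iff intro!: C_conj[OF g s(1)[OF g]] cC)
      also have "\<dots> = cls i (c g) \<otimes>\<^bsub>V i\<^esub> cls i b"
        using mean_const[OF cC[OF g]] mean_conj[OF cL g s(1)[OF g] a] by (simp add: b_def)
      also have "\<dots> = cls i (c g \<bullet> b)" using cls_mult[OF cC[OF g] b] by simp
      finally have "cls i (c g \<bullet> b) = cls i a" by simp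
      then have "(c g \<bullet> b) \<bullet> \<iota> a \<in> C (Suc i)"
        using cls_eq_iff[OF C_mult[OF cC[OF g] b] a(1)] by simp
      moreover have "a \<in> C 0" using a C_le_0 by blast
      ultimately have "\<iota> a \<bullet> ((c g \<bullet> b) \<bullet> \<iota> a) \<bullet> \<iota> (\<iota> a) \<in> C (Suc i)"
        using C_conj[OF G.one_closed] C_inv C_0 by blast
      moreover have "\<iota> a \<bullet> ((c g \<bullet> b) \<bullet> \<iota> a) \<bullet> \<iota> (\<iota> a) = \<iota> (\<gamma> \<bullet> a) \<bullet> t g \<bullet> (\<gamma> \<bullet> a) \<bullet> \<iota> (s g)"
        using aH \<gamma>H sH[OF g] tH[OF g] by (simp add: c_def b_def m_assoc inv_mult_group inv_mult_cancel)
      ultimately show ?thesis by simp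
    qed
    then show ?case using C_mult[OF \<gamma>(1)] a(1) C_le_0 by blast
  qed
  then obtain \<gamma> where \<gamma>: "\<gamma> \<in> C 0" "\<And>g. g \<in> carrier G \<Longrightarrow> \<iota> \<gamma> \<bullet> t g \<bullet> \<gamma> \<bullet> \<iota> (s g) = \<one>\<^bsub>H\<^esub>"
    using C_l by (metis singletonD)
  have \<gamma>H: "\<gamma> \<in> carrier H" using C_carrier \<gamma>(1) .
  show thesis
  proof (rule that)
    show "\<gamma> \<in> E \<one>" using \<gamma>(1) C_0 by simp
    fix g assume g: "g \<in> carrier G"
    have "\<iota> \<gamma> \<bullet> t g \<bullet> \<gamma> = s g"
      using inv_equality[OF \<gamma>(2)[OF g]] \<gamma>H sH[OF g] tH[OF g] by simp
    then have "\<gamma> \<bullet> s g \<bullet> \<iota> \<gamma> = \<gamma> \<bullet> (\<iota> \<gamma> \<bullet> t g \<bullet> \<gamma>) \<bullet> \<iota> \<gamma>" by simp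
    then show "t g = \<gamma> \<bullet> s g \<bullet> \<iota> \<gamma>"
      using \<gamma>H tH[OF g] by (simp add: m_assoc inv_mult_cancel)
  qed
qed

end

section \<open>Powers of ideals\<close>

text \<open>Powers in the multiplicative monoid of ideals, the form used in
  \<open>adically_complete\<close>. Exponent 0 gives the whole ring, so a filtration indexed this
  way starts with no condition.\<close>

abbreviation ideal_pow :: "('a, 'm) ring_scheme \<Rightarrow> 'a set \<Rightarrow> nat \<Rightarrow> 'a set" where
  "ideal_pow R I n \<equiv> I [^]\<^bsub>ideals_set R\<^esub> n"

context cring
begin

lemma ideal_pow_0: "ideal_pow R I 0 = carrier R"
  by (simp add: ideals_set_def)

lemma ideal_pow_Suc: "ideal_pow R I (Suc n) = ideal_prod R (ideal_pow R I n) I"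
  by (simp add: ideals_set_def)

lemma ideal_pow_ideal: "ideal I R \<Longrightarrow> ideal (ideal_pow R I n) R"
proof (induction n)
  case (Suc n)
  then show ?case unfolding ideal_pow_Suc by (intro ideal_prod_is_ideal) auto
next
  case 0
  show ?case unfolding ideal_pow_0 by (rule oneideal)
qed

lemma ideal_pow_1: "ideal I R \<Longrightarrow> ideal_pow R I 1 = I"
  unfolding One_nat_def ideal_pow_Suc ideal_pow_0
  using ideal_prod_one[of I] ideal_prod_commute[OF oneideal] by simp

lemma ideal_pow_le: "\<lbrakk>ideal I R; a \<le> b\<rbrakk> \<Longrightarrow> ideal_pow R I b \<subseteq> ideal_pow R I a"
proof (induction b)
  case (Suc b)
  have "ideal_pow R I (Suc b) \<subseteq> ideal_pow R I b"
    unfolding ideal_pow_Suc using ideal_prod_inter[OF ideal_pow_ideal[OF Suc(2)] Suc(2)] by blast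
  then show ?case using Suc by (cases "a = Suc b") (auto simp: le_Suc_eq)
qed simp

lemma ideal_pow_mult:
  assumes I: "ideal I R" and x: "x \<in> ideal_pow R I a" and y: "y \<in> ideal_pow R I b"
  shows "x \<otimes> y \<in> ideal_pow R I (a + b)"
  using y
proof (induction b arbitrary: y)
  case 0
  then have "y \<in> carrier R" unfolding ideal_pow_0 .
  then show ?case using ideal.I_r_closed[OF ideal_pow_ideal[OF I] x] by simp
next
  case (Suc b)
  have xc: "x \<in> carrier R" using ideal.Icarr[OF ideal_pow_ideal[OF I] x] .
  from Suc.prems have "y \<in> ideal_prod R (ideal_pow R I b) I" by (simp only: ideal_pow_Suc)
  then show ?case
  proof (induction rule: ideal_prod.induct)
    case (prod i j)
    have "i \<in> carrier R" "j \<in> carrier R"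
      using ideal.Icarr[OF ideal_pow_ideal[OF I] prod(1)] ideal.Icarr[OF I prod(2)] by auto
    then have "x \<otimes> (i \<otimes> j) = (x \<otimes> i) \<otimes> j" using xc by (simp add: m_assoc)
    then show ?case
      using ideal_prod.prod[OF Suc.IH[OF prod(1)] prod(2), of R] unfolding add_Suc_right ideal_pow_Suc by simp
  next
    case (sum u v)
    have "u \<in> carrier R" "v \<in> carrier R"
      using sum ideal_prod_in_carrier[OF ideal_pow_ideal[OF I] I] by auto
    then have "x \<otimes> (u \<oplus> v) = x \<otimes> u \<oplus> x \<otimes> v" using xc by (simp add: r_distr)
    then show ?case
      using additive_subgroup.a_closed[OF ideal.axioms(1)[OF ideal_pow_ideal[OF I]] sum(3,4)] by simp
  qed
qed

lemma ideal_a_closed: "\<lbrakk>ideal I R; x \<in> I; y \<in> I\<rbrakk> \<Longrightarrow> x \<oplus> y \<in> I"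
  by (simp add: additive_subgroup.a_closed ideal.axioms(1))

lemma ideal_a_inv_closed: "\<lbrakk>ideal I R; x \<in> I\<rbrakk> \<Longrightarrow> \<ominus> x \<in> I"
  by (simp add: additive_subgroup.a_inv_closed ideal.axioms(1))

lemma ideal_minus_closed: "\<lbrakk>ideal I R; x \<in> I; y \<in> I\<rbrakk> \<Longrightarrow> x \<ominus> y \<in> I"
  unfolding a_minus_def by (intro ideal_a_closed ideal_a_inv_closed)

lemma ideal_zero_closed: "ideal I R \<Longrightarrow> \<zero> \<in> I"
  by (simp add: additive_subgroup.zero_closed ideal.axioms(1))

lemma ideal_finsum_closed:
  assumes "ideal I R" "finite A" "\<And>i. i \<in> A \<Longrightarrow> f i \<in> I"
  shows "finsum R f A \<in> I"
  using assms(2,3)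
proof (induction A rule: finite_induct)
  case (insert x A)
  then have "f \<in> A \<rightarrow> carrier R" "f x \<in> carrier R" using ideal.Icarr[OF assms(1)] by auto
  then show ?case using insert by (simp add: ideal_a_closed[OF assms(1)])
qed (simp add: ideal_zero_closed[OF assms(1)])

lemma diff_self: "x \<in> carrier R \<Longrightarrow> x \<ominus> x = \<zero>"
  by (simp add: minus_eq r_neg)

lemma diff_add_diff: "\<lbrakk>x \<in> carrier R; y \<in> carrier R; z \<in> carrier R\<rbrakk> \<Longrightarrow> (x \<ominus> y) \<oplus> (y \<ominus> z) = x \<ominus> z"
  by algebra

lemma idealI_cring:
  assumes "I \<subseteq> carrier R" "\<zero> \<in> I" "\<And>x y. \<lbrakk>x \<in> I; y \<in> I\<rbrakk> \<Longrightarrow> x \<oplus> y \<in> I"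
    "\<And>r x. \<lbrakk>r \<in> carrier R; x \<in> I\<rbrakk> \<Longrightarrow> r \<otimes> x \<in> I"
  shows "ideal I R"
proof (rule idealI[OF ring_axioms])
  have neg: "\<ominus> x \<in> I" if "x \<in> I" for x
  proof -
    have "x \<in> carrier R" using that assms(1) by blast
    then have "\<ominus> x = (\<ominus> \<one>) \<otimes> x" by algebra
    then show ?thesis using assms(4)[of "\<ominus> \<one>" x] that by simp
  qed
  show "subgroup I (add_monoid R)"
    using assms neg by (intro add.subgroupI) (auto simp: a_inv_def)
  show "a \<otimes> x \<in> I" if "a \<in> I" "x \<in> carrier R" for a x
    using assms(4)[OF that(2,1)] m_comm[of a x] that assms(1) by auto
qed (use assms in auto)

end

section \<open>The ring of formal power series\<close>

lemma ps_ring_simps: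
  "carrier (ps_ring A) = {F. \<forall>n. F n \<in> carrier A}"
  "F \<otimes>\<^bsub>ps_ring A\<^esub> H = (\<lambda>n. \<Oplus>\<^bsub>A\<^esub>i\<in>{..n}. F i \<otimes>\<^bsub>A\<^esub> H (n - i))"
  "\<one>\<^bsub>ps_ring A\<^esub> = (\<lambda>n. if n = 0 then \<one>\<^bsub>A\<^esub> else \<zero>\<^bsub>A\<^esub>)"
  "\<zero>\<^bsub>ps_ring A\<^esub> = (\<lambda>n. \<zero>\<^bsub>A\<^esub>)"
  "F \<oplus>\<^bsub>ps_ring A\<^esub> H = (\<lambda>n. F n \<oplus>\<^bsub>A\<^esub> H n)"
  by (simp_all add: ps_ring_def)

context cring
begin

lemma finsum_single:
  assumes "finite A" "i \<in> A" "f i \<in> carrier R" "\<And>j. j \<in> A \<Longrightarrow> j \<noteq> i \<Longrightarrow> f j = \<zero>"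
  shows "finsum R f A = f i"
proof -
  have "finsum R f A = (\<Oplus>j\<in>A. if i = j then f i else \<zero>)"
    using assms by (intro finsum_cong') auto
  also have "\<dots> = f i" using finsum_singleton[OF assms(2,1), of "\<lambda>_. f i"] assms(3) by simp
  finally show ?thesis .
qed

definition trunc :: "nat \<Rightarrow> (nat \<Rightarrow> 'a) \<Rightarrow> nat \<Rightarrow> 'a" where
  "trunc M F = (\<lambda>n. if n < M then F n else \<zero>)"

lemma trunc_up: "F \<in> carrier (ps_ring R) \<Longrightarrow> trunc M F \<in> carrier (UP R)"
  by (auto simp: UP_def up_def trunc_def ps_ring_simps bound_def intro!: exI[of _ M])

lemma ps_mult_trunc:
  assumes "F \<in> carrier (ps_ring R)" "H \<in> carrier (ps_ring R)" "n < M"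
  shows "(F \<otimes>\<^bsub>ps_ring R\<^esub> H) n = (trunc M F \<otimes>\<^bsub>UP R\<^esub> trunc M H) n"
proof -
  have "(\<Oplus>i\<in>{..n}. F i \<otimes> H (n - i)) = (\<Oplus>i\<in>{..n}. trunc M F i \<otimes> trunc M H (n - i))"
    using assms by (intro finsum_cong') (auto simp: trunc_def ps_ring_simps)
  then show ?thesis
    using trunc_up[OF assms(1), of M] trunc_up[OF assms(2), of M] by (simp add: ps_ring_simps UP_def)
qed

lemma ps_mult_closed:
  "\<lbrakk>F \<in> carrier (ps_ring R); H \<in> carrier (ps_ring R)\<rbrakk> \<Longrightarrow> F \<otimes>\<^bsub>ps_ring R\<^esub> H \<in> carrier (ps_ring R)"
  by (auto simp: ps_ring_simps intro!: finsum_closed)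

text \<open>Needed for triple products, where the left factor is itself a product and agrees with a
  polynomial only in low degrees.\<close>

lemma ps_mult_trunc_left:
  assumes "F \<in> carrier (UP R)" "H \<in> carrier (ps_ring R)" "n < M" "\<And>i. i < M \<Longrightarrow> F' i = F i"
  shows "(F' \<otimes>\<^bsub>ps_ring R\<^esub> H) n = (F \<otimes>\<^bsub>UP R\<^esub> trunc M H) n"
proof -
  have F: "F i \<in> carrier R" for i using assms(1) by (auto simp: UP_def up_def)
  have "(\<Oplus>i\<in>{..n}. F' i \<otimes> H (n - i)) = (\<Oplus>i\<in>{..n}. F i \<otimes> trunc M H (n - i))"
    using assms F by (intro finsum_cong') (auto simp: trunc_def ps_ring_simps)
  then show ?thesis
    using trunc_up[OF assms(2), of M] assms(1) by (simp add: ps_ring_simps UP_def)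
qed

text \<open>Coefficient n of a product involves only coefficients up to n, so commutativity and
  associativity are read off from polynomials after truncation.\<close>

lemma ps_ring_cring: "cring (ps_ring R)"
proof -
  interpret U: UP_cring R "UP R" by unfold_locales simp
  have comm: "F \<otimes>\<^bsub>ps_ring R\<^esub> H = H \<otimes>\<^bsub>ps_ring R\<^esub> F"
    if "F \<in> carrier (ps_ring R)" "H \<in> carrier (ps_ring R)" for F H
  proof
    fix n show "(F \<otimes>\<^bsub>ps_ring R\<^esub> H) n = (H \<otimes>\<^bsub>ps_ring R\<^esub> F) n"
      using ps_mult_trunc[OF that, of n "Suc n"] ps_mult_trunc[OF that(2,1), of n "Suc n"]
        U.UP_m_comm[OF trunc_up[OF that(1)] trunc_up[OF that(2)]] by simp
  qed
  have assoc: "(F \<otimes>\<^bsub>ps_ring R\<^esub> H) \<otimes>\<^bsub>ps_ring R\<^esub> K = F \<otimes>\<^bsub>ps_ring R\<^esub> (H \<otimes>\<^bsub>ps_ring R\<^esub> K)"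
    if a: "F \<in> carrier (ps_ring R)" "H \<in> carrier (ps_ring R)" "K \<in> carrier (ps_ring R)" for F H K
  proof
    fix n
    let ?t = "trunc (Suc n)"
    have "((F \<otimes>\<^bsub>ps_ring R\<^esub> H) \<otimes>\<^bsub>ps_ring R\<^esub> K) n = ((?t F \<otimes>\<^bsub>UP R\<^esub> ?t H) \<otimes>\<^bsub>UP R\<^esub> ?t K) n"
      by (rule ps_mult_trunc_left[OF U.UP_mult_closed[OF trunc_up[OF a(1)] trunc_up[OF a(2)]] a(3)])
         (use ps_mult_trunc[OF a(1,2)] in auto)
    \<comment> \<open>The factors are rotated so that the inner product stands on the left on both
      sides, where \<open>ps_mult_trunc_left\<close> can be used.\<close>
    also have "\<dots> = ((?t H \<otimes>\<^bsub>UP R\<^esub> ?t K) \<otimes>\<^bsub>UP R\<^esub> ?t F) n"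
      using a trunc_up U.UP_m_assoc U.UP_m_comm U.UP_mult_closed by metis
    also have "\<dots> = ((H \<otimes>\<^bsub>ps_ring R\<^esub> K) \<otimes>\<^bsub>ps_ring R\<^esub> F) n"
      by (rule ps_mult_trunc_left[OF U.UP_mult_closed[OF trunc_up[OF a(2)] trunc_up[OF a(3)]] a(1), symmetric])
         (use ps_mult_trunc[OF a(2,3)] in auto)
    finally show "((F \<otimes>\<^bsub>ps_ring R\<^esub> H) \<otimes>\<^bsub>ps_ring R\<^esub> K) n = (F \<otimes>\<^bsub>ps_ring R\<^esub> (H \<otimes>\<^bsub>ps_ring R\<^esub> K)) n"
      using comm[OF ps_mult_closed[OF a(2,3)] a(1)] by simp
  qed
  have one: "\<one>\<^bsub>ps_ring R\<^esub> \<otimes>\<^bsub>ps_ring R\<^esub> F = F" if "F \<in> carrier (ps_ring R)" for F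
  proof
    fix n
    have "(\<Oplus>i\<in>{..n}. (if i = 0 then \<one> else \<zero>) \<otimes> F (n - i)) = (if (0::nat) = 0 then \<one> else \<zero>) \<otimes> F (n - 0)"
      using that by (intro finsum_single) (auto simp: ps_ring_simps)
    then show "(\<one>\<^bsub>ps_ring R\<^esub> \<otimes>\<^bsub>ps_ring R\<^esub> F) n = F n" using that by (simp add: ps_ring_simps)
  qed
  have distr: "(F \<oplus>\<^bsub>ps_ring R\<^esub> H) \<otimes>\<^bsub>ps_ring R\<^esub> K = F \<otimes>\<^bsub>ps_ring R\<^esub> K \<oplus>\<^bsub>ps_ring R\<^esub> H \<otimes>\<^bsub>ps_ring R\<^esub> K"
    if a: "F \<in> carrier (ps_ring R)" "H \<in> carrier (ps_ring R)" "K \<in> carrier (ps_ring R)" for F H K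
  proof
    fix n
    have "(\<Oplus>i\<in>{..n}. (F i \<oplus> H i) \<otimes> K (n - i)) = (\<Oplus>i\<in>{..n}. F i \<otimes> K (n - i) \<oplus> H i \<otimes> K (n - i))"
      using a by (intro finsum_cong') (auto simp: ps_ring_simps l_distr)
    also have "\<dots> = (\<Oplus>i\<in>{..n}. F i \<otimes> K (n - i)) \<oplus> (\<Oplus>i\<in>{..n}. H i \<otimes> K (n - i))"
      using a by (intro finsum_addf) (auto simp: ps_ring_simps)
    finally show "((F \<oplus>\<^bsub>ps_ring R\<^esub> H) \<otimes>\<^bsub>ps_ring R\<^esub> K) n = (F \<otimes>\<^bsub>ps_ring R\<^esub> K \<oplus>\<^bsub>ps_ring R\<^esub> H \<otimes>\<^bsub>ps_ring R\<^esub> K) n"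
      by (simp add: ps_ring_simps)
  qed
  show ?thesis
  proof (rule cringI)
    show "abelian_group (ps_ring R)"
    proof (rule abelian_groupI)
      fix F assume F: "F \<in> carrier (ps_ring R)"
      then show "\<exists>y\<in>carrier (ps_ring R). y \<oplus>\<^bsub>ps_ring R\<^esub> F = \<zero>\<^bsub>ps_ring R\<^esub>"
        by (intro bexI[of _ "\<lambda>n. \<ominus> F n"]) (auto simp: ps_ring_simps l_neg)
    qed (auto simp: ps_ring_simps a_ac)
    show "comm_monoid (ps_ring R)"
    proof (rule comm_monoidI)
      show "\<one>\<^bsub>ps_ring R\<^esub> \<in> carrier (ps_ring R)" by (auto simp: ps_ring_simps)
    qed (use ps_mult_closed assoc one comm in auto)
  qed (use distr in auto)
qed

end

locale power_series = cring R for R (structure)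

sublocale power_series \<subseteq> P: cring "ps_ring R"
  by (rule ps_ring_cring)

definition ps_X :: "('a, 'm) ring_scheme \<Rightarrow> nat \<Rightarrow> 'a" where
  "ps_X A = (\<lambda>n. if n = 1 then \<one>\<^bsub>A\<^esub> else \<zero>\<^bsub>A\<^esub>)"

definition ps_shift :: "(nat \<Rightarrow> 'a) \<Rightarrow> nat \<Rightarrow> 'a" where
  "ps_shift F = (\<lambda>n. F (Suc n))"

context power_series
begin

abbreviation "P \<equiv> ps_ring R"

abbreviation "C \<equiv> ps_const R"

abbreviation "Xv \<equiv> ps_X R"

lemma coeff_closed: "F \<in> carrier P \<Longrightarrow> F n \<in> carrier R"
  by (simp add: ps_ring_simps)

lemma X_closed [simp, intro]: "Xv \<in> carrier P"
  by (simp add: ps_X_def ps_ring_simps)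

lemma C_closed [simp, intro]: "a \<in> carrier R \<Longrightarrow> C a \<in> carrier P"
  by (simp add: ps_const_def ps_ring_simps)

lemma shift_closed [simp, intro]: "F \<in> carrier P \<Longrightarrow> ps_shift F \<in> carrier P"
  by (simp add: ps_shift_def ps_ring_simps)

lemma C_mult:
  assumes "a \<in> carrier R" "F \<in> carrier P" shows "(C a \<otimes>\<^bsub>P\<^esub> F) n = a \<otimes> F n"
proof -
  have "(\<Oplus>i\<in>{..n}. C a i \<otimes> F (n - i)) = C a 0 \<otimes> F (n - 0)"
    using assms by (intro finsum_single) (auto simp: ps_ring_simps ps_const_def)
  then show ?thesis by (simp add: ps_ring_simps ps_const_def)
qed

lemma X_mult:
  assumes "F \<in> carrier P" shows "(Xv \<otimes>\<^bsub>P\<^esub> F) n = (case n of 0 \<Rightarrow> \<zero> | Suc j \<Rightarrow> F j)"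
proof (cases n)
  case 0
  then show ?thesis using assms by (simp add: ps_ring_simps ps_X_def)
next
  case (Suc j)
  have "(\<Oplus>i\<in>{..n}. Xv i \<otimes> F (n - i)) = Xv 1 \<otimes> F (n - 1)"
    using assms Suc by (intro finsum_single) (auto simp: ps_ring_simps ps_X_def)
  then show ?thesis using assms Suc by (simp add: ps_ring_simps ps_X_def)
qed

lemma C_ring_hom: "C \<in> ring_hom R P"
proof (rule ring_hom_memI)
  fix a b assume ab: "a \<in> carrier R" "b \<in> carrier R"
  show "C (a \<otimes> b) = C a \<otimes>\<^bsub>P\<^esub> C b"
    using C_mult[OF ab(1) C_closed[OF ab(2)]] ab by (auto simp: ps_const_def fun_eq_iff)
  show "C (a \<oplus> b) = C a \<oplus>\<^bsub>P\<^esub> C b"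
    using ab by (auto simp: ps_const_def ps_ring_simps fun_eq_iff)
qed (auto simp: ps_const_def ps_ring_simps)

text \<open>The recursion behind everything that follows: a series is reached through its constant
  term and a factor X, and each such factor gains one level of the (m,X)-adic filtration.\<close>

lemma ps_decomp: "F \<in> carrier P \<Longrightarrow> F = C (F 0) \<oplus>\<^bsub>P\<^esub> Xv \<otimes>\<^bsub>P\<^esub> ps_shift F"
proof
  fix n assume F: "F \<in> carrier P"
  have "(C (F 0) \<oplus>\<^bsub>P\<^esub> Xv \<otimes>\<^bsub>P\<^esub> ps_shift F) n = C (F 0) n \<oplus> (Xv \<otimes>\<^bsub>P\<^esub> ps_shift F) n"
    by (simp add: ps_ring_simps(5))
  then show "F n = (C (F 0) \<oplus>\<^bsub>P\<^esub> Xv \<otimes>\<^bsub>P\<^esub> ps_shift F) n"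
    using X_mult[OF shift_closed[OF F], of n] coeff_closed[OF F]
    by (cases n) (auto simp: ps_const_def ps_shift_def)
qed

lemma minus_coeff:
  assumes "F \<in> carrier P" "H \<in> carrier P"
  shows "(F \<ominus>\<^bsub>P\<^esub> H) n = F n \<ominus> H n"
proof -
  have "(F \<ominus>\<^bsub>P\<^esub> H) \<oplus>\<^bsub>P\<^esub> H = F" using assms by algebra
  then have "(F \<ominus>\<^bsub>P\<^esub> H) n \<oplus> H n = F n" by (metis ps_ring_simps(5))
  moreover have c: "(F \<ominus>\<^bsub>P\<^esub> H) n \<in> carrier R" using coeff_closed P.minus_closed assms by blast
  moreover have "x = (x \<oplus> y) \<ominus> y" if "x \<in> carrier R" "y \<in> carrier R" for x y using that by algebra
  ultimately show ?thesis using coeff_closed[OF assms(2), of n] by metis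
qed

text \<open>The inverse is the geometric series with coefficients a^n, characterised by H = 1 + X a
  H.\<close>

lemma geometric:
  assumes "a \<in> carrier R"
  shows "(\<one>\<^bsub>P\<^esub> \<ominus>\<^bsub>P\<^esub> Xv \<otimes>\<^bsub>P\<^esub> C a) \<in> Units P"
proof -
  define H where "H = (\<lambda>n::nat. a [^] n)"
  have H: "H \<in> carrier P" using assms by (simp add: H_def ps_ring_simps)
  have "H = C (H 0) \<oplus>\<^bsub>P\<^esub> Xv \<otimes>\<^bsub>P\<^esub> ps_shift H" by (rule ps_decomp[OF H])
  moreover have "ps_shift H = C a \<otimes>\<^bsub>P\<^esub> H"
    using C_mult[OF assms H] assms by (auto simp: ps_shift_def H_def m_comm)
  moreover have "C (H 0) = \<one>\<^bsub>P\<^esub>" by (simp add: H_def ps_const_def ps_ring_simps)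
  ultimately have *: "H = \<one>\<^bsub>P\<^esub> \<oplus>\<^bsub>P\<^esub> Xv \<otimes>\<^bsub>P\<^esub> (C a \<otimes>\<^bsub>P\<^esub> H)" by simp
  have "(\<one>\<^bsub>P\<^esub> \<ominus>\<^bsub>P\<^esub> Xv \<otimes>\<^bsub>P\<^esub> C a) \<otimes>\<^bsub>P\<^esub> H = H \<ominus>\<^bsub>P\<^esub> Xv \<otimes>\<^bsub>P\<^esub> (C a \<otimes>\<^bsub>P\<^esub> H)"
    using H X_closed C_closed[OF assms] by (simp add: P.minus_eq P.l_distr P.l_minus P.m_assoc)
  also have "\<dots> = \<one>\<^bsub>P\<^esub> \<oplus>\<^bsub>P\<^esub> Xv \<otimes>\<^bsub>P\<^esub> (C a \<otimes>\<^bsub>P\<^esub> H) \<ominus>\<^bsub>P\<^esub> Xv \<otimes>\<^bsub>P\<^esub> (C a \<otimes>\<^bsub>P\<^esub> H)"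
    using * by simp
  also have "\<dots> = \<one>\<^bsub>P\<^esub>" using H X_closed C_closed[OF assms] by algebra
  finally show ?thesis
    using H C_closed[OF assms] P.m_comm unfolding Units_def by fastforce
qed

end

section \<open>Automorphisms of power series rings over a local ring with nilpotent maximal ideal\<close>

text \<open>Instances are the objects of \<open>Art\<close> with their maximal ideal and k itself
  with the zero ideal, so that reduction to k is a base change like any other.\<close>

locale nil_local = power_series R for R (structure) +
  fixes m :: "'a set"
  assumes m_ideal: "ideal m R"
    and m_nil: "\<exists>n. ideal_pow R m n = {\<zero>}"
    and m_unit: "x \<in> carrier R \<Longrightarrow> x \<notin> m \<Longrightarrow> x \<in> Units R"

text \<open>This is the n-th power of the ideal (I, X) of the power series ring. With truncated
  subtraction, coefficients from degree n on are unrestricted.\<close>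

definition mx_pow :: "('a, 'b) ring_scheme \<Rightarrow> 'a set \<Rightarrow> nat \<Rightarrow> (nat \<Rightarrow> 'a) set" where
  "mx_pow A I n = {F \<in> carrier (ps_ring A). \<forall>j. F j \<in> ideal_pow A I (n - j)}"

text \<open>The kernel of reducing coefficients modulo I^n; unlike \<open>mx_pow\<close> it is
  uniform in the degree and measures how close an automorphism is to the identity.\<close>

definition coeffs_in :: "('a, 'b) ring_scheme \<Rightarrow> 'a set \<Rightarrow> nat \<Rightarrow> (nat \<Rightarrow> 'a) set" where
  "coeffs_in A I n = {F \<in> carrier (ps_ring A). \<forall>j. F j \<in> ideal_pow A I n}"

text \<open>The condition on the constant term makes the endomorphism continuous for the (I,X)-adic
  filtration, hence determined by the image of X.\<close>

definition ps_hom :: "('a, 'b) ring_scheme \<Rightarrow> 'a set \<Rightarrow> ((nat \<Rightarrow> 'a) \<Rightarrow> (nat \<Rightarrow> 'a)) \<Rightarrow> bool" where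
  "ps_hom A I \<phi> \<longleftrightarrow> \<phi> \<in> ring_hom (ps_ring A) (ps_ring A) \<and>
     (\<forall>a\<in>carrier A. \<phi> (ps_const A a) = ps_const A a) \<and> \<phi> (ps_X A) 0 \<in> I"

context nil_local
begin

abbreviation "Q \<equiv> mx_pow R m"

abbreviation "PI \<equiv> coeffs_in R m"

lemmas mpow_ideal = ideal_pow_ideal[OF m_ideal]

lemma P_sumD: "(F \<oplus>\<^bsub>P\<^esub> H) j = F j \<oplus> H j" and P_multD: "(F \<otimes>\<^bsub>P\<^esub> H) j = (\<Oplus>i\<in>{..j}. F i \<otimes> H (j - i))"
  by (simp_all add: ps_ring_simps)

lemma Q_carrier: "F \<in> Q n \<Longrightarrow> F \<in> carrier P" and PI_carrier: "F \<in> PI n \<Longrightarrow> F \<in> carrier P"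
  by (simp_all add: mx_pow_def coeffs_in_def)

lemma Q_mult:
  assumes "F \<in> Q a" "H \<in> Q b"
  shows "F \<otimes>\<^bsub>P\<^esub> H \<in> Q (a + b)"
proof -
  have "F i \<otimes> H (j - i) \<in> ideal_pow R m (a + b - j)" if "i \<le> j" for i j
  proof -
    have "F i \<otimes> H (j - i) \<in> ideal_pow R m ((a - i) + (b - (j - i)))"
      using assms by (intro ideal_pow_mult m_ideal) (auto simp: mx_pow_def)
    moreover have "a + b - j \<le> (a - i) + (b - (j - i))" using that by auto
    ultimately show ?thesis using ideal_pow_le[OF m_ideal] by blast
  qed
  then show ?thesis using P.m_closed[OF Q_carrier[OF assms(1)] Q_carrier[OF assms(2)]]
    by (auto simp: mx_pow_def P_multD intro!: ideal_finsum_closed[OF mpow_ideal])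
qed

lemma PI_mult:
  assumes "F \<in> PI a" "H \<in> PI b"
  shows "F \<otimes>\<^bsub>P\<^esub> H \<in> PI (a + b)"
proof -
  have "(\<Oplus>i\<in>{..j}. F i \<otimes> H (j - i)) \<in> ideal_pow R m (a + b)" for j
    using assms by (intro ideal_finsum_closed[OF mpow_ideal] ideal_pow_mult[OF m_ideal]) (auto simp: coeffs_in_def)
  then show ?thesis using P.m_closed[OF PI_carrier[OF assms(1)] PI_carrier[OF assms(2)]]
    by (simp add: coeffs_in_def P_multD)
qed

lemma Q_0: "Q 0 = carrier P" and PI_0: "PI 0 = carrier P"
  unfolding mx_pow_def coeffs_in_def diff_0_eq_0 ideal_pow_0 by (auto simp: ps_ring_simps)

lemma Q_ideal: "ideal (Q n) P"
proof (rule P.idealI_cring)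
  show "r \<otimes>\<^bsub>P\<^esub> x \<in> Q n" if "r \<in> carrier P" "x \<in> Q n" for r x
    using Q_mult[of r 0 x n] that by (simp add: Q_0)
  show "x \<oplus>\<^bsub>P\<^esub> y \<in> Q n" if "x \<in> Q n" "y \<in> Q n" for x y
    using that P.a_closed[of x y] by (simp add: mx_pow_def P_sumD ideal_a_closed[OF mpow_ideal])
  show "\<zero>\<^bsub>P\<^esub> \<in> Q n"
    by (simp add: mx_pow_def ps_ring_simps ideal_zero_closed[OF mpow_ideal])
  show "Q n \<subseteq> carrier P" by (rule subsetI) (rule Q_carrier)
qed

lemma PI_ideal: "ideal (PI n) P"
proof (rule P.idealI_cring)
  show "r \<otimes>\<^bsub>P\<^esub> x \<in> PI n" if "r \<in> carrier P" "x \<in> PI n" for r x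
    using PI_mult[of r 0 x n] that by (simp add: PI_0)
  show "x \<oplus>\<^bsub>P\<^esub> y \<in> PI n" if "x \<in> PI n" "y \<in> PI n" for x y
    using that P.a_closed[of x y] by (simp add: coeffs_in_def P_sumD ideal_a_closed[OF mpow_ideal])
  show "\<zero>\<^bsub>P\<^esub> \<in> PI n"
    by (simp add: coeffs_in_def ps_ring_simps ideal_zero_closed[OF mpow_ideal])
  show "PI n \<subseteq> carrier P" by (rule subsetI) (rule PI_carrier)
qed

lemma Q_le: "a \<le> b \<Longrightarrow> Q b \<subseteq> Q a"
  using ideal_pow_le[OF m_ideal, OF diff_le_mono, of a b] by (auto simp: mx_pow_def)

lemma PI_le: "a \<le> b \<Longrightarrow> PI b \<subseteq> PI a"
  using ideal_pow_le[OF m_ideal, of a b] by (auto simp: coeffs_in_def)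

definition nil_index :: nat where "nil_index = (SOME n. ideal_pow R m n = {\<zero>})"

lemma nil_index: "ideal_pow R m nil_index = {\<zero>}"
  unfolding nil_index_def by (rule someI_ex[OF m_nil])

lemma PI_nil: "PI nil_index = {\<zero>\<^bsub>P\<^esub>}"
  unfolding coeffs_in_def nil_index by (auto simp: ps_ring_simps)

text \<open>Level \<open>nil_index\<close> + j forces coefficient j into a vanishing power of
  m.\<close>

lemma Q_Inter: "(\<And>n. F \<in> Q n) \<Longrightarrow> F = \<zero>\<^bsub>P\<^esub>"
proof
  fix j assume "\<And>n. F \<in> Q n"
  then have "F j \<in> ideal_pow R m (nil_index + j - j)" unfolding mx_pow_def by blast
  then show "F j = \<zero>\<^bsub>P\<^esub> j" using nil_index by (simp add: ps_ring_simps)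
qed

lemma Q_eqI:
  assumes "F \<in> carrier P" "H \<in> carrier P" "\<And>n. F \<ominus>\<^bsub>P\<^esub> H \<in> Q n"
  shows "F = H"
proof -
  have "F \<ominus>\<^bsub>P\<^esub> H = \<zero>\<^bsub>P\<^esub>" using Q_Inter assms(3) by blast
  then show ?thesis using assms P.r_right_minus_eq by blast
qed

lemma Q_1I: "\<lbrakk>s \<in> carrier P; s 0 \<in> m\<rbrakk> \<Longrightarrow> s \<in> Q 1"
proof -
  assume a: "s \<in> carrier P" "s 0 \<in> m"
  have "s j \<in> ideal_pow R m (1 - j)" for j
  proof (cases j)
    case 0
    then show ?thesis using a ideal_pow_1[OF m_ideal] by simp
  next
    case (Suc i)
    then have "ideal_pow R m (1 - j) = carrier R" using ideal_pow_0 by simp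
    then show ?thesis using coeff_closed[OF a(1)] by simp
  qed
  then show ?thesis using a by (simp add: mx_pow_def)
qed

lemma X_Q_1: "Xv \<in> Q 1"
  by (rule Q_1I[OF X_closed]) (use ideal_zero_closed[OF m_ideal] in \<open>simp add: ps_X_def\<close>)

text \<open>Completeness needs nilpotency of m only: each single coefficient of the sequence is
  eventually constant.\<close>

lemma Q_limit:
  assumes H: "\<And>n. H n \<in> carrier P" "\<And>n. H (Suc n) \<ominus>\<^bsub>P\<^esub> H n \<in> Q n"
  shows "\<exists>L\<in>carrier P. \<forall>n. L \<ominus>\<^bsub>P\<^esub> H n \<in> Q n"
proof -
  have diff: "H (n + d) \<ominus>\<^bsub>P\<^esub> H n \<in> Q n" for n d
  proof (induction d)
    case 0
    then show ?case using H(1)[of n] P.ideal_zero_closed[OF Q_ideal] by (simp add: P.diff_self)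
  next
    case (Suc d)
    have "H (Suc (n + d)) \<ominus>\<^bsub>P\<^esub> H (n + d) \<in> Q n" using H(2)[of "n + d"] Q_le[of n "n + d"] by auto
    from P.ideal_a_closed[OF Q_ideal this Suc]
    show ?case using P.diff_add_diff[OF H(1) H(1) H(1)] by simp
  qed
  \<comment> \<open>Coefficient j no longer changes from index \<open>nil_index\<close> + j on,
    because a change at that stage lies in a vanishing power of m.\<close>
  define L where "L = (\<lambda>j. H (nil_index + j) j)"
  have L: "L \<in> carrier P" using coeff_closed[OF H(1)] by (simp add: L_def ps_ring_simps)
  have "(L \<ominus>\<^bsub>P\<^esub> H n) j \<in> ideal_pow R m (n - j)" for n j
  proof -
    have eq: "(L \<ominus>\<^bsub>P\<^esub> H n) j = (H (nil_index + j) \<ominus>\<^bsub>P\<^esub> H n) j"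
      unfolding minus_coeff[OF L H(1)] minus_coeff[OF H(1) H(1)] by (simp add: L_def)
    show ?thesis
    proof (cases "n \<le> nil_index + j")
      case True
      then have "H (nil_index + j) \<ominus>\<^bsub>P\<^esub> H n \<in> Q n" using diff[of n "nil_index + j - n"] by simp
      then show ?thesis using eq by (simp add: mx_pow_def)
    next
      case False
      then have "H n \<ominus>\<^bsub>P\<^esub> H (nil_index + j) \<in> Q (nil_index + j)"
        using diff[of "nil_index + j" "n - (nil_index + j)"] by simp
      then have "(H n \<ominus>\<^bsub>P\<^esub> H (nil_index + j)) j \<in> ideal_pow R m nil_index"
        by (auto simp: mx_pow_def dest: spec[of _ j])
      then have "H n j \<ominus> H (nil_index + j) j = \<zero>"
        using nil_index minus_coeff[OF H(1) H(1)] by simp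
      then have "H n j = H (nil_index + j) j" using coeff_closed[OF H(1)] r_right_minus_eq by blast
      then show ?thesis using eq minus_coeff[OF H(1) H(1)] coeff_closed[OF H(1)]
          ideal_zero_closed[OF mpow_ideal] by (simp add: diff_self)
    qed
  qed
  then have "L \<ominus>\<^bsub>P\<^esub> H n \<in> Q n" for n
    using P.minus_closed[OF L H(1)] by (simp add: mx_pow_def)
  then show ?thesis using L by blast
qed

text \<open>The Horner form of the partial sum of F(i) s^i over i < n, that is, n terms of the
  substitution of s into F.\<close>

primrec horner :: "(nat \<Rightarrow> 'a) \<Rightarrow> nat \<Rightarrow> (nat \<Rightarrow> 'a) \<Rightarrow> nat \<Rightarrow> 'a" where
  "horner s 0 F = \<zero>\<^bsub>P\<^esub>"
| "horner s (Suc n) F = C (F 0) \<oplus>\<^bsub>P\<^esub> s \<otimes>\<^bsub>P\<^esub> horner s n (ps_shift F)"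

lemma horner_closed: "\<lbrakk>s \<in> carrier P; F \<in> carrier P\<rbrakk> \<Longrightarrow> horner s n F \<in> carrier P"
  by (induction n arbitrary: F) (auto simp: coeff_closed)

lemma C_add: "\<lbrakk>a \<in> carrier R; b \<in> carrier R\<rbrakk> \<Longrightarrow> C (a \<oplus> b) = C a \<oplus>\<^bsub>P\<^esub> C b"
  and C_times: "\<lbrakk>a \<in> carrier R; b \<in> carrier R\<rbrakk> \<Longrightarrow> C (a \<otimes> b) = C a \<otimes>\<^bsub>P\<^esub> C b"
  and C_1: "C \<one> = \<one>\<^bsub>P\<^esub>" and C_zero: "C \<zero> = \<zero>\<^bsub>P\<^esub>"
  by (simp_all add: ring_hom_add[OF C_ring_hom] ring_hom_mult[OF C_ring_hom] ring_hom_one[OF C_ring_hom])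
     (simp add: ps_const_def ps_ring_simps)

lemma shift_add: "ps_shift (F \<oplus>\<^bsub>P\<^esub> H) = ps_shift F \<oplus>\<^bsub>P\<^esub> ps_shift H"
  by (simp add: ps_shift_def ps_ring_simps)

lemma horner_add: "\<lbrakk>s \<in> carrier P; F \<in> carrier P; H \<in> carrier P\<rbrakk> \<Longrightarrow>
  horner s n (F \<oplus>\<^bsub>P\<^esub> H) = horner s n F \<oplus>\<^bsub>P\<^esub> horner s n H"
proof (induction n arbitrary: F H)
  case (Suc n)
  then have c: "C (F 0) \<in> carrier P" "C (H 0) \<in> carrier P"
    "horner s n (ps_shift F) \<in> carrier P" "horner s n (ps_shift H) \<in> carrier P"
    by (auto simp: coeff_closed horner_closed)
  have "horner s (Suc n) (F \<oplus>\<^bsub>P\<^esub> H) = (C (F 0) \<oplus>\<^bsub>P\<^esub> C (H 0)) \<oplus>\<^bsub>P\<^esub> s \<otimes>\<^bsub>P\<^esub> (horner s n (ps_shift F) \<oplus>\<^bsub>P\<^esub> horner s n (ps_shift H))"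
    using Suc.IH[OF Suc.prems(1) shift_closed[OF Suc.prems(2)] shift_closed[OF Suc.prems(3)]] Suc.prems
    by (simp add: shift_add P_sumD[of F H 0] C_add coeff_closed)
  also have "\<dots> = horner s (Suc n) F \<oplus>\<^bsub>P\<^esub> horner s (Suc n) H"
    unfolding horner.simps using c Suc.prems by algebra
  finally show ?case .
qed simp

lemma shift_C_mult:
  assumes "a \<in> carrier R" "F \<in> carrier P"
  shows "ps_shift (C a \<otimes>\<^bsub>P\<^esub> F) = C a \<otimes>\<^bsub>P\<^esub> ps_shift F"
  using C_mult[OF assms] C_mult[OF assms(1) shift_closed[OF assms(2)]] by (auto simp: ps_shift_def)

lemma horner_C_mult: "\<lbrakk>s \<in> carrier P; a \<in> carrier R; F \<in> carrier P\<rbrakk> \<Longrightarrow>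
  horner s n (C a \<otimes>\<^bsub>P\<^esub> F) = C a \<otimes>\<^bsub>P\<^esub> horner s n F"
proof (induction n arbitrary: F)
  case (Suc n)
  then have c: "C (F 0) \<in> carrier P" "horner s n (ps_shift F) \<in> carrier P" "C a \<in> carrier P"
    by (auto simp: coeff_closed horner_closed)
  have "horner s (Suc n) (C a \<otimes>\<^bsub>P\<^esub> F) = C a \<otimes>\<^bsub>P\<^esub> C (F 0) \<oplus>\<^bsub>P\<^esub> s \<otimes>\<^bsub>P\<^esub> (C a \<otimes>\<^bsub>P\<^esub> horner s n (ps_shift F))"
    using Suc.IH[OF Suc.prems(1,2) shift_closed[OF Suc.prems(3)]] Suc.prems
    by (simp add: shift_C_mult C_mult[of a F 0] C_times coeff_closed)
  also have "\<dots> = C a \<otimes>\<^bsub>P\<^esub> horner s (Suc n) F"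
    unfolding horner.simps using c Suc.prems(1) by algebra
  finally show ?case .
qed simp

lemma horner_Suc_diff:
  assumes "s \<in> carrier P" "s 0 \<in> m" "F \<in> carrier P"
  shows "horner s (Suc n) F \<ominus>\<^bsub>P\<^esub> horner s n F \<in> Q n"
  using assms(3)
proof (induction n arbitrary: F)
  case 0
  then show ?case using horner_closed[OF assms(1)] unfolding Q_0 by blast
next
  case (Suc n)
  have c: "C (F 0) \<in> carrier P" "horner s n (ps_shift F) \<in> carrier P" "horner s (Suc n) (ps_shift F) \<in> carrier P"
    using Suc.prems assms(1) by (auto simp: coeff_closed horner_closed simp del: horner.simps)
  have "horner s (Suc (Suc n)) F \<ominus>\<^bsub>P\<^esub> horner s (Suc n) F =
      s \<otimes>\<^bsub>P\<^esub> (horner s (Suc n) (ps_shift F) \<ominus>\<^bsub>P\<^esub> horner s n (ps_shift F))"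
    unfolding horner.simps(2)[of s "Suc n" F] horner.simps(2)[of s n F] using c assms(1) by algebra
  then show ?case
    using Q_mult[OF Q_1I[OF assms(1,2)] Suc.IH[OF shift_closed[OF Suc.prems]]] by simp
qed

lemma shift_mult:
  assumes "F \<in> carrier P" "H \<in> carrier P"
  shows "ps_shift (F \<otimes>\<^bsub>P\<^esub> H) = C (F 0) \<otimes>\<^bsub>P\<^esub> ps_shift H \<oplus>\<^bsub>P\<^esub> ps_shift F \<otimes>\<^bsub>P\<^esub> H"
    and "(F \<otimes>\<^bsub>P\<^esub> H) 0 = F 0 \<otimes> H 0"
proof -
  have c: "C (F 0) \<in> carrier P" "ps_shift F \<in> carrier P" using assms by (auto simp: coeff_closed)
  have "F \<otimes>\<^bsub>P\<^esub> H = (C (F 0) \<oplus>\<^bsub>P\<^esub> Xv \<otimes>\<^bsub>P\<^esub> ps_shift F) \<otimes>\<^bsub>P\<^esub> H" using ps_decomp[OF assms(1)] by simp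
  also have "\<dots> = C (F 0) \<otimes>\<^bsub>P\<^esub> H \<oplus>\<^bsub>P\<^esub> Xv \<otimes>\<^bsub>P\<^esub> (ps_shift F \<otimes>\<^bsub>P\<^esub> H)"
    using c assms X_closed by algebra
  finally have "F \<otimes>\<^bsub>P\<^esub> H = C (F 0) \<otimes>\<^bsub>P\<^esub> H \<oplus>\<^bsub>P\<^esub> Xv \<otimes>\<^bsub>P\<^esub> (ps_shift F \<otimes>\<^bsub>P\<^esub> H)" .
  moreover have "ps_shift (Xv \<otimes>\<^bsub>P\<^esub> (ps_shift F \<otimes>\<^bsub>P\<^esub> H)) = ps_shift F \<otimes>\<^bsub>P\<^esub> H"
    using X_mult[of "ps_shift F \<otimes>\<^bsub>P\<^esub> H"] c assms by (auto simp: ps_shift_def[of "Xv \<otimes>\<^bsub>P\<^esub> _"])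
  ultimately show "ps_shift (F \<otimes>\<^bsub>P\<^esub> H) = C (F 0) \<otimes>\<^bsub>P\<^esub> ps_shift H \<oplus>\<^bsub>P\<^esub> ps_shift F \<otimes>\<^bsub>P\<^esub> H"
    using shift_C_mult[OF _ assms(2), of "F 0"] coeff_closed[OF assms(1)] by (metis shift_add)
  show "(F \<otimes>\<^bsub>P\<^esub> H) 0 = F 0 \<otimes> H 0" using coeff_closed assms by (simp add: P_multD)
qed

text \<open>Truncated substitution is multiplicative only up to the (m,X)-adic order of the
  truncation. The induction follows the product rule \<open>shift_mult\<close>.\<close>

lemma horner_mult:
  assumes "s \<in> carrier P" "s 0 \<in> m" "F \<in> carrier P" "H \<in> carrier P"
  shows "horner s n (F \<otimes>\<^bsub>P\<^esub> H) \<ominus>\<^bsub>P\<^esub> horner s n F \<otimes>\<^bsub>P\<^esub> horner s n H \<in> Q n"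
  using assms(3,4)
proof (induction n arbitrary: F H)
  case 0
  then show ?case using horner_closed[OF assms(1)] unfolding Q_0 by blast
next
  case (Suc n)
  let ?F = "ps_shift F" and ?H = "ps_shift H"
  have FH: "?F \<in> carrier P" "?H \<in> carrier P" "F 0 \<in> carrier R" "H 0 \<in> carrier R"
    using Suc.prems by (auto simp: coeff_closed)
  define a b f h h' t where "a = C (F 0)" and "b = C (H 0)" and "f = horner s n ?F" and "h = horner s n ?H"
    and "h' = horner s n H" and "t = horner s n (?F \<otimes>\<^bsub>P\<^esub> H)"
  have c: "a \<in> carrier P" "b \<in> carrier P" "f \<in> carrier P" "h \<in> carrier P" "h' \<in> carrier P" "t \<in> carrier P"
    using FH Suc.prems assms(1) by (auto simp: horner_closed a_def b_def f_def h_def h'_def t_def)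
  have 1: "horner s (Suc n) (F \<otimes>\<^bsub>P\<^esub> H) = a \<otimes>\<^bsub>P\<^esub> b \<oplus>\<^bsub>P\<^esub> s \<otimes>\<^bsub>P\<^esub> (a \<otimes>\<^bsub>P\<^esub> h \<oplus>\<^bsub>P\<^esub> t)"
    using FH Suc.prems assms(1)
    by (simp add: shift_mult horner_add horner_C_mult C_times a_def b_def h_def t_def)
  have 2: "horner s (Suc n) F = a \<oplus>\<^bsub>P\<^esub> s \<otimes>\<^bsub>P\<^esub> f" "horner s (Suc n) H = b \<oplus>\<^bsub>P\<^esub> s \<otimes>\<^bsub>P\<^esub> h"
    by (simp_all add: a_def b_def f_def h_def)
  \<comment> \<open>The product rule involves H itself, whereas the expansion of the second factor
    goes one term further. The gap between consecutive partial sums lies in Q n and is absorbed by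
    the factor s.\<close>
  have t: "t \<ominus>\<^bsub>P\<^esub> f \<otimes>\<^bsub>P\<^esub> h' \<in> Q n" using Suc.IH[OF FH(1) Suc.prems(2)] by (simp add: t_def f_def h'_def)
  have "(b \<oplus>\<^bsub>P\<^esub> s \<otimes>\<^bsub>P\<^esub> h) \<ominus>\<^bsub>P\<^esub> h' \<in> Q n"
    using horner_Suc_diff[OF assms(1,2) Suc.prems(2), of n] unfolding 2 h'_def .
  then have h': "f \<otimes>\<^bsub>P\<^esub> ((b \<oplus>\<^bsub>P\<^esub> s \<otimes>\<^bsub>P\<^esub> h) \<ominus>\<^bsub>P\<^esub> h') \<in> Q n"
    using ideal.I_l_closed[OF Q_ideal] c by blast
  have "a \<otimes>\<^bsub>P\<^esub> b \<oplus>\<^bsub>P\<^esub> s \<otimes>\<^bsub>P\<^esub> (a \<otimes>\<^bsub>P\<^esub> h \<oplus>\<^bsub>P\<^esub> t) \<ominus>\<^bsub>P\<^esub> (a \<oplus>\<^bsub>P\<^esub> s \<otimes>\<^bsub>P\<^esub> f) \<otimes>\<^bsub>P\<^esub> (b \<oplus>\<^bsub>P\<^esub> s \<otimes>\<^bsub>P\<^esub> h) =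
      s \<otimes>\<^bsub>P\<^esub> ((t \<ominus>\<^bsub>P\<^esub> f \<otimes>\<^bsub>P\<^esub> h') \<ominus>\<^bsub>P\<^esub> f \<otimes>\<^bsub>P\<^esub> ((b \<oplus>\<^bsub>P\<^esub> s \<otimes>\<^bsub>P\<^esub> h) \<ominus>\<^bsub>P\<^esub> h'))"
    using c assms(1) by algebra
  moreover have "\<dots> \<in> Q (1 + n)"
    using Q_mult[OF Q_1I[OF assms(1,2)] P.ideal_minus_closed[OF Q_ideal t h']] .
  ultimately show ?case unfolding 1 2 by simp
qed

lemma horner_C: "\<lbrakk>s \<in> carrier P; a \<in> carrier R\<rbrakk> \<Longrightarrow> horner s (Suc n) (C a) = C a"
proof -
  assume a: "s \<in> carrier P" "a \<in> carrier R"
  have "ps_shift (C a) = C \<zero>" by (auto simp: ps_shift_def ps_const_def)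
  moreover have "horner s n (C \<zero>) = \<zero>\<^bsub>P\<^esub>"
    using horner_C_mult[OF a(1) zero_closed C_closed[OF zero_closed], of n] horner_closed[OF a(1) C_closed[OF zero_closed]]
    by (simp add: C_zero)
  moreover have "C a 0 = a" by (simp add: ps_const_def)
  ultimately show ?thesis using a C_closed by simp
qed

lemma horner_X: "s \<in> carrier P \<Longrightarrow> horner s (Suc (Suc n)) Xv = s"
proof -
  assume s: "s \<in> carrier P"
  have "ps_shift Xv = C \<one>" by (auto simp: ps_shift_def ps_X_def ps_const_def)
  then have "horner s (Suc (Suc n)) Xv = C (Xv 0) \<oplus>\<^bsub>P\<^esub> s \<otimes>\<^bsub>P\<^esub> horner s (Suc n) (C \<one>)" by simp
  also have "\<dots> = s" using s horner_C[OF s one_closed] by (simp add: C_1 ps_X_def C_zero)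
  finally show ?thesis .
qed

text \<open>F(s) is the limit of the partial sums. Limits are unique, so relations that hold for
  partial sums up to Q n for every n become exact.\<close>

theorem substitution:
  assumes s: "s \<in> carrier P" "s 0 \<in> m"
  obtains \<phi> where "ps_hom R m \<phi>" "\<phi> Xv = s"
proof -
  have "\<exists>L\<in>carrier P. \<forall>n. L \<ominus>\<^bsub>P\<^esub> horner s n F \<in> Q n" if "F \<in> carrier P" for F
    by (rule Q_limit) (use horner_closed[OF s(1) that] horner_Suc_diff[OF s that] in auto)
  then obtain \<phi> where \<phi>: "\<And>F. F \<in> carrier P \<Longrightarrow> \<phi> F \<in> carrier P"
      "\<And>F n. F \<in> carrier P \<Longrightarrow> \<phi> F \<ominus>\<^bsub>P\<^esub> horner s n F \<in> Q n"
    by metis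
  have uniq: "\<phi> F = L" if "F \<in> carrier P" "L \<in> carrier P" "\<And>n. L \<ominus>\<^bsub>P\<^esub> horner s n F \<in> Q n" for F L
  proof (rule Q_eqI[OF \<phi>(1)[OF that(1)] that(2)])
    fix n
    have "\<phi> F \<ominus>\<^bsub>P\<^esub> L = (\<phi> F \<ominus>\<^bsub>P\<^esub> horner s n F) \<ominus>\<^bsub>P\<^esub> (L \<ominus>\<^bsub>P\<^esub> horner s n F)"
      using \<phi>(1)[OF that(1)] that(2) horner_closed[OF s(1) that(1), of n] by algebra
    then show "\<phi> F \<ominus>\<^bsub>P\<^esub> L \<in> Q n"
      using P.ideal_minus_closed[OF Q_ideal \<phi>(2)[OF that(1)] that(3)] by simp
  qed
  have C: "\<phi> (C a) = C a" if "a \<in> carrier R" for a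
  proof (rule uniq)
    show "C a \<ominus>\<^bsub>P\<^esub> horner s n (C a) \<in> Q n" for n
      using horner_C[OF s(1) that] that C_closed[OF that] Q_0 P.ideal_zero_closed[OF Q_ideal, of n]
      by (cases n) (auto simp: P.diff_self simp del: horner.simps(2))
  qed (use that in auto)
  have Xv: "\<phi> Xv = s"
  proof (rule uniq)
    show "s \<ominus>\<^bsub>P\<^esub> horner s n Xv \<in> Q n" for n
    proof -
      \<comment> \<open>Partial sums reproduce X only from two terms on. For n = 1 the sum is zero,
        and s itself lies in Q 1 because its constant term is in m.\<close>
      consider "n = 0" | "n = 1" | k where "n = Suc (Suc k)" by (metis One_nat_def not0_implies_Suc)
      then show ?thesis
      proof cases
        case 2
        have "horner s 1 Xv = \<zero>\<^bsub>P\<^esub>" using s(1) by (simp add: ps_X_def C_zero)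
        then have "s \<ominus>\<^bsub>P\<^esub> horner s 1 Xv = s" using s(1) by algebra
        then show ?thesis using Q_1I[OF s] 2 by simp
      qed (use s P.ideal_zero_closed[OF Q_ideal] horner_X[OF s(1)] Q_0 in \<open>auto simp: P.diff_self simp del: horner.simps(2)\<close>)
    qed
  qed (use s in auto)
  have "\<phi> \<in> ring_hom P P"
  proof (rule ring_hom_memI)
    fix F H assume FH: "F \<in> carrier P" "H \<in> carrier P"
    note c = \<phi>(1)[OF FH(1)] \<phi>(1)[OF FH(2)] horner_closed[OF s(1) FH(1)] horner_closed[OF s(1) FH(2)]
    show "\<phi> (F \<oplus>\<^bsub>P\<^esub> H) = \<phi> F \<oplus>\<^bsub>P\<^esub> \<phi> H"
    proof (rule uniq)
      fix n
      have "\<phi> F \<oplus>\<^bsub>P\<^esub> \<phi> H \<ominus>\<^bsub>P\<^esub> (horner s n F \<oplus>\<^bsub>P\<^esub> horner s n H) =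
          (\<phi> F \<ominus>\<^bsub>P\<^esub> horner s n F) \<oplus>\<^bsub>P\<^esub> (\<phi> H \<ominus>\<^bsub>P\<^esub> horner s n H)"
        using c(1,2) c(3,4)[of n] by algebra
      then show "\<phi> F \<oplus>\<^bsub>P\<^esub> \<phi> H \<ominus>\<^bsub>P\<^esub> horner s n (F \<oplus>\<^bsub>P\<^esub> H) \<in> Q n"
        using P.ideal_a_closed[OF Q_ideal \<phi>(2)[OF FH(1)] \<phi>(2)[OF FH(2)]] horner_add[OF s(1) FH] by simp
    qed (use FH c in auto)
    show "\<phi> (F \<otimes>\<^bsub>P\<^esub> H) = \<phi> F \<otimes>\<^bsub>P\<^esub> \<phi> H"
    proof (rule uniq)
      fix n
      define f h fh where "f = horner s n F" and "h = horner s n H" and "fh = horner s n (F \<otimes>\<^bsub>P\<^esub> H)"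
      have c': "f \<in> carrier P" "h \<in> carrier P" "fh \<in> carrier P"
        using c FH horner_closed[OF s(1)] by (auto simp: f_def h_def fh_def)
      have "\<phi> F \<otimes>\<^bsub>P\<^esub> \<phi> H \<ominus>\<^bsub>P\<^esub> fh = \<phi> F \<otimes>\<^bsub>P\<^esub> (\<phi> H \<ominus>\<^bsub>P\<^esub> h) \<oplus>\<^bsub>P\<^esub> h \<otimes>\<^bsub>P\<^esub> (\<phi> F \<ominus>\<^bsub>P\<^esub> f) \<ominus>\<^bsub>P\<^esub> (fh \<ominus>\<^bsub>P\<^esub> f \<otimes>\<^bsub>P\<^esub> h)"
        using c(1,2) c' by algebra
      moreover have "\<phi> F \<otimes>\<^bsub>P\<^esub> (\<phi> H \<ominus>\<^bsub>P\<^esub> h) \<in> Q n" "h \<otimes>\<^bsub>P\<^esub> (\<phi> F \<ominus>\<^bsub>P\<^esub> f) \<in> Q n" "fh \<ominus>\<^bsub>P\<^esub> f \<otimes>\<^bsub>P\<^esub> h \<in> Q n"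
        using ideal.I_l_closed[OF Q_ideal] \<phi>(2)[OF FH(1)] \<phi>(2)[OF FH(2)] c(1) c' horner_mult[OF s FH]
        by (auto simp: f_def h_def fh_def)
      ultimately show "\<phi> F \<otimes>\<^bsub>P\<^esub> \<phi> H \<ominus>\<^bsub>P\<^esub> horner s n (F \<otimes>\<^bsub>P\<^esub> H) \<in> Q n"
        using P.ideal_minus_closed[OF Q_ideal P.ideal_a_closed[OF Q_ideal]] by (simp add: fh_def)
    qed (use FH c in auto)
  qed (use \<phi> C[OF one_closed] in \<open>auto simp: C_1\<close>)
  then show thesis using that[of \<phi>] C Xv s by (simp add: ps_hom_def)
qed

end

lemma ring_hom_cringI2: "\<lbrakk>cring R; cring S; f \<in> ring_hom R S\<rbrakk> \<Longrightarrow> ring_hom_cring R S f"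
  by (simp add: ring_hom_cring_def ring_hom_cring_axioms_def)

lemma comp_ring_hom_ps:
  assumes "cring R" "cring S" "f \<in> ring_hom R S"
  shows "(\<lambda>F. f \<circ> F) \<in> ring_hom (ps_ring R) (ps_ring S)"
proof -
  interpret R: cring R by fact
  interpret S: cring S by fact
  interpret f: ring_hom_cring R S f by (rule ring_hom_cringI2[OF assms])
  have "f (\<Oplus>\<^bsub>R\<^esub>i\<in>{..n}. F i \<otimes>\<^bsub>R\<^esub> H (n - i)) = (\<Oplus>\<^bsub>S\<^esub>i\<in>{..n}. f (F i) \<otimes>\<^bsub>S\<^esub> f (H (n - i)))"
    if "\<forall>n. F n \<in> carrier R" "\<forall>n. H n \<in> carrier R" for F H :: "nat \<Rightarrow> _" and n :: nat
    using that by (subst f.hom_finsum) (auto intro!: S.finsum_cong')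
  then show ?thesis
    by (intro ring_hom_memI) (auto simp: ps_ring_simps fun_eq_iff)
qed

lemma comp_const: "f \<zero>\<^bsub>R\<^esub> = \<zero>\<^bsub>S\<^esub> \<Longrightarrow> f \<circ> ps_const R a = ps_const S (f a)"
  by (auto simp: ps_const_def)

lemma comp_X: "\<lbrakk>f \<zero>\<^bsub>R\<^esub> = \<zero>\<^bsub>S\<^esub>; f \<one>\<^bsub>R\<^esub> = \<one>\<^bsub>S\<^esub>\<rbrakk> \<Longrightarrow> f \<circ> ps_X R = ps_X S"
  by (auto simp: ps_X_def)

text \<open>By \<open>ps_decomp\<close> the difference of the two maps at F is s, the image of X,
  times their difference at the shift, so each round gains a level of Q. The source ring S is
  allowed to differ from R so that the two sides of a base change square can be compared.\<close>

lemma (in nil_local) ps_ring_hom_unique: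
  assumes S: "cring S" and f: "f \<in> ring_hom (ps_ring S) P" and g: "g \<in> ring_hom (ps_ring S) P"
    and C: "\<And>a. a \<in> carrier S \<Longrightarrow> f (ps_const S a) = g (ps_const S a)"
    and X: "f (ps_X S) = g (ps_X S)" and m: "f (ps_X S) 0 \<in> m"
    and F: "F \<in> carrier (ps_ring S)"
  shows "f F = g F"
proof -
  interpret S: power_series S using S by (simp add: power_series_def)
  have fc: "f H \<in> carrier P" and gc: "g H \<in> carrier P" if "H \<in> carrier (ps_ring S)" for H
    using ring_hom_closed[OF f that] ring_hom_closed[OF g that] by auto
  have "f F \<ominus>\<^bsub>P\<^esub> g F \<in> Q n" for n
    using F
  proof (induction n arbitrary: F)
    case 0
    then show ?case using fc gc unfolding Q_0 by blast
  next
    case (Suc n)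
    note sh = S.shift_closed[OF Suc.prems] and cc = S.C_closed[OF S.coeff_closed[OF Suc.prems], of 0]
    define a s x y where "a = f (ps_const S (F 0))" and "s = f (ps_X S)" and "x = f (ps_shift F)" and "y = g (ps_shift F)"
    have c: "a \<in> carrier P" "s \<in> carrier P" "x \<in> carrier P" "y \<in> carrier P"
      using fc gc sh cc by (auto simp: a_def s_def x_def y_def)
    have "F = ps_const S (F 0) \<oplus>\<^bsub>ps_ring S\<^esub> ps_X S \<otimes>\<^bsub>ps_ring S\<^esub> ps_shift F" by (rule S.ps_decomp[OF Suc.prems])
    then have "f F = a \<oplus>\<^bsub>P\<^esub> s \<otimes>\<^bsub>P\<^esub> x" "g F = a \<oplus>\<^bsub>P\<^esub> s \<otimes>\<^bsub>P\<^esub> y"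
      using cc sh S.P.m_closed[OF S.X_closed sh] C[OF S.coeff_closed[OF Suc.prems]] X
        ring_hom_add[OF f] ring_hom_mult[OF f] ring_hom_add[OF g] ring_hom_mult[OF g]
      by (metis S.X_closed a_def s_def x_def, metis S.X_closed a_def s_def y_def)
    moreover have "(a \<oplus>\<^bsub>P\<^esub> s \<otimes>\<^bsub>P\<^esub> x) \<ominus>\<^bsub>P\<^esub> (a \<oplus>\<^bsub>P\<^esub> s \<otimes>\<^bsub>P\<^esub> y) = s \<otimes>\<^bsub>P\<^esub> (x \<ominus>\<^bsub>P\<^esub> y)"
      using c by algebra
    moreover have "s \<otimes>\<^bsub>P\<^esub> (x \<ominus>\<^bsub>P\<^esub> y) \<in> Q (1 + n)"
      using Q_mult[OF Q_1I[OF c(2)] Suc.IH[OF sh]] m by (simp add: s_def x_def y_def)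
    ultimately show ?case by simp
  qed
  then show ?thesis using Q_eqI[OF fc gc] F by blast
qed

lemma Gam_simps:
  "carrier (Gam A) = {\<phi> \<in> extensional (carrier (ps_ring A)).
      \<phi> \<in> ring_iso (ps_ring A) (ps_ring A) \<and> (\<forall>a \<in> carrier A. \<phi> (ps_const A a) = ps_const A a)}"
  "\<phi> \<otimes>\<^bsub>Gam A\<^esub> \<psi> = compose (carrier (ps_ring A)) \<phi> \<psi>"
  "\<one>\<^bsub>Gam A\<^esub> = (\<lambda>F\<in>carrier (ps_ring A). F)"
  by (simp_all add: Gam_def)

context power_series
begin

lemma Gam_closed: "\<lbrakk>\<phi> \<in> carrier (Gam R); F \<in> carrier P\<rbrakk> \<Longrightarrow> \<phi> F \<in> carrier P"
  by (rule ring_hom_closed[of \<phi> P P]) (simp_all add: Gam_simps(1) ring_iso_def)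

lemma Gam_hom: "\<phi> \<in> carrier (Gam R) \<Longrightarrow> \<phi> \<in> ring_hom P P"
  by (simp add: Gam_simps ring_iso_def)

lemma Gam_C: "\<phi> \<in> carrier (Gam R) \<Longrightarrow> a \<in> carrier R \<Longrightarrow> \<phi> (C a) = C a"
  by (simp add: Gam_simps)

lemma Gam_mult_apply: "F \<in> carrier P \<Longrightarrow> (\<phi> \<otimes>\<^bsub>Gam R\<^esub> \<psi>) F = \<phi> (\<psi> F)"
  by (simp add: Gam_simps compose_def)

lemma Gam_one_apply: "F \<in> carrier P \<Longrightarrow> \<one>\<^bsub>Gam R\<^esub> F = F"
  by (simp add: Gam_simps)

lemma Gam_eqI:
  "\<lbrakk>\<phi> \<in> carrier (Gam R); \<psi> \<in> carrier (Gam R); \<And>F. F \<in> carrier P \<Longrightarrow> \<phi> F = \<psi> F\<rbrakk> \<Longrightarrow> \<phi> = \<psi>"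
  by (rule extensionalityI[of _ "carrier P"]) (simp_all add: Gam_simps(1))

lemma Gam_memI:
  assumes "\<phi> \<in> ring_hom P P" "\<And>a. a \<in> carrier R \<Longrightarrow> \<phi> (C a) = C a" "bij_betw \<phi> (carrier P) (carrier P)"
  shows "restrict \<phi> (carrier P) \<in> carrier (Gam R)"
proof -
  have "restrict \<phi> (carrier P) \<in> ring_hom P P"
    using assms(1) P.ring_hom_restrict[OF assms(1), of "restrict \<phi> (carrier P)"] by simp
  moreover have "bij_betw (restrict \<phi> (carrier P)) (carrier P) (carrier P)"
    by (rule iffD1[OF bij_betw_cong assms(3)]) simp
  ultimately show ?thesis using assms(2) by (simp add: Gam_simps ring_iso_def)
qed

lemma Gam_group: "group (Gam R)"
proof (rule groupI)
  fix \<phi> \<psi> assume a: "\<phi> \<in> carrier (Gam R)" "\<psi> \<in> carrier (Gam R)"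
  have "\<phi> \<circ> \<psi> \<in> ring_hom P P" using ring_hom_trans[OF Gam_hom[OF a(2)] Gam_hom[OF a(1)]] .
  moreover have "bij_betw (\<phi> \<circ> \<psi>) (carrier P) (carrier P)"
    using a by (intro bij_betw_trans[of _ _ "carrier P"]) (auto simp: Gam_simps ring_iso_def)
  moreover have "(\<phi> \<circ> \<psi>) (C c) = C c" if "c \<in> carrier R" for c using a that by (simp add: Gam_C)
  ultimately have "restrict (\<phi> \<circ> \<psi>) (carrier P) \<in> carrier (Gam R)"
    by (intro Gam_memI)
  then show "\<phi> \<otimes>\<^bsub>Gam R\<^esub> \<psi> \<in> carrier (Gam R)" by (simp add: Gam_simps(2) compose_def comp_def)
next
  have "restrict id (carrier P) \<in> carrier (Gam R)" by (rule Gam_memI) auto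
  then show "\<one>\<^bsub>Gam R\<^esub> \<in> carrier (Gam R)" by (simp add: Gam_simps(3) id_def)
next
  fix x y z assume "x \<in> carrier (Gam R)" "y \<in> carrier (Gam R)" "z \<in> carrier (Gam R)"
  then show "x \<otimes>\<^bsub>Gam R\<^esub> y \<otimes>\<^bsub>Gam R\<^esub> z = x \<otimes>\<^bsub>Gam R\<^esub> (y \<otimes>\<^bsub>Gam R\<^esub> z)"
    using compose_assoc[of z "carrier P" "carrier P" x y] Gam_closed[of z] by (simp add: Gam_simps(2) Pi_I)
next
  fix x assume x: "x \<in> carrier (Gam R)"
  then show "\<one>\<^bsub>Gam R\<^esub> \<otimes>\<^bsub>Gam R\<^esub> x = x"
    using Id_compose[of x "carrier P" "carrier P"] Gam_closed[of x] by (simp add: Gam_simps(1,3) Gam_simps(2)[of R] Pi_I)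
  have iso: "x \<in> ring_iso P P" and bij: "bij_betw x (carrier P) (carrier P)" using x by (auto simp: Gam_simps ring_iso_def)
  define y where "y = inv_into (carrier P) x"
  have y: "y \<in> ring_iso P P" using ring_iso_set_sym[OF P.ring_axioms iso] by (simp add: y_def)
  have yx: "y (x F) = F" if "F \<in> carrier P" for F
    using that bij by (simp add: y_def bij_betw_def inv_into_f_f)
  have yC: "y (C a) = C a" if "a \<in> carrier R" for a
    using yx[OF C_closed[OF that]] Gam_C[OF x that] by simp
  have "restrict y (carrier P) \<in> carrier (Gam R)"
    using y yC by (intro Gam_memI) (auto simp: ring_iso_def)
  moreover have "restrict y (carrier P) \<otimes>\<^bsub>Gam R\<^esub> x = \<one>\<^bsub>Gam R\<^esub>"
    unfolding Gam_simps(2,3) using yx Gam_closed[OF x] by (intro ext) (simp add: compose_def)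
  ultimately show "\<exists>y\<in>carrier (Gam R). y \<otimes>\<^bsub>Gam R\<^esub> x = \<one>\<^bsub>Gam R\<^esub>" by blast
qed

end

sublocale power_series \<subseteq> \<Gamma>: group "Gam R"
  by (rule Gam_group)

context power_series
begin

lemma Gam_inv_apply:
  assumes "\<phi> \<in> carrier (Gam R)" "F \<in> carrier P"
  shows "\<phi> ((inv\<^bsub>Gam R\<^esub> \<phi>) F) = F" "(inv\<^bsub>Gam R\<^esub> \<phi>) (\<phi> F) = F"
  using Gam_mult_apply[OF assms(2), of \<phi> "inv\<^bsub>Gam R\<^esub> \<phi>"] Gam_mult_apply[OF assms(2), of "inv\<^bsub>Gam R\<^esub> \<phi>" \<phi>]
    \<Gamma>.l_inv[OF assms(1)] \<Gamma>.r_inv[OF assms(1)] Gam_one_apply[OF assms(2)] by auto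

end

context nil_local
begin

text \<open>Were the constant term u of the image of X a unit, 1 - X/u would be invertible by
  \<open>geometric\<close>, yet be sent to a series with constant term zero. Hence automorphisms
  need no separate continuity condition.\<close>

lemma Gam_X_m:
  assumes "\<phi> \<in> carrier (Gam R)"
  shows "\<phi> Xv 0 \<in> m"
proof (rule ccontr)
  assume n: "\<phi> Xv 0 \<notin> m"
  define u where "u = \<phi> Xv 0"
  have s: "\<phi> Xv \<in> carrier P" using Gam_closed[OF assms X_closed] .
  have u: "u \<in> Units R" using m_unit[OF coeff_closed[OF s]] n by (simp add: u_def)
  then have a: "inv u \<in> carrier R" and uc: "u \<in> carrier R" by auto
  interpret \<phi>: ring_hom_cring P P \<phi>
    by (rule ring_hom_cringI2[OF P.is_cring P.is_cring Gam_hom[OF assms]])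
  have "\<one>\<^bsub>P\<^esub> \<ominus>\<^bsub>P\<^esub> Xv \<otimes>\<^bsub>P\<^esub> C (inv u) \<in> Units P" using geometric[OF a] .
  then obtain v where v: "v \<in> carrier P" "(\<one>\<^bsub>P\<^esub> \<ominus>\<^bsub>P\<^esub> Xv \<otimes>\<^bsub>P\<^esub> C (inv u)) \<otimes>\<^bsub>P\<^esub> v = \<one>\<^bsub>P\<^esub>"
    unfolding Units_def by blast
  define w where "w = \<one>\<^bsub>P\<^esub> \<ominus>\<^bsub>P\<^esub> \<phi> Xv \<otimes>\<^bsub>P\<^esub> C (inv u)"
  have wc: "w \<in> carrier P" using s a by (simp add: w_def)
  have "\<phi> ((\<one>\<^bsub>P\<^esub> \<ominus>\<^bsub>P\<^esub> Xv \<otimes>\<^bsub>P\<^esub> C (inv u)) \<otimes>\<^bsub>P\<^esub> v) = w \<otimes>\<^bsub>P\<^esub> \<phi> v"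
    using v(1) a by (simp add: w_def P.minus_eq Gam_C[OF assms a])
  then have "w \<otimes>\<^bsub>P\<^esub> \<phi> v = \<one>\<^bsub>P\<^esub>" using v(2) by simp
  then have "(w \<otimes>\<^bsub>P\<^esub> \<phi> v) 0 = \<one>" by (simp add: ps_ring_simps(3))
  then have "w 0 \<otimes> \<phi> v 0 = \<one>" using shift_mult(2)[OF wc] v(1) by simp
  moreover have "w 0 = \<one> \<ominus> u \<otimes> inv u"
    unfolding w_def minus_coeff[OF P.one_closed P.m_closed[OF s C_closed[OF a]]]
    using C_mult[OF a s, of 0] P.m_comm[OF s C_closed[OF a]] a uc
    by (simp add: ps_ring_simps(3) m_comm u_def)
  moreover have "\<dots> = \<zero>" using u uc a by (simp add: diff_self)
  moreover have "\<phi> v 0 \<in> carrier R" using coeff_closed v(1) by auto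
  ultimately have "\<one> = \<zero>" by simp
  then have "u = \<zero>" using uc by (metis r_one r_null)
  then show False using n ideal_zero_closed[OF m_ideal] by (simp add: u_def)
qed

lemma Gam_ps_hom: "\<phi> \<in> carrier (Gam R) \<Longrightarrow> ps_hom R m \<phi>"
  unfolding ps_hom_def using Gam_X_m[of \<phi>] Gam_hom[of \<phi>] Gam_C[of \<phi>] by blast

lemma ps_hom_closed: "\<lbrakk>ps_hom R m \<phi>; F \<in> carrier P\<rbrakk> \<Longrightarrow> \<phi> F \<in> carrier P"
  unfolding ps_hom_def using ring_hom_closed[of \<phi> P P F] by blast

lemma ps_hom_unique:
  assumes "ps_hom R m \<phi>" "ps_hom R m \<psi>" "\<phi> Xv = \<psi> Xv" "F \<in> carrier P"
  shows "\<phi> F = \<psi> F"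
  by (rule ps_ring_hom_unique[OF is_cring, of \<phi> \<psi>]) (use assms in \<open>simp_all add: ps_hom_def\<close>)

lemma ps_hom_decomp:
  assumes "ps_hom R m \<phi>" "F \<in> carrier P"
  shows "\<phi> F = C (F 0) \<oplus>\<^bsub>P\<^esub> \<phi> Xv \<otimes>\<^bsub>P\<^esub> \<phi> (ps_shift F)"
proof -
  have h: "\<phi> \<in> ring_hom P P" using assms by (simp add: ps_hom_def)
  have "\<phi> F = \<phi> (C (F 0) \<oplus>\<^bsub>P\<^esub> Xv \<otimes>\<^bsub>P\<^esub> ps_shift F)" using ps_decomp[OF assms(2)] by simp
  also have "\<dots> = C (F 0) \<oplus>\<^bsub>P\<^esub> \<phi> Xv \<otimes>\<^bsub>P\<^esub> \<phi> (ps_shift F)"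
    using assms coeff_closed[OF assms(2)] by (simp add: ring_hom_add[OF h] ring_hom_mult[OF h] ps_hom_def)
  finally show ?thesis .
qed

lemma C_PI: "F \<in> PI i \<Longrightarrow> C (F j) \<in> PI i"
  using C_closed[of "F j"] ideal_zero_closed[OF mpow_ideal] coeff_closed[OF PI_carrier, of F i j]
  by (simp add: coeffs_in_def) (simp add: ps_const_def)

lemma shift_PI: "F \<in> PI i \<Longrightarrow> ps_shift F \<in> PI i"
  using shift_closed[of F] by (simp add: coeffs_in_def) (simp add: ps_shift_def)

text \<open>Closedness in the (m,X)-adic topology: an approximation modulo Q
  (\<open>nil_index\<close> + j) already has the correct coefficient j.\<close>

lemma PI_closed:
  assumes "F \<in> carrier P" "\<And>n. \<exists>H\<in>PI i. F \<ominus>\<^bsub>P\<^esub> H \<in> Q n"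
  shows "F \<in> PI i"
proof -
  have "F j \<in> ideal_pow R m i" for j
  proof -
    obtain H where H: "H \<in> PI i" "F \<ominus>\<^bsub>P\<^esub> H \<in> Q (nil_index + j)" using assms(2) by blast
    have "(F \<ominus>\<^bsub>P\<^esub> H) j \<in> ideal_pow R m (nil_index + j - j)" using H(2) unfolding mx_pow_def by blast
    then have "F j \<ominus> H j = \<zero>" using nil_index minus_coeff[OF assms(1) PI_carrier[OF H(1)]] by simp
    then have "F j = H j"
      using coeff_closed[OF assms(1)] coeff_closed[OF PI_carrier[OF H(1)]] r_right_minus_eq by blast
    then show ?thesis using H(1) by (simp add: coeffs_in_def)
  qed
  then show ?thesis using assms(1) by (simp add: coeffs_in_def)
qed

text \<open>On infinite series \<phi> is accessible only through the recursion of
  \<open>ps_decomp\<close>, so the image is approximated modulo each Q n by series with coefficients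
  in m^i; \<open>PI_closed\<close> passes to the limit.\<close>

lemma ps_hom_PI:
  assumes \<phi>: "ps_hom R m \<phi>" and F: "F \<in> PI i"
  shows "\<phi> F \<in> PI i"
proof (rule PI_closed)
  show "\<exists>H\<in>PI i. \<phi> F \<ominus>\<^bsub>P\<^esub> H \<in> Q n" for n
    using F
  proof (induction n arbitrary: F)
    case 0
    then show ?case
      using P.ideal_zero_closed[OF PI_ideal] ps_hom_closed[OF \<phi> PI_carrier] unfolding Q_0 by blast
  next
    case (Suc n)
    have Fc: "F \<in> carrier P" using PI_carrier Suc.prems .
    obtain H where H: "H \<in> PI i" "\<phi> (ps_shift F) \<ominus>\<^bsub>P\<^esub> H \<in> Q n" using Suc.IH[OF shift_PI[OF Suc.prems]] by blast
    define s a x where "s = \<phi> Xv" and "a = C (F 0)" and "x = \<phi> (ps_shift F)"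
    have c: "s \<in> carrier P" "a \<in> carrier P" "x \<in> carrier P" "H \<in> carrier P"
      using ps_hom_closed[OF \<phi>] Fc PI_carrier[OF H(1)] coeff_closed[OF Fc] by (auto simp: s_def a_def x_def)
    have "\<phi> F \<ominus>\<^bsub>P\<^esub> (a \<oplus>\<^bsub>P\<^esub> s \<otimes>\<^bsub>P\<^esub> H) = s \<otimes>\<^bsub>P\<^esub> (x \<ominus>\<^bsub>P\<^esub> H)"
      unfolding ps_hom_decomp[OF \<phi> Fc] s_def[symmetric] a_def[symmetric] x_def[symmetric] using c by algebra
    moreover have "\<dots> \<in> Q (1 + n)"
      using Q_mult[OF Q_1I[OF c(1)]] H(2) \<phi> by (simp add: x_def s_def ps_hom_def)
    moreover have "a \<oplus>\<^bsub>P\<^esub> s \<otimes>\<^bsub>P\<^esub> H \<in> PI i"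
      unfolding a_def by (intro P.ideal_a_closed[OF PI_ideal] C_PI Suc.prems ideal.I_l_closed[OF PI_ideal H(1)] c(1))
    ultimately show ?case by (intro bexI[of _ "a \<oplus>\<^bsub>P\<^esub> s \<otimes>\<^bsub>P\<^esub> H"]) auto
  qed
qed (rule ps_hom_closed[OF \<phi> PI_carrier[OF F]])

text \<open>Write G for the shift of F. Then \<phi> F - F = (\<phi> X - X) \<phi> G + X (\<phi> G -
  G). The first summand has the required order i + l, and the second is the same question with an
  extra factor X.\<close>

lemma ps_hom_diff_PI:
  assumes \<phi>: "ps_hom R m \<phi>" and X: "\<phi> Xv \<ominus>\<^bsub>P\<^esub> Xv \<in> PI i" and F: "F \<in> PI l"
  shows "\<phi> F \<ominus>\<^bsub>P\<^esub> F \<in> PI (i + l)"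
proof (rule PI_closed)
  show "\<exists>H\<in>PI (i + l). (\<phi> F \<ominus>\<^bsub>P\<^esub> F) \<ominus>\<^bsub>P\<^esub> H \<in> Q n" for n
    using F
  proof (induction n arbitrary: F)
    case 0
    then show ?case
      using P.ideal_zero_closed[OF PI_ideal] ps_hom_closed[OF \<phi> PI_carrier] PI_carrier unfolding Q_0
      by blast
  next
    case (Suc n)
    have Fc: "F \<in> carrier P" using PI_carrier Suc.prems .
    obtain H where H: "H \<in> PI (i + l)" "(\<phi> (ps_shift F) \<ominus>\<^bsub>P\<^esub> ps_shift F) \<ominus>\<^bsub>P\<^esub> H \<in> Q n"
      using Suc.IH[OF shift_PI[OF Suc.prems]] by blast
    define s a x y where "s = \<phi> Xv" and "a = C (F 0)" and "x = \<phi> (ps_shift F)" and "y = ps_shift F"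
    have c: "s \<in> carrier P" "a \<in> carrier P" "x \<in> carrier P" "y \<in> carrier P" "H \<in> carrier P" "Xv \<in> carrier P"
      using ps_hom_closed[OF \<phi>] Fc PI_carrier[OF H(1)] coeff_closed[OF Fc] by (auto simp: s_def a_def x_def y_def)
    have F_eq: "F = a \<oplus>\<^bsub>P\<^esub> Xv \<otimes>\<^bsub>P\<^esub> y" using ps_decomp[OF Fc] by (simp add: a_def y_def)
    have "\<phi> F \<ominus>\<^bsub>P\<^esub> F \<ominus>\<^bsub>P\<^esub> ((s \<ominus>\<^bsub>P\<^esub> Xv) \<otimes>\<^bsub>P\<^esub> x \<oplus>\<^bsub>P\<^esub> Xv \<otimes>\<^bsub>P\<^esub> H) =
        (a \<oplus>\<^bsub>P\<^esub> s \<otimes>\<^bsub>P\<^esub> x) \<ominus>\<^bsub>P\<^esub> (a \<oplus>\<^bsub>P\<^esub> Xv \<otimes>\<^bsub>P\<^esub> y) \<ominus>\<^bsub>P\<^esub> ((s \<ominus>\<^bsub>P\<^esub> Xv) \<otimes>\<^bsub>P\<^esub> x \<oplus>\<^bsub>P\<^esub> Xv \<otimes>\<^bsub>P\<^esub> H)"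
      using F_eq ps_hom_decomp[OF \<phi> Fc] by (simp add: s_def a_def x_def)
    also have "\<dots> = Xv \<otimes>\<^bsub>P\<^esub> ((x \<ominus>\<^bsub>P\<^esub> y) \<ominus>\<^bsub>P\<^esub> H)" using c by algebra
    also have "\<dots> \<in> Q (1 + n)" using Q_mult[OF X_Q_1 H(2)] by (simp add: x_def y_def)
    finally have "\<phi> F \<ominus>\<^bsub>P\<^esub> F \<ominus>\<^bsub>P\<^esub> ((s \<ominus>\<^bsub>P\<^esub> Xv) \<otimes>\<^bsub>P\<^esub> x \<oplus>\<^bsub>P\<^esub> Xv \<otimes>\<^bsub>P\<^esub> H) \<in> Q (Suc n)" by simp
    moreover have "(s \<ominus>\<^bsub>P\<^esub> Xv) \<otimes>\<^bsub>P\<^esub> x \<in> PI (i + l)"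
      using PI_mult[OF X ps_hom_PI[OF \<phi> shift_PI[OF Suc.prems]]] by (simp add: s_def x_def)
    moreover have "Xv \<otimes>\<^bsub>P\<^esub> H \<in> PI (i + l)" using ideal.I_l_closed[OF PI_ideal H(1) X_closed] .
    ultimately show ?case using P.ideal_a_closed[OF PI_ideal] by blast
  qed
qed (rule P.minus_closed[OF ps_hom_closed[OF \<phi> PI_carrier[OF F]] PI_carrier[OF F]])

text \<open>An endomorphism congruent to the identity modulo \<open>m\<close> is bijective: it differs from the identity
  by a nilpotent map.\<close>

lemma ps_hom_bij:
  assumes \<phi>: "ps_hom R m \<phi>" and X: "\<phi> Xv \<ominus>\<^bsub>P\<^esub> Xv \<in> PI 1"
  shows "bij_betw \<phi> (carrier P) (carrier P)"
proof -
  have h: "\<phi> \<in> ring_hom P P" using \<phi> by (simp add: ps_hom_def)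
  interpret \<phi>: ring_hom_ring P P \<phi> by (rule ring_hom_ringI2[OF P.ring_axioms P.ring_axioms h])
  have "F = \<zero>\<^bsub>P\<^esub>" if F: "F \<in> carrier P" "\<phi> F = \<zero>\<^bsub>P\<^esub>" for F
  proof -
    have "F \<in> PI i" for i
    proof (induction i)
      case (Suc i)
      have "\<phi> F \<ominus>\<^bsub>P\<^esub> F \<in> PI (1 + i)" using ps_hom_diff_PI[OF \<phi> X Suc] .
      then have "\<ominus>\<^bsub>P\<^esub> (\<phi> F \<ominus>\<^bsub>P\<^esub> F) \<in> PI (1 + i)" by (rule P.ideal_a_inv_closed[OF PI_ideal])
      then show ?case using F by (simp add: P.minus_eq)
    qed (use F PI_0 in simp)
    then show ?thesis using PI_nil by blast
  qed
  then have "a_kernel P P \<phi> = {\<zero>\<^bsub>P\<^esub>}" unfolding a_kernel_def' using \<phi>.hom_zero by blast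
  then have "inj_on \<phi> (carrier P)" by (rule \<phi>.trivial_ker_imp_inj)
  \<comment> \<open>Surjectivity by descending induction from the level where only zero is left: F
    equals \<phi> F minus an error one level deeper, which is already an image.\<close>
  moreover have "\<exists>H\<in>carrier P. \<phi> H = F" if "F \<in> PI i" "i \<le> nil_index" for F i
    using that(2,1)
  proof (induction i arbitrary: F rule: inc_induct)
    case base
    then have "F = \<zero>\<^bsub>P\<^esub>" using PI_nil by blast
    then show ?case using P.zero_closed \<phi>.hom_zero by blast
  next
    case (step i)
    have Fc: "F \<in> carrier P" using PI_carrier step.prems .
    have "\<phi> F \<ominus>\<^bsub>P\<^esub> F \<in> PI (Suc i)" using ps_hom_diff_PI[OF \<phi> X step.prems] by simp
    then obtain H where H: "H \<in> carrier P" "\<phi> H = \<phi> F \<ominus>\<^bsub>P\<^esub> F" using step.IH by blast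
    have "\<phi> (F \<ominus>\<^bsub>P\<^esub> H) = \<phi> F \<ominus>\<^bsub>P\<^esub> (\<phi> F \<ominus>\<^bsub>P\<^esub> F)" using H Fc by (simp add: P.minus_eq)
    also have "\<dots> = F" using Fc ps_hom_closed[OF \<phi> Fc] by algebra
    finally show ?case using H Fc by blast
  qed
  then have "carrier P \<subseteq> \<phi> ` carrier P" using PI_0 by (metis image_eqI le0 subsetI)
  ultimately show ?thesis using ps_hom_closed[OF \<phi>] by (auto simp: bij_betw_def)
qed

end

section \<open>Base change and lifting of automorphisms\<close>

lemma lies_overD: "lies_over A f \<phi> \<psi> \<Longrightarrow> F \<in> carrier (ps_ring A) \<Longrightarrow> \<psi> (f \<circ> F) = f \<circ> \<phi> F"
  by (simp add: lies_over_def)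

lemma ps_comp_closed: "\<lbrakk>f \<in> ring_hom A B; F \<in> carrier (ps_ring A)\<rbrakk> \<Longrightarrow> f \<circ> F \<in> carrier (ps_ring B)"
  using ring_hom_closed[of f A B] by (simp add: ps_ring_simps)

lemma lies_over_comp:
  "\<lbrakk>f \<in> ring_hom A B; lies_over A f \<phi> \<psi>; lies_over B g \<psi> \<chi>\<rbrakk> \<Longrightarrow> lies_over A (g \<circ> f) \<phi> \<chi>"
  using ps_comp_closed[of f A B] by (simp add: lies_over_def comp_assoc)

lemma lies_over_mult:
  assumes "cring A" "cring B" "f \<in> ring_hom A B" "\<phi>' \<in> carrier (Gam A)"
    "lies_over A f \<phi> \<psi>" "lies_over A f \<phi>' \<psi>'"
  shows "lies_over A f (\<phi> \<otimes>\<^bsub>Gam A\<^esub> \<phi>') (\<psi> \<otimes>\<^bsub>Gam B\<^esub> \<psi>')"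
proof -
  interpret A: power_series A using assms by (simp add: power_series_def)
  interpret B: power_series B using assms by (simp add: power_series_def)
  show ?thesis
    unfolding lies_over_def
  proof
    fix F assume F: "F \<in> carrier (ps_ring A)"
    show "(\<psi> \<otimes>\<^bsub>Gam B\<^esub> \<psi>') (f \<circ> F) = f \<circ> (\<phi> \<otimes>\<^bsub>Gam A\<^esub> \<phi>') F"
      unfolding B.Gam_mult_apply[OF ps_comp_closed[OF assms(3) F]] A.Gam_mult_apply[OF F]
        lies_overD[OF assms(6) F] lies_overD[OF assms(5) A.Gam_closed[OF assms(4) F]] ..
  qed
qed

context
  fixes A :: "('a, 'm) ring_scheme" and B :: "('b, 'n) ring_scheme" and f a b
  assumes A: "nil_local A a" and B: "nil_local B b" and f: "f \<in> ring_hom A B" and fab: "f ` a \<subseteq> b"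
begin

interpretation A: nil_local A a by (rule A)

interpretation B: nil_local B b by (rule B)

interpretation f: ring_hom_cring A B f by (rule ring_hom_cringI2[OF A.is_cring B.is_cring f])

lemma base_change_unique:
  assumes "\<phi> \<in> carrier (Gam A)" "\<psi> \<in> carrier (Gam B)" "\<psi>' \<in> carrier (Gam B)" "lies_over A f \<phi> \<psi>" "lies_over A f \<phi> \<psi>'"
  shows "\<psi> = \<psi>'"
proof (rule B.Gam_eqI[OF assms(2,3)])
  have "f \<circ> ps_X A = ps_X B" by (rule comp_X) simp_all
  then have "\<psi> (ps_X B) = \<psi>' (ps_X B)"
    using lies_overD[OF assms(4) A.X_closed] lies_overD[OF assms(5) A.X_closed] by simp
  then show "\<psi> F = \<psi>' F" if "F \<in> carrier (ps_ring B)" for F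
    using B.ps_hom_unique[OF B.Gam_ps_hom[OF assms(2)] B.Gam_ps_hom[OF assms(3)]] that by simp
qed

text \<open>Both ways around the square are ring homomorphisms from series over A to series over B
  that agree on constants and on X, so \<open>ps_ring_hom_unique\<close> identifies them.\<close>

lemma ps_hom_over:
  assumes "ps_hom A a \<phi>" "ps_hom B b \<psi>" "\<psi> (ps_X B) = f \<circ> \<phi> (ps_X A)"
  shows "lies_over A f \<phi> \<psi>"
  unfolding lies_over_def
proof
  fix F assume F: "F \<in> carrier (ps_ring A)"
  have ff: "(\<lambda>F. f \<circ> F) \<in> ring_hom (ps_ring A) (ps_ring B)" by (rule comp_ring_hom_ps[OF A.is_cring B.is_cring f])
  have X: "f \<circ> ps_X A = ps_X B" by (rule comp_X) simp_all
  have C: "f \<circ> ps_const A c = ps_const B (f c)" for c by (rule comp_const) simp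
  have \<phi>: "\<phi> \<in> ring_hom (ps_ring A) (ps_ring A)" "\<And>c. c \<in> carrier A \<Longrightarrow> \<phi> (ps_const A c) = ps_const A c"
    and \<psi>: "\<psi> \<in> ring_hom (ps_ring B) (ps_ring B)" "\<And>c. c \<in> carrier B \<Longrightarrow> \<psi> (ps_const B c) = ps_const B c"
      "\<psi> (ps_X B) 0 \<in> b"
    using assms(1,2) unfolding ps_hom_def by blast+
  have "(\<psi> \<circ> (\<lambda>F. f \<circ> F)) F = ((\<lambda>F. f \<circ> F) \<circ> \<phi>) F"
  proof (rule B.ps_ring_hom_unique[OF A.is_cring ring_hom_trans[OF ff \<psi>(1)] ring_hom_trans[OF \<phi>(1) ff] _ _ _ F])
    show "(\<psi> \<circ> (\<lambda>F. f \<circ> F)) (ps_const A c) = ((\<lambda>F. f \<circ> F) \<circ> \<phi>) (ps_const A c)" if "c \<in> carrier A" for c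
      unfolding comp_apply[of _ "\<lambda>F. f \<circ> F"] comp_apply[of "\<lambda>F. f \<circ> F"] \<phi>(2)[OF that] C
      by (rule \<psi>(2)) (use that in simp)
    show "(\<psi> \<circ> (\<lambda>F. f \<circ> F)) (ps_X A) = ((\<lambda>F. f \<circ> F) \<circ> \<phi>) (ps_X A)"
      unfolding comp_apply[of _ "\<lambda>F. f \<circ> F"] comp_apply[of "\<lambda>F. f \<circ> F"] X by (rule assms(3))
    show "(\<psi> \<circ> (\<lambda>F. f \<circ> F)) (ps_X A) 0 \<in> b"
      unfolding comp_apply[of _ "\<lambda>F. f \<circ> F"] X by (rule \<psi>(3))
  qed
  then show "\<psi> (f \<circ> F) = f \<circ> \<phi> F" by (simp only: comp_apply[of _ "\<lambda>F. f \<circ> F"] comp_apply[of "\<lambda>F. f \<circ> F"])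
qed

text \<open>The image of X is transported by f and substituted. Doing the same with the inverse of
  \<phi> gives a substitution inverse to the first, because both composites fix X.\<close>

lemma base_change_ex:
  assumes \<phi>: "\<phi> \<in> carrier (Gam A)"
  shows "\<exists>\<psi>\<in>carrier (Gam B). lies_over A f \<phi> \<psi>"
proof -
  have X: "f \<circ> ps_X A = ps_X B" by (rule comp_X) simp_all
  have ex: "\<exists>\<psi>. ps_hom B b \<psi> \<and> \<psi> (ps_X B) = f \<circ> \<chi> (ps_X A)" if "\<chi> \<in> carrier (Gam A)" for \<chi>
  proof -
    have s: "f \<circ> \<chi> (ps_X A) \<in> carrier (ps_ring B)" "(f \<circ> \<chi> (ps_X A)) 0 \<in> b"
      using ps_comp_closed[OF f A.Gam_closed[OF that A.X_closed]] A.Gam_X_m[OF that] fab by auto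
    obtain \<psi> where "ps_hom B b \<psi>" "\<psi> (ps_X B) = f \<circ> \<chi> (ps_X A)" using B.substitution[OF s] .
    then show ?thesis by blast
  qed
  define \<phi>' where "\<phi>' = inv\<^bsub>Gam A\<^esub> \<phi>"
  have \<phi>': "\<phi>' \<in> carrier (Gam A)" using \<phi> by (simp add: \<phi>'_def)
  obtain \<psi> where \<psi>: "ps_hom B b \<psi>" "\<psi> (ps_X B) = f \<circ> \<phi> (ps_X A)" using ex[OF \<phi>] by blast
  obtain \<psi>' where \<psi>': "ps_hom B b \<psi>'" "\<psi>' (ps_X B) = f \<circ> \<phi>' (ps_X A)" using ex[OF \<phi>'] by blast
  have over: "lies_over A f \<phi> \<psi>" "lies_over A f \<phi>' \<psi>'"
    using ps_hom_over[OF A.Gam_ps_hom[OF \<phi>] \<psi>] ps_hom_over[OF A.Gam_ps_hom[OF \<phi>'] \<psi>'] by blast+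
  have inv: "\<chi>' (\<chi> F) = F"
    if \<chi>: "\<eta> \<in> carrier (Gam A)" "ps_hom B b \<chi>" "lies_over A f \<eta> \<chi>" "\<chi> (ps_X B) = f \<circ> \<eta> (ps_X A)"
      and \<chi>': "ps_hom B b \<chi>'" "lies_over A f \<eta>' \<chi>'" "\<eta>' (\<eta> (ps_X A)) = ps_X A"
      and F: "F \<in> carrier (ps_ring B)" for \<chi> \<chi>' \<eta> \<eta>' F
  proof -
    have "(\<chi>' \<circ> \<chi>) (ps_X B) = ps_X B"
      unfolding comp_apply[of \<chi>' \<chi>] \<chi>(4) lies_overD[OF \<chi>'(2) A.Gam_closed[OF \<chi>(1) A.X_closed]] \<chi>'(3) by (rule X)
    moreover have "\<chi>' \<circ> \<chi> \<in> ring_hom (ps_ring B) (ps_ring B)"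
      using ring_hom_trans \<chi>(2) \<chi>'(1) unfolding ps_hom_def by blast
    ultimately have "ps_hom B b (\<chi>' \<circ> \<chi>)"
      using \<chi>(2) \<chi>'(1) B.ideal_zero_closed[OF B.m_ideal] by (simp add: ps_hom_def ps_X_def)
    moreover have "ps_hom B b id"
      using B.ideal_zero_closed[OF B.m_ideal] by (simp add: ps_hom_def ps_X_def)
    ultimately show ?thesis
      using B.ps_hom_unique[of "\<chi>' \<circ> \<chi>" id F] \<open>(\<chi>' \<circ> \<chi>) (ps_X B) = ps_X B\<close> F by simp
  qed
  have inv1: "\<psi>' (\<psi> F) = F" if "F \<in> carrier (ps_ring B)" for F
    by (rule inv[OF \<phi> \<psi>(1) over(1) \<psi>(2) \<psi>'(1) over(2) _ that])
       (simp add: \<phi>'_def A.Gam_inv_apply(2)[OF \<phi> A.X_closed])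
  have inv2: "\<psi> (\<psi>' F) = F" if "F \<in> carrier (ps_ring B)" for F
    by (rule inv[OF \<phi>' \<psi>'(1) over(2) \<psi>'(2) \<psi>(1) over(1) _ that])
       (simp add: \<phi>'_def A.Gam_inv_apply(1)[OF \<phi> A.X_closed])
  have "bij_betw \<psi> (carrier (ps_ring B)) (carrier (ps_ring B))"
    by (rule bij_betwI[of _ _ _ \<psi>'])
       (use inv1 inv2 B.ps_hom_closed[OF \<psi>(1)] B.ps_hom_closed[OF \<psi>'(1)] in auto)
  then have "restrict \<psi> (carrier (ps_ring B)) \<in> carrier (Gam B)"
    using \<psi>(1) by (intro B.Gam_memI) (auto simp: ps_hom_def)
  moreover have "lies_over A f \<phi> (restrict \<psi> (carrier (ps_ring B)))"
    using over(1) ps_comp_closed[OF f] by (simp add: lies_over_def)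
  ultimately show ?thesis by blast
qed

lemma Gam_map:
  assumes "\<phi> \<in> carrier (Gam A)"
  shows "Gam_map A B f \<phi> \<in> carrier (Gam B)" "lies_over A f \<phi> (Gam_map A B f \<phi>)"
proof -
  have "\<exists>!\<psi>. \<psi> \<in> carrier (Gam B) \<and> lies_over A f \<phi> \<psi>"
    using base_change_ex[OF assms] base_change_unique[OF assms] by blast
  from theI'[OF this] show "Gam_map A B f \<phi> \<in> carrier (Gam B)" "lies_over A f \<phi> (Gam_map A B f \<phi>)"
    by (simp_all add: Gam_map_def)
qed

lemma Gam_map_eqI:
  "\<lbrakk>\<phi> \<in> carrier (Gam A); \<psi> \<in> carrier (Gam B); lies_over A f \<phi> \<psi>\<rbrakk> \<Longrightarrow> Gam_map A B f \<phi> = \<psi>"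
  using base_change_unique Gam_map by blast

lemma Gam_map_hom: "Gam_map A B f \<in> hom (Gam A) (Gam B)"
proof (rule homI)
  fix x y assume xy: "x \<in> carrier (Gam A)" "y \<in> carrier (Gam A)"
  show "Gam_map A B f (x \<otimes>\<^bsub>Gam A\<^esub> y) = Gam_map A B f x \<otimes>\<^bsub>Gam B\<^esub> Gam_map A B f y"
    by (intro Gam_map_eqI A.\<Gamma>.m_closed B.\<Gamma>.m_closed xy Gam_map lies_over_mult A.is_cring B.is_cring f)
qed (rule Gam_map)

text \<open>The coefficients of the image of X are lifted arbitrarily, for \<psi> and for its
  inverse. The two lifts need not be inverse to each other, but their composites are the identity
  modulo a, hence bijective, and this makes each lift bijective.\<close>

lemma Gam_lift_ex:
  assumes surj: "f ` carrier A = carrier B" and refl: "\<And>x. x \<in> carrier A \<Longrightarrow> f x \<in> b \<Longrightarrow> x \<in> a"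
    and \<psi>: "\<psi> \<in> carrier (Gam B)"
  shows "\<exists>\<phi>\<in>carrier (Gam A). lies_over A f \<phi> \<psi>"
proof -
  have X: "f \<circ> ps_X A = ps_X B" by (rule comp_X) simp_all
  have ex: "\<exists>\<phi>. ps_hom A a \<phi> \<and> f \<circ> \<phi> (ps_X A) = \<chi> (ps_X B)" if "\<chi> \<in> carrier (Gam B)" for \<chi>
  proof -
    have "\<forall>n. \<exists>x\<in>carrier A. f x = \<chi> (ps_X B) n"
      using B.coeff_closed[OF B.Gam_closed[OF that B.X_closed]] surj by (metis imageE)
    then obtain s where s: "\<And>n. s n \<in> carrier A" "\<And>n. f (s n) = \<chi> (ps_X B) n" by metis
    have "s \<in> carrier (ps_ring A)" "s 0 \<in> a"
      using s refl[of "s 0"] B.Gam_X_m[OF that] by (auto simp: ps_ring_simps)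
    then obtain \<phi> where "ps_hom A a \<phi>" "\<phi> (ps_X A) = s" by (rule A.substitution)
    moreover have "f \<circ> s = \<chi> (ps_X B)" using s by auto
    ultimately show ?thesis by auto
  qed
  define \<psi>' where "\<psi>' = inv\<^bsub>Gam B\<^esub> \<psi>"
  have \<psi>': "\<psi>' \<in> carrier (Gam B)" using \<psi> by (simp add: \<psi>'_def)
  obtain \<phi> where \<phi>: "ps_hom A a \<phi>" "f \<circ> \<phi> (ps_X A) = \<psi> (ps_X B)" using ex[OF \<psi>] by blast
  obtain \<phi>' where \<phi>': "ps_hom A a \<phi>'" "f \<circ> \<phi>' (ps_X A) = \<psi>' (ps_X B)" using ex[OF \<psi>'] by blast
  have over: "lies_over A f \<phi> \<psi>" "lies_over A f \<phi>' \<psi>'"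
    using ps_hom_over[OF \<phi>(1) B.Gam_ps_hom[OF \<psi>]] ps_hom_over[OF \<phi>'(1) B.Gam_ps_hom[OF \<psi>']] \<phi>(2) \<phi>'(2) by auto
  \<comment> \<open>Stated for a general pair because both orders of composition occur. By
    \<open>refl\<close>, elements that vanish under f lie in a, so the composite moves X by
    coefficients in a and \<open>ps_hom_bij\<close> applies.\<close>
  have bij: "bij_betw (\<chi>' \<circ> \<chi>) (carrier (ps_ring A)) (carrier (ps_ring A))"
    if \<chi>: "ps_hom A a \<chi>" "ps_hom A a \<chi>'" "lies_over A f \<chi> \<eta>" "lies_over A f \<chi>' \<eta>'" "\<eta>' (\<eta> (ps_X B)) = ps_X B"
    for \<chi> \<chi>' \<eta> \<eta>'
  proof -
    have h: "\<chi>' \<circ> \<chi> \<in> ring_hom (ps_ring A) (ps_ring A)"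
      using ring_hom_trans \<chi>(1,2) unfolding ps_hom_def by blast
    have c: "\<chi> (ps_X A) \<in> carrier (ps_ring A)" "\<chi>' (\<chi> (ps_X A)) \<in> carrier (ps_ring A)"
      using A.ps_hom_closed \<chi>(1,2) by blast+
    have "f \<circ> \<chi>' (\<chi> (ps_X A)) = ps_X B"
      using lies_overD[OF \<chi>(4) c(1)] lies_overD[OF \<chi>(3) A.X_closed] X \<chi>(5) by simp
    then have fX: "f (\<chi>' (\<chi> (ps_X A)) n) = f (ps_X A n)" for n using X by (metis comp_apply)
    have "(\<chi>' (\<chi> (ps_X A)) \<ominus>\<^bsub>ps_ring A\<^esub> ps_X A) n \<in> a" for n
    proof (rule refl)
      have cc: "\<chi>' (\<chi> (ps_X A)) n \<in> carrier A" "ps_X A n \<in> carrier A"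
        using A.coeff_closed[OF c(2)] A.coeff_closed[OF A.X_closed] by auto
      show "(\<chi>' (\<chi> (ps_X A)) \<ominus>\<^bsub>ps_ring A\<^esub> ps_X A) n \<in> carrier A"
        using A.coeff_closed c by blast
      have "f (\<chi>' (\<chi> (ps_X A)) n \<ominus>\<^bsub>A\<^esub> ps_X A n) = f (ps_X A n) \<ominus>\<^bsub>B\<^esub> f (ps_X A n)"
        using cc fX[of n] by (simp add: A.minus_eq B.minus_eq)
      then show "f ((\<chi>' (\<chi> (ps_X A)) \<ominus>\<^bsub>ps_ring A\<^esub> ps_X A) n) \<in> b"
        unfolding A.minus_coeff[OF c(2) A.X_closed] using cc B.ideal_zero_closed[OF B.m_ideal] by (simp add: B.diff_self)
    qed
    then have PI: "(\<chi>' \<circ> \<chi>) (ps_X A) \<ominus>\<^bsub>ps_ring A\<^esub> ps_X A \<in> coeffs_in A a 1"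
      unfolding coeffs_in_def A.ideal_pow_1[OF A.m_ideal] using c by simp
    have "\<chi>' (\<chi> (ps_X A)) 0 \<in> a"
      using refl[OF A.coeff_closed[OF c(2)], of 0] fX[of 0] B.ideal_zero_closed[OF B.m_ideal] by (simp add: ps_X_def)
    then have "ps_hom A a (\<chi>' \<circ> \<chi>)" using h \<chi>(1,2) by (simp add: ps_hom_def)
    then show ?thesis using A.ps_hom_bij PI by blast
  qed
  have "bij_betw (\<phi>' \<circ> \<phi>) (carrier (ps_ring A)) (carrier (ps_ring A))"
    by (rule bij[OF \<phi>(1) \<phi>'(1) over]) (simp add: \<psi>'_def B.Gam_inv_apply(2)[OF \<psi> B.X_closed])
  moreover have "bij_betw (\<phi> \<circ> \<phi>') (carrier (ps_ring A)) (carrier (ps_ring A))"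
    by (rule bij[OF \<phi>'(1) \<phi>(1) over(2,1)]) (simp add: \<psi>'_def B.Gam_inv_apply(1)[OF \<psi> B.X_closed])
  ultimately have "bij_betw \<phi> (carrier (ps_ring A)) (carrier (ps_ring A))"
  proof -
    assume 1: "bij_betw (\<phi>' \<circ> \<phi>) (carrier (ps_ring A)) (carrier (ps_ring A))"
      and 2: "bij_betw (\<phi> \<circ> \<phi>') (carrier (ps_ring A)) (carrier (ps_ring A))"
    have "inj_on \<phi> (carrier (ps_ring A))" using 1 inj_on_imageI2 unfolding bij_betw_def by blast
    moreover have "carrier (ps_ring A) \<subseteq> \<phi> ` carrier (ps_ring A)"
    proof
      fix F assume "F \<in> carrier (ps_ring A)"
      then obtain H where "H \<in> carrier (ps_ring A)" "\<phi> (\<phi>' H) = F"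
        using 2 unfolding bij_betw_def by force
      then show "F \<in> \<phi> ` carrier (ps_ring A)" using A.ps_hom_closed[OF \<phi>'(1)] by blast
    qed
    ultimately show ?thesis using A.ps_hom_closed[OF \<phi>(1)] by (auto simp: bij_betw_def)
  qed
  then have "restrict \<phi> (carrier (ps_ring A)) \<in> carrier (Gam A)"
    using \<phi>(1) by (intro A.Gam_memI) (auto simp: ps_hom_def)
  moreover have "lies_over A f (restrict \<phi> (carrier (ps_ring A))) \<psi>"
    using over(1) by (simp add: lies_over_def)
  ultimately show ?thesis by blast
qed

end

section \<open>Congruence subgroups\<close>

definition Gam_fil :: "('a, 'b) ring_scheme \<Rightarrow> 'a set \<Rightarrow> nat \<Rightarrow> ((nat \<Rightarrow> 'a) \<Rightarrow> (nat \<Rightarrow> 'a)) set" where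
  "Gam_fil A I i = {\<gamma> \<in> carrier (Gam A). \<gamma> (ps_X A) \<ominus>\<^bsub>ps_ring A\<^esub> ps_X A \<in> coeffs_in A I i}"

context nil_local
begin

abbreviation "K \<equiv> Gam_fil R m"

lemma K_carrier: "\<gamma> \<in> K i \<Longrightarrow> \<gamma> \<in> carrier (Gam R)"
  by (simp add: Gam_fil_def)

text \<open>Membership in K i is tested on X only; it propagates to all series, and the orders add
  when F already has coefficients in m^l.\<close>

lemma K_diff: "\<lbrakk>\<gamma> \<in> K i; F \<in> PI l\<rbrakk> \<Longrightarrow> \<gamma> F \<ominus>\<^bsub>P\<^esub> F \<in> PI (i + l)"
  using ps_hom_diff_PI[OF Gam_ps_hom] by (simp add: Gam_fil_def)

lemma K_diff_0: "\<lbrakk>\<gamma> \<in> K i; F \<in> carrier P\<rbrakk> \<Longrightarrow> \<gamma> F \<ominus>\<^bsub>P\<^esub> F \<in> PI i"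
  using K_diff[of \<gamma> i F 0] PI_0 by simp

lemma Gam_add: "\<lbrakk>\<gamma> \<in> carrier (Gam R); F \<in> carrier P; H \<in> carrier P\<rbrakk> \<Longrightarrow> \<gamma> (F \<oplus>\<^bsub>P\<^esub> H) = \<gamma> F \<oplus>\<^bsub>P\<^esub> \<gamma> H"
  using ring_hom_add[OF Gam_hom] .

lemma Gam_minus:
  assumes "\<gamma> \<in> carrier (Gam R)" "F \<in> carrier P" "H \<in> carrier P"
  shows "\<gamma> (F \<ominus>\<^bsub>P\<^esub> H) = \<gamma> F \<ominus>\<^bsub>P\<^esub> \<gamma> H"
proof -
  interpret \<gamma>: ring_hom_cring P P \<gamma> by (rule ring_hom_cringI2[OF P.is_cring P.is_cring Gam_hom[OF assms(1)]])
  show ?thesis using assms by (simp add: P.minus_eq)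
qed

lemma K_subgroup: "subgroup (K i) (Gam R)"
proof (rule \<Gamma>.subgroupI)
  have "\<one>\<^bsub>Gam R\<^esub> \<in> K i"
    using P.ideal_zero_closed[OF PI_ideal] Gam_one_apply[OF X_closed] by (simp add: Gam_fil_def P.diff_self)
  then show "K i \<noteq> {}" by blast
  show "K i \<subseteq> carrier (Gam R)" using K_carrier by blast
  fix \<gamma> assume \<gamma>: "\<gamma> \<in> K i"
  have \<gamma>': "inv\<^bsub>Gam R\<^esub> \<gamma> \<in> carrier (Gam R)" using K_carrier[OF \<gamma>] by simp
  have H: "(inv\<^bsub>Gam R\<^esub> \<gamma>) Xv \<in> carrier P" using Gam_closed[OF \<gamma>' X_closed] .
  have "\<ominus>\<^bsub>P\<^esub> (\<gamma> ((inv\<^bsub>Gam R\<^esub> \<gamma>) Xv) \<ominus>\<^bsub>P\<^esub> (inv\<^bsub>Gam R\<^esub> \<gamma>) Xv) \<in> PI i"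
    using P.ideal_a_inv_closed[OF PI_ideal K_diff_0[OF \<gamma> H]] .
  moreover have "\<ominus>\<^bsub>P\<^esub> (Xv \<ominus>\<^bsub>P\<^esub> (inv\<^bsub>Gam R\<^esub> \<gamma>) Xv) = (inv\<^bsub>Gam R\<^esub> \<gamma>) Xv \<ominus>\<^bsub>P\<^esub> Xv"
    using H X_closed by algebra
  ultimately show "inv\<^bsub>Gam R\<^esub> \<gamma> \<in> K i"
    using \<gamma>' Gam_inv_apply(1)[OF K_carrier[OF \<gamma>] X_closed] by (simp add: Gam_fil_def)
  fix \<delta> assume \<delta>: "\<delta> \<in> K i"
  have d: "\<delta> Xv \<in> carrier P" using Gam_closed[OF K_carrier[OF \<delta>] X_closed] .
  have "(\<gamma> (\<delta> Xv) \<ominus>\<^bsub>P\<^esub> \<delta> Xv) \<oplus>\<^bsub>P\<^esub> (\<delta> Xv \<ominus>\<^bsub>P\<^esub> Xv) \<in> PI i"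
    using P.ideal_a_closed[OF PI_ideal K_diff_0[OF \<gamma> d]  K_diff_0[OF \<delta> X_closed]] .
  then show "\<gamma> \<otimes>\<^bsub>Gam R\<^esub> \<delta> \<in> K i"
    using K_carrier[OF \<gamma>] K_carrier[OF \<delta>] P.diff_add_diff[OF Gam_closed[OF K_carrier[OF \<gamma>] d] d X_closed]
    by (simp add: Gam_fil_def Gam_mult_apply)
qed

text \<open>\<phi> preserves series with coefficients in m^i. It ranges over all automorphisms, not
  just the kernel of reduction, as conjugation by fibres over arbitrary group elements
  requires.\<close>

lemma K_conj:
  assumes "\<phi> \<in> carrier (Gam R)" "\<gamma> \<in> K i"
  shows "\<phi> \<otimes>\<^bsub>Gam R\<^esub> \<gamma> \<otimes>\<^bsub>Gam R\<^esub> inv\<^bsub>Gam R\<^esub> \<phi> \<in> K i"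
proof -
  let ?H = "(inv\<^bsub>Gam R\<^esub> \<phi>) Xv"
  have H: "?H \<in> carrier P" using Gam_closed[OF \<Gamma>.inv_closed[OF assms(1)] X_closed] .
  have "\<phi> (\<gamma> ?H \<ominus>\<^bsub>P\<^esub> ?H) \<in> PI i" using ps_hom_PI[OF Gam_ps_hom[OF assms(1)] K_diff_0[OF assms(2) H]] .
  then have "\<phi> (\<gamma> ?H) \<ominus>\<^bsub>P\<^esub> \<phi> ?H \<in> PI i"
    using Gam_minus[OF assms(1) Gam_closed[OF K_carrier[OF assms(2)] H] H] by simp
  then show ?thesis
    using assms(1) K_carrier[OF assms(2)] H Gam_inv_apply(1)[OF assms(1) X_closed]
    by (simp add: Gam_fil_def Gam_mult_apply)
qed

lemma K_Suc: "K (Suc i) \<subseteq> K i"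
  using PI_le[of i "Suc i"] by (auto simp: Gam_fil_def)

lemma K_nil: "nil_index \<le> i \<Longrightarrow> K i = {\<one>\<^bsub>Gam R\<^esub>}"
proof -
  assume i: "nil_index \<le> i"
  have "\<gamma> = \<one>\<^bsub>Gam R\<^esub>" if "\<gamma> \<in> K i" for \<gamma>
  proof (rule Gam_eqI[OF K_carrier[OF that] \<Gamma>.one_closed])
    fix F assume F: "F \<in> carrier P"
    have "\<gamma> F \<ominus>\<^bsub>P\<^esub> F \<in> PI nil_index" using K_diff_0[OF that F] PI_le[OF i] by blast
    then have "\<gamma> F \<ominus>\<^bsub>P\<^esub> F = \<zero>\<^bsub>P\<^esub>" using PI_nil by simp
    then have "\<gamma> F = F" using F Gam_closed[OF K_carrier[OF that] F] P.r_right_minus_eq by blast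
    then show "\<gamma> F = \<one>\<^bsub>Gam R\<^esub> F" using Gam_one_apply[OF F] by simp
  qed
  then show ?thesis using subgroup.one_closed[OF K_subgroup] by blast
qed

text \<open>Let F be the preimage of X under \<delta>\<gamma>; the commutator sends X to
  \<gamma>\<delta>F. The second differences (\<gamma>-1)(\<delta>-1)F and (\<delta>-1)(\<gamma>-1)F
  have coefficients in m^(2i), and they differ by \<gamma>\<delta>F - X. Finally 2i is at least
  i+1.\<close>

lemma K_comm:
  assumes i: "1 \<le> i" and \<gamma>: "\<gamma> \<in> K i" and \<delta>: "\<delta> \<in> K i"
  shows "\<gamma> \<otimes>\<^bsub>Gam R\<^esub> \<delta> \<otimes>\<^bsub>Gam R\<^esub> inv\<^bsub>Gam R\<^esub> (\<delta> \<otimes>\<^bsub>Gam R\<^esub> \<gamma>) \<in> K (Suc i)"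
proof -
  note c = K_carrier[OF \<gamma>] K_carrier[OF \<delta>]
  define F where "F = (inv\<^bsub>Gam R\<^esub> (\<delta> \<otimes>\<^bsub>Gam R\<^esub> \<gamma>)) Xv"
  have F: "F \<in> carrier P" using c Gam_closed[OF _ X_closed] by (simp add: F_def)
  note cF = F Gam_closed[OF c(1) F] Gam_closed[OF c(2) F] Gam_closed[OF c(1) Gam_closed[OF c(2) F]] Gam_closed[OF c(2) Gam_closed[OF c(1) F]]
  have X: "\<delta> (\<gamma> F) = Xv"
    using Gam_inv_apply(1)[OF \<Gamma>.m_closed[OF c(2,1)] X_closed] F by (simp add: Gam_mult_apply F_def[symmetric])
  have "\<gamma> (\<delta> F \<ominus>\<^bsub>P\<^esub> F) \<ominus>\<^bsub>P\<^esub> (\<delta> F \<ominus>\<^bsub>P\<^esub> F) \<in> PI (i + i)" "\<delta> (\<gamma> F \<ominus>\<^bsub>P\<^esub> F) \<ominus>\<^bsub>P\<^esub> (\<gamma> F \<ominus>\<^bsub>P\<^esub> F) \<in> PI (i + i)"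
    using K_diff[OF \<gamma> K_diff_0[OF \<delta> F]] K_diff[OF \<delta> K_diff_0[OF \<gamma> F]] by auto
  from P.ideal_minus_closed[OF PI_ideal this]
  have "((\<gamma> (\<delta> F) \<ominus>\<^bsub>P\<^esub> \<gamma> F) \<ominus>\<^bsub>P\<^esub> (\<delta> F \<ominus>\<^bsub>P\<^esub> F)) \<ominus>\<^bsub>P\<^esub> ((\<delta> (\<gamma> F) \<ominus>\<^bsub>P\<^esub> \<delta> F) \<ominus>\<^bsub>P\<^esub> (\<gamma> F \<ominus>\<^bsub>P\<^esub> F)) \<in> PI (i + i)"
    using c cF by (simp add: Gam_minus)
  moreover have "((\<gamma> (\<delta> F) \<ominus>\<^bsub>P\<^esub> \<gamma> F) \<ominus>\<^bsub>P\<^esub> (\<delta> F \<ominus>\<^bsub>P\<^esub> F)) \<ominus>\<^bsub>P\<^esub> ((\<delta> (\<gamma> F) \<ominus>\<^bsub>P\<^esub> \<delta> F) \<ominus>\<^bsub>P\<^esub> (\<gamma> F \<ominus>\<^bsub>P\<^esub> F)) = \<gamma> (\<delta> F) \<ominus>\<^bsub>P\<^esub> \<delta> (\<gamma> F)"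
    using cF by algebra
  ultimately have "\<gamma> (\<delta> F) \<ominus>\<^bsub>P\<^esub> Xv \<in> PI (i + i)" using X by simp
  then have "\<gamma> (\<delta> F) \<ominus>\<^bsub>P\<^esub> Xv \<in> PI (Suc i)" using PI_le[of "Suc i" "i + i"] i by auto
  moreover have "(\<gamma> \<otimes>\<^bsub>Gam R\<^esub> \<delta> \<otimes>\<^bsub>Gam R\<^esub> inv\<^bsub>Gam R\<^esub> (\<delta> \<otimes>\<^bsub>Gam R\<^esub> \<gamma>)) Xv = \<gamma> (\<delta> F)"
    using F by (simp add: Gam_mult_apply F_def)
  ultimately show ?thesis using c by (simp add: Gam_fil_def)
qed

lemma add_pow_coeff: "F \<in> carrier P \<Longrightarrow> ([(n::nat)] \<cdot>\<^bsub>P\<^esub> F) j = [n] \<cdot> F j"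
  by (induction n) (auto simp: add_pow_def ps_ring_simps)

text \<open>With d = \<gamma>X - X, the n-th power moves X by n d up to m^(2i), since powers of
  \<gamma> change d itself only within m^(2i). For n = p the term p d gains one power of m because p
  lies in m.\<close>

lemma K_pow:
  assumes i: "1 \<le> i" and \<gamma>: "\<gamma> \<in> K i" and p: "[(p::nat)] \<cdot> \<one> \<in> m"
  shows "\<gamma> [^]\<^bsub>Gam R\<^esub> p \<in> K (Suc i)"
proof -
  define d where "d = \<gamma> Xv \<ominus>\<^bsub>P\<^esub> Xv"
  have d: "d \<in> PI i" using K_diff_0[OF \<gamma> X_closed] by (simp add: d_def)
  have dc: "d \<in> carrier P" using PI_carrier[OF d] .
  note \<gamma>c = K_carrier[OF \<gamma>]
  have pow: "\<gamma> [^]\<^bsub>Gam R\<^esub> n \<in> K i" for n :: nat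
    by (induction n) (use \<gamma> subgroup.one_closed[OF K_subgroup] subgroup.m_closed[OF K_subgroup] in auto)
  have "((\<gamma> [^]\<^bsub>Gam R\<^esub> n) Xv \<ominus>\<^bsub>P\<^esub> Xv) \<ominus>\<^bsub>P\<^esub> [n] \<cdot>\<^bsub>P\<^esub> d \<in> PI (i + i)" for n :: nat
  proof (induction n)
    case 0
    then show ?case using P.ideal_zero_closed[OF PI_ideal]
      by (simp add: Gam_one_apply P.diff_self add_pow_def)
  next
    case (Suc n)
    define g where "g = \<gamma> [^]\<^bsub>Gam R\<^esub> n"
    have g: "g \<in> K i" using pow by (simp add: g_def)
    note gc = K_carrier[OF g]
    have "\<gamma> Xv = Xv \<oplus>\<^bsub>P\<^esub> d" unfolding d_def using Gam_closed[OF \<gamma>c X_closed] X_closed by algebra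
    then have "(\<gamma> [^]\<^bsub>Gam R\<^esub> Suc n) Xv = g Xv \<oplus>\<^bsub>P\<^esub> g d"
      using dc gc by (simp add: g_def Gam_mult_apply Gam_add)
    moreover have "[Suc n] \<cdot>\<^bsub>P\<^esub> d = [n] \<cdot>\<^bsub>P\<^esub> d \<oplus>\<^bsub>P\<^esub> d" by (simp add: add_pow_def)
    moreover have c: "g Xv \<in> carrier P" "g d \<in> carrier P" "[n] \<cdot>\<^bsub>P\<^esub> d \<in> carrier P"
      using Gam_closed[OF gc] dc P.add.nat_pow_closed[OF dc] by (auto simp: add_pow_def)
    moreover have "((g Xv \<oplus>\<^bsub>P\<^esub> g d) \<ominus>\<^bsub>P\<^esub> Xv) \<ominus>\<^bsub>P\<^esub> ([n] \<cdot>\<^bsub>P\<^esub> d \<oplus>\<^bsub>P\<^esub> d) = ((g Xv \<ominus>\<^bsub>P\<^esub> Xv) \<ominus>\<^bsub>P\<^esub> [n] \<cdot>\<^bsub>P\<^esub> d) \<oplus>\<^bsub>P\<^esub> (g d \<ominus>\<^bsub>P\<^esub> d)"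
      using c dc X_closed by algebra
    moreover have "\<dots> \<in> PI (i + i)"
      using P.ideal_a_closed[OF PI_ideal Suc K_diff[OF g d]] by (simp add: g_def)
    ultimately show ?case by simp
  qed
  then have 1: "((\<gamma> [^]\<^bsub>Gam R\<^esub> p) Xv \<ominus>\<^bsub>P\<^esub> Xv) \<ominus>\<^bsub>P\<^esub> [p] \<cdot>\<^bsub>P\<^esub> d \<in> PI (Suc i)"
    using PI_le[of "Suc i" "i + i"] i by auto
  have pd: "[p] \<cdot>\<^bsub>P\<^esub> d \<in> carrier P" using P.add.nat_pow_closed[OF dc] by (simp add: add_pow_def)
  have "([p] \<cdot>\<^bsub>P\<^esub> d) j \<in> ideal_pow R m (Suc i)" for j
  proof -
    have "d j \<in> carrier R" "d j \<in> ideal_pow R m i" using coeff_closed[OF dc] d by (auto simp: coeffs_in_def)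
    moreover have "[p] \<cdot> \<one> \<in> ideal_pow R m 1" using p ideal_pow_1[OF m_ideal] by simp
    ultimately have "([p] \<cdot> \<one>) \<otimes> d j \<in> ideal_pow R m (1 + i)" using ideal_pow_mult[OF m_ideal] by blast
    then show ?thesis using add_pow_ldistr[of \<one> "d j" p] \<open>d j \<in> carrier R\<close> add_pow_coeff[OF dc] by simp
  qed
  then have 2: "[p] \<cdot>\<^bsub>P\<^esub> d \<in> PI (Suc i)" using pd by (simp add: coeffs_in_def)
  have c: "(\<gamma> [^]\<^bsub>Gam R\<^esub> p) Xv \<in> carrier P" using Gam_closed[OF K_carrier[OF pow] X_closed] .
  have "((\<gamma> [^]\<^bsub>Gam R\<^esub> p) Xv \<ominus>\<^bsub>P\<^esub> Xv) \<ominus>\<^bsub>P\<^esub> [p] \<cdot>\<^bsub>P\<^esub> d \<oplus>\<^bsub>P\<^esub> [p] \<cdot>\<^bsub>P\<^esub> d = (\<gamma> [^]\<^bsub>Gam R\<^esub> p) Xv \<ominus>\<^bsub>P\<^esub> Xv"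
    using c pd X_closed by algebra
  then show ?thesis
    using P.ideal_a_closed[OF PI_ideal 1 2] K_carrier[OF pow] by (simp add: Gam_fil_def)
qed

text \<open>Identifies level 1 of the filtration with the kernel of reduction; f stands for the
  residue map, whose kernel is m.\<close>

lemma K_1_iff:
  assumes "cring S" "f \<in> ring_hom R S" "\<And>x. x \<in> carrier R \<Longrightarrow> f x = \<zero>\<^bsub>S\<^esub> \<longleftrightarrow> x \<in> m"
    and \<gamma>: "\<gamma> \<in> carrier (Gam R)"
  shows "\<gamma> \<in> K 1 \<longleftrightarrow> lies_over R f \<gamma> \<one>\<^bsub>Gam S\<^esub>"
proof -
  interpret S: power_series S using assms by (simp add: power_series_def)
  interpret f: ring_hom_cring R S f by (rule ring_hom_cringI2[OF is_cring S.is_cring assms(2)])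
  have eq: "F \<ominus>\<^bsub>P\<^esub> H \<in> PI 1 \<longleftrightarrow> f \<circ> F = f \<circ> H" if FH: "F \<in> carrier P" "H \<in> carrier P" for F H
  proof -
    have "(F \<ominus>\<^bsub>P\<^esub> H) j \<in> m \<longleftrightarrow> f (F j) = f (H j)" for j
    proof -
      note c = coeff_closed[OF FH(1)] coeff_closed[OF FH(2)]
      have "(F \<ominus>\<^bsub>P\<^esub> H) j \<in> m \<longleftrightarrow> f (F j \<ominus> H j) = \<zero>\<^bsub>S\<^esub>"
        using assms(3)[of "F j \<ominus> H j"] c minus_coeff[OF FH] by simp
      also have "\<dots> \<longleftrightarrow> f (F j) \<ominus>\<^bsub>S\<^esub> f (H j) = \<zero>\<^bsub>S\<^esub>" using c by (simp add: minus_eq S.minus_eq)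
      also have "\<dots> \<longleftrightarrow> f (F j) = f (H j)" using c by (intro S.r_right_minus_eq) auto
      finally show ?thesis .
    qed
    then show ?thesis
      unfolding coeffs_in_def ideal_pow_1[OF m_ideal] using FH by (auto simp: fun_eq_iff)
  qed
  have one: "\<one>\<^bsub>Gam S\<^esub> (f \<circ> F) = f \<circ> F" if "F \<in> carrier P" for F
    using S.Gam_one_apply[OF ps_comp_closed[OF assms(2) that]] .
  show ?thesis
  proof
    assume "\<gamma> \<in> K 1"
    then show "lies_over R f \<gamma> \<one>\<^bsub>Gam S\<^esub>"
      using K_diff_0[of \<gamma> 1] eq[OF Gam_closed[OF \<gamma>]] one by (simp add: lies_over_def)
  next
    assume "lies_over R f \<gamma> \<one>\<^bsub>Gam S\<^esub>"
    then have "f \<circ> \<gamma> Xv = f \<circ> Xv" using one[OF X_closed] lies_overD[of R f \<gamma> _ Xv] X_closed by metis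
    then show "\<gamma> \<in> K 1" using eq[OF Gam_closed[OF \<gamma> X_closed] X_closed] \<gamma> by (simp add: Gam_fil_def)
  qed
qed

end

section \<open>Chain conditions in local rings\<close>

definition adjoin :: "('a, 'm) ring_scheme \<Rightarrow> 'a set \<Rightarrow> 'a \<Rightarrow> 'a set" where
  "adjoin R J x = {j \<oplus>\<^bsub>R\<^esub> r \<otimes>\<^bsub>R\<^esub> x | j r. j \<in> J \<and> r \<in> carrier R}"

context cring
begin

lemma adjoinI: "\<lbrakk>j \<in> J; r \<in> carrier R\<rbrakk> \<Longrightarrow> j \<oplus> r \<otimes> x \<in> adjoin R J x"
  by (auto simp: adjoin_def)

lemma adjoin_ideal:
  assumes J: "ideal J R" and x: "x \<in> carrier R"
  shows "ideal (adjoin R J x) R" "J \<subseteq> adjoin R J x" "x \<in> adjoin R J x"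
proof -
  have Jc: "j \<in> carrier R" if "j \<in> J" for j using ideal.Icarr[OF J that] .
  show sub: "J \<subseteq> adjoin R J x"
  proof
    fix j assume "j \<in> J"
    then show "j \<in> adjoin R J x" using adjoinI[of j J "\<zero>" x] Jc x by simp
  qed
  show "x \<in> adjoin R J x" using adjoinI[of "\<zero>" J "\<one>" x] ideal_zero_closed[OF J] x by simp
  show "ideal (adjoin R J x) R"
  proof (rule idealI_cring)
    show "adjoin R J x \<subseteq> carrier R" using Jc x by (auto simp: adjoin_def)
    show "\<zero> \<in> adjoin R J x" using sub ideal_zero_closed[OF J] by blast
  next
    fix a b assume "a \<in> adjoin R J x" "b \<in> adjoin R J x"
    then obtain i r j s where *: "i \<in> J" "r \<in> carrier R" "a = i \<oplus> r \<otimes> x" "j \<in> J" "s \<in> carrier R" "b = j \<oplus> s \<otimes> x"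
      by (auto simp: adjoin_def)
    have "a \<oplus> b = (i \<oplus> j) \<oplus> (r \<oplus> s) \<otimes> x" using * Jc[of i] Jc[of j] x by algebra
    then show "a \<oplus> b \<in> adjoin R J x" using adjoinI[of "i \<oplus> j" J "r \<oplus> s" x] * ideal_a_closed[OF J] by simp
  next
    fix a b assume a: "a \<in> carrier R" and "b \<in> adjoin R J x"
    then obtain j s where *: "j \<in> J" "s \<in> carrier R" "b = j \<oplus> s \<otimes> x" by (auto simp: adjoin_def)
    have "a \<otimes> b = a \<otimes> j \<oplus> (a \<otimes> s) \<otimes> x" using * Jc[of j] x a by algebra
    then show "a \<otimes> b \<in> adjoin R J x" using adjoinI[of "a \<otimes> j" J "a \<otimes> s" x] * ideal.I_l_closed[OF J] a by simp
  qed
qed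

lemma one_in_ideal: "\<lbrakk>ideal J R; \<one> \<in> J\<rbrakk> \<Longrightarrow> J = carrier R"
  by (rule ideal.one_imp_carrier)

lemma unit_in_ideal:
  assumes "ideal J R" "u \<in> Units R" "u \<in> J" shows "J = carrier R"
  using one_in_ideal[OF assms(1)] ideal.I_l_closed[OF assms(1,3), of "inv u"] assms(2) by auto

lemma maximalideal_ex:
  assumes I: "ideal I R" "\<one> \<notin> I"
  shows "\<exists>M. maximalideal M R \<and> I \<subseteq> M"
proof -
  let ?A = "{J. ideal J R \<and> I \<subseteq> J \<and> \<one> \<notin> J}"
  have "\<exists>M\<in>?A. \<forall>J\<in>?A. M \<subseteq> J \<longrightarrow> J = M"
  proof (rule subset_Zorn_nonempty)
    show "?A \<noteq> {}" using I by blast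
    fix \<C> assume C: "\<C> \<noteq> {}" "subset.chain ?A \<C>"
    then have "subset.chain {J. ideal J R} \<C>" by (auto simp: pred_on.chain_def)
    from chain_Union_is_ideal[OF this] have "ideal (\<Union>\<C>) R" using C(1) by simp
    moreover have "\<C> \<subseteq> ?A" using C(2) by (simp add: pred_on.chain_def)
    then have "I \<subseteq> \<Union>\<C>" "\<one> \<notin> \<Union>\<C>" using C(1) by blast+
    ultimately show "\<Union>\<C> \<in> ?A" by simp
  qed
  then obtain M where M': "M \<in> ?A" and max: "\<forall>J\<in>?A. M \<subseteq> J \<longrightarrow> J = M" by blast
  then have M: "ideal M R" "I \<subseteq> M" "\<one> \<notin> M" by auto
  have "maximalideal M R"
  proof (rule maximalidealI[OF M(1)])
    show "carrier R \<noteq> M" using M(3) by auto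
    show "J = M \<or> J = carrier R" if "ideal J R" "M \<subseteq> J" "J \<subseteq> carrier R" for J
      using max one_in_ideal[OF that(1)] that M(2) by blast
  qed
  then show ?thesis using M(2) by blast
qed

lemma nonunit_maximalideal:
  assumes "x \<in> carrier R" "x \<notin> Units R"
  shows "\<exists>M. maximalideal M R \<and> x \<in> M"
proof -
  have Z: "ideal {\<zero>} R" by (rule zeroideal)
  have "\<one> \<notin> adjoin R {\<zero>} x"
  proof
    assume "\<one> \<in> adjoin R {\<zero>} x"
    then obtain r where "r \<in> carrier R" "\<one> = r \<otimes> x" using assms(1) by (auto simp: adjoin_def)
    then have "x \<in> Units R" using assms(1) m_comm unfolding Units_def by force
    then show False using assms(2) by simp
  qed
  then show ?thesis
    using maximalideal_ex[OF adjoin_ideal(1)[OF Z assms(1)]] adjoin_ideal(3)[OF Z assms(1)] by blast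
qed

lemma ideal_pow_subset:
  assumes I: "ideal I R" and J: "ideal J R" and le: "\<And>x y. \<lbrakk>x \<in> ideal_pow R I n; y \<in> I\<rbrakk> \<Longrightarrow> x \<otimes> y \<in> J"
  shows "ideal_pow R I (Suc n) \<subseteq> J"
  unfolding ideal_pow_Suc
proof
  fix z assume "z \<in> ideal_prod R (ideal_pow R I n) I"
  then show "z \<in> J"
    by (induction rule: ideal_prod.induct) (auto intro: le ideal_a_closed[OF J])
qed

lemma ideal_pow_add: "ideal I R \<Longrightarrow> ideal_pow R I (a + b) = ideal_prod R (ideal_pow R I a) (ideal_pow R I b)"
  using monoid.nat_pow_mult[OF comm_monoid.axioms(1)[OF ideals_set_is_comm_monoid], of I a b]
  by (simp add: ideals_set_def)

end

text \<open>\<open>artinian\<close> speaks of sequences; a set without minimal member would yield a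
  strictly descending one by iterated choice.\<close>

lemma artinian_minimal:
  assumes "artinian R" "S \<noteq> {}" "\<And>J. J \<in> S \<Longrightarrow> ideal J R"
  shows "\<exists>J\<in>S. \<forall>J'\<in>S. J' \<subseteq> J \<longrightarrow> J' = J"
proof (rule ccontr)
  assume "\<not> ?thesis"
  then have "\<forall>J\<in>S. \<exists>J'. J' \<in> S \<and> J' \<subset> J" by blast
  then obtain f where f: "\<And>J. J \<in> S \<Longrightarrow> f J \<in> S \<and> f J \<subset> J" by metis
  obtain J0 where J0: "J0 \<in> S" using assms(2) by blast
  define I where "I n = (f ^^ n) J0" for n
  have IS: "I n \<in> S" for n by (induction n) (use J0 f in \<open>auto simp: I_def\<close>)
  have dec: "I (Suc n) \<subset> I n" for n using f[OF IS[of n]] by (simp add: I_def)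
  have "\<exists>m. \<forall>n\<ge>m. I n = I m"
    using assms(1) IS assms(3) dec unfolding artinian_def by blast
  then obtain m where m: "\<And>n. n \<ge> m \<Longrightarrow> I n = I m" by blast
  have "I (Suc m) = I m" by (rule m) simp
  then show False using dec[of m] by simp
qed

lemma (in noetherian_ring) noetherian_maximal:
  assumes "S \<noteq> {}" "\<And>J. J \<in> S \<Longrightarrow> ideal J R"
  shows "\<exists>J\<in>S. \<forall>J'\<in>S. J \<subseteq> J' \<longrightarrow> J' = J"
proof (rule subset_Zorn_nonempty[OF assms(1)])
  fix \<C> assume C: "\<C> \<noteq> {}" "subset.chain S \<C>"
  then have "subset.chain {J. ideal J R} \<C>" using assms(2) by (auto simp: pred_on.chain_def)
  then have "\<Union>\<C> \<in> \<C>" using ideal_chain_is_trivial C(1) by blast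
  then show "\<Union>\<C> \<in> S" using C(2) by (auto simp: pred_on.chain_def)
qed

locale local_cring = cring R for R (structure) +
  fixes m :: "'a set"
  assumes m_ideal: "ideal m R" and m_proper: "\<one> \<notin> m"
    and m_unit: "x \<in> carrier R \<Longrightarrow> x \<notin> m \<Longrightarrow> x \<in> Units R"
begin

lemma one_minus_unit: "a \<in> m \<Longrightarrow> \<one> \<ominus> a \<in> Units R"
proof (rule m_unit)
  assume a: "a \<in> m"
  then have ac: "a \<in> carrier R" using ideal.Icarr[OF m_ideal] by blast
  then show "\<one> \<ominus> a \<in> carrier R" by simp
  show "\<one> \<ominus> a \<notin> m"
  proof
    assume "\<one> \<ominus> a \<in> m"
    then have "(\<one> \<ominus> a) \<oplus> a \<in> m" using a ideal_a_closed[OF m_ideal] by blast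
    moreover have "(\<one> \<ominus> a) \<oplus> a = \<one>" using ac by algebra
    ultimately show False using m_proper by simp
  qed
qed

lemma one_minus_mult:
  assumes "a \<in> m" "x \<in> carrier R" "ideal J R" "(\<one> \<ominus> a) \<otimes> x \<in> J"
  shows "x \<in> J"
proof -
  have u: "\<one> \<ominus> a \<in> Units R" by (rule one_minus_unit[OF assms(1)])
  then have "inv (\<one> \<ominus> a) \<otimes> ((\<one> \<ominus> a) \<otimes> x) \<in> J" using ideal.I_l_closed[OF assms(3,4)] by blast
  moreover have "inv (\<one> \<ominus> a) \<otimes> ((\<one> \<ominus> a) \<otimes> x) = x"
    using u assms(2) Units_closed[OF u] by (simp flip: m_assoc)
  ultimately show ?thesis by simp
qed

text \<open>The powers of m stabilise at an idempotent ideal I. If I were nonzero, an ideal J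
  minimal with I J nonzero would be of the form I x with x in J, forcing x = e x for some e in m and
  hence x = 0.\<close>

lemma artinian_nilpotent:
  assumes "artinian R"
  shows "\<exists>n. ideal_pow R m n = {\<zero>}"
proof -
  have "(\<forall>n. ideal (ideal_pow R m n) R) \<and> (\<forall>n. ideal_pow R m (Suc n) \<subseteq> ideal_pow R m n)"
    using ideal_pow_ideal[OF m_ideal] ideal_pow_le[OF m_ideal] by (meson le_Suc_eq order_refl)
  then obtain n0 where "\<And>n. n \<ge> n0 \<Longrightarrow> ideal_pow R m n = ideal_pow R m n0"
    using assms unfolding artinian_def by blast
  then have st: "ideal_pow R m n = ideal_pow R m (Suc n0)" if "n \<ge> Suc n0" for n
    using that by (metis Suc_leD le_SucI order_refl)
  define I where "I = ideal_pow R m (Suc n0)"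
  have I: "ideal I R" using ideal_pow_ideal[OF m_ideal] by (simp only: I_def)
  have Im: "I \<subseteq> m" using ideal_pow_le[OF m_ideal, of 1 "Suc n0"] ideal_pow_1[OF m_ideal] unfolding I_def by simp
  have II: "ideal_prod R I I = I"
    using ideal_pow_add[OF m_ideal, of "Suc n0" "Suc n0"] st[of "Suc n0 + Suc n0"] unfolding I_def by simp
  have "I = {\<zero>}"
  proof (rule ccontr)
    assume ne: "I \<noteq> {\<zero>}"
    \<comment> \<open>Elements of I are sums of products from I, so what the products annihilate is
      annihilated by I.\<close>
    have kill: "i \<otimes> x = \<zero>" if x: "x \<in> carrier R" and z: "\<And>a b. \<lbrakk>a \<in> I; b \<in> I\<rbrakk> \<Longrightarrow> a \<otimes> b \<otimes> x = \<zero>" and i: "i \<in> I" for i x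
    proof -
      have "i \<in> ideal_prod R I I" using i II by simp
      then have "i \<otimes> x = \<zero> \<and> i \<in> carrier R"
        by (induction rule: ideal_prod.induct) (use x z ideal.Icarr[OF I] in \<open>auto simp: l_distr\<close>)
      then show ?thesis by simp
    qed
    let ?S = "{J. ideal J R \<and> (\<exists>i\<in>I. \<exists>x\<in>J. i \<otimes> x \<noteq> \<zero>)}"
    have "I \<in> ?S"
    proof -
      have "\<exists>i\<in>I. \<exists>x\<in>I. i \<otimes> x \<noteq> \<zero>"
      proof (rule ccontr)
        assume "\<not> ?thesis"
        then have "i \<otimes> \<one> = \<zero>" if "i \<in> I" for i
          using kill[OF one_closed _ that] ideal.Icarr[OF I] by simp
        then have "i = \<zero>" if "i \<in> I" for i using that ideal.Icarr[OF I that] by (metis r_one)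
        then show False using ne ideal_zero_closed[OF I] by blast
      qed
      then show ?thesis using I by blast
    qed
    then have "\<exists>J\<in>?S. \<forall>J'\<in>?S. J' \<subseteq> J \<longrightarrow> J' = J"
      by (intro artinian_minimal[OF assms]) auto
    then obtain J where J: "J \<in> ?S" and min: "\<forall>J'\<in>?S. J' \<subseteq> J \<longrightarrow> J' = J" by blast
    then obtain i x where ix: "i \<in> I" "x \<in> J" "i \<otimes> x \<noteq> \<zero>" by blast
    have Ji: "ideal J R" using J by blast
    have xc: "x \<in> carrier R" using ideal.Icarr[OF Ji ix(2)] .
    \<comment> \<open>Idempotency of I makes this ideal a competitor of J, and it is contained in J;
      minimality puts x into it.\<close>
    let ?J' = "(\<lambda>a. a \<otimes> x) ` I"
    have J': "ideal ?J' R"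
    proof (rule idealI_cring)
      show "?J' \<subseteq> carrier R" using ideal.Icarr[OF I] xc by auto
      show "\<zero> \<in> ?J'" using ideal_zero_closed[OF I] xc by (auto simp: image_iff intro!: bexI[of _ "\<zero>"])
      fix a b assume "a \<in> ?J'" "b \<in> ?J'"
      then obtain u v where uv: "u \<in> I" "a = u \<otimes> x" "v \<in> I" "b = v \<otimes> x" by blast
      note c = ideal.Icarr[OF I uv(1)] ideal.Icarr[OF I uv(3)]
      have "a \<oplus> b = (u \<oplus> v) \<otimes> x" using uv c xc by (simp add: l_distr)
      then show "a \<oplus> b \<in> ?J'" using ideal_a_closed[OF I uv(1,3)] by blast
    next
      fix r a assume r: "r \<in> carrier R" and "a \<in> ?J'"
      then obtain u where u: "u \<in> I" "a = u \<otimes> x" by blast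
      have "r \<otimes> a = (r \<otimes> u) \<otimes> x" using u ideal.Icarr[OF I u(1)] r xc by (simp add: m_assoc)
      then show "r \<otimes> a \<in> ?J'" using ideal.I_l_closed[OF I u(1) r] by blast
    qed
    have "\<exists>a\<in>I. \<exists>b\<in>I. a \<otimes> b \<otimes> x \<noteq> \<zero>" using kill[OF xc _ ix(1)] ix(3) by blast
    then have "\<exists>a\<in>I. \<exists>y\<in>?J'. a \<otimes> y \<noteq> \<zero>" using ideal.Icarr[OF I] xc by (metis image_eqI m_assoc)
    then have "?J' \<in> ?S" using J' by blast
    moreover have "?J' \<subseteq> J" using ideal.I_l_closed[OF Ji ix(2)] ideal.Icarr[OF I] by auto
    ultimately have "x \<in> ?J'" using min ix(2) by blast
    then obtain e where e: "e \<in> I" "x = e \<otimes> x" by blast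
    then have ec: "e \<in> carrier R" using ideal.Icarr[OF I] by blast
    have "(\<one> \<ominus> e) \<otimes> x = x \<ominus> e \<otimes> x" using ec xc by (simp add: minus_eq l_distr l_minus)
    also have "\<dots> = \<zero>" using e(2) xc by (simp flip: e(2) add: diff_self)
    finally have "x \<in> {\<zero>}" using one_minus_mult[OF _ xc zeroideal] e(1) Im by auto
    then show False using ix ideal.Icarr[OF I ix(1)] by simp
  qed
  then show ?thesis unfolding I_def by blast
qed

text \<open>Noetherian induction on the lower bound J of a descending chain. A maximal
  counterexample J is enlarged by some x that m multiplies into J; by the modular law, a chain above
  J is determined by its sums and intersections with J + R x.\<close>

lemma nilpotent_noetherian_artinian:
  assumes noeth: "noetherian_ring R" and nil: "ideal_pow R m N = {\<zero>}"
  shows "artinian R"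
proof -
  define dcc where "dcc J \<longleftrightarrow> (\<forall>I :: nat \<Rightarrow> 'a set. (\<forall>n. ideal (I n) R) \<and> (\<forall>n. I (Suc n) \<subseteq> I n) \<and> (\<forall>n. J \<subseteq> I n) \<longrightarrow>
        (\<exists>m. \<forall>n\<ge>m. I n = I m))" for J
  have "dcc J" if "ideal J R" for J
  proof (rule ccontr)
    assume "\<not> dcc J"
    then obtain J where J: "ideal J R" "\<not> dcc J" and max: "\<And>J'. \<lbrakk>ideal J' R; J \<subseteq> J'; J' \<noteq> J\<rbrakk> \<Longrightarrow> dcc J'"
      using noetherian_ring.noetherian_maximal[OF noeth, of "{J. ideal J R \<and> \<not> dcc J}"] \<open>ideal J R\<close> by blast
    have Jc: "j \<in> carrier R" if "j \<in> J" for j using ideal.Icarr[OF J(1) that] .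
    have "J \<noteq> carrier R"
    proof
      assume "J = carrier R"
      moreover have "I n = carrier R" if "\<forall>n. ideal (I n) R" "\<forall>n. carrier R \<subseteq> I n" for I :: "nat \<Rightarrow> 'a set" and n
        using that by (meson ideal.Icarr subsetI subset_antisym)
      ultimately have "dcc J" unfolding dcc_def by metis
      then show False using J(2) by simp
    qed
    moreover have "ideal_pow R m N \<subseteq> J" using nil ideal_zero_closed[OF J(1)] by auto
    \<comment> \<open>The place where the powers of m enter J: an element x of the n-th power
      outside J is multiplied into J by m, so (J + R x) / J is simple.\<close>
    ultimately obtain n where n: "\<not> ideal_pow R m n \<subseteq> J" "ideal_pow R m (Suc n) \<subseteq> J"
    proof (induction N)
      case 0
      then show ?case using ideal.Icarr[OF J(1)] unfolding ideal_pow_0 by blast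
    qed blast
    then obtain x where x: "x \<in> ideal_pow R m n" "x \<notin> J" by blast
    have xc: "x \<in> carrier R" using ideal.Icarr[OF ideal_pow_ideal[OF m_ideal] x(1)] .
    have mx: "a \<otimes> x \<in> J" if "a \<in> m" for a
    proof -
      have ac: "a \<in> carrier R" using that ideal.Icarr[OF m_ideal] by blast
      have "x \<otimes> a \<in> ideal_pow R m (n + 1)"
        by (rule ideal_pow_mult[OF m_ideal x(1)]) (use that ideal_pow_1[OF m_ideal] in blast)
      then show ?thesis using n(2) m_comm[OF xc ac] by (metis Suc_eq_plus1 subsetD)
    qed
    let ?J' = "adjoin R J x"
    note J' = adjoin_ideal[OF J(1) xc]
    have dcc': "dcc ?J'" using max[OF J'(1,2)] J'(3) x(2) by blast
    have "dcc J"
      unfolding dcc_def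
    proof (intro allI impI, elim conjE)
      fix I :: "nat \<Rightarrow> 'a set"
      assume I: "\<forall>n. ideal (I n) R" and dec: "\<forall>n. I (Suc n) \<subseteq> I n" and JI: "\<forall>n. J \<subseteq> I n"
      have Ii: "ideal (I n) R" for n using I by blast
      have dec': "I b \<subseteq> I a" if "a \<le> b" for a b
        using lift_Suc_antimono_le[of I a b] that dec by blast
      have "\<exists>m. \<forall>n\<ge>m. (I n <+>\<^bsub>R\<^esub> ?J') = (I m <+>\<^bsub>R\<^esub> ?J')"
      proof -
        have "ideal (I n <+>\<^bsub>R\<^esub> ?J') R" for n using add_ideals[OF Ii J'(1)] .
        moreover have "(I (Suc n) <+>\<^bsub>R\<^esub> ?J') \<subseteq> (I n <+>\<^bsub>R\<^esub> ?J')" for n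
          using dec unfolding set_add_def' by blast
        moreover have "?J' \<subseteq> (I n <+>\<^bsub>R\<^esub> ?J')" for n
        proof
          fix y assume y: "y \<in> ?J'"
          then have "y = \<zero> \<oplus> y" using ideal.Icarr[OF J'(1)] by simp
          then show "y \<in> I n <+>\<^bsub>R\<^esub> ?J'" using y ideal_zero_closed[OF Ii] unfolding set_add_def' by blast
        qed
        ultimately have "(\<forall>n. ideal (I n <+>\<^bsub>R\<^esub> ?J') R) \<and> (\<forall>n. (I (Suc n) <+>\<^bsub>R\<^esub> ?J') \<subseteq> (I n <+>\<^bsub>R\<^esub> ?J'))
            \<and> (\<forall>n. ?J' \<subseteq> (I n <+>\<^bsub>R\<^esub> ?J'))" by blast
        then show ?thesis using dcc'[unfolded dcc_def, THEN spec, of "\<lambda>n. I n <+>\<^bsub>R\<^esub> ?J'"] by (rule rev_mp)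
      qed
      then obtain m1 where m1: "\<And>n. n \<ge> m1 \<Longrightarrow> (I n <+>\<^bsub>R\<^esub> ?J') = (I m1 <+>\<^bsub>R\<^esub> ?J')" by blast
      have "\<exists>m2. (\<forall>n\<ge>m2. x \<in> I n) \<or> (\<forall>n\<ge>m2. x \<notin> I n)" using dec' by blast
      then obtain m2 where m2: "(\<forall>n\<ge>m2. x \<in> I n) \<or> (\<forall>n\<ge>m2. x \<notin> I n)" by blast
      \<comment> \<open>An ideal above J meets J + R x in all of it or just in J, according to
        whether it contains x, and this is eventually constant along the chain.\<close>
      have int: "z \<in> I b" if z: "z \<in> I a" "z \<in> ?J'" and ab: "a \<ge> m2" "b \<ge> m2" for z a b
      proof -
        obtain j r where jr: "j \<in> J" "r \<in> carrier R" "z = j \<oplus> r \<otimes> x" using z(2) by (auto simp: adjoin_def)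
        show ?thesis
        proof (cases "x \<in> I b")
          case True
          then show ?thesis using jr JI ideal_a_closed[OF Ii] ideal.I_l_closed[OF Ii True jr(2)] by blast
        next
          case False
          then have xa: "x \<notin> I a" using m2 ab by blast
          have "r \<in> m"
          proof (rule ccontr)
            assume "r \<notin> m"
            then have r: "r \<in> Units R" using m_unit jr(2) by blast
            have "z \<ominus> j \<in> I a" using ideal_minus_closed[OF Ii z(1)] jr(1) JI by blast
            moreover have "z \<ominus> j = r \<otimes> x" using jr Jc[OF jr(1)] xc by algebra
            ultimately have "inv r \<otimes> (r \<otimes> x) \<in> I a" using ideal.I_l_closed[OF Ii] r by simp
            moreover have "inv r \<otimes> (r \<otimes> x) = x" using r xc jr(2) by (simp flip: m_assoc)
            ultimately show False using xa by simp
          qed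
          then have "z \<in> J" using jr mx ideal_a_closed[OF J(1)] by blast
          then show ?thesis using JI by blast
        qed
      qed
      define l where "l = max m1 m2"
      have "I l \<subseteq> I n" if n: "n \<ge> l" for n
      proof
        fix y assume y: "y \<in> I l"
        have yc: "y \<in> carrier R" using ideal.Icarr[OF Ii y] .
        have "y = y \<oplus> \<zero>" using yc by simp
        then have "y \<in> I l <+>\<^bsub>R\<^esub> ?J'" using y ideal_zero_closed[OF J'(1)] unfolding set_add_def' by blast
        then have "y \<in> I n <+>\<^bsub>R\<^esub> ?J'" using m1[of l] m1[of n] n by (simp add: l_def)
        then obtain u z where uz: "u \<in> I n" "z \<in> ?J'" "y = u \<oplus> z" unfolding set_add_def' by blast
        have c: "u \<in> carrier R" "z \<in> carrier R" using uz ideal.Icarr[OF Ii] ideal.Icarr[OF J'(1)] by auto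
        have "z = y \<ominus> u" using uz(3) c by algebra
        then have "z \<in> I l" using ideal_minus_closed[OF Ii y] uz(1) dec'[OF n] by blast
        then have "z \<in> I n" using int[OF _ uz(2)] n by (simp add: l_def)
        then show "y \<in> I n" using uz ideal_a_closed[OF Ii] by blast
      qed
      then have "\<forall>n\<ge>l. I n = I l" using dec' by blast
      then show "\<exists>m. \<forall>n\<ge>m. I n = I m" by blast
    qed
    then show False using J(2) by simp
  qed
  from this[OF zeroideal] have D: "dcc {\<zero>}" .
  show ?thesis
    unfolding artinian_def
  proof (intro conjI allI impI ring_axioms)
    fix I :: "nat \<Rightarrow> 'a set" assume I: "(\<forall>n. ideal (I n) R) \<and> (\<forall>n. I (Suc n) \<subseteq> I n)"
    then have "\<forall>n. {\<zero>} \<subseteq> I n" using ideal_zero_closed by auto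
    then show "\<exists>m. \<forall>n\<ge>m. I n = I m" using D I unfolding dcc_def by blast
  qed
qed

text \<open>An ideal maximal among those avoiding a nonzero element of the intersection contains a power of
  every element of \<open>m\<close>, hence a power of \<open>m\<close>.\<close>

theorem krull_intersection:
  assumes noeth: "noetherian_ring R" and y: "\<And>n. y \<in> ideal_pow R m n"
  shows "y = \<zero>"
proof (rule ccontr)
  assume "y \<noteq> \<zero>"
  then obtain J where J: "ideal J R" "y \<notin> J" and max: "\<And>J'. \<lbrakk>ideal J' R; y \<notin> J'; J \<subseteq> J'\<rbrakk> \<Longrightarrow> J' = J"
    using noetherian_ring.noetherian_maximal[OF noeth, of "{J. ideal J R \<and> y \<notin> J}"] zeroideal by blast
  have yc: "y \<in> carrier R" using y[of 0] unfolding ideal_pow_0 .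
  have Jc: "j \<in> carrier R" if "j \<in> J" for j using ideal.Icarr[OF J(1) that] .
  \<comment> \<open>Otherwise maximality of J puts y into J + R a y, so (1 - r a) y lies in J for
    some r, and 1 - r a is a unit.\<close>
  have my: "a \<otimes> y \<in> J" if a: "a \<in> m" for a
  proof (rule ccontr)
    assume n: "a \<otimes> y \<notin> J"
    have ac: "a \<in> carrier R" using a ideal.Icarr[OF m_ideal] by blast
    have ay: "a \<otimes> y \<in> carrier R" using ac yc by simp
    have "y \<in> adjoin R J (a \<otimes> y)"
      using max[OF adjoin_ideal(1)[OF J(1) ay] _ adjoin_ideal(2)[OF J(1) ay]] adjoin_ideal(3)[OF J(1) ay] n by blast
    then obtain j r where jr: "j \<in> J" "r \<in> carrier R" "y = j \<oplus> r \<otimes> (a \<otimes> y)" by (auto simp: adjoin_def)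
    have "(\<one> \<ominus> r \<otimes> a) \<otimes> y = y \<ominus> r \<otimes> (a \<otimes> y)" using jr(2) ac yc by (simp add: minus_eq l_distr l_minus m_assoc)
    also have "\<dots> = (j \<oplus> r \<otimes> (a \<otimes> y)) \<ominus> r \<otimes> (a \<otimes> y)" using jr(3) by simp
    also have "\<dots> = j" using jr(2) Jc[OF jr(1)] ac yc by algebra
    finally have "(\<one> \<ominus> r \<otimes> a) \<otimes> y \<in> J" using jr(1) by simp
    then show False using one_minus_mult[OF ideal.I_l_closed[OF m_ideal a jr(2)] yc J(1)] J(2) by blast
  qed
  have pow: "\<exists>n. x [^] (n::nat) \<in> J" if x: "x \<in> m" for x
  proof -
    have xc: "x \<in> carrier R" using x ideal.Icarr[OF m_ideal] by blast
    \<comment> \<open>The colon ideals (J : x^n). If no power of x lies in J, then y = j + r x^n at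
      the index where they stabilise; x y in J puts r into (J : x^(n+1)), hence r x^n and y into
      J.\<close>
    define Q where "Q n = {r \<in> carrier R. r \<otimes> x [^] (n::nat) \<in> J}" for n
    have Qi: "ideal (Q n) R" for n
    proof (rule idealI_cring)
      show "a \<oplus> b \<in> Q n" if "a \<in> Q n" "b \<in> Q n" for a b
        using that xc ideal_a_closed[OF J(1)] by (auto simp: Q_def l_distr)
      show "r \<otimes> a \<in> Q n" if "r \<in> carrier R" "a \<in> Q n" for r a
        using that xc ideal.I_l_closed[OF J(1)] by (auto simp: Q_def m_assoc)
    qed (use xc ideal_zero_closed[OF J(1)] in \<open>auto simp: Q_def\<close>)
    have Qs: "Q n \<subseteq> Q (Suc n)" for n
    proof
      fix r assume r: "r \<in> Q n"
      then have "x \<otimes> (r \<otimes> x [^] n) \<in> J" using ideal.I_l_closed[OF J(1) _ xc] by (simp add: Q_def)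
      then show "r \<in> Q (Suc n)" using r xc by (simp add: Q_def m_ac)
    qed
    have Qinc: "Q a \<subseteq> Q b" if "a \<le> b" for a b using lift_Suc_mono_le[of Q a b] that Qs by blast
    obtain n where n: "Q n = Q (Suc n)"
    proof -
      have "\<exists>J\<in>range Q. \<forall>J'\<in>range Q. J \<subseteq> J' \<longrightarrow> J' = J"
        using Qi by (intro noetherian_ring.noetherian_maximal[OF noeth]) auto
      then obtain J' n where n: "J' = Q n" and max': "\<forall>J''\<in>range Q. J' \<subseteq> J'' \<longrightarrow> J'' = J'" by blast
      have "Q n = Q (Suc n)" using max' Qs[of n] n by blast
      then show ?thesis by (rule that)
    qed
    have xn: "x [^] n \<in> carrier R" using xc by simp
    show ?thesis
    proof (rule ccontr)
      assume no: "\<nexists>n. x [^] (n::nat) \<in> J"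
      have "y \<in> adjoin R J (x [^] n)"
        using max[OF adjoin_ideal(1)[OF J(1) xn] _ adjoin_ideal(2)[OF J(1) xn]] adjoin_ideal(3)[OF J(1) xn] no by blast
      then obtain j r where jr: "j \<in> J" "r \<in> carrier R" "y = j \<oplus> r \<otimes> x [^] n" by (auto simp: adjoin_def)
      have "x \<otimes> y \<ominus> x \<otimes> j \<in> J" using my[OF x] ideal.I_l_closed[OF J(1) jr(1) xc] ideal_minus_closed[OF J(1)] by blast
      moreover have "x \<otimes> y \<ominus> x \<otimes> j = r \<otimes> (x [^] n \<otimes> x)"
        unfolding jr(3) using xc xn jr(2) Jc[OF jr(1)] by algebra
      ultimately have "r \<in> Q (Suc n)" using jr(2) by (simp add: Q_def)
      then have "r \<in> Q n" using n by simp
      then have "r \<otimes> x [^] n \<in> J" by (simp add: Q_def)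
      then show False using jr J(2) ideal_a_closed[OF J(1)] by blast
    qed
  qed
  \<comment> \<open>Passes from powers of single elements to a power of m without choosing
    generators: a maximal member of S cannot omit any element of m.\<close>
  define S where "S = {K. ideal K R \<and> K \<subseteq> m \<and> (\<exists>N. ideal_pow R K N \<subseteq> J)}"
  have "{\<zero>} \<in> S"
  proof -
    have "ideal_pow R {\<zero>} 1 \<subseteq> J" unfolding ideal_pow_1[OF zeroideal] using ideal_zero_closed[OF J(1)] by simp
    then show ?thesis using zeroideal ideal_zero_closed[OF m_ideal] unfolding S_def by blast
  qed
  then have "\<exists>K\<in>S. \<forall>K'\<in>S. K \<subseteq> K' \<longrightarrow> K' = K"
    by (intro noetherian_ring.noetherian_maximal[OF noeth]) (auto simp: S_def)
  then obtain K where K: "K \<in> S" and Kmax: "\<forall>K'\<in>S. K \<subseteq> K' \<longrightarrow> K' = K" by blast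
  have Ki: "ideal K R" and Km: "K \<subseteq> m" using K by (auto simp: S_def)
  obtain N where N: "ideal_pow R K N \<subseteq> J" using K by (auto simp: S_def)
  have "m \<subseteq> K"
  proof
    fix x assume x: "x \<in> m"
    have xc: "x \<in> carrier R" using x ideal.Icarr[OF m_ideal] by blast
    obtain n where n: "x [^] (n::nat) \<in> J" using pow[OF x] by blast
    let ?K' = "adjoin R K x"
    note K' = adjoin_ideal[OF Ki xc]
    have Kc: "u \<in> carrier R" if "u \<in> K" for u using ideal.Icarr[OF Ki that] .
    \<comment> \<open>Expanding a product of i factors, every term except the multiple of x^i
      contains a factor from K.\<close>
    have 1: "ideal_pow R ?K' i \<subseteq> adjoin R K (x [^] i)" for i :: nat
    proof (induction i)
      case 0
      have "r \<in> adjoin R K \<one>" if "r \<in> carrier R" for r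
        using adjoinI[OF ideal_zero_closed[OF Ki] that, of "\<one>"] that by simp
      then show ?case unfolding ideal_pow_0 nat_pow_0 by blast
    next
      case (Suc i)
      have xi: "x [^] i \<in> carrier R" "x [^] Suc i \<in> carrier R" using xc by auto
      show ?case
      proof (rule ideal_pow_subset[OF K'(1) adjoin_ideal(1)[OF Ki xi(2)]])
        fix u v assume "u \<in> ideal_pow R ?K' i" "v \<in> ?K'"
        then obtain a r b s where *: "a \<in> K" "r \<in> carrier R" "u = a \<oplus> r \<otimes> x [^] i" "b \<in> K" "s \<in> carrier R" "v = b \<oplus> s \<otimes> x"
          using Suc.IH by (auto simp: adjoin_def)
        note c = Kc[OF *(1)] Kc[OF *(4)]
        have "u \<otimes> v = (a \<otimes> v \<oplus> (r \<otimes> x [^] i) \<otimes> b) \<oplus> (r \<otimes> s) \<otimes> (x [^] i \<otimes> x)"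
          unfolding *(3) *(6) using * c xc xi by algebra
        moreover have "a \<otimes> v \<oplus> (r \<otimes> x [^] i) \<otimes> b \<in> K"
          using * c xc xi by (intro ideal_a_closed[OF Ki] ideal.I_l_closed[OF Ki] ideal.I_r_closed[OF Ki]) auto
        ultimately show "u \<otimes> v \<in> adjoin R K (x [^] Suc i)" using adjoinI[of _ K "r \<otimes> s"] * by simp
      qed
    qed
    \<comment> \<open>As x^n lies in J, an element of the n-th power of K + R x belongs to K up to
      J; hence the i-th powers agree up to J, and i = N lands in J.\<close>
    have 2: "\<exists>v\<in>ideal_pow R K i. u \<ominus> v \<in> J" if "u \<in> ideal_pow R (ideal_pow R ?K' n) i" for i u
      using that
    proof (induction i arbitrary: u)
      case 0
      then have "u \<in> carrier R" unfolding ideal_pow_0 .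
      then show ?case unfolding ideal_pow_0 using ideal_zero_closed[OF J(1)] diff_self by metis
    next
      case (Suc i)
      from Suc.prems have "u \<in> ideal_prod R (ideal_pow R (ideal_pow R ?K' n) i) (ideal_pow R ?K' n)"
        unfolding ideal_pow_Suc .
      then show ?case
      proof (induction rule: ideal_prod.induct)
        case (prod a b)
        obtain a' where a': "a' \<in> ideal_pow R K i" "a \<ominus> a' \<in> J" using Suc.IH[OF prod(1)] by blast
        obtain b' r where b': "b' \<in> K" "r \<in> carrier R" "b = b' \<oplus> r \<otimes> x [^] n"
          using 1[of n] prod(2) by (auto simp: adjoin_def)
        have c: "a \<in> carrier R" "a' \<in> carrier R" "b' \<in> carrier R" "x [^] n \<in> carrier R"
          using ideal.Icarr[OF ideal_pow_ideal[OF ideal_pow_ideal[OF K'(1)]] prod(1)]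
            ideal.Icarr[OF ideal_pow_ideal[OF Ki] a'(1)] Kc[OF b'(1)] xc by auto
        have "a \<otimes> b \<ominus> a' \<otimes> b' = b' \<otimes> (a \<ominus> a') \<oplus> (a \<otimes> r) \<otimes> x [^] n"
          unfolding b'(3) using c b'(2) by algebra
        moreover have "\<dots> \<in> J"
          using c b'(2) a'(2) n by (intro ideal_a_closed[OF J(1)] ideal.I_l_closed[OF J(1)]) auto
        moreover have "a' \<otimes> b' \<in> ideal_pow R K (Suc i)" unfolding ideal_pow_Suc using ideal_prod.prod[OF a'(1) b'(1)] .
        ultimately show ?case by (intro bexI[of _ "a' \<otimes> b'"]) simp_all
      next
        case (sum a b)
        then obtain a' b' where *: "a' \<in> ideal_pow R K (Suc i)" "a \<ominus> a' \<in> J" "b' \<in> ideal_pow R K (Suc i)" "b \<ominus> b' \<in> J" by blast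
        have c: "a \<in> carrier R" "b \<in> carrier R" "a' \<in> carrier R" "b' \<in> carrier R"
          using subsetD[OF ideal_prod_in_carrier[OF ideal_pow_ideal[OF ideal_pow_ideal[OF K'(1)]] ideal_pow_ideal[OF K'(1)]] sum(1)]
            subsetD[OF ideal_prod_in_carrier[OF ideal_pow_ideal[OF ideal_pow_ideal[OF K'(1)]] ideal_pow_ideal[OF K'(1)]] sum(2)]
            ideal.Icarr[OF ideal_pow_ideal[OF Ki] *(1)] ideal.Icarr[OF ideal_pow_ideal[OF Ki] *(3)] by blast+
        have "(a \<oplus> b) \<ominus> (a' \<oplus> b') = (a \<ominus> a') \<oplus> (b \<ominus> b')" using c by algebra
        then show ?case
          using ideal_a_closed[OF J(1) *(2,4)] ideal_a_closed[OF ideal_pow_ideal[OF Ki] *(1,3)]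
          by (intro bexI[of _ "a' \<oplus> b'"]) simp_all
      qed
    qed
    have "ideal_pow R ?K' (n * N) \<subseteq> J"
    proof
      fix u assume u: "u \<in> ideal_pow R ?K' (n * N)"
      have "ideal_pow R (ideal_pow R ?K' n) N = ideal_pow R ?K' (n * N)"
        using monoid.nat_pow_pow[OF comm_monoid.axioms(1)[OF ideals_set_is_comm_monoid], of ?K' n N] K'(1)
        by (simp add: ideals_set_def)
      then obtain v where v: "v \<in> ideal_pow R K N" "u \<ominus> v \<in> J" using 2[of u N] u by auto
      have c: "u \<in> carrier R" "v \<in> carrier R"
        using ideal.Icarr[OF ideal_pow_ideal[OF K'(1)] u] ideal.Icarr[OF ideal_pow_ideal[OF Ki] v(1)] by auto
      have "(u \<ominus> v) \<oplus> v = u" using c by algebra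
      moreover have "(u \<ominus> v) \<oplus> v \<in> J" using ideal_a_closed[OF J(1) v(2)] N v(1) by blast
      ultimately show "u \<in> J" by simp
    qed
    moreover have "?K' \<subseteq> m"
      using Km x by (auto simp: adjoin_def intro!: ideal_a_closed[OF m_ideal] ideal.I_l_closed[OF m_ideal])
    ultimately have "?K' \<in> S" using K'(1) unfolding S_def by blast
    then show "x \<in> K" using Kmax K'(2,3) by blast
  qed
  then have "K = m" using Km by blast
  then show False using N y[of N] J(2) by blast
qed

end

context ring_hom_cring
begin

lemma image_ideal_pow:
  assumes I: "ideal I R" and J: "ideal J S" and eq: "h ` I = J" and surj: "h ` carrier R = carrier S"
  shows "h ` ideal_pow R I n = ideal_pow S J n"
proof (induction n)
  case 0
  show ?case unfolding R.ideal_pow_0 S.ideal_pow_0 by (rule surj)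
next
  case (Suc n)
  note In = R.ideal_pow_ideal[OF I, of n]
  have Ic: "i \<in> carrier R" if "i \<in> I" for i using ideal.Icarr[OF I that] .
  have Inc: "i \<in> carrier R" if "i \<in> ideal_pow R I n" for i using ideal.Icarr[OF In that] .
  show ?case
    unfolding R.ideal_pow_Suc S.ideal_pow_Suc
  proof (intro equalityI subsetI)
    fix y assume "y \<in> h ` ideal_prod R (ideal_pow R I n) I"
    then obtain x where x: "x \<in> ideal_prod R (ideal_pow R I n) I" "y = h x" by blast
    from x(1) have "h x \<in> ideal_prod S (ideal_pow S J n) J \<and> x \<in> carrier R"
    proof (induction rule: ideal_prod.induct)
      case (prod i j)
      then have "h i \<in> ideal_pow S J n" "h j \<in> J" using Suc eq by auto
      from ideal_prod.prod[OF this, of S] show ?case using Inc[OF prod(1)] Ic[OF prod(2)] by simp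
    next
      case (sum a b)
      then show ?case using ideal_prod.sum[of "h a" S _ _ "h b"] by simp
    qed
    then show "y \<in> ideal_prod S (ideal_pow S J n) J" using x(2) by simp
  next
    fix y assume "y \<in> ideal_prod S (ideal_pow S J n) J"
    then show "y \<in> h ` ideal_prod R (ideal_pow R I n) I"
    proof (induction rule: ideal_prod.induct)
      case (prod i j)
      then obtain a b where ab: "a \<in> ideal_pow R I n" "i = h a" "b \<in> I" "j = h b" using Suc eq by (metis imageE)
      then have "i \<otimes>\<^bsub>S\<^esub> j = h (a \<otimes> b)" using Inc Ic by simp
      then show ?case using ideal_prod.prod[OF ab(1,3), of R] by blast
    next
      case (sum a b)
      then obtain u v where uv: "u \<in> ideal_prod R (ideal_pow R I n) I" "a = h u"
        "v \<in> ideal_prod R (ideal_pow R I n) I" "b = h v" by blast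
      then have "u \<in> carrier R" "v \<in> carrier R" using R.ideal_prod_in_carrier[OF In I] by auto
      then have "a \<oplus>\<^bsub>S\<^esub> b = h (u \<oplus> v)" using uv by simp
      then show ?case using ideal_prod.sum[OF uv(1,3)] by blast
    qed
  qed
qed

lemma image_ideal_pow_subset:
  assumes I: "ideal I R" and J: "ideal J S" and le: "h ` I \<subseteq> J"
  shows "h ` ideal_pow R I n \<subseteq> ideal_pow S J n"
proof (induction n)
  case 0
  show ?case unfolding R.ideal_pow_0 S.ideal_pow_0 by auto
next
  case (Suc n)
  show ?case
    unfolding R.ideal_pow_Suc
  proof
    fix y assume "y \<in> h ` ideal_prod R (ideal_pow R I n) I"
    then obtain x where x: "x \<in> ideal_prod R (ideal_pow R I n) I" "y = h x" by blast
    from x(1) have "h x \<in> ideal_pow S J (Suc n) \<and> x \<in> carrier R"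
    proof (induction rule: ideal_prod.induct)
      case (prod i j)
      then have "h i \<in> ideal_pow S J n" "h j \<in> J" using Suc le by auto
      from ideal_prod.prod[OF this, of S] show ?case
        unfolding S.ideal_pow_Suc using ideal.Icarr[OF R.ideal_pow_ideal[OF I] prod(1)] ideal.Icarr[OF I prod(2)] by simp
    next
      case (sum a b)
      then have "h (a \<oplus> b) = h a \<oplus>\<^bsub>S\<^esub> h b" "a \<oplus> b \<in> carrier R" by auto
      then show ?case
        using S.ideal_a_closed[OF S.ideal_pow_ideal[OF J] conjunct1[OF sum(3)] conjunct1[OF sum(4)]] by argo
    qed
    then show "y \<in> ideal_pow S J (Suc n)" using x(2) by simp
  qed
qed

lemma noetherian_image:
  assumes noeth: "noetherian_ring R" and surj: "h ` carrier R = carrier S"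
  shows "noetherian_ring S"
proof (rule S.noetherian_ringI)
  fix J assume J: "ideal J S"
  let ?I = "{r \<in> carrier R. h r \<in> J}"
  have I: "ideal ?I R" using ring.ideal_vimage[OF J] .
  obtain F where F: "F \<subseteq> carrier R" "finite F" "?I = Idl\<^bsub>R\<^esub> F" using noetherian_ring.finetely_gen[OF noeth I] by blast
  have FI: "F \<subseteq> ?I" using R.genideal_self[OF F(1)] F(3) by simp
  have hF: "h ` F \<subseteq> carrier S" using F(1) by auto
  have "J = Idl\<^bsub>S\<^esub> (h ` F)"
  proof
    show "Idl\<^bsub>S\<^esub> (h ` F) \<subseteq> J" using FI by (intro S.genideal_minimal J) auto
    have "ideal {r \<in> carrier R. h r \<in> Idl\<^bsub>S\<^esub> (h ` F)} R" using ring.ideal_vimage[OF S.genideal_ideal[OF hF]] .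
    then have "Idl\<^bsub>R\<^esub> F \<subseteq> {r \<in> carrier R. h r \<in> Idl\<^bsub>S\<^esub> (h ` F)}"
      using F(1) S.genideal_self[OF hF] by (intro R.genideal_minimal) auto
    then have 1: "h r \<in> Idl\<^bsub>S\<^esub> (h ` F)" if "r \<in> carrier R" "h r \<in> J" for r
      using F(3) that by blast
    show "J \<subseteq> Idl\<^bsub>S\<^esub> (h ` F)"
    proof
      fix y assume y: "y \<in> J"
      then have "y \<in> h ` carrier R" using surj ideal.Icarr[OF J] by blast
      then show "y \<in> Idl\<^bsub>S\<^esub> (h ` F)" using 1 y by blast
    qed
  qed
  then show "\<exists>A\<subseteq>carrier S. finite A \<and> J = Idl\<^bsub>S\<^esub> A" using hF F(2) by blast
qed

end

section \<open>Local \<open>W(k)\<close>-algebras\<close>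

locale coeff_field = k: field k for p :: nat and k :: "'k ring"
begin

text \<open>The witness (c, 0, 0, ...) is the Teichmueller representative.\<close>

lemma witt_lift: "c \<in> carrier k \<Longrightarrow> \<exists>w\<in>carrier (witt p k). w 0 = c"
  by (intro bexI[of _ "\<lambda>n. if n = 0 then c else \<zero>\<^bsub>k\<^esub>"]) (auto simp: witt_def)

lemma wpoly_eval_closed:
  assumes "\<And>n. x n \<in> carrier k" "\<And>n. y n \<in> carrier k"
  shows "wpoly_eval k P x y \<in> carrier k"
proof -
  have v: "case_sum x y v \<in> carrier k" for v using assms by (cases v) auto
  have pow: "[i] \<cdot>\<^bsub>k\<^esub> c \<in> carrier k" if "c \<in> carrier k" for c and i :: int
    using group.int_pow_closed[OF k.a_group, of c i] that by (simp add: add_pow_def)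
  show ?thesis
    unfolding wpoly_eval_def
    by (intro k.finsum_closed Pi_I pow k.finprod_closed k.nat_pow_closed v)
qed

lemma witt_closed:
  assumes "v \<in> carrier (witt p k)" "w \<in> carrier (witt p k)"
  shows "v \<otimes>\<^bsub>witt p k\<^esub> w \<in> carrier (witt p k)" "v \<oplus>\<^bsub>witt p k\<^esub> w \<in> carrier (witt p k)"
  using assms wpoly_eval_closed[of v w] by (simp_all add: witt_def)

lemma witt_one_closed: "\<one>\<^bsub>witt p k\<^esub> \<in> carrier (witt p k)"
  by (simp add: witt_def)

lemma mem_max_ideal: "x \<in> max_ideal k A \<longleftrightarrow> x \<in> carrier A \<and> red A x = \<zero>\<^bsub>k\<^esub>"
  by (simp add: max_ideal_def a_kernel_def')

lemma max_ideal_carrier: "max_ideal k A \<subseteq> carrier A"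
  by (rule subsetI) (simp add: mem_max_ideal)

lemma local_walg_cring:
  fixes A :: "('a, 'k) walg"
  shows "local_walg p k A \<Longrightarrow> cring A"
  by (simp add: local_walg_def)

lemma red_hom_ring:
  fixes A :: "('a, 'k) walg"
  shows "local_walg p k A \<Longrightarrow> ring_hom_cring A k (red A)"
  by (rule ring_hom_cringI2[OF local_walg_cring k.is_cring]) (simp_all add: local_walg_def)

lemma alg_closed:
  fixes A :: "('a, 'k) walg"
  assumes "local_walg p k A" "w \<in> carrier (witt p k)"
  shows "alg A w \<in> carrier A"
  by (rule ring_hom_closed[OF _ assms(2)]) (use assms(1) in \<open>simp add: local_walg_def\<close>)

lemma max_ideal_maximal:
  fixes A :: "('a, 'k) walg"
  assumes A: "cring A" and red: "red A \<in> ring_hom A k" "red A ` carrier A = carrier k"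
  shows "maximalideal (max_ideal k A) A"
proof -
  interpret A: cring A by fact
  interpret r: ring_hom_cring A k "red A" by (rule ring_hom_cringI2[OF A k.is_cring red(1)])
  have I: "ideal (max_ideal k A) A" unfolding max_ideal_def by (rule r.ring.kernel_is_ideal)
  show ?thesis
  proof (rule maximalidealI[OF I])
    have "\<one>\<^bsub>A\<^esub> \<notin> max_ideal k A" by (simp add: mem_max_ideal)
    then show "carrier A \<noteq> max_ideal k A" using A.one_closed by blast
    fix J assume J: "ideal J A" "max_ideal k A \<subseteq> J" "J \<subseteq> carrier A"
    show "J = max_ideal k A \<or> J = carrier A"
    proof (cases "J \<subseteq> max_ideal k A")
      case False
      then obtain x where x: "x \<in> J" "x \<notin> max_ideal k A" by blast
      then have x: "x \<in> J" "x \<in> carrier A" "red A x \<noteq> \<zero>\<^bsub>k\<^esub>" using J(3) by (auto simp: mem_max_ideal)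
      then have u: "red A x \<in> Units k" using k.field_Units by auto
      then obtain y where y: "y \<in> carrier A" "red A y = inv\<^bsub>k\<^esub> (red A x)"
        using red(2) by (metis imageE k.Units_inv_closed)
      have "x \<otimes>\<^bsub>A\<^esub> y \<ominus>\<^bsub>A\<^esub> \<one>\<^bsub>A\<^esub> \<in> max_ideal k A"
        using x y u by (simp add: mem_max_ideal A.minus_eq k.r_neg)
      then have "x \<otimes>\<^bsub>A\<^esub> y \<ominus>\<^bsub>A\<^esub> (x \<otimes>\<^bsub>A\<^esub> y \<ominus>\<^bsub>A\<^esub> \<one>\<^bsub>A\<^esub>) \<in> J"
        using J(2) ideal.I_r_closed[OF J(1) x(1) y(1)] A.ideal_minus_closed[OF J(1)] by blast
      moreover have "x \<otimes>\<^bsub>A\<^esub> y \<ominus>\<^bsub>A\<^esub> (x \<otimes>\<^bsub>A\<^esub> y \<ominus>\<^bsub>A\<^esub> \<one>\<^bsub>A\<^esub>) = \<one>\<^bsub>A\<^esub>"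
        using x(2) y(1) A.one_closed A.m_closed[OF x(2) y(1)] by algebra
      ultimately show ?thesis using A.one_in_ideal[OF J(1)] by simp
    qed (use J in blast)
  qed
qed

lemma local_walg_local_cring:
  fixes A :: "('a, 'k) walg"
  assumes A: "local_walg p k A"
  shows "local_cring A (max_ideal k A)"
proof -
  interpret A: cring A using A by (simp add: local_walg_def)
  interpret r: ring_hom_cring A k "red A" by (rule red_hom_ring[OF A])
  have max: "maximalideal (max_ideal k A) A"
    by (rule max_ideal_maximal[OF local_walg_cring[OF A]]) (use A in \<open>simp_all add: local_walg_def\<close>)
  show ?thesis
  proof (intro local_cring.intro local_cring_axioms.intro A.is_cring)
    show "ideal (max_ideal k A) A" using max by (rule maximalideal.axioms)
    show "\<one>\<^bsub>A\<^esub> \<notin> max_ideal k A" by (simp add: mem_max_ideal)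
    fix x assume x: "x \<in> carrier A" "x \<notin> max_ideal k A"
    show "x \<in> Units A"
    proof (rule ccontr)
      assume "x \<notin> Units A"
      then obtain M where "maximalideal M A" "x \<in> M" using A.nonunit_maximalideal[OF x(1)] by blast
      moreover have "\<exists>!M. maximalideal M A" using A by (simp add: local_walg_def)
      ultimately show False using max x(2) by blast
    qed
  qed
qed

lemma local_walgI:
  fixes A :: "('a, 'k) walg"
  assumes A: "cring A" and red: "red A \<in> ring_hom A k" "red A ` carrier A = carrier k"
    and alg: "alg A \<in> ring_hom (witt p k) A" "\<And>w. w \<in> carrier (witt p k) \<Longrightarrow> red A (alg A w) = w 0"
    and unit: "\<And>x. x \<in> carrier A \<Longrightarrow> red A x \<noteq> \<zero>\<^bsub>k\<^esub> \<Longrightarrow> x \<in> Units A"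
  shows "local_walg p k A"
proof -
  interpret A: cring A by fact
  have max: "maximalideal (max_ideal k A) A" by (rule max_ideal_maximal[OF A red])
  have "M = max_ideal k A" if M: "maximalideal M A" for M
  proof -
    interpret M: maximalideal M A by fact
    have "M \<subseteq> max_ideal k A"
    proof
      fix x assume x: "x \<in> M"
      then have "x \<notin> Units A" using A.unit_in_ideal[OF M.is_ideal _ x] M.I_notcarr by auto
      then show "x \<in> max_ideal k A" using unit M.Icarr[OF x] by (auto simp: mem_max_ideal)
    qed
    then have "max_ideal k A = M \<or> max_ideal k A = carrier A"
      by (rule M.I_maximal[OF maximalideal.axioms(1)[OF max] _ max_ideal_carrier])
    then show ?thesis using maximalideal.I_notcarr[OF max] by auto
  qed
  then have "\<exists>!M. maximalideal M A" using max by blast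
  then show ?thesis using A red alg by (simp add: local_walg_def)
qed

text \<open>Transport of structure along a surjection compatible with scalars and residues. It
  serves the quotient on representatives, the quotient by cosets, and the dual numbers.\<close>

lemma local_walg_image:
  fixes R :: "('a, 'k) walg" and B :: "('b, 'k) walg"
  assumes R: "local_walg p k R" and \<delta>: "\<delta> \<in> ring_hom R B" "\<delta> ` carrier R = carrier B" "\<delta> \<zero>\<^bsub>R\<^esub> = \<zero>\<^bsub>B\<^esub>"
    and alg: "\<And>w. w \<in> carrier (witt p k) \<Longrightarrow> alg B w = \<delta> (alg R w)"
    and red: "\<And>x. x \<in> carrier R \<Longrightarrow> red B (\<delta> x) = red R x"
  shows "local_walg p k B"
proof -
  interpret R: local_cring R "max_ideal k R" by (rule local_walg_local_cring[OF R])
  interpret r: ring_hom_cring R k "red R" by (rule red_hom_ring[OF R])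
  have inv: "\<exists>x\<in>carrier R. y = \<delta> x" if "y \<in> carrier B" for y using that \<delta>(2) by blast
  have hom: "\<delta> (x \<otimes>\<^bsub>R\<^esub> y) = \<delta> x \<otimes>\<^bsub>B\<^esub> \<delta> y" "\<delta> (x \<oplus>\<^bsub>R\<^esub> y) = \<delta> x \<oplus>\<^bsub>B\<^esub> \<delta> y"
    if "x \<in> carrier R" "y \<in> carrier R" for x y
    using ring_hom_mult[OF \<delta>(1) that] ring_hom_add[OF \<delta>(1) that] .
  have "B\<lparr>carrier := \<delta> ` carrier R, zero := \<delta> \<zero>\<^bsub>R\<^esub>\<rparr> = B" using \<delta>(2,3) by simp
  then have ringB: "ring B" using R.ring_hom_imp_img_ring[OF \<delta>(1)] by simp
  have comm: "a \<otimes>\<^bsub>B\<^esub> b = b \<otimes>\<^bsub>B\<^esub> a" if ab: "a \<in> carrier B" "b \<in> carrier B" for a b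
  proof -
    obtain x y where "x \<in> carrier R" "a = \<delta> x" "y \<in> carrier R" "b = \<delta> y" using inv[OF ab(1)] inv[OF ab(2)] by blast
    then show ?thesis using hom(1)[of x y] hom(1)[of y x] R.m_comm[of x y] by simp
  qed
  have cringB: "cring B"
    using ringB comm by (simp add: cring_def monoid.monoid_comm_monoidI ring.axioms(2))
  have algR: "alg R \<in> ring_hom (witt p k) R" using R by (simp add: local_walg_def)
  show ?thesis
  proof (rule local_walgI[OF cringB])
    show "red B \<in> ring_hom B k"
    proof (rule ring_hom_memI)
      fix a b assume ab: "a \<in> carrier B" "b \<in> carrier B"
      obtain x y where xy: "x \<in> carrier R" "a = \<delta> x" "y \<in> carrier R" "b = \<delta> y" using inv[OF ab(1)] inv[OF ab(2)] by blast
      show "red B a \<in> carrier k" using xy red by simp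
      show "red B (a \<otimes>\<^bsub>B\<^esub> b) = red B a \<otimes>\<^bsub>k\<^esub> red B b" "red B (a \<oplus>\<^bsub>B\<^esub> b) = red B a \<oplus>\<^bsub>k\<^esub> red B b"
        using xy hom[OF xy(1,3)] red[of "x \<otimes>\<^bsub>R\<^esub> y"] red[of "x \<oplus>\<^bsub>R\<^esub> y"] red[of x] red[of y] by simp_all
    qed (use red[of "\<one>\<^bsub>R\<^esub>"] ring_hom_one[OF \<delta>(1)] in simp)
    have "red B ` carrier B = (\<lambda>x. red B (\<delta> x)) ` carrier R" using \<delta>(2) by (metis image_image)
    also have "\<dots> = red R ` carrier R" using red by auto
    finally show "red B ` carrier B = carrier k" using R by (simp add: local_walg_def)
    have "\<delta> \<circ> alg R \<in> ring_hom (witt p k) B" by (rule ring_hom_trans[OF algR \<delta>(1)])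
    then show "alg B \<in> ring_hom (witt p k) B"
      unfolding ring_hom_def using alg witt_closed witt_one_closed by (simp add: Pi_iff)
    show "red B (alg B w) = w 0" if "w \<in> carrier (witt p k)" for w
      using alg[OF that] red[OF alg_closed[OF R that]] R that by (simp add: local_walg_def)
    fix a assume a: "a \<in> carrier B" "red B a \<noteq> \<zero>\<^bsub>k\<^esub>"
    obtain x where x: "x \<in> carrier R" "a = \<delta> x" using inv[OF a(1)] by blast
    then have u: "x \<in> Units R" using R.m_unit[of x] a(2) red by (simp add: mem_max_ideal)
    have "a \<otimes>\<^bsub>B\<^esub> \<delta> (inv\<^bsub>R\<^esub> x) = \<one>\<^bsub>B\<^esub>"
      using u x hom(1)[of x "inv\<^bsub>R\<^esub> x"] ring_hom_one[OF \<delta>(1)] by simp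
    moreover have c: "\<delta> (inv\<^bsub>R\<^esub> x) \<in> carrier B" using u \<delta>(2) by blast
    ultimately show "a \<in> Units B" using a(1) comm[OF a(1) c] by (auto simp: Units_def)
  qed
qed

text \<open>W(k) surjects onto k, so x differs from a scalar by an element of the maximal ideal, and
  f respects both scalars and maximal ideals.\<close>

lemma walg_hom_red:
  fixes A :: "('a, 'k) walg" and B :: "('b, 'k) walg"
  assumes A: "local_walg p k A" and B: "local_walg p k B"
    and f: "f \<in> ring_hom A B" "\<And>w. w \<in> carrier (witt p k) \<Longrightarrow> f (alg A w) = alg B w"
      "f ` max_ideal k A \<subseteq> max_ideal k B"
    and x: "x \<in> carrier A"
  shows "red B (f x) = red A x"
proof -
  interpret A: cring A using A by (simp add: local_walg_def)
  interpret B: cring B using B by (simp add: local_walg_def)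
  interpret rA: ring_hom_cring A k "red A" by (rule red_hom_ring[OF A])
  interpret rB: ring_hom_cring B k "red B" by (rule red_hom_ring[OF B])
  interpret f: ring_hom_cring A B f by (rule ring_hom_cringI2[OF A.is_cring B.is_cring f(1)])
  obtain w where w: "w \<in> carrier (witt p k)" "w 0 = red A x" using witt_lift[of "red A x"] x by auto
  have a: "alg A w \<in> carrier A" "red A (alg A w) = w 0" "red B (alg B w) = w 0" "alg B w \<in> carrier B"
    using alg_closed[OF A w(1)] alg_closed[OF B w(1)] A B w(1) by (simp_all add: local_walg_def)
  have "x \<ominus>\<^bsub>A\<^esub> alg A w \<in> max_ideal k A"
    using x a w(2) by (simp add: mem_max_ideal A.minus_eq k.r_neg)
  then have "f (x \<ominus>\<^bsub>A\<^esub> alg A w) \<in> max_ideal k B" using f(3) by blast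
  then have "red B (f x) \<ominus>\<^bsub>k\<^esub> red A x = \<zero>\<^bsub>k\<^esub>"
    using x a w f(2)[OF w(1)] by (simp add: mem_max_ideal A.minus_eq k.minus_eq)
  then show ?thesis using x k.r_right_minus_eq by auto
qed

lemma walg_homI:
  fixes A :: "('a, 'k) walg" and B :: "('b, 'k) walg"
  assumes "f \<in> extensional (carrier A)" "f \<in> ring_hom A B"
    "\<And>w. w \<in> carrier (witt p k) \<Longrightarrow> f (alg A w) = alg B w"
    "\<And>x. x \<in> carrier A \<Longrightarrow> red B (f x) = red A x"
  shows "f \<in> walg_hom p k A B"
proof -
  have "f x \<in> max_ideal k B" if "x \<in> max_ideal k A" for x
    using that assms(4)[of x] ring_hom_closed[OF assms(2), of x] by (simp add: mem_max_ideal)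
  then show ?thesis using assms(1-3) by (auto simp: walg_hom_def)
qed

lemma walg_homD:
  fixes A :: "('a, 'k) walg" and B :: "('b, 'k) walg"
  assumes A: "local_walg p k A" and B: "local_walg p k B" and f: "f \<in> walg_hom p k A B"
  shows "f \<in> extensional (carrier A)" "f \<in> ring_hom A B"
    "\<And>w. w \<in> carrier (witt p k) \<Longrightarrow> f (alg A w) = alg B w"
    "\<And>x. x \<in> carrier A \<Longrightarrow> red B (f x) = red A x"
    "\<And>x. x \<in> carrier A \<Longrightarrow> f x \<in> carrier B"
    "ring_hom_cring A B f"
proof -
  have f': "f \<in> extensional (carrier A)" "f \<in> ring_hom A B" "f ` max_ideal k A \<subseteq> max_ideal k B"
    and alg: "\<And>w. w \<in> carrier (witt p k) \<Longrightarrow> f (alg A w) = alg B w"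
    using f unfolding walg_hom_def by blast+
  show "f \<in> extensional (carrier A)" "f \<in> ring_hom A B" by (fact f')+
  show "f (alg A w) = alg B w" if "w \<in> carrier (witt p k)" for w by (rule alg[OF that])
  show "red B (f x) = red A x" if "x \<in> carrier A" for x
    by (rule walg_hom_red[OF A B f'(2) alg f'(3) that])
  show "f x \<in> carrier B" if "x \<in> carrier A" for x by (rule ring_hom_closed[OF f'(2) that])
  show "ring_hom_cring A B f" by (rule ring_hom_cringI2[OF local_walg_cring[OF A] local_walg_cring[OF B] f'(2)])
qed

lemma walg_hom_eqI:
  fixes A :: "('a, 'k) walg" and B :: "('b, 'k) walg"
  assumes "f \<in> walg_hom p k A B" "g \<in> walg_hom p k A B" "\<And>x. x \<in> carrier A \<Longrightarrow> f x = g x"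
  shows "f = g"
proof (rule extensionalityI)
  show "f \<in> extensional (carrier A)" "g \<in> extensional (carrier A)" using assms(1,2) by (simp_all add: walg_hom_def)
qed (rule assms(3))

lemma walg_hom_compose:
  fixes A :: "('a, 'k) walg" and B :: "('b, 'k) walg" and D :: "('c, 'k) walg"
  assumes A: "local_walg p k A" and B: "local_walg p k B" and D: "local_walg p k D"
    and f: "f \<in> walg_hom p k A B" and g: "g \<in> walg_hom p k B D"
  shows "compose (carrier A) g f \<in> walg_hom p k A D"
proof (rule walg_homI)
  note f = walg_homD[OF A B f] and g = walg_homD[OF B D g]
  have "g \<circ> f \<in> ring_hom A D" by (rule ring_hom_trans[OF f(2) g(2)])
  moreover have "ring A" using A by (simp add: local_walg_def cring.axioms)
  ultimately show "compose (carrier A) g f \<in> ring_hom A D"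
    by (rule_tac ring.ring_hom_restrict[of A "g \<circ> f"]) (auto simp: compose_def)
  show "compose (carrier A) g f \<in> extensional (carrier A)" by (simp add: compose_def)
  show "compose (carrier A) g f (alg A w) = alg D w" if "w \<in> carrier (witt p k)" for w
    using f(3)[OF that] g(3)[OF that] alg_closed[OF A that] by (simp add: compose_eq)
  show "red D (compose (carrier A) g f x) = red A x" if "x \<in> carrier A" for x
    using f(4)[OF that] g(4)[OF f(5)[OF that]] that by (simp add: compose_eq)
qed

lemma walg_hom_id:
  fixes A :: "('a, 'k) walg"
  assumes A: "local_walg p k A"
  shows "(\<lambda>x\<in>carrier A. x) \<in> walg_hom p k A A"
proof (rule walg_homI)
  have "ring A" using A by (simp add: local_walg_def cring.axioms)
  then show "(\<lambda>x\<in>carrier A. x) \<in> ring_hom A A"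
    by (rule ring.ring_hom_restrict[of A id]) auto
qed (use alg_closed[OF A] in auto)

lemma walg_iso_inv:
  fixes A :: "('a, 'k) walg" and B :: "('b, 'k) walg"
  assumes A: "local_walg p k A" and B: "local_walg p k B" and f: "f \<in> walg_iso p k A B"
  shows "(\<lambda>y\<in>carrier B. inv_into (carrier A) f y) \<in> walg_iso p k B A"
proof -
  have fh: "f \<in> walg_hom p k A B" and bij: "bij_betw f (carrier A) (carrier B)" using f by (auto simp: walg_iso_def)
  note fD = walg_homD[OF A B fh]
  let ?g = "\<lambda>y\<in>carrier B. inv_into (carrier A) f y"
  have rA: "ring A" and rB: "ring B" using A B by (auto simp: local_walg_def cring.axioms)
  have gf: "inv_into (carrier A) f (f x) = x" if "x \<in> carrier A" for x
    using bij that by (simp add: bij_betw_def inv_into_f_f)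
  have fg: "f (inv_into (carrier A) f y) = y" "inv_into (carrier A) f y \<in> carrier A" if "y \<in> carrier B" for y
    using bij that by (auto simp: bij_betw_def f_inv_into_f inv_into_into)
  have "inv_into (carrier A) f \<in> ring_iso B A"
    using ring_iso_set_sym[OF rA, of f B] fD(2) bij by (simp add: ring_iso_def)
  then have "inv_into (carrier A) f \<in> ring_hom B A" by (simp add: ring_iso_def)
  then have "?g \<in> ring_hom B A" by (rule ring.ring_hom_restrict[OF rB]) simp
  moreover have "?g (alg B w) = alg A w" if "w \<in> carrier (witt p k)" for w
    using gf[OF alg_closed[OF A that]] fD(3)[OF that] alg_closed[OF B that] by simp
  moreover have "red A (?g y) = red B y" if "y \<in> carrier B" for y
    using fD(4)[OF fg(2)[OF that]] fg(1)[OF that] that by simp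
  ultimately have "?g \<in> walg_hom p k B A" by (intro walg_homI) auto
  moreover have "bij_betw ?g (carrier B) (carrier A)"
    using bij_betw_inv_into[OF bij] bij_betw_cong[of "carrier B" ?g "inv_into (carrier A) f" "carrier A"] by simp
  ultimately show ?thesis by (simp add: walg_iso_def)
qed

text \<open>Unlike \<^const>\<open>quot_walg\<close>, the quotient is taken in the type of \<open>R\<close>, as representability
  only concerns algebras over that type.\<close>

definition walg_quotient :: "('a, 'k) walg \<Rightarrow> 'a set \<Rightarrow> ('a, 'k) walg \<Rightarrow> ('a \<Rightarrow> 'a) \<Rightarrow> bool" where
  "walg_quotient R I A \<pi> \<longleftrightarrow> local_walg p k A \<and> \<pi> \<in> walg_hom p k R A \<and> \<pi> ` carrier R = carrier A \<and>
     (\<forall>x\<in>carrier R. \<pi> x = \<zero>\<^bsub>A\<^esub> \<longleftrightarrow> x \<in> I)"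

lemma walg_quotient_ex:
  fixes R :: "('a, 'k) walg"
  assumes R: "local_walg p k R" and I: "ideal I R" "I \<subseteq> max_ideal k R"
  shows "\<exists>A \<pi>. walg_quotient R I A \<pi>"
proof -
  interpret R: local_cring R "max_ideal k R" by (rule local_walg_local_cring[OF R])
  interpret r: ring_hom_cring R k "red R" by (rule red_hom_ring[OF R])
  interpret I: ideal I R by (rule I(1))
  \<comment> \<open>The predicate behind the choice depends only on the coset of x, so \<pi> is
    constant on cosets and its image is a set of representatives inside R. This set carries the
    quotient structure.\<close>
  define \<pi> where "\<pi> x = (SOME y. y \<in> carrier R \<and> y \<ominus>\<^bsub>R\<^esub> x \<in> I)" for x
  have \<pi>: "\<pi> x \<in> carrier R" "\<pi> x \<ominus>\<^bsub>R\<^esub> x \<in> I" if "x \<in> carrier R" for x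
  proof -
    have "x \<in> carrier R \<and> x \<ominus>\<^bsub>R\<^esub> x \<in> I" using that R.ideal_zero_closed[OF I(1)] by (simp add: R.diff_self)
    then have "\<pi> x \<in> carrier R \<and> \<pi> x \<ominus>\<^bsub>R\<^esub> x \<in> I"
      unfolding \<pi>_def by (rule someI[of "\<lambda>y. y \<in> carrier R \<and> y \<ominus>\<^bsub>R\<^esub> x \<in> I"])
    then show "\<pi> x \<in> carrier R" "\<pi> x \<ominus>\<^bsub>R\<^esub> x \<in> I" by auto
  qed
  have sym: "x \<ominus>\<^bsub>R\<^esub> y \<in> I" if "x \<in> carrier R" "y \<in> carrier R" "y \<ominus>\<^bsub>R\<^esub> x \<in> I" for x y
  proof -
    have "\<ominus>\<^bsub>R\<^esub> (y \<ominus>\<^bsub>R\<^esub> x) = x \<ominus>\<^bsub>R\<^esub> y" using that by algebra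
    then show ?thesis using R.ideal_a_inv_closed[OF I(1) that(3)] by simp
  qed
  have trans: "x \<ominus>\<^bsub>R\<^esub> z \<in> I" if "x \<in> carrier R" "y \<in> carrier R" "z \<in> carrier R" "x \<ominus>\<^bsub>R\<^esub> y \<in> I" "y \<ominus>\<^bsub>R\<^esub> z \<in> I" for x y z
    using R.ideal_a_closed[OF I(1) that(4,5)] R.diff_add_diff[OF that(1-3)] by simp
  have eq_iff: "\<pi> x = \<pi> y \<longleftrightarrow> x \<ominus>\<^bsub>R\<^esub> y \<in> I" if "x \<in> carrier R" "y \<in> carrier R" for x y
  proof
    assume "\<pi> x = \<pi> y"
    then show "x \<ominus>\<^bsub>R\<^esub> y \<in> I" using trans[OF that(1) \<pi>(1)[OF that(1)] that(2)] sym[OF that(1) \<pi>(1,2)[OF that(1)]] \<pi>(2)[OF that(2)] by simp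
  next
    assume xy: "x \<ominus>\<^bsub>R\<^esub> y \<in> I"
    have "(z \<ominus>\<^bsub>R\<^esub> x \<in> I) = (z \<ominus>\<^bsub>R\<^esub> y \<in> I)" if "z \<in> carrier R" for z
      using trans[OF that _ _ _ xy] trans[OF that _ _ _ sym] xy \<open>x \<in> carrier R\<close> \<open>y \<in> carrier R\<close> by blast
    then have "(\<lambda>z. z \<in> carrier R \<and> z \<ominus>\<^bsub>R\<^esub> x \<in> I) = (\<lambda>z. z \<in> carrier R \<and> z \<ominus>\<^bsub>R\<^esub> y \<in> I)" by blast
    then show "\<pi> x = \<pi> y" unfolding \<pi>_def by simp
  qed
  have \<pi>\<pi>: "\<pi> (\<pi> x) = \<pi> x" if "x \<in> carrier R" for x using eq_iff[OF \<pi>(1)[OF that] that] \<pi>(2)[OF that] by simp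
  have add: "\<pi> (\<pi> x \<oplus>\<^bsub>R\<^esub> \<pi> y) = \<pi> (x \<oplus>\<^bsub>R\<^esub> y)" if "x \<in> carrier R" "y \<in> carrier R" for x y
  proof -
    note c = that \<pi>(1)[OF that(1)] \<pi>(1)[OF that(2)]
    have "(\<pi> x \<oplus>\<^bsub>R\<^esub> \<pi> y) \<ominus>\<^bsub>R\<^esub> (x \<oplus>\<^bsub>R\<^esub> y) = (\<pi> x \<ominus>\<^bsub>R\<^esub> x) \<oplus>\<^bsub>R\<^esub> (\<pi> y \<ominus>\<^bsub>R\<^esub> y)" using c by algebra
    then show ?thesis using eq_iff c \<pi>(2) that R.ideal_a_closed[OF I(1)] by simp
  qed
  have mult: "\<pi> (\<pi> x \<otimes>\<^bsub>R\<^esub> \<pi> y) = \<pi> (x \<otimes>\<^bsub>R\<^esub> y)" if "x \<in> carrier R" "y \<in> carrier R" for x y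
  proof -
    note c = that \<pi>(1)[OF that(1)] \<pi>(1)[OF that(2)]
    have "(\<pi> x \<otimes>\<^bsub>R\<^esub> \<pi> y) \<ominus>\<^bsub>R\<^esub> (x \<otimes>\<^bsub>R\<^esub> y) = \<pi> y \<otimes>\<^bsub>R\<^esub> (\<pi> x \<ominus>\<^bsub>R\<^esub> x) \<oplus>\<^bsub>R\<^esub> x \<otimes>\<^bsub>R\<^esub> (\<pi> y \<ominus>\<^bsub>R\<^esub> y)" using c by algebra
    moreover have "\<dots> \<in> I" using R.ideal_a_closed[OF I(1)] I.I_l_closed \<pi>(2) c that by simp
    ultimately show ?thesis using eq_iff c by simp
  qed
  have redI: "red R x = \<zero>\<^bsub>k\<^esub>" if "x \<in> I" for x using that I(2) by (auto simp: mem_max_ideal)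
  have red: "red R (\<pi> x) = red R x" if "x \<in> carrier R" for x
  proof -
    have "red R (\<pi> x) \<ominus>\<^bsub>k\<^esub> red R x = \<zero>\<^bsub>k\<^esub>"
      using redI[OF \<pi>(2)[OF that]] that \<pi>(1)[OF that] by (simp add: R.minus_eq k.minus_eq)
    then show ?thesis using that \<pi>(1)[OF that] k.r_right_minus_eq by auto
  qed
  define A :: "('a, 'k) walg" where
    "A = \<lparr>carrier = \<pi> ` carrier R, monoid.mult = (\<lambda>a b. \<pi> (a \<otimes>\<^bsub>R\<^esub> b)), monoid.one = \<pi> \<one>\<^bsub>R\<^esub>, ring.zero = \<pi> \<zero>\<^bsub>R\<^esub>,
      ring.add = (\<lambda>a b. \<pi> (a \<oplus>\<^bsub>R\<^esub> b)), alg = (\<lambda>w. \<pi> (alg R w)), red = red R\<rparr>"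
  have A_simps: "carrier A = \<pi> ` carrier R" "\<And>a b. a \<otimes>\<^bsub>A\<^esub> b = \<pi> (a \<otimes>\<^bsub>R\<^esub> b)" "\<one>\<^bsub>A\<^esub> = \<pi> \<one>\<^bsub>R\<^esub>" "\<zero>\<^bsub>A\<^esub> = \<pi> \<zero>\<^bsub>R\<^esub>"
    "\<And>a b. a \<oplus>\<^bsub>A\<^esub> b = \<pi> (a \<oplus>\<^bsub>R\<^esub> b)" "\<And>w. alg A w = \<pi> (alg R w)" "red A = red R"
    by (simp_all add: A_def)
  have \<pi>_hom: "\<pi> \<in> ring_hom R A" by (rule ring_hom_memI) (auto simp: A_simps add mult)
  have "local_walg p k A"
    by (rule local_walg_image[OF R \<pi>_hom]) (simp_all add: A_simps red)
  moreover have "restrict \<pi> (carrier R) \<in> walg_hom p k R A"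
  proof (rule walg_homI)
    show "restrict \<pi> (carrier R) \<in> ring_hom R A" by (rule R.ring_hom_restrict[OF \<pi>_hom]) simp
  qed (use red alg_closed[OF R] in \<open>auto simp: A_simps\<close>)
  moreover have "\<pi> x = \<zero>\<^bsub>A\<^esub> \<longleftrightarrow> x \<in> I" if "x \<in> carrier R" for x
    using eq_iff[OF that R.zero_closed] that by (simp add: A_simps R.minus_eq)
  ultimately have "walg_quotient R I A (restrict \<pi> (carrier R))"
    by (auto simp: walg_quotient_def A_simps)
  then show ?thesis by blast
qed

lemma walg_quotientD:
  assumes R: "local_walg p k R" and q: "walg_quotient R I A \<pi>"
  shows "local_walg p k A" "\<pi> \<in> walg_hom p k R A" "\<And>x. x \<in> carrier R \<Longrightarrow> \<pi> x \<in> carrier A"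
    "\<And>y. y \<in> carrier A \<Longrightarrow> \<exists>x\<in>carrier R. y = \<pi> x" "\<And>x. x \<in> carrier R \<Longrightarrow> \<pi> x = \<zero>\<^bsub>A\<^esub> \<longleftrightarrow> x \<in> I"
    "\<pi> ` carrier R = carrier A" "ring_hom_cring R A \<pi>"
proof -
  show A: "local_walg p k A" and \<pi>: "\<pi> \<in> walg_hom p k R A" using q by (simp_all add: walg_quotient_def)
  show "\<pi> x \<in> carrier A" if "x \<in> carrier R" for x by (rule walg_homD(5)[OF R A \<pi> that])
  show "\<exists>x\<in>carrier R. y = \<pi> x" if "y \<in> carrier A" for y using q that by (auto simp: walg_quotient_def)
  show "\<pi> x = \<zero>\<^bsub>A\<^esub> \<longleftrightarrow> x \<in> I" if "x \<in> carrier R" for x using q that by (simp add: walg_quotient_def)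
  show "\<pi> ` carrier R = carrier A" using q by (simp add: walg_quotient_def)
  show "ring_hom_cring R A \<pi>" by (rule walg_homD(6)[OF R A \<pi>])
qed

lemma walg_quotient_eq_iff:
  assumes R: "local_walg p k R" and q: "walg_quotient R I A \<pi>" and xy: "x \<in> carrier R" "y \<in> carrier R"
  shows "\<pi> x = \<pi> y \<longleftrightarrow> x \<ominus>\<^bsub>R\<^esub> y \<in> I"
proof -
  note D = walg_quotientD[OF R q]
  interpret R: cring R by (rule local_walg_cring[OF R])
  interpret A: cring A by (rule local_walg_cring[OF D(1)])
  interpret \<pi>: ring_hom_cring R A \<pi> by (rule D(7))
  have "x \<ominus>\<^bsub>R\<^esub> y \<in> I \<longleftrightarrow> \<pi> x \<ominus>\<^bsub>A\<^esub> \<pi> y = \<zero>\<^bsub>A\<^esub>"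
    using D(5)[of "x \<ominus>\<^bsub>R\<^esub> y"] xy by (simp add: R.minus_eq A.minus_eq)
  then show ?thesis using xy A.r_right_minus_eq by auto
qed

lemma walg_quotient_max:
  assumes R: "local_walg p k R" and q: "walg_quotient R I A \<pi>"
  shows "\<pi> ` max_ideal k R = max_ideal k A"
proof -
  note D = walg_quotientD[OF R q] and h = walg_homD[OF R walg_quotientD(1,2)[OF R q]]
  show ?thesis
  proof (intro equalityI subsetI)
    fix y assume "y \<in> max_ideal k A"
    then show "y \<in> \<pi> ` max_ideal k R" using D(4)[of y] h(4) by (auto simp: mem_max_ideal)
  qed (use D(3) h(4) in \<open>auto simp: mem_max_ideal\<close>)
qed

lemma walg_quotient_factor:
  fixes R :: "('a, 'k) walg" and B :: "('b, 'k) walg"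
  assumes R: "local_walg p k R" and q: "walg_quotient R I A \<pi>" and B: "local_walg p k B"
    and f: "f \<in> walg_hom p k R B" and kill: "\<And>x. x \<in> I \<Longrightarrow> x \<in> carrier R \<Longrightarrow> f x = \<zero>\<^bsub>B\<^esub>"
  shows "\<exists>g\<in>walg_hom p k A B. \<forall>x\<in>carrier R. g (\<pi> x) = f x"
proof -
  note D = walg_quotientD[OF R q] and h = walg_homD[OF R walg_quotientD(1,2)[OF R q]] and fD = walg_homD[OF R B f]
  interpret R: cring R by (rule local_walg_cring[OF R])
  interpret B: cring B by (rule local_walg_cring[OF B])
  interpret \<pi>: ring_hom_cring R A \<pi> by (rule D(7))
  interpret f: ring_hom_cring R B f by (rule fD(6))
  define s where "s y = (SOME x. x \<in> carrier R \<and> \<pi> x = y)" for y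
  have s: "s y \<in> carrier R" "\<pi> (s y) = y" if "y \<in> carrier A" for y
  proof -
    have "\<exists>x. x \<in> carrier R \<and> \<pi> x = y" using D(4)[OF that] by blast
    from someI_ex[OF this] show "s y \<in> carrier R" "\<pi> (s y) = y" by (auto simp: s_def)
  qed
  define g where "g = (\<lambda>y\<in>carrier A. f (s y))"
  have g: "g (\<pi> x) = f x" if x: "x \<in> carrier R" for x
  proof -
    have sx: "s (\<pi> x) \<in> carrier R" "\<pi> (s (\<pi> x)) = \<pi> x" using s D(3)[OF x] by auto
    have "f (s (\<pi> x) \<ominus>\<^bsub>R\<^esub> x) = \<zero>\<^bsub>B\<^esub>"
      using kill walg_quotient_eq_iff[OF R q sx(1) x] sx x by simp
    then have "f (s (\<pi> x)) \<ominus>\<^bsub>B\<^esub> f x = \<zero>\<^bsub>B\<^esub>" using sx(1) x by (simp add: R.minus_eq B.minus_eq)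
    then show ?thesis using sx(1) x D(3)[OF x] B.r_right_minus_eq by (simp add: g_def)
  qed
  have "g \<in> walg_hom p k A B"
  proof (rule walg_homI)
    show "g \<in> extensional (carrier A)" by (simp add: g_def)
    show "g \<in> ring_hom A B"
    proof (rule ring_hom_memI)
      show "g x \<in> carrier B" if "x \<in> carrier A" for x using D(4)[OF that] g by auto
      show "g (x \<otimes>\<^bsub>A\<^esub> y) = g x \<otimes>\<^bsub>B\<^esub> g y" "g (x \<oplus>\<^bsub>A\<^esub> y) = g x \<oplus>\<^bsub>B\<^esub> g y" if xy: "x \<in> carrier A" "y \<in> carrier A" for x y
      proof -
        obtain a b where ab: "a \<in> carrier R" "x = \<pi> a" "b \<in> carrier R" "y = \<pi> b" using D(4)[OF xy(1)] D(4)[OF xy(2)] by blast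
        have "x \<otimes>\<^bsub>A\<^esub> y = \<pi> (a \<otimes>\<^bsub>R\<^esub> b)" "x \<oplus>\<^bsub>A\<^esub> y = \<pi> (a \<oplus>\<^bsub>R\<^esub> b)" using ab by simp_all
        then show "g (x \<otimes>\<^bsub>A\<^esub> y) = g x \<otimes>\<^bsub>B\<^esub> g y" "g (x \<oplus>\<^bsub>A\<^esub> y) = g x \<oplus>\<^bsub>B\<^esub> g y"
          using ab g[of "a \<otimes>\<^bsub>R\<^esub> b"] g[of "a \<oplus>\<^bsub>R\<^esub> b"] g[of a] g[of b] by simp_all
      qed
      show "g \<one>\<^bsub>A\<^esub> = \<one>\<^bsub>B\<^esub>" using g[of "\<one>\<^bsub>R\<^esub>"] by simp
    qed
    show "g (alg A w) = alg B w" if "w \<in> carrier (witt p k)" for w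
      using g[OF alg_closed[OF R that]] h(3)[OF that] fD(3)[OF that] by simp
    show "red B (g y) = red A y" if "y \<in> carrier A" for y
      using D(4)[OF that] g h(4) fD(4) by auto
  qed
  then show ?thesis using g by blast
qed

text \<open>Connects the copy of the quotient used in the representability arguments with the
  quotient by cosets that appears in the theorem.\<close>

lemma walg_quotient_iso:
  fixes R :: "('a, 'k) walg"
  assumes R: "local_walg p k R" and I: "ideal I R" and q: "walg_quotient R I A \<pi>"
  shows "local_walg p k (quot_walg R I)" "walg_iso p k A (quot_walg R I) \<noteq> {}"
proof -
  note D = walg_quotientD[OF R q] and h = walg_homD[OF R walg_quotientD(1,2)[OF R q]]
  interpret R: local_cring R "max_ideal k R" by (rule local_walg_local_cring[OF R])
  interpret A: local_cring A "max_ideal k A" by (rule local_walg_local_cring[OF D(1)])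
  interpret \<pi>: ring_hom_cring R A \<pi> by (rule D(7))
  interpret rA: ring_hom_cring A k "red A" by (rule red_hom_ring[OF D(1)])
  interpret I: ideal I R by (rule I)
  let ?B = "quot_walg R I"
  interpret Q: cring "R Quot I" by (rule I.quotient_is_cring[OF R.is_cring])
  have coset_eq: "I +>\<^bsub>R\<^esub> x = I +>\<^bsub>R\<^esub> y \<longleftrightarrow> \<pi> x = \<pi> y" if "x \<in> carrier R" "y \<in> carrier R" for x y
    using walg_quotient_eq_iff[OF R q that] that
      R.quotient_eq_iff_same_a_r_cos[OF I that] by simp
  have B: "carrier ?B = {I +>\<^bsub>R\<^esub> x | x. x \<in> carrier R}"
    by (auto simp: quot_walg_def FactRing_def A_RCOSETS_def')
  \<comment> \<open>\<open>quot_walg\<close> reads the residue off a whole coset, so the residue has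
    to be constant there; \<pi> is constant on cosets and preserves residues.\<close>
  have redB: "red ?B (I +>\<^bsub>R\<^esub> x) = red R x" if x: "x \<in> carrier R" for x
  proof -
    have "red R y = red R x" if y: "y \<in> I +>\<^bsub>R\<^esub> x" for y
    proof -
      obtain i where i: "i \<in> I" "y = i \<oplus>\<^bsub>R\<^esub> x" using y by (auto simp: a_r_coset_def')
      then have "\<pi> y = \<pi> x" "y \<in> carrier R" using x D(5)[of i] by auto
      then show ?thesis using h(4) x by metis
    qed
    moreover have "x \<in> I +>\<^bsub>R\<^esub> x" using x by (rule I.a_rcos_self)
    ultimately have "red R ` (I +>\<^bsub>R\<^esub> x) = {red R x}" by blast
    then show ?thesis by (simp add: quot_walg_def)
  qed
  have coset_hom: "(\<lambda>x. I +>\<^bsub>R\<^esub> x) \<in> ring_hom R ?B"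
    using I.rcos_ring_hom by (simp add: ring_hom_def quot_walg_def)
  define g where "g = (\<lambda>y\<in>carrier A. I +>\<^bsub>R\<^esub> (SOME x. x \<in> carrier R \<and> \<pi> x = y))"
  have g: "g (\<pi> x) = I +>\<^bsub>R\<^esub> x" if x: "x \<in> carrier R" for x
  proof -
    have "\<exists>z. z \<in> carrier R \<and> \<pi> z = \<pi> x" using x by blast
    from someI_ex[OF this] show ?thesis using coset_eq x D(3)[OF x] by (simp add: g_def)
  qed
  have gA: "\<exists>x\<in>carrier R. y = \<pi> x \<and> g y = I +>\<^bsub>R\<^esub> x" if "y \<in> carrier A" for y
    using D(4)[OF that] g by auto
  have g_hom: "g \<in> ring_hom A ?B"
  proof (rule ring_hom_memI)
    show "g x \<in> carrier ?B" if "x \<in> carrier A" for x using gA[OF that] by (auto simp: B)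
    show "g (x \<otimes>\<^bsub>A\<^esub> y) = g x \<otimes>\<^bsub>?B\<^esub> g y" "g (x \<oplus>\<^bsub>A\<^esub> y) = g x \<oplus>\<^bsub>?B\<^esub> g y" if xy: "x \<in> carrier A" "y \<in> carrier A" for x y
    proof -
      obtain a b where ab: "a \<in> carrier R" "x = \<pi> a" "g x = I +>\<^bsub>R\<^esub> a" "b \<in> carrier R" "y = \<pi> b" "g y = I +>\<^bsub>R\<^esub> b"
        using gA[OF xy(1)] gA[OF xy(2)] by blast
      have "x \<otimes>\<^bsub>A\<^esub> y = \<pi> (a \<otimes>\<^bsub>R\<^esub> b)" "x \<oplus>\<^bsub>A\<^esub> y = \<pi> (a \<oplus>\<^bsub>R\<^esub> b)" using ab by simp_all
      then show "g (x \<otimes>\<^bsub>A\<^esub> y) = g x \<otimes>\<^bsub>?B\<^esub> g y" "g (x \<oplus>\<^bsub>A\<^esub> y) = g x \<oplus>\<^bsub>?B\<^esub> g y"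
        using ab g[of "a \<otimes>\<^bsub>R\<^esub> b"] g[of "a \<oplus>\<^bsub>R\<^esub> b"] ring_hom_mult[OF coset_hom] ring_hom_add[OF coset_hom] by simp_all
    qed
    show "g \<one>\<^bsub>A\<^esub> = \<one>\<^bsub>?B\<^esub>" using g[of "\<one>\<^bsub>R\<^esub>"] ring_hom_one[OF coset_hom] by simp
  qed
  have g_alg: "g (alg A w) = alg ?B w" if "w \<in> carrier (witt p k)" for w
    using g[OF alg_closed[OF R that]] h(3)[OF that] by (simp add: quot_walg_def)
  have g_red: "red ?B (g y) = red A y" if "y \<in> carrier A" for y
    using gA[OF that] redB h(4) by auto
  have g_bij: "bij_betw g (carrier A) (carrier ?B)"
    unfolding bij_betw_def
  proof
    show "inj_on g (carrier A)"
    proof (rule inj_onI)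
      fix x y assume xy: "x \<in> carrier A" "y \<in> carrier A" "g x = g y"
      obtain a b where ab: "a \<in> carrier R" "x = \<pi> a" "g x = I +>\<^bsub>R\<^esub> a" "b \<in> carrier R" "y = \<pi> b" "g y = I +>\<^bsub>R\<^esub> b"
        using gA[OF xy(1)] gA[OF xy(2)] by blast
      then show "x = y" using coset_eq[OF ab(1,4)] xy(3) by simp
    qed
    show "g ` carrier A = carrier ?B"
    proof (intro equalityI subsetI)
      fix c assume "c \<in> carrier ?B"
      then obtain x where "x \<in> carrier R" "c = I +>\<^bsub>R\<^esub> x" by (auto simp: B)
      then show "c \<in> g ` carrier A" using g D(3) by (metis image_eqI)
    qed (use gA in \<open>auto simp: B\<close>)
  qed
  show "local_walg p k ?B"
  proof (rule local_walg_image[OF R coset_hom])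
    show "I +>\<^bsub>R\<^esub> \<zero>\<^bsub>R\<^esub> = \<zero>\<^bsub>?B\<^esub>"
      using R.a_rcos_zero[OF I R.ideal_zero_closed[OF I]] by (simp add: quot_walg_def FactRing_def)
    show "(\<lambda>x. I +>\<^bsub>R\<^esub> x) ` carrier R = carrier ?B" unfolding B by blast
    show "alg ?B w = I +>\<^bsub>R\<^esub> alg R w" for w by (simp add: quot_walg_def)
  qed (rule redB)
  have "g \<in> walg_hom p k A ?B"
    using g_hom g_alg g_red by (intro walg_homI) (auto simp: g_def)
  then show "walg_iso p k A ?B \<noteq> {}" using g_bij by (auto simp: walg_iso_def)
qed

end

section \<open>Complete local \<open>W(k)\<close>-algebras and the functors they represent\<close>

lemma compose_apply: "x \<in> A \<Longrightarrow> compose A g f x = g (f x)"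
  by (simp add: compose_eq)

context coeff_field
begin

abbreviation m_pow :: "('a, 'k) walg \<Rightarrow> nat \<Rightarrow> 'a set" where "m_pow A n \<equiv> ideal_pow A (max_ideal k A) n"

lemma Art_local: "A \<in> Art p k \<Longrightarrow> local_walg p k A" for A :: "('a, 'k) walg"
  by (simp add: Art_def)

lemma Art_hat_local: "A \<in> Art_hat p k \<Longrightarrow> local_walg p k A" for A :: "('a, 'k) walg"
  by (simp add: Art_hat_def)

lemma Art_nilpotent:
  fixes A :: "('a, 'k) walg"
  assumes "A \<in> Art p k" shows "\<exists>n. m_pow A n = {\<zero>\<^bsub>A\<^esub>}"
  using local_cring.artinian_nilpotent[OF local_walg_local_cring[OF Art_local[OF assms]]] assms by (simp add: Art_def)

lemma Art_nil_local:
  fixes A :: "('a, 'k) walg"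
  assumes A: "A \<in> Art p k" shows "nil_local A (max_ideal k A)"
proof -
  interpret A: local_cring A "max_ideal k A" by (rule local_walg_local_cring[OF Art_local[OF A]])
  show ?thesis
    by (intro nil_local.intro power_series.intro nil_local_axioms.intro A.is_cring A.m_ideal Art_nilpotent[OF A] A.m_unit)
qed

lemma field_nil_local: "nil_local k {\<zero>\<^bsub>k\<^esub>}"
proof (intro nil_local.intro power_series.intro nil_local_axioms.intro k.is_cring k.zeroideal)
  show "\<exists>n. ideal_pow k {\<zero>\<^bsub>k\<^esub>} n = {\<zero>\<^bsub>k\<^esub>}" using k.ideal_pow_1[OF k.zeroideal] by blast
  show "x \<in> Units k" if "x \<in> carrier k" "x \<notin> {\<zero>\<^bsub>k\<^esub>}" for x using that k.field_Units by auto
qed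

text \<open>A power of the maximal ideal vanishes in the quotient, and a noetherian local ring with
  nilpotent maximal ideal is artinian.\<close>

lemma Art_quotient:
  fixes R :: "('a, 'k) walg"
  assumes R: "local_walg p k R" "noetherian_ring R" and q: "walg_quotient R I A \<pi>" and le: "m_pow R n \<subseteq> I"
  shows "A \<in> Art p k"
proof -
  note D = walg_quotientD[OF R(1) q]
  interpret R: local_cring R "max_ideal k R" by (rule local_walg_local_cring[OF R(1)])
  interpret A: local_cring A "max_ideal k A" by (rule local_walg_local_cring[OF D(1)])
  interpret \<pi>: ring_hom_cring R A \<pi> by (rule D(7))
  have "m_pow A n = \<pi> ` m_pow R n"
    using \<pi>.image_ideal_pow[OF R.m_ideal A.m_ideal walg_quotient_max[OF R(1) q] D(6)] by simp
  also have "\<dots> \<subseteq> {\<zero>\<^bsub>A\<^esub>}"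
    using le D(5) ideal.Icarr[OF R.ideal_pow_ideal[OF R.m_ideal]] by blast
  finally have "m_pow A n = {\<zero>\<^bsub>A\<^esub>}" using A.ideal_zero_closed[OF A.ideal_pow_ideal[OF A.m_ideal]] by blast
  then have "artinian A" using A.nilpotent_noetherian_artinian \<pi>.noetherian_image[OF R(2) D(6)] by blast
  then show ?thesis using D(1) by (simp add: Art_def)
qed

lemma Art_hat_separated:
  fixes R :: "('a, 'k) walg"
  assumes R: "R \<in> Art_hat p k" and xy: "x \<in> carrier R" "y \<in> carrier R" "\<And>n. x \<ominus>\<^bsub>R\<^esub> y \<in> m_pow R n"
  shows "x = y"
proof -
  interpret R: local_cring R "max_ideal k R" by (rule local_walg_local_cring[OF Art_hat_local[OF R]])
  have "x \<ominus>\<^bsub>R\<^esub> y = \<zero>\<^bsub>R\<^esub>" using R R.krull_intersection xy(3) by (simp add: Art_hat_def)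
  then show ?thesis using xy R.r_right_minus_eq by auto
qed

lemma Art_hat_limit:
  fixes R :: "('a, 'k) walg"
  assumes "R \<in> Art_hat p k" "\<And>n. x n \<in> carrier R" "\<And>n. x (Suc n) \<ominus>\<^bsub>R\<^esub> x n \<in> m_pow R n"
  shows "\<exists>a\<in>carrier R. \<forall>n. a \<ominus>\<^bsub>R\<^esub> x n \<in> m_pow R n"
  using assms unfolding Art_hat_def adically_complete_def by blast

text \<open>A Cauchy sequence in the quotient lifts to one in R, where it has a limit. Uniqueness of
  the limit downstairs is Krull's theorem applied to the quotient.\<close>

lemma Art_hat_quotient:
  fixes R :: "('a, 'k) walg"
  assumes R: "R \<in> Art_hat p k" and q: "walg_quotient R I A \<pi>"
  shows "A \<in> Art_hat p k"
proof -
  note Rl = Art_hat_local[OF R]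
  note D = walg_quotientD[OF Rl q]
  interpret R: local_cring R "max_ideal k R" by (rule local_walg_local_cring[OF Rl])
  interpret A: local_cring A "max_ideal k A" by (rule local_walg_local_cring[OF D(1)])
  interpret \<pi>: ring_hom_cring R A \<pi> by (rule D(7))
  have noeth: "noetherian_ring A" using \<pi>.noetherian_image[OF _ D(6)] R by (simp add: Art_hat_def)
  have pow: "\<pi> ` m_pow R n = m_pow A n" for n
    using \<pi>.image_ideal_pow[OF R.m_ideal A.m_ideal walg_quotient_max[OF Rl q] D(6)] .
  have "\<exists>!a. a \<in> carrier A \<and> (\<forall>n. a \<ominus>\<^bsub>A\<^esub> x n \<in> m_pow A n)"
    if x: "\<And>n. x n \<in> carrier A" "\<And>n. x (Suc n) \<ominus>\<^bsub>A\<^esub> x n \<in> m_pow A n" for x :: "nat \<Rightarrow> 'a"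
  proof -
    obtain y0 where y0: "y0 \<in> carrier R" "x 0 = \<pi> y0" using D(4)[OF x(1)] by blast
    \<comment> \<open>Increments are lifted instead of terms, each into the same power of the
      maximal ideal; their partial sums form a Cauchy sequence over the given one.\<close>
    have "\<forall>n. \<exists>d\<in>m_pow R n. x (Suc n) \<ominus>\<^bsub>A\<^esub> x n = \<pi> d" using x(2) pow by blast
    then obtain d where d: "\<And>n. d n \<in> m_pow R n" "\<And>n. x (Suc n) \<ominus>\<^bsub>A\<^esub> x n = \<pi> (d n)" by metis
    have dc: "d n \<in> carrier R" for n using ideal.Icarr[OF R.ideal_pow_ideal[OF R.m_ideal] d(1)] .
    define z where "z = rec_nat y0 (\<lambda>n z. z \<oplus>\<^bsub>R\<^esub> d n)"
    have z0: "z 0 = y0" and zS: "z (Suc n) = z n \<oplus>\<^bsub>R\<^esub> d n" for n by (simp_all add: z_def)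
    have zc: "z n \<in> carrier R" for n by (induction n) (use y0 dc in \<open>simp_all add: z0 zS\<close>)
    have \<pi>z: "\<pi> (z n) = x n" for n
    proof (induction n)
      case (Suc n)
      have "\<pi> (z (Suc n)) = x n \<oplus>\<^bsub>A\<^esub> (x (Suc n) \<ominus>\<^bsub>A\<^esub> x n)" using Suc zc dc d(2) by (simp add: zS)
      also have "\<dots> = x (Suc n)" using x(1)[of n] x(1)[of "Suc n"] by algebra
      finally show ?case .
    qed (simp add: z0 y0)
    have "z (Suc n) \<ominus>\<^bsub>R\<^esub> z n = d n" for n
      unfolding zS using zc[of n] dc[of n] by algebra
    then have "z (Suc n) \<ominus>\<^bsub>R\<^esub> z n \<in> m_pow R n" for n using d(1) by simp
    then obtain a where a: "a \<in> carrier R" "\<And>n. a \<ominus>\<^bsub>R\<^esub> z n \<in> m_pow R n"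
      using Art_hat_limit[of R z, OF R zc] by blast
    have lim: "\<pi> a \<ominus>\<^bsub>A\<^esub> x n \<in> m_pow A n" for n
    proof -
      have "\<pi> (a \<ominus>\<^bsub>R\<^esub> z n) \<in> m_pow A n" using a(2) pow by blast
      then show ?thesis using a(1) zc \<pi>z by (simp add: R.minus_eq A.minus_eq)
    qed
    show ?thesis
    proof (rule ex1I[of _ "\<pi> a"])
      show "\<pi> a \<in> carrier A \<and> (\<forall>n. \<pi> a \<ominus>\<^bsub>A\<^esub> x n \<in> m_pow A n)" using lim a(1) by simp
      fix b assume b: "b \<in> carrier A \<and> (\<forall>n. b \<ominus>\<^bsub>A\<^esub> x n \<in> m_pow A n)"
      then have bc: "b \<in> carrier A" and bl: "\<And>n. b \<ominus>\<^bsub>A\<^esub> x n \<in> m_pow A n" by auto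
      have "b \<ominus>\<^bsub>A\<^esub> \<pi> a \<in> m_pow A n" for n
      proof -
        have "(b \<ominus>\<^bsub>A\<^esub> x n) \<ominus>\<^bsub>A\<^esub> (\<pi> a \<ominus>\<^bsub>A\<^esub> x n) \<in> m_pow A n"
          by (rule A.ideal_minus_closed[OF A.ideal_pow_ideal[OF A.m_ideal] bl lim])
        moreover have "(b \<ominus>\<^bsub>A\<^esub> x n) \<ominus>\<^bsub>A\<^esub> (\<pi> a \<ominus>\<^bsub>A\<^esub> x n) = b \<ominus>\<^bsub>A\<^esub> \<pi> a"
          using bc x(1)[of n] \<pi>.hom_closed[OF a(1)] by algebra
        ultimately show ?thesis by simp
      qed
      then have "b \<ominus>\<^bsub>A\<^esub> \<pi> a = \<zero>\<^bsub>A\<^esub>" by (rule A.krull_intersection[OF noeth])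
      then show "b = \<pi> a" using bc \<pi>.hom_closed[OF a(1)] A.r_right_minus_eq by blast
    qed
  qed
  then have "adically_complete k A" unfolding adically_complete_def by blast
  then show ?thesis using D(1) noeth by (simp add: Art_hat_def)
qed

text \<open>The exponent is n+1 because the quotient by the power 0 would be the zero ring; stage 0
  is thus a copy of k.\<close>

definition tower :: "('a, 'k) walg \<Rightarrow> (nat \<Rightarrow> ('a, 'k) walg) \<Rightarrow> (nat \<Rightarrow> 'a \<Rightarrow> 'a) \<Rightarrow> bool" where
  "tower R A \<pi> \<longleftrightarrow> (\<forall>n. walg_quotient R (m_pow R (Suc n)) (A n) (\<pi> n) \<and> A n \<in> Art p k)"

lemma tower_ex:
  fixes R :: "('a, 'k) walg"
  assumes R: "R \<in> Art_hat p k"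
  shows "\<exists>A \<pi>. tower R A \<pi>"
proof -
  interpret R: local_cring R "max_ideal k R" by (rule local_walg_local_cring[OF Art_hat_local[OF R]])
  have "\<exists>A \<pi>. walg_quotient R (m_pow R (Suc n)) A \<pi> \<and> A \<in> Art p k" for n
  proof -
    have "m_pow R (Suc n) \<subseteq> m_pow R 1" by (rule R.ideal_pow_le[OF R.m_ideal]) simp
    then have le: "m_pow R (Suc n) \<subseteq> max_ideal k R" unfolding R.ideal_pow_1[OF R.m_ideal] .
    obtain A \<pi> where q: "walg_quotient R (m_pow R (Suc n)) A \<pi>"
      using walg_quotient_ex[OF Art_hat_local[OF R] R.ideal_pow_ideal[OF R.m_ideal] le] by blast
    have "A \<in> Art p k"
      by (rule Art_quotient[OF Art_hat_local[OF R] _ q order_refl]) (use R in \<open>simp add: Art_hat_def\<close>)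
    then show ?thesis using q by blast
  qed
  then show ?thesis unfolding tower_def by metis
qed

lemma towerD:
  assumes "tower R A \<pi>"
  shows "walg_quotient R (m_pow R (Suc n)) (A n) (\<pi> n)" "A n \<in> Art p k" "local_walg p k (A n)"
  using assms Art_local[of "A n"] by (auto simp: tower_def)

lemma tower_hom:
  fixes R :: "('a, 'k) walg"
  shows "R \<in> Art_hat p k \<Longrightarrow> tower R A \<pi> \<Longrightarrow> \<pi> n \<in> walg_hom p k R (A n)"
  using walg_quotientD(2)[OF Art_hat_local towerD(1)] .

lemma tower_transition:
  fixes R :: "('a, 'k) walg"
  assumes R: "R \<in> Art_hat p k" and t: "tower R A \<pi>"
  shows "\<exists>\<tau>\<in>walg_hom p k (A (Suc n)) (A n). \<tau> ` carrier (A (Suc n)) = carrier (A n) \<and> (\<forall>x\<in>carrier R. \<tau> (\<pi> (Suc n) x) = \<pi> n x)"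
proof -
  note Rl = Art_hat_local[OF R]
  interpret R: local_cring R "max_ideal k R" by (rule local_walg_local_cring[OF Rl])
  note Dn = walg_quotientD[OF Rl towerD(1)[OF t, of n]] and DS = walg_quotientD[OF Rl towerD(1)[OF t, of "Suc n"]]
  have le: "m_pow R (Suc (Suc n)) \<subseteq> m_pow R (Suc n)" by (rule R.ideal_pow_le[OF R.m_ideal]) simp
  obtain \<tau> where \<tau>: "\<tau> \<in> walg_hom p k (A (Suc n)) (A n)" "\<And>x. x \<in> carrier R \<Longrightarrow> \<tau> (\<pi> (Suc n) x) = \<pi> n x"
    using walg_quotient_factor[OF Rl towerD(1)[OF t, of "Suc n"] Dn(1,2)] Dn(5) le by blast
  have "\<tau> ` carrier (A (Suc n)) = \<tau> ` \<pi> (Suc n) ` carrier R" using DS(6) by simp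
  also have "\<dots> = \<pi> n ` carrier R" using \<tau>(2) by (simp add: image_image)
  finally show ?thesis using \<tau> Dn(6) by auto
qed

lemma tower_separated:
  fixes R :: "('a, 'k) walg"
  assumes R: "R \<in> Art_hat p k" and t: "tower R A \<pi>" and xy: "x \<in> carrier R" "y \<in> carrier R" "\<And>n. \<pi> n x = \<pi> n y"
  shows "x = y"
proof (rule Art_hat_separated[OF R xy(1,2)])
  interpret R: local_cring R "max_ideal k R" by (rule local_walg_local_cring[OF Art_hat_local[OF R]])
  fix n
  have "x \<ominus>\<^bsub>R\<^esub> y \<in> m_pow R (Suc n)"
    using walg_quotient_eq_iff[OF Art_hat_local[OF R] towerD(1)[OF t] xy(1,2)] xy(3) by blast
  then show "x \<ominus>\<^bsub>R\<^esub> y \<in> m_pow R n" using R.ideal_pow_le[OF R.m_ideal, of n "Suc n"] by auto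
qed

text \<open>R is the inverse limit of its artinian quotients. Transition maps are not part of
  \<open>tower\<close>, so compatibility is required for every map commuting with the projections;
  surjectivity of the projections leaves one such map.\<close>

lemma tower_limit:
  fixes R :: "('a, 'k) walg" and S :: "('b, 'k) walg"
  assumes R: "R \<in> Art_hat p k" and t: "tower R A \<pi>" and S: "local_walg p k S"
    and g: "\<And>n. g n \<in> walg_hom p k S (A n)"
    and compat: "\<And>n \<tau> s. \<lbrakk>\<tau> \<in> walg_hom p k (A (Suc n)) (A n); \<And>x. x \<in> carrier R \<Longrightarrow> \<tau> (\<pi> (Suc n) x) = \<pi> n x; s \<in> carrier S\<rbrakk> \<Longrightarrow>
        \<tau> (g (Suc n) s) = g n s"
  shows "\<exists>f\<in>walg_hom p k S R. \<forall>n. \<forall>s\<in>carrier S. \<pi> n (f s) = g n s"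
proof -
  note Rl = Art_hat_local[OF R]
  interpret R: local_cring R "max_ideal k R" by (rule local_walg_local_cring[OF Rl])
  interpret S: cring S by (rule local_walg_cring[OF S])
  note D = walg_quotientD[OF Rl towerD(1)[OF t]]
  note h = walg_homD[OF Rl D(1,2)] and gh = walg_homD[OF S towerD(3)[OF t] g]
  have ex: "\<exists>a\<in>carrier R. \<forall>n. \<pi> n a = g n s" if s: "s \<in> carrier S" for s
  proof -
    have "\<forall>n. \<exists>y\<in>carrier R. g n s = \<pi> n y" using D(4) gh(5)[OF s] by blast
    then obtain y where y: "\<And>n. y n \<in> carrier R" "\<And>n. g n s = \<pi> n (y n)" by metis
    have \<pi>y: "\<pi> n (y (Suc n)) = \<pi> n (y n)" for n
    proof -
      obtain \<tau> where \<tau>: "\<tau> \<in> walg_hom p k (A (Suc n)) (A n)" "\<forall>x\<in>carrier R. \<tau> (\<pi> (Suc n) x) = \<pi> n x"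
        using tower_transition[OF R t] by blast
      have "\<pi> n (y (Suc n)) = \<tau> (g (Suc n) s)" using \<tau>(2) y by simp
      also have "\<dots> = g n s" using compat[OF \<tau>(1) _ s] \<tau>(2) by simp
      finally show ?thesis using y(2) by simp
    qed
    have "y (Suc n) \<ominus>\<^bsub>R\<^esub> y n \<in> m_pow R n" for n
    proof -
      have "y (Suc n) \<ominus>\<^bsub>R\<^esub> y n \<in> m_pow R (Suc n)"
        using walg_quotient_eq_iff[OF Rl towerD(1)[OF t] y(1) y(1), of n "Suc n" n] \<pi>y[of n] by blast
      then show ?thesis using R.ideal_pow_le[OF R.m_ideal, of n "Suc n"] by auto
    qed
    then obtain a where a: "a \<in> carrier R" "\<And>n. a \<ominus>\<^bsub>R\<^esub> y n \<in> m_pow R n"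
      using Art_hat_limit[of R y, OF R y(1)] by blast
    \<comment> \<open>Stage n divides by the power n+1, while the limit is controlled only modulo
      the n-th power by y n; hence y (n+1) is used.\<close>
    have "\<pi> n a = g n s" for n
      using walg_quotient_eq_iff[OF Rl towerD(1)[OF t] a(1) y(1), of n "Suc n"] a(2)[of "Suc n"] \<pi>y[of n] y(2)[of n] by simp
    then show ?thesis using a(1) by blast
  qed
  define f where "f = (\<lambda>s\<in>carrier S. SOME a. a \<in> carrier R \<and> (\<forall>n. \<pi> n a = g n s))"
  have f: "f s \<in> carrier R" "\<pi> n (f s) = g n s" if "s \<in> carrier S" for s n
  proof -
    have "\<exists>a. a \<in> carrier R \<and> (\<forall>n. \<pi> n a = g n s)" using ex[OF that] by blast
    from someI_ex[OF this] show "f s \<in> carrier R" "\<pi> n (f s) = g n s" using that by (auto simp: f_def)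
  qed
  have "f \<in> walg_hom p k S R"
  proof (rule walg_homI)
    show "f \<in> extensional (carrier S)" by (simp add: f_def)
    show "f \<in> ring_hom S R"
    proof (rule ring_hom_memI)
      fix x y assume xy: "x \<in> carrier S" "y \<in> carrier S"
      show "f (x \<otimes>\<^bsub>S\<^esub> y) = f x \<otimes>\<^bsub>R\<^esub> f y"
        by (rule tower_separated[OF R t])
           (use f xy ring_hom_mult[OF h(2)] ring_hom_mult[OF gh(2)] in auto)
      show "f (x \<oplus>\<^bsub>S\<^esub> y) = f x \<oplus>\<^bsub>R\<^esub> f y"
        by (rule tower_separated[OF R t])
           (use f xy ring_hom_add[OF h(2)] ring_hom_add[OF gh(2)] in auto)
    next
      show "f \<one>\<^bsub>S\<^esub> = \<one>\<^bsub>R\<^esub>"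
        by (rule tower_separated[OF R t]) (use f ring_hom_one[OF h(2)] ring_hom_one[OF gh(2)] in auto)
    qed (rule f(1))
    show "f (alg S w) = alg R w" if w: "w \<in> carrier (witt p k)" for w
      by (rule tower_separated[OF R t])
         (use f(1)[OF alg_closed[OF S w]] f(2)[OF alg_closed[OF S w]] alg_closed[OF Rl w] h(3)[OF w] gh(3)[OF w] in auto)
    show "red R (f s) = red S s" if s: "s \<in> carrier S" for s
      using h(4)[OF f(1)[OF s], of 0] gh(4)[OF s, of 0] f(2)[OF s, of 0] by simp
  qed
  then show ?thesis using f(2) by blast
qed

text \<open>A local homomorphism carries powers of the maximal ideal into powers, and these vanish
  eventually in an artinian target.\<close>

lemma tower_factor:
  fixes R :: "('a, 'k) walg" and B :: "('b, 'k) walg"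
  assumes R: "R \<in> Art_hat p k" and t: "tower R A \<pi>" and B: "B \<in> Art p k" and f: "f \<in> walg_hom p k R B"
  shows "\<exists>n. \<exists>g\<in>walg_hom p k (A n) B. f = compose (carrier R) g (\<pi> n)"
proof -
  note Rl = Art_hat_local[OF R] and Bl = Art_local[OF B]
  note fD = walg_homD[OF Rl Bl f]
  interpret R: local_cring R "max_ideal k R" by (rule local_walg_local_cring[OF Rl])
  interpret B: local_cring B "max_ideal k B" by (rule local_walg_local_cring[OF Bl])
  interpret f: ring_hom_cring R B f by (rule fD(6))
  obtain n where n: "m_pow B n = {\<zero>\<^bsub>B\<^esub>}" using Art_nilpotent[OF B] by blast
  have fm: "f ` max_ideal k R \<subseteq> max_ideal k B" using f by (simp add: walg_hom_def)
  have kill: "f x = \<zero>\<^bsub>B\<^esub>" if "x \<in> m_pow R (Suc n)" for x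
  proof -
    have "x \<in> m_pow R n" using that R.ideal_pow_le[OF R.m_ideal, of n "Suc n"] by auto
    then show ?thesis using f.image_ideal_pow_subset[OF R.m_ideal B.m_ideal fm, of n] n by blast
  qed
  obtain g where g: "g \<in> walg_hom p k (A n) B" "\<forall>x\<in>carrier R. g (\<pi> n x) = f x"
    using walg_quotient_factor[OF Rl towerD(1)[OF t] Bl f kill] by blast
  have "f = compose (carrier R) g (\<pi> n)"
    by (rule walg_hom_eqI[OF f walg_hom_compose[OF Rl towerD(3)[OF t] Bl tower_hom[OF R t] g(1)]])
       (use g(2) in \<open>simp add: compose_apply\<close>)
  then show ?thesis using g(1) by blast
qed

text \<open>T cannot be evaluated at the identity of R when R is not artinian. Its values at the
  projections to R/m^(n+1) are compatible by naturality and glue to u; since maps into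
  \<open>Art\<close> factor through this tower, u determines T.\<close>

theorem yoneda:
  fixes R S :: "('u, 'k) walg" and T :: "('u, 'k) walg \<Rightarrow> ('u \<Rightarrow> 'u) \<Rightarrow> 'u \<Rightarrow> 'u"
  assumes R: "R \<in> Art_hat p k" and S: "S \<in> Art_hat p k"
    and T: "\<And>A f. \<lbrakk>A \<in> Art p k; f \<in> walg_hom p k R A\<rbrakk> \<Longrightarrow> T A f \<in> walg_hom p k S A"
    and nat: "\<And>A B f g. \<lbrakk>A \<in> Art p k; B \<in> Art p k; g \<in> walg_hom p k A B; f \<in> walg_hom p k R A\<rbrakk> \<Longrightarrow>
        T B (compose (carrier R) g f) = compose (carrier S) g (T A f)"
  obtains u where "u \<in> walg_hom p k S R"
    "\<And>A f. \<lbrakk>A \<in> Art p k; f \<in> walg_hom p k R A\<rbrakk> \<Longrightarrow> T A f = compose (carrier S) f u"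
proof -
  note Rl = Art_hat_local[OF R] and Sl = Art_hat_local[OF S]
  obtain A :: "nat \<Rightarrow> ('u, 'k) walg" and \<pi> where t: "tower R A \<pi>" using tower_ex[OF R] by blast
  have \<pi>: "\<pi> n \<in> walg_hom p k R (A n)" for n by (rule tower_hom[OF R t])
  have "\<exists>u\<in>walg_hom p k S R. \<forall>n. \<forall>s\<in>carrier S. \<pi> n (u s) = T (A n) (\<pi> n) s"
  proof (rule tower_limit[OF R t Sl])
    show "T (A n) (\<pi> n) \<in> walg_hom p k S (A n)" for n by (rule T[OF towerD(2)[OF t] \<pi>])
    fix n \<tau> s assume \<tau>: "\<tau> \<in> walg_hom p k (A (Suc n)) (A n)"
      and \<tau>\<pi>: "\<And>x. x \<in> carrier R \<Longrightarrow> \<tau> (\<pi> (Suc n) x) = \<pi> n x" and s: "s \<in> carrier S"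
    have "compose (carrier R) \<tau> (\<pi> (Suc n)) = \<pi> n"
      by (rule walg_hom_eqI[OF walg_hom_compose[OF Rl towerD(3)[OF t] towerD(3)[OF t] \<pi> \<tau>] \<pi>])
         (simp add: compose_apply \<tau>\<pi>)
    then have "T (A n) (\<pi> n) = compose (carrier S) \<tau> (T (A (Suc n)) (\<pi> (Suc n)))"
      using nat[OF towerD(2)[OF t] towerD(2)[OF t] \<tau> \<pi>] by simp
    then show "\<tau> (T (A (Suc n)) (\<pi> (Suc n)) s) = T (A n) (\<pi> n) s" using s by (simp add: compose_apply)
  qed
  then obtain u where u: "u \<in> walg_hom p k S R" "\<And>n s. s \<in> carrier S \<Longrightarrow> \<pi> n (u s) = T (A n) (\<pi> n) s" by blast
  have "T B f = compose (carrier S) f u" if B: "B \<in> Art p k" and f: "f \<in> walg_hom p k R B" for B f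
  proof -
    obtain n g where g: "g \<in> walg_hom p k (A n) B" "f = compose (carrier R) g (\<pi> n)"
      using tower_factor[OF R t B f] by blast
    have "T B f = compose (carrier S) g (T (A n) (\<pi> n))" unfolding g(2) by (rule nat[OF towerD(2)[OF t] B g(1) \<pi>])
    moreover have "compose (carrier S) g (T (A n) (\<pi> n)) \<in> walg_hom p k S B"
      by (rule walg_hom_compose[OF Sl towerD(3)[OF t] Art_local[OF B] T[OF towerD(2)[OF t] \<pi>] g(1)])
    moreover have "compose (carrier S) f u \<in> walg_hom p k S B"
      by (rule walg_hom_compose[OF Sl Rl Art_local[OF B] u(1) f])
    ultimately show ?thesis
      using walg_homD(5)[OF Sl Rl u(1)] u(2) by (intro walg_hom_eqI[of "T B f" S B]) (auto simp: g(2) compose_apply)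
  qed
  then show thesis using that u(1) by blast
qed

lemma yoneda_unique:
  fixes R S :: "('u, 'k) walg"
  assumes R: "R \<in> Art_hat p k" and S: "S \<in> Art_hat p k" and u: "u \<in> walg_hom p k S R" and v: "v \<in> walg_hom p k S R"
    and eq: "\<And>(A :: ('u, 'k) walg) f. \<lbrakk>A \<in> Art p k; f \<in> walg_hom p k R A\<rbrakk> \<Longrightarrow> compose (carrier S) f u = compose (carrier S) f v"
  shows "u = v"
proof (rule walg_hom_eqI[OF u v])
  note Rl = Art_hat_local[OF R] and Sl = Art_hat_local[OF S]
  obtain A :: "nat \<Rightarrow> ('u, 'k) walg" and \<pi> where t: "tower R A \<pi>" using tower_ex[OF R] by blast
  fix s assume s: "s \<in> carrier S"
  show "u s = v s"
  proof (rule tower_separated[OF R t walg_homD(5)[OF Sl Rl u s] walg_homD(5)[OF Sl Rl v s]])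
    show "\<pi> n (u s) = \<pi> n (v s)" for n
      using fun_cong[OF eq[OF towerD(2)[OF t] tower_hom[OF R t]], of n s] s by (simp add: compose_apply)
  qed
qed

end

section \<open>Tangent vectors and uniqueness of hulls\<close>

context coeff_field
begin

lemma hom_functor_simps:
  "fobj (hom_functor p k R) A = walg_hom p k R A" "fmap (hom_functor p k R) A B f h = compose (carrier R) f h"
  by (simp_all add: hom_functor_def)

lemma nat_isoD:
  assumes "nat_iso p k D E \<eta>" "A \<in> Art p k"
  shows "bij_betw (\<eta> A) (fobj D A) (fobj E A)"
    "\<And>B f x. \<lbrakk>B \<in> Art p k; f \<in> walg_hom p k A B; x \<in> fobj D A\<rbrakk> \<Longrightarrow> \<eta> B (fmap D A B f x) = fmap E A B f (\<eta> A x)"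
  using assms by (auto simp: nat_iso_def nat_trans_def)

text \<open>A retraction \<open>v\<close> of \<open>u : S \<rightarrow> R\<close> is injective as soon as precomposition with \<open>u\<close> is injective on
  tangent vectors: a minimal quotient \<open>J/J'\<close> of the kernel \<open>J\<close> of \<open>v\<close> splits off a copy of the dual
  numbers, on which \<open>id\<close> and \<open>u \<circ> v\<close> induce different homomorphisms that agree after composition with \<open>u\<close>.\<close>

lemma retraction_injective:
  fixes R S :: "('u, 'k) walg"
  assumes R: "R \<in> Art_hat p k" and S: "S \<in> Art_hat p k"
    and u: "u \<in> walg_hom p k S R" and v: "v \<in> walg_hom p k R S" and vu: "\<And>x. x \<in> carrier S \<Longrightarrow> v (u x) = x"
    and tangent: "\<And>(A :: ('u, 'k) walg) f g. \<lbrakk>A \<in> Art p k; walg_iso p k (dual_numbers k) A \<noteq> {}; f \<in> walg_hom p k R A;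
        g \<in> walg_hom p k R A; compose (carrier S) f u = compose (carrier S) g u\<rbrakk> \<Longrightarrow> f = g"
    and x: "x \<in> carrier R" "v x = \<zero>\<^bsub>S\<^esub>"
  shows "x = \<zero>\<^bsub>R\<^esub>"
proof (rule ccontr)
  assume nz: "x \<noteq> \<zero>\<^bsub>R\<^esub>"
  note Rl = Art_hat_local[OF R] and Sl = Art_hat_local[OF S]
  note uD = walg_homD[OF Sl Rl u] and vD = walg_homD[OF Rl Sl v]
  interpret R: local_cring R "max_ideal k R" by (rule local_walg_local_cring[OF Rl])
  interpret S: cring S by (rule local_walg_cring[OF Sl])
  interpret r: ring_hom_cring R k "red R" by (rule red_hom_ring[OF Rl])
  interpret u: ring_hom_cring S R u by (rule uD(6))
  interpret v: ring_hom_cring R S v by (rule vD(6))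
  define J where "J = {y \<in> carrier R. v y = \<zero>\<^bsub>S\<^esub>}"
  have J: "ideal J R"
    unfolding J_def by (rule R.idealI_cring) auto
  have Jc: "y \<in> carrier R" if "y \<in> J" for y using that by (simp add: J_def)
  \<comment> \<open>An idempotent endomorphism whose image is a copy of S; each z splits as e z plus
    an element of J.\<close>
  define e where "e y = u (v y)" for y
  have e: "e y \<in> carrier R" if "y \<in> carrier R" for y using that by (simp add: e_def)
  have e_add: "e (y \<oplus>\<^bsub>R\<^esub> z) = e y \<oplus>\<^bsub>R\<^esub> e z" and e_mult: "e (y \<otimes>\<^bsub>R\<^esub> z) = e y \<otimes>\<^bsub>R\<^esub> e z"
    if "y \<in> carrier R" "z \<in> carrier R" for y z using that by (simp_all add: e_def)
  have e_one: "e \<one>\<^bsub>R\<^esub> = \<one>\<^bsub>R\<^esub>" and e_zero: "e \<zero>\<^bsub>R\<^esub> = \<zero>\<^bsub>R\<^esub>" by (simp_all add: e_def)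
  have e_red: "red R (e y) = red R y" if "y \<in> carrier R" for y using that uD(4) vD(4) by (simp add: e_def)
  have e_alg: "e (alg R w) = alg R w" if "w \<in> carrier (witt p k)" for w using that uD(3) vD(3) by (simp add: e_def)
  have e_J: "e y = \<zero>\<^bsub>R\<^esub>" if "y \<in> J" for y using that by (simp add: e_def J_def)
  have e_idem: "e (e y) = e y" if "y \<in> carrier R" for y using that vu by (simp add: e_def)
  have diff_J: "y \<ominus>\<^bsub>R\<^esub> e y \<in> J" if y: "y \<in> carrier R" for y
  proof -
    have "v (y \<ominus>\<^bsub>R\<^esub> e y) = v y \<ominus>\<^bsub>S\<^esub> v (e y)" using y e by (simp add: R.minus_eq S.minus_eq)
    also have "v (e y) = v y" using y vu by (simp add: e_def)
    finally show ?thesis using y e by (simp add: J_def S.diff_self)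
  qed
  have J_red: "red R y = \<zero>\<^bsub>k\<^esub>" if "y \<in> J" for y using e_red[OF Jc[OF that]] e_J[OF that] by simp
  have xJ: "x \<in> J" using x by (simp add: J_def)
  \<comment> \<open>R is noetherian, so J has a maximal proper subideal J'; the quotient J/J' is a
    line over k, spanned by the class of b.\<close>
  let ?S = "{I. ideal I R \<and> I \<subseteq> J \<and> I \<noteq> J}"
  have "{\<zero>\<^bsub>R\<^esub>} \<in> ?S" using R.zeroideal R.ideal_zero_closed[OF J] xJ nz by auto
  then have "\<exists>I\<in>?S. \<forall>I'\<in>?S. I \<subseteq> I' \<longrightarrow> I' = I"
    using R by (intro noetherian_ring.noetherian_maximal) (auto simp: Art_hat_def)
  then obtain J' where J'S: "J' \<in> ?S" and J'max: "\<forall>I'\<in>?S. J' \<subseteq> I' \<longrightarrow> I' = J'" by blast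
  have J': "ideal J' R" "J' \<subseteq> J" "J' \<noteq> J" using J'S by auto
  have J'c: "y \<in> carrier R" if "y \<in> J'" for y using that J'(2) Jc by blast
  obtain b where b: "b \<in> J" "b \<notin> J'" using J'(2,3) by blast
  have bc: "b \<in> carrier R" using Jc[OF b(1)] .
  have full: "adjoin R J' y = J" if y: "y \<in> J" "y \<notin> J'" for y
  proof -
    have sub: "adjoin R J' y \<subseteq> J"
      using y(1) J'(2) by (auto simp: adjoin_def intro!: R.ideal_a_closed[OF J] ideal.I_l_closed[OF J])
    note ad = R.adjoin_ideal[OF J'(1) Jc[OF y(1)]]
    have "adjoin R J' y \<noteq> J'" using ad(3) y(2) by blast
    then have "adjoin R J' y \<notin> ?S" using J'max ad(2) by blast
    then show ?thesis using sub ad(1) by blast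
  qed
  have m_b: "a \<otimes>\<^bsub>R\<^esub> b \<in> J'" if a: "a \<in> max_ideal k R" for a
  proof (rule ccontr)
    assume n: "a \<otimes>\<^bsub>R\<^esub> b \<notin> J'"
    have ac: "a \<in> carrier R" using ideal.Icarr[OF R.m_ideal a] .
    have "b \<in> adjoin R J' (a \<otimes>\<^bsub>R\<^esub> b)" using full[OF ideal.I_l_closed[OF J b(1) ac] n] b(1) by simp
    then obtain j s where js: "j \<in> J'" "s \<in> carrier R" "b = j \<oplus>\<^bsub>R\<^esub> s \<otimes>\<^bsub>R\<^esub> (a \<otimes>\<^bsub>R\<^esub> b)" by (auto simp: adjoin_def)
    have "(\<one>\<^bsub>R\<^esub> \<ominus>\<^bsub>R\<^esub> s \<otimes>\<^bsub>R\<^esub> a) \<otimes>\<^bsub>R\<^esub> b = b \<ominus>\<^bsub>R\<^esub> s \<otimes>\<^bsub>R\<^esub> (a \<otimes>\<^bsub>R\<^esub> b)"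
      using js(2) ac bc by (simp add: R.minus_eq R.l_distr R.l_minus R.m_assoc)
    also have "\<dots> = (j \<oplus>\<^bsub>R\<^esub> s \<otimes>\<^bsub>R\<^esub> (a \<otimes>\<^bsub>R\<^esub> b)) \<ominus>\<^bsub>R\<^esub> s \<otimes>\<^bsub>R\<^esub> (a \<otimes>\<^bsub>R\<^esub> b)" using js(3) by simp
    also have "\<dots> = j" using js(2) J'c[OF js(1)] ac bc by algebra
    finally show False
      using R.one_minus_mult[OF ideal.I_l_closed[OF R.m_ideal a js(2)] bc J'(1)] js(1) b(2) by simp
  qed
  have coord: "\<exists>s\<in>carrier R. y \<ominus>\<^bsub>R\<^esub> s \<otimes>\<^bsub>R\<^esub> b \<in> J'" if y: "y \<in> J" for y
  proof -
    obtain j s where js: "j \<in> J'" "s \<in> carrier R" "y = j \<oplus>\<^bsub>R\<^esub> s \<otimes>\<^bsub>R\<^esub> b"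
      using y full[OF b] by (auto simp: adjoin_def)
    have "y \<ominus>\<^bsub>R\<^esub> s \<otimes>\<^bsub>R\<^esub> b = j" unfolding js(3) using js(2) J'c[OF js(1)] bc by algebra
    then show ?thesis by (intro bexI[of _ s]) (simp_all only: js)
  qed
  \<comment> \<open>The coordinate on J/J' with respect to b. The coefficient of b is determined
    only up to the maximal ideal, so its residue is recorded.\<close>
  define \<mu> where "\<mu> y = red R (SOME s. s \<in> carrier R \<and> y \<ominus>\<^bsub>R\<^esub> s \<otimes>\<^bsub>R\<^esub> b \<in> J')" for y
  have s_b: "s \<otimes>\<^bsub>R\<^esub> b \<in> J' \<longleftrightarrow> red R s = \<zero>\<^bsub>k\<^esub>" if s: "s \<in> carrier R" for s
  proof
    assume sb: "s \<otimes>\<^bsub>R\<^esub> b \<in> J'"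
    show "red R s = \<zero>\<^bsub>k\<^esub>"
    proof (rule ccontr)
      assume "red R s \<noteq> \<zero>\<^bsub>k\<^esub>"
      then have un: "s \<in> Units R" using R.m_unit[OF s] by (simp add: mem_max_ideal)
      then have "inv\<^bsub>R\<^esub> s \<otimes>\<^bsub>R\<^esub> (s \<otimes>\<^bsub>R\<^esub> b) \<in> J'" using ideal.I_l_closed[OF J'(1) sb] by simp
      moreover have "inv\<^bsub>R\<^esub> s \<otimes>\<^bsub>R\<^esub> (s \<otimes>\<^bsub>R\<^esub> b) = b" using un bc s by (simp flip: R.m_assoc)
      ultimately show False using b(2) by simp
    qed
  qed (use s m_b in \<open>simp add: mem_max_ideal\<close>)
  have \<mu>: "\<mu> y = red R s" if y: "y \<in> J" and s: "s \<in> carrier R" "y \<ominus>\<^bsub>R\<^esub> s \<otimes>\<^bsub>R\<^esub> b \<in> J'" for y s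
  proof -
    define t where "t = (SOME s. s \<in> carrier R \<and> y \<ominus>\<^bsub>R\<^esub> s \<otimes>\<^bsub>R\<^esub> b \<in> J')"
    have "\<exists>s. s \<in> carrier R \<and> y \<ominus>\<^bsub>R\<^esub> s \<otimes>\<^bsub>R\<^esub> b \<in> J'" using s by blast
    from someI_ex[OF this] have t: "t \<in> carrier R" "y \<ominus>\<^bsub>R\<^esub> t \<otimes>\<^bsub>R\<^esub> b \<in> J'" by (auto simp: t_def)
    have "(y \<ominus>\<^bsub>R\<^esub> s \<otimes>\<^bsub>R\<^esub> b) \<ominus>\<^bsub>R\<^esub> (y \<ominus>\<^bsub>R\<^esub> t \<otimes>\<^bsub>R\<^esub> b) = (t \<ominus>\<^bsub>R\<^esub> s) \<otimes>\<^bsub>R\<^esub> b"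
      using Jc[OF y] s(1) t(1) bc by algebra
    then have "(t \<ominus>\<^bsub>R\<^esub> s) \<otimes>\<^bsub>R\<^esub> b \<in> J'" using R.ideal_minus_closed[OF J'(1) s(2) t(2)] by simp
    then have "red R t \<ominus>\<^bsub>k\<^esub> red R s = \<zero>\<^bsub>k\<^esub>" using s_b[of "t \<ominus>\<^bsub>R\<^esub> s"] s(1) t(1) by (simp add: R.minus_eq k.minus_eq)
    then have "red R t = red R s" using s(1) t(1) k.r_right_minus_eq by auto
    then show ?thesis by (simp add: \<mu>_def t_def)
  qed
  have \<mu>_closed: "\<mu> y \<in> carrier k" if "y \<in> J" for y using coord[OF that] \<mu>[OF that] by auto
  have \<mu>_add: "\<mu> (y \<oplus>\<^bsub>R\<^esub> z) = \<mu> y \<oplus>\<^bsub>k\<^esub> \<mu> z" if yz: "y \<in> J" "z \<in> J" for y z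
  proof -
    obtain s t where st: "s \<in> carrier R" "y \<ominus>\<^bsub>R\<^esub> s \<otimes>\<^bsub>R\<^esub> b \<in> J'" "t \<in> carrier R" "z \<ominus>\<^bsub>R\<^esub> t \<otimes>\<^bsub>R\<^esub> b \<in> J'"
      using coord[OF yz(1)] coord[OF yz(2)] by blast
    have "(y \<oplus>\<^bsub>R\<^esub> z) \<ominus>\<^bsub>R\<^esub> (s \<oplus>\<^bsub>R\<^esub> t) \<otimes>\<^bsub>R\<^esub> b = (y \<ominus>\<^bsub>R\<^esub> s \<otimes>\<^bsub>R\<^esub> b) \<oplus>\<^bsub>R\<^esub> (z \<ominus>\<^bsub>R\<^esub> t \<otimes>\<^bsub>R\<^esub> b)"
      using Jc[OF yz(1)] Jc[OF yz(2)] st(1,3) bc by algebra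
    then have "\<mu> (y \<oplus>\<^bsub>R\<^esub> z) = red R (s \<oplus>\<^bsub>R\<^esub> t)"
      using R.ideal_a_closed[OF J'(1) st(2,4)] R.ideal_a_closed[OF J yz] st(1,3) by (intro \<mu>) auto
    then show ?thesis using \<mu>[OF yz(1) st(1,2)] \<mu>[OF yz(2) st(3,4)] st(1,3) by simp
  qed
  have \<mu>_mult: "\<mu> (c \<otimes>\<^bsub>R\<^esub> y) = red R c \<otimes>\<^bsub>k\<^esub> \<mu> y" if c: "c \<in> carrier R" and y: "y \<in> J" for c y
  proof -
    obtain s where s: "s \<in> carrier R" "y \<ominus>\<^bsub>R\<^esub> s \<otimes>\<^bsub>R\<^esub> b \<in> J'" using coord[OF y] by blast
    have "c \<otimes>\<^bsub>R\<^esub> y \<ominus>\<^bsub>R\<^esub> (c \<otimes>\<^bsub>R\<^esub> s) \<otimes>\<^bsub>R\<^esub> b = c \<otimes>\<^bsub>R\<^esub> (y \<ominus>\<^bsub>R\<^esub> s \<otimes>\<^bsub>R\<^esub> b)"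
      using Jc[OF y] s(1) c bc by algebra
    then have "\<mu> (c \<otimes>\<^bsub>R\<^esub> y) = red R (c \<otimes>\<^bsub>R\<^esub> s)"
      using ideal.I_l_closed[OF J'(1) s(2) c] ideal.I_l_closed[OF J y c] s(1) c by (intro \<mu>) auto
    then show ?thesis using \<mu>[OF y s] s(1) c by simp
  qed
  have \<mu>_0: "\<mu> y = \<zero>\<^bsub>k\<^esub> \<longleftrightarrow> y \<in> J'" if y: "y \<in> J" for y
  proof
    assume 0: "\<mu> y = \<zero>\<^bsub>k\<^esub>"
    obtain s where s: "s \<in> carrier R" "y \<ominus>\<^bsub>R\<^esub> s \<otimes>\<^bsub>R\<^esub> b \<in> J'" using coord[OF y] by blast
    have "s \<otimes>\<^bsub>R\<^esub> b \<in> J'" using s_b[OF s(1)] \<mu>[OF y s] 0 by simp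
    from R.ideal_a_closed[OF J'(1) s(2) this] have "(y \<ominus>\<^bsub>R\<^esub> s \<otimes>\<^bsub>R\<^esub> b) \<oplus>\<^bsub>R\<^esub> s \<otimes>\<^bsub>R\<^esub> b \<in> J'" .
    moreover have "(y \<ominus>\<^bsub>R\<^esub> s \<otimes>\<^bsub>R\<^esub> b) \<oplus>\<^bsub>R\<^esub> s \<otimes>\<^bsub>R\<^esub> b = y" using Jc[OF y] s(1) bc by algebra
    ultimately show "y \<in> J'" by simp
  next
    assume "y \<in> J'"
    then have "y \<ominus>\<^bsub>R\<^esub> \<zero>\<^bsub>R\<^esub> \<otimes>\<^bsub>R\<^esub> b \<in> J'" using J'c bc by (simp add: R.minus_eq)
    then show "\<mu> y = \<zero>\<^bsub>k\<^esub>" using \<mu>[OF y R.zero_closed] by simp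
  qed
  \<comment> \<open>A surjection onto k[\<epsilon>] that sees the J-component modulo J'. Composition
    with e kills the \<epsilon>-part, whereas b has \<epsilon>-part \<one>.\<close>
  define \<delta> where "\<delta> z = (red R z, \<mu> (z \<ominus>\<^bsub>R\<^esub> e z))" for z
  let ?D = "dual_numbers k"
  have D_simps: "carrier ?D = carrier k \<times> carrier k" "\<one>\<^bsub>?D\<^esub> = (\<one>\<^bsub>k\<^esub>, \<zero>\<^bsub>k\<^esub>)" "\<zero>\<^bsub>?D\<^esub> = (\<zero>\<^bsub>k\<^esub>, \<zero>\<^bsub>k\<^esub>)"
    "\<And>a b c d. (a, b) \<otimes>\<^bsub>?D\<^esub> (c, d) = (a \<otimes>\<^bsub>k\<^esub> c, (a \<otimes>\<^bsub>k\<^esub> d) \<oplus>\<^bsub>k\<^esub> (b \<otimes>\<^bsub>k\<^esub> c))"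
    "\<And>a b c d. (a, b) \<oplus>\<^bsub>?D\<^esub> (c, d) = (a \<oplus>\<^bsub>k\<^esub> c, b \<oplus>\<^bsub>k\<^esub> d)" "\<And>w. alg ?D w = (w 0, \<zero>\<^bsub>k\<^esub>)" "red ?D = fst"
    by (simp_all add: dual_numbers_def)
  have \<mu>0: "\<mu> \<zero>\<^bsub>R\<^esub> = \<zero>\<^bsub>k\<^esub>" using \<mu>_0[of "\<zero>\<^bsub>R\<^esub>"] R.ideal_zero_closed[OF J] R.ideal_zero_closed[OF J'(1)] by simp
  have \<delta>_hom: "\<delta> \<in> ring_hom R ?D"
  proof (rule ring_hom_memI)
    show "\<delta> z \<in> carrier ?D" if "z \<in> carrier R" for z using \<mu>_closed[OF diff_J[OF that]] that by (simp add: \<delta>_def D_simps)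
    show "\<delta> \<one>\<^bsub>R\<^esub> = \<one>\<^bsub>?D\<^esub>" using \<mu>0 by (simp add: \<delta>_def D_simps e_one R.diff_self)
    fix y z assume yz: "y \<in> carrier R" "z \<in> carrier R"
    note c = yz e[OF yz(1)] e[OF yz(2)] and d = diff_J[OF yz(1)] diff_J[OF yz(2)]
    have "y \<oplus>\<^bsub>R\<^esub> z \<ominus>\<^bsub>R\<^esub> (e y \<oplus>\<^bsub>R\<^esub> e z) = (y \<ominus>\<^bsub>R\<^esub> e y) \<oplus>\<^bsub>R\<^esub> (z \<ominus>\<^bsub>R\<^esub> e z)" using c by algebra
    then show "\<delta> (y \<oplus>\<^bsub>R\<^esub> z) = \<delta> y \<oplus>\<^bsub>?D\<^esub> \<delta> z"
      using yz \<mu>_add[OF d] by (simp add: \<delta>_def D_simps e_add)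
    have "y \<otimes>\<^bsub>R\<^esub> z \<ominus>\<^bsub>R\<^esub> e y \<otimes>\<^bsub>R\<^esub> e z = y \<otimes>\<^bsub>R\<^esub> (z \<ominus>\<^bsub>R\<^esub> e z) \<oplus>\<^bsub>R\<^esub> e z \<otimes>\<^bsub>R\<^esub> (y \<ominus>\<^bsub>R\<^esub> e y)" using c by algebra
    then have "\<mu> (y \<otimes>\<^bsub>R\<^esub> z \<ominus>\<^bsub>R\<^esub> e y \<otimes>\<^bsub>R\<^esub> e z) = red R y \<otimes>\<^bsub>k\<^esub> \<mu> (z \<ominus>\<^bsub>R\<^esub> e z) \<oplus>\<^bsub>k\<^esub> red R z \<otimes>\<^bsub>k\<^esub> \<mu> (y \<ominus>\<^bsub>R\<^esub> e y)"
      using \<mu>_add[OF ideal.I_l_closed[OF J d(2) c(1)] ideal.I_l_closed[OF J d(1) c(4)]]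
        \<mu>_mult[OF c(1) d(2)] \<mu>_mult[OF c(4) d(1)] e_red[OF yz(2)] by simp
    then show "\<delta> (y \<otimes>\<^bsub>R\<^esub> z) = \<delta> y \<otimes>\<^bsub>?D\<^esub> \<delta> z"
      using yz \<mu>_closed[OF d(1)] by (simp add: \<delta>_def D_simps e_mult k.m_comm)
  qed
  have \<delta>_surj: "\<delta> ` carrier R = carrier ?D"
  proof
    show "\<delta> ` carrier R \<subseteq> carrier ?D" using ring_hom_closed[OF \<delta>_hom] by blast
    show "carrier ?D \<subseteq> \<delta> ` carrier R"
    proof
      fix cd assume "cd \<in> carrier ?D"
      then obtain c d where cd: "cd = (c, d)" "c \<in> carrier k" "d \<in> carrier k" by (auto simp: D_simps)
      have "red R ` carrier R = carrier k" using Rl by (simp add: local_walg_def)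
      then obtain s t where st: "s \<in> carrier R" "red R s = c" "t \<in> carrier R" "red R t = d"
        using cd(2,3) by (metis imageE)
      define z where "z = e s \<oplus>\<^bsub>R\<^esub> t \<otimes>\<^bsub>R\<^esub> b"
      have tb: "t \<otimes>\<^bsub>R\<^esub> b \<in> J" by (rule ideal.I_l_closed[OF J b(1) st(3)])
      have z: "z \<in> carrier R" "e z = e s" using e e_add e_idem st(1) Jc[OF tb] e_J[OF tb] by (auto simp: z_def)
      have "(e s \<oplus>\<^bsub>R\<^esub> t \<otimes>\<^bsub>R\<^esub> b) \<ominus>\<^bsub>R\<^esub> e s = t \<otimes>\<^bsub>R\<^esub> b" using e[OF st(1)] st(3) bc by algebra
      then have "z \<ominus>\<^bsub>R\<^esub> e z = t \<otimes>\<^bsub>R\<^esub> b" by (simp only: z(2)) (simp only: z_def)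
      moreover have "\<mu> (t \<otimes>\<^bsub>R\<^esub> b) = d"
        using \<mu>[OF tb st(3)] Jc[OF tb] R.ideal_zero_closed[OF J'(1)] st(4) by (simp add: R.diff_self)
      moreover have "red R z = c"
        using e[OF st(1)] Jc[OF tb] J_red[OF tb] e_red[OF st(1)] st(2) cd(2) by (simp add: z_def)
      ultimately have "\<delta> z = cd" by (simp add: \<delta>_def cd(1))
      then show "cd \<in> \<delta> ` carrier R" using z(1) by blast
    qed
  qed
  have \<delta>_alg: "\<delta> (alg R w) = alg ?D w" if "w \<in> carrier (witt p k)" for w
    using e_alg[OF that] alg_closed[OF Rl that] Rl that \<mu>0 by (simp add: \<delta>_def D_simps R.diff_self local_walg_def)
  have \<delta>_red: "red ?D (\<delta> z) = red R z" for z by (simp add: \<delta>_def D_simps)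
  have \<delta>_zero: "\<delta> \<zero>\<^bsub>R\<^esub> = \<zero>\<^bsub>?D\<^esub>" using \<mu>0 by (simp add: \<delta>_def D_simps e_zero R.diff_self)
  have Dl: "local_walg p k ?D"
    by (rule local_walg_image[OF Rl \<delta>_hom \<delta>_surj \<delta>_zero \<delta>_alg[symmetric] \<delta>_red])
  interpret D: cring ?D by (rule local_walg_cring[OF Dl])
  interpret \<delta>: ring_hom_cring R ?D \<delta> by (rule ring_hom_cringI2[OF R.is_cring D.is_cring \<delta>_hom])
  \<comment> \<open>\<open>dual_numbers k\<close> lives in another type. The quotient by this kernel
    is an isomorphic copy in the type of R, and it is artinian because the kernel contains the
    square of the maximal ideal.\<close>
  define K where "K = {z \<in> carrier R. \<delta> z = \<zero>\<^bsub>?D\<^esub>}"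
  have K: "ideal K R" unfolding K_def by (rule R.idealI_cring) auto
  have Km: "K \<subseteq> max_ideal k R" by (auto simp: K_def \<delta>_def D_simps mem_max_ideal)
  obtain A \<pi> where q: "walg_quotient R K A \<pi>" using walg_quotient_ex[OF Rl K Km] by blast
  note qD = walg_quotientD[OF Rl q]
  have mp: "m_pow R (Suc 1) \<subseteq> K"
  proof (rule R.ideal_pow_subset[OF R.m_ideal K])
    fix y z assume "y \<in> m_pow R 1" "z \<in> max_ideal k R"
    then have yz: "y \<in> carrier R" "red R y = \<zero>\<^bsub>k\<^esub>" "z \<in> carrier R" "red R z = \<zero>\<^bsub>k\<^esub>"
      unfolding R.ideal_pow_1[OF R.m_ideal] by (auto simp: mem_max_ideal)
    have "\<delta> (y \<otimes>\<^bsub>R\<^esub> z) = \<delta> y \<otimes>\<^bsub>?D\<^esub> \<delta> z" using yz by simp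
    also have "\<dots> = \<zero>\<^bsub>?D\<^esub>"
      using yz \<mu>_closed[OF diff_J[OF yz(1)]] \<mu>_closed[OF diff_J[OF yz(3)]] by (simp add: \<delta>_def D_simps)
    finally show "y \<otimes>\<^bsub>R\<^esub> z \<in> K" using yz by (simp add: K_def)
  qed
  have "noetherian_ring R" using R by (simp add: Art_hat_def)
  then have A: "A \<in> Art p k" by (rule Art_quotient[OF Rl _ q mp])
  have "restrict \<delta> (carrier R) \<in> walg_hom p k R ?D"
  proof (rule walg_homI)
    show "restrict \<delta> (carrier R) \<in> ring_hom R ?D" by (rule R.ring_hom_restrict[OF \<delta>_hom]) simp
  qed (simp_all add: \<delta>_alg alg_closed[OF Rl] \<delta>_red)
  from walg_quotient_factor[OF Rl q Dl this] obtain g where g: "g \<in> walg_hom p k A ?D" "\<And>z. z \<in> carrier R \<Longrightarrow> g (\<pi> z) = \<delta> z"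
    by (auto simp: K_def)
  have "bij_betw g (carrier A) (carrier ?D)"
    unfolding bij_betw_def
  proof
    show "inj_on g (carrier A)"
    proof (rule inj_onI)
      fix y z assume yz: "y \<in> carrier A" "z \<in> carrier A" "g y = g z"
      obtain s t where st: "s \<in> carrier R" "y = \<pi> s" "t \<in> carrier R" "z = \<pi> t" using qD(4)[OF yz(1)] qD(4)[OF yz(2)] by blast
      have "\<delta> s = \<delta> t" using yz(3) g(2) st by simp
      then have "\<delta> (s \<ominus>\<^bsub>R\<^esub> t) = \<zero>\<^bsub>?D\<^esub>" using st(1,3) by (simp add: R.minus_eq D.r_neg)
      then show "y = z" using walg_quotient_eq_iff[OF Rl q st(1,3)] st by (simp add: K_def)
    qed
    have "g ` carrier A = (\<lambda>z. g (\<pi> z)) ` carrier R" using qD(6) by (metis image_image)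
    then show "g ` carrier A = carrier ?D" using g(2) \<delta>_surj by simp
  qed
  then have iso: "walg_iso p k ?D A \<noteq> {}"
    using walg_iso_inv[OF qD(1) Dl, of g] g(1) by (auto simp: walg_iso_def)
  have eh: "compose (carrier R) u v \<in> walg_hom p k R R" by (rule walg_hom_compose[OF Rl Sl Rl v u])
  \<comment> \<open>Both maps agree after composition with u, as v after u is the identity;
    injectivity on tangent vectors identifies them. At b this contradicts b lying outside
    J'.\<close>
  have "\<pi> = compose (carrier R) \<pi> (compose (carrier R) u v)"
  proof (rule tangent[OF A iso qD(2) walg_hom_compose[OF Rl Rl qD(1) eh qD(2)]])
    show "compose (carrier S) \<pi> u = compose (carrier S) (compose (carrier R) \<pi> (compose (carrier R) u v)) u"
      using vu by (auto simp: compose_def fun_eq_iff)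
  qed
  then have "\<pi> b = \<pi> (e b)" using bc by (metis compose_apply e_def)
  also have "\<dots> = \<zero>\<^bsub>A\<^esub>" using e_J[OF b(1)] qD(5)[OF R.zero_closed] R.ideal_zero_closed[OF K] by simp
  finally have "b \<in> K" using qD(5)[OF bc] by simp
  then have "\<mu> (b \<ominus>\<^bsub>R\<^esub> e b) = \<zero>\<^bsub>k\<^esub>" by (simp add: K_def \<delta>_def D_simps)
  then have "b \<in> J'" using \<mu>_0[OF b(1)] e_J[OF b(1)] bc by (simp add: R.minus_eq)
  then show False using b(2) by simp
qed

text \<open>Such a B is a copy of k through its residue map, so the residue map of R followed by the
  inverse identification will do.\<close>

lemma residue_hom:
  fixes R :: "('a, 'k) walg" and B :: "('b, 'k) walg"
  assumes R: "local_walg p k R" and B: "local_walg p k B" and inj: "\<And>y. y \<in> carrier B \<Longrightarrow> red B y = \<zero>\<^bsub>k\<^esub> \<Longrightarrow> y = \<zero>\<^bsub>B\<^esub>"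
  shows "\<exists>f. f \<in> walg_hom p k R B"
proof -
  interpret R: cring R by (rule local_walg_cring[OF R])
  interpret B: cring B by (rule local_walg_cring[OF B])
  interpret rB: ring_hom_cring B k "red B" by (rule red_hom_ring[OF B])
  have eq: "y = z" if "y \<in> carrier B" "z \<in> carrier B" "red B y = red B z" for y z
  proof -
    have "red B (y \<ominus>\<^bsub>B\<^esub> z) = \<zero>\<^bsub>k\<^esub>" using that by (simp add: B.minus_eq k.r_neg)
    then have "y \<ominus>\<^bsub>B\<^esub> z = \<zero>\<^bsub>B\<^esub>" using inj that by simp
    then show ?thesis using that B.r_right_minus_eq by blast
  qed
  have bij: "bij_betw (red B) (carrier B) (carrier k)"
    using eq B unfolding bij_betw_def local_walg_def by (auto intro: inj_onI)
  have "inv_into (carrier B) (red B) \<in> ring_iso k B"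
    using ring_iso_set_sym[OF B.ring_axioms, of "red B" k] bij rB.homh by (simp add: ring_iso_def)
  then have h: "inv_into (carrier B) (red B) \<in> ring_hom k B" by (simp add: ring_iso_def)
  have inv: "red B (inv_into (carrier B) (red B) c) = c" "inv_into (carrier B) (red B) c \<in> carrier B" if "c \<in> carrier k" for c
    using bij that by (auto simp: bij_betw_def f_inv_into_f inv_into_into)
  have "red R \<in> ring_hom R k" using R by (simp add: local_walg_def)
  from ring_hom_trans[OF this h] have h2: "inv_into (carrier B) (red B) \<circ> red R \<in> ring_hom R B" .
  have rc: "red R x \<in> carrier k" if "x \<in> carrier R" for x
    using ring_hom_closed[OF \<open>red R \<in> ring_hom R k\<close> that] .
  let ?f = "restrict (inv_into (carrier B) (red B) \<circ> red R) (carrier R)"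
  have "?f \<in> walg_hom p k R B"
  proof (rule walg_homI)
    show "?f \<in> ring_hom R B" by (rule R.ring_hom_restrict[OF h2]) simp
    show red: "red B (?f x) = red R x" if "x \<in> carrier R" for x using inv rc that by simp
    show "?f (alg R w) = alg B w" if w: "w \<in> carrier (witt p k)" for w
    proof (rule eq)
      show "?f (alg R w) \<in> carrier B" using inv rc alg_closed[OF R w] by simp
      show "red B (?f (alg R w)) = red B (alg B w)"
        using red[OF alg_closed[OF R w]] R B w by (simp add: local_walg_def)
    qed (rule alg_closed[OF B w])
  qed simp
  then show ?thesis by blast
qed

text \<open>Smoothness concerns \<open>Art\<close> only, so the retraction onto S is built as a
  compatible system of maps from R to the quotients S/m^(n+1). At n = 0 the map is forced by
  residues; each passage to n+1 is one application of smoothness to a transition map.\<close>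

theorem hull_unique:
  fixes R S :: "('u, 'k) walg" and D :: "('u, 'k, 'x) set_functor"
  assumes S: "S \<in> Art_hat p k" and \<eta>: "nat_iso p k (hom_functor p k S) D \<eta>" and \<xi>: "versal_hull p k R \<xi> D"
  obtains u where "u \<in> walg_iso p k S R"
    "\<And>A f. \<lbrakk>A \<in> Art p k; f \<in> walg_hom p k R A\<rbrakk> \<Longrightarrow> \<xi> A f = \<eta> A (compose (carrier S) f u)"
proof -
  have R: "R \<in> Art_hat p k" and sm: "smooth_trans p k (hom_functor p k R) D \<xi>"
    and tan: "\<And>A. \<lbrakk>A \<in> Art p k; walg_iso p k (dual_numbers k) A \<noteq> {}\<rbrakk> \<Longrightarrow> bij_betw (\<xi> A) (walg_hom p k R A) (fobj D A)"
    using \<xi> by (simp_all add: versal_hull_def hom_functor_simps)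
  note Rl = Art_hat_local[OF R] and Sl = Art_hat_local[OF S]
  have \<xi>D: "\<And>A x. \<lbrakk>A \<in> Art p k; x \<in> walg_hom p k R A\<rbrakk> \<Longrightarrow> \<xi> A x \<in> fobj D A"
    "\<And>A B f x. \<lbrakk>A \<in> Art p k; B \<in> Art p k; f \<in> walg_hom p k A B; x \<in> walg_hom p k R A\<rbrakk> \<Longrightarrow>
      \<xi> B (compose (carrier R) f x) = fmap D A B f (\<xi> A x)"
    using sm by (simp_all add: smooth_trans_def nat_trans_def hom_functor_simps)
  have \<eta>D: "\<And>A. A \<in> Art p k \<Longrightarrow> bij_betw (\<eta> A) (walg_hom p k S A) (fobj D A)"
    "\<And>A B f x. \<lbrakk>A \<in> Art p k; B \<in> Art p k; f \<in> walg_hom p k A B; x \<in> walg_hom p k S A\<rbrakk> \<Longrightarrow>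
      \<eta> B (compose (carrier S) f x) = fmap D A B f (\<eta> A x)"
    using nat_isoD[OF \<eta>] by (simp_all add: hom_functor_simps)
  have \<eta>inj: "f = g" if "A \<in> Art p k" "f \<in> walg_hom p k S A" "g \<in> walg_hom p k S A" "\<eta> A f = \<eta> A g" for A f g
    using \<eta>D(1)[OF that(1)] that by (auto simp: bij_betw_def inj_on_def)
  \<comment> \<open>Bijectivity of \<eta> turns \<xi> into a transformation between the two Hom
    functors, which Yoneda realises by a ring homomorphism u.\<close>
  define T where "T A f = inv_into (walg_hom p k S A) (\<eta> A) (\<xi> A f)" for A :: "('u, 'k) walg" and f
  have T: "T A f \<in> walg_hom p k S A" "\<eta> A (T A f) = \<xi> A f" if "A \<in> Art p k" "f \<in> walg_hom p k R A" for A f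
    using \<eta>D(1)[OF that(1)] \<xi>D(1)[OF that] by (auto simp: T_def bij_betw_def inv_into_into f_inv_into_f)
  have T_nat: "T B (compose (carrier R) g f) = compose (carrier S) g (T A f)"
    if a: "A \<in> Art p k" "B \<in> Art p k" "g \<in> walg_hom p k A B" "f \<in> walg_hom p k R A" for A B f g
  proof (rule \<eta>inj[OF a(2)])
    have gf: "compose (carrier R) g f \<in> walg_hom p k R B"
      by (rule walg_hom_compose[OF Rl Art_local[OF a(1)] Art_local[OF a(2)] a(4,3)])
    show "T B (compose (carrier R) g f) \<in> walg_hom p k S B" by (rule T(1)[OF a(2) gf])
    show "compose (carrier S) g (T A f) \<in> walg_hom p k S B"
      by (rule walg_hom_compose[OF Sl Art_local[OF a(1)] Art_local[OF a(2)] T(1)[OF a(1,4)] a(3)])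
    show "\<eta> B (T B (compose (carrier R) g f)) = \<eta> B (compose (carrier S) g (T A f))"
      using T(2)[OF a(2) gf] \<xi>D(2)[OF a] \<eta>D(2)[OF a(1-3) T(1)[OF a(1,4)]] T(2)[OF a(1,4)] by simp
  qed
  obtain u where u: "u \<in> walg_hom p k S R" and Tu: "\<And>(A :: ('u, 'k) walg) f. \<lbrakk>A \<in> Art p k; f \<in> walg_hom p k R A\<rbrakk> \<Longrightarrow> T A f = compose (carrier S) f u"
    by (rule yoneda[where T = T, OF R S T(1) T_nat]) blast+
  have \<xi>u: "\<xi> A f = \<eta> A (compose (carrier S) f u)" if "A \<in> Art p k" "f \<in> walg_hom p k R A" for A f
    using T(2)[OF that] Tu[OF that] by simp
  obtain A :: "nat \<Rightarrow> ('u, 'k) walg" and \<pi> where t: "tower S A \<pi>" using tower_ex[OF S] by blast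
  have \<pi>: "\<pi> n \<in> walg_hom p k S (A n)" for n by (rule tower_hom[OF S t])
  obtain \<tau> where \<tau>: "\<And>n. \<tau> n \<in> walg_hom p k (A (Suc n)) (A n)" "\<And>n. \<tau> n ` carrier (A (Suc n)) = carrier (A n)"
    "\<And>n x. x \<in> carrier S \<Longrightarrow> \<tau> n (\<pi> (Suc n) x) = \<pi> n x"
    using tower_transition[OF S t] by metis
  let ?P = "\<lambda>n f. f \<in> walg_hom p k R (A n) \<and> compose (carrier S) f u = \<pi> n"
  have "\<exists>f. ?P 0 f"
  proof -
    note q = towerD(1)[OF t, of 0] and D = walg_quotientD[OF Sl towerD(1)[OF t, of 0]]
    interpret S: local_cring S "max_ideal k S" by (rule local_walg_local_cring[OF Sl])
    have inj: "y = \<zero>\<^bsub>A 0\<^esub>" if y: "y \<in> carrier (A 0)" "red (A 0) y = \<zero>\<^bsub>k\<^esub>" for y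
    proof -
      obtain x where x: "x \<in> carrier S" "y = \<pi> 0 x" using D(4)[OF y(1)] by blast
      then have "x \<in> max_ideal k S" using walg_homD(4)[OF Sl D(1,2)] y(2) by (simp add: mem_max_ideal)
      then have "x \<in> m_pow S (Suc 0)" using S.ideal_pow_1[OF S.m_ideal] unfolding One_nat_def by blast
      then show ?thesis using D(5)[OF x(1)] x(2) by blast
    qed
    obtain f where f: "f \<in> walg_hom p k R (A 0)" using residue_hom[OF Rl D(1) inj] by blast
    interpret A0: cring "A 0" by (rule local_walg_cring[OF D(1)])
    interpret r0: ring_hom_cring "A 0" k "red (A 0)" by (rule red_hom_ring[OF D(1)])
    have "compose (carrier S) f u = \<pi> 0"
    proof (rule walg_hom_eqI[OF walg_hom_compose[OF Sl Rl D(1) u f] D(2)])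
      fix x assume x: "x \<in> carrier S"
      have c: "f (u x) \<in> carrier (A 0)" "\<pi> 0 x \<in> carrier (A 0)"
        using walg_homD(5)[OF Rl D(1) f] walg_homD(5)[OF Sl Rl u x] D(3)[OF x] by auto
      have "red (A 0) (f (u x) \<ominus>\<^bsub>A 0\<^esub> \<pi> 0 x) = \<zero>\<^bsub>k\<^esub>"
        using c walg_homD(4)[OF Rl D(1) f walg_homD(5)[OF Sl Rl u x]] walg_homD(4)[OF Sl Rl u x] walg_homD(4)[OF Sl D(1,2) x]
        by (simp add: A0.minus_eq k.r_neg r0.hom_closed[OF c(2), unfolded walg_homD(4)[OF Sl D(1,2) x]])
      then have "f (u x) \<ominus>\<^bsub>A 0\<^esub> \<pi> 0 x = \<zero>\<^bsub>A 0\<^esub>" using inj c by simp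
      then show "compose (carrier S) f u x = \<pi> 0 x" using c x A0.r_right_minus_eq by (simp add: compose_apply)
    qed
    then show ?thesis using f by blast
  qed
  \<comment> \<open>The class to be lifted along the hull is the one that \<eta> attaches to the
    projection of S. Since \<eta> is injective, hitting this class means that composition with u
    gives the projection.\<close>
  moreover have "\<exists>f'. ?P (Suc n) f' \<and> compose (carrier R) (\<tau> n) f' = f" if f: "?P n f" for f n
  proof -
    have y: "\<eta> (A (Suc n)) (\<pi> (Suc n)) \<in> fobj D (A (Suc n))"
      using \<eta>D(1)[OF towerD(2)[OF t]] \<pi> by (auto simp: bij_betw_def)
    have "compose (carrier S) (\<tau> n) (\<pi> (Suc n)) = \<pi> n"
      by (rule walg_hom_eqI[OF walg_hom_compose[OF Sl towerD(3)[OF t] towerD(3)[OF t] \<pi> \<tau>(1)] \<pi>])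
         (simp add: compose_apply \<tau>(3))
    then have "\<xi> (A n) f = fmap D (A (Suc n)) (A n) (\<tau> n) (\<eta> (A (Suc n)) (\<pi> (Suc n)))"
      using \<xi>u[OF towerD(2)[OF t] conjunct1[OF f]] f \<eta>D(2)[OF towerD(2)[OF t] towerD(2)[OF t] \<tau>(1) \<pi>, of n] by simp
    then obtain z where z: "z \<in> walg_hom p k R (A (Suc n))" "compose (carrier R) (\<tau> n) z = f"
        "\<xi> (A (Suc n)) z = \<eta> (A (Suc n)) (\<pi> (Suc n))"
      using sm towerD(2)[OF t] \<tau>(1,2) f y unfolding smooth_trans_def hom_functor_simps by metis
    have "compose (carrier S) z u = \<pi> (Suc n)"
      using z(3) \<xi>u[OF towerD(2)[OF t] z(1)]
      by (intro \<eta>inj[OF towerD(2)[OF t] walg_hom_compose[OF Sl Rl towerD(3)[OF t] u z(1)] \<pi>]) simp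
    then show ?thesis using z by blast
  qed
  ultimately obtain g where g: "\<And>n. ?P n (g n)" "\<And>n. compose (carrier R) (\<tau> n) (g (Suc n)) = g n"
    using dependent_nat_choice[of ?P "\<lambda>n f f'. compose (carrier R) (\<tau> n) f' = f"] by metis
  have "\<exists>v\<in>walg_hom p k R S. \<forall>n. \<forall>s\<in>carrier R. \<pi> n (v s) = g n s"
  proof (rule tower_limit[OF S t Rl])
    show "g n \<in> walg_hom p k R (A n)" for n using g(1) by blast
    fix n \<tau>' s
    assume \<tau>': "\<tau>' \<in> walg_hom p k (A (Suc n)) (A n)" "\<And>x. x \<in> carrier S \<Longrightarrow> \<tau>' (\<pi> (Suc n) x) = \<pi> n x" and s: "s \<in> carrier R"
    have gs: "g (Suc n) s \<in> carrier (A (Suc n))" using walg_homD(5)[OF Rl towerD(3)[OF t] conjunct1[OF g(1)] s] .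
    then obtain x where x: "x \<in> carrier S" "g (Suc n) s = \<pi> (Suc n) x"
      using walg_quotientD(4)[OF Sl towerD(1)[OF t]] by blast
    then have "\<tau>' (g (Suc n) s) = \<tau> n (g (Suc n) s)" using \<tau>'(2) \<tau>(3) by simp
    also have "\<dots> = g n s" using fun_cong[OF g(2)[of n], of s] s by (simp add: compose_apply)
    finally show "\<tau>' (g (Suc n) s) = g n s" .
  qed
  then obtain v where v: "v \<in> walg_hom p k R S" "\<And>n s. s \<in> carrier R \<Longrightarrow> \<pi> n (v s) = g n s" by blast
  note uc = walg_homD(5)[OF Sl Rl u] and vc = walg_homD(5)[OF Rl Sl v(1)]
  have vu: "v (u x) = x" if x: "x \<in> carrier S" for x
  proof (rule tower_separated[OF S t vc[OF uc[OF x]] x])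
    show "\<pi> n (v (u x)) = \<pi> n x" for n
      using v(2)[OF uc[OF x], of n] fun_cong[OF conjunct2[OF g(1)[of n]], of x] x by (simp add: compose_apply)
  qed
  interpret R: cring R by (rule local_walg_cring[OF Rl])
  interpret S: cring S by (rule local_walg_cring[OF Sl])
  interpret v: ring_hom_cring R S v by (rule walg_homD(6)[OF Rl Sl v(1)])
  \<comment> \<open>On tangent vectors \<xi> is bijective by the definition of a hull, and it
    factors through precomposition with u, which is therefore injective there.\<close>
  have kerv: "x = \<zero>\<^bsub>R\<^esub>" if "x \<in> carrier R" "v x = \<zero>\<^bsub>S\<^esub>" for x
  proof (rule retraction_injective[OF R S u v(1) vu _ that])
    fix A :: "('u, 'k) walg" and f g
    assume a: "A \<in> Art p k" "walg_iso p k (dual_numbers k) A \<noteq> {}" "f \<in> walg_hom p k R A" "g \<in> walg_hom p k R A"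
      "compose (carrier S) f u = compose (carrier S) g u"
    then have "\<xi> A f = \<xi> A g" using \<xi>u by simp
    then show "f = g" using tan[OF a(1,2)] a(3,4) by (auto simp: bij_betw_def inj_on_def)
  qed
  have uv: "u (v y) = y" if y: "y \<in> carrier R" for y
  proof -
    have c: "u (v y) \<in> carrier R" using uc vc y by blast
    have "v (u (v y) \<ominus>\<^bsub>R\<^esub> y) = \<zero>\<^bsub>S\<^esub>" using c y vu[OF vc[OF y]] by (simp add: R.minus_eq S.r_neg)
    then have "u (v y) \<ominus>\<^bsub>R\<^esub> y = \<zero>\<^bsub>R\<^esub>" using kerv c y by simp
    then show ?thesis using c y R.r_right_minus_eq by blast
  qed
  have "bij_betw u (carrier S) (carrier R)"
    by (rule bij_betwI[of _ _ _ v]) (use uc vc uv vu in auto)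
  then have "u \<in> walg_iso p k S R" using u by (simp add: walg_iso_def)
  then show thesis using that \<xi>u by blast
qed

end

section \<open>Lifting homomorphisms of finite groups\<close>

text \<open>The deformation problem reduced to group theory: \<pi> stands for the reduction of
  automorphisms over A to automorphisms over k.\<close>

locale lifting = H: group H + Q: group Q for H :: "('h, 'n) monoid_scheme" (structure) and Q :: "('q, 'm) monoid_scheme" +
  fixes \<pi> :: "'h \<Rightarrow> 'q"
  assumes \<pi>_hom: "\<pi> \<in> hom H Q" and \<pi>_surj: "\<pi> ` carrier H = carrier Q"
begin

lemma \<pi>_mult [simp]: "\<lbrakk>x \<in> carrier H; y \<in> carrier H\<rbrakk> \<Longrightarrow> \<pi> (x \<otimes> y) = \<pi> x \<otimes>\<^bsub>Q\<^esub> \<pi> y"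
  and \<pi>_closed [simp]: "x \<in> carrier H \<Longrightarrow> \<pi> x \<in> carrier Q"
  using \<pi>_hom by (auto simp: hom_def)

lemma \<pi>_group_hom: "group_hom H Q \<pi>"
  by (simp add: group_hom.intro group_hom_axioms.intro H.is_group Q.is_group \<pi>_hom)

lemma \<pi>_one [simp]: "\<pi> \<one> = \<one>\<^bsub>Q\<^esub>"
  by (rule group_hom.hom_one[OF \<pi>_group_hom])

lemma \<pi>_inv [simp]: "x \<in> carrier H \<Longrightarrow> \<pi> (inv x) = inv\<^bsub>Q\<^esub> (\<pi> x)"
  by (rule group_hom.hom_inv[OF \<pi>_group_hom])

definition "ker = {\<gamma> \<in> carrier H. \<pi> \<gamma> = \<one>\<^bsub>Q\<^esub>}"

lemma ker_carrier: "\<gamma> \<in> ker \<Longrightarrow> \<gamma> \<in> carrier H"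
  by (simp add: ker_def)

definition hlifts :: "('g, 'l) monoid_scheme \<Rightarrow> ('g \<Rightarrow> 'q) \<Rightarrow> ('g \<Rightarrow> 'h) set" where
  "hlifts G \<rho> = {\<sigma> \<in> extensional (carrier G). \<sigma> \<in> hom G H \<and> (\<forall>g\<in>carrier G. \<pi> (\<sigma> g) = \<rho> g)}"

definition hequiv :: "('g, 'l) monoid_scheme \<Rightarrow> ('g \<Rightarrow> 'q) \<Rightarrow> (('g \<Rightarrow> 'h) \<times> ('g \<Rightarrow> 'h)) set" where
  "hequiv G \<rho> = {(\<sigma>, \<tau>). \<sigma> \<in> hlifts G \<rho> \<and> \<tau> \<in> hlifts G \<rho> \<and> (\<exists>\<gamma>\<in>ker. \<forall>g\<in>carrier G. \<tau> g = \<gamma> \<otimes> \<sigma> g \<otimes> inv \<gamma>)}"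

lemma hliftsD:
  assumes "\<sigma> \<in> hlifts G \<rho>"
  shows "\<sigma> \<in> extensional (carrier G)" "g \<in> carrier G \<Longrightarrow> \<sigma> g \<in> carrier H" "g \<in> carrier G \<Longrightarrow> \<pi> (\<sigma> g) = \<rho> g"
    "\<lbrakk>g \<in> carrier G; h \<in> carrier G\<rbrakk> \<Longrightarrow> \<sigma> (g \<otimes>\<^bsub>G\<^esub> h) = \<sigma> g \<otimes> \<sigma> h"
  using assms by (auto simp: hlifts_def hom_def)

lemma hliftsI:
  assumes "\<sigma> \<in> extensional (carrier G)" "\<And>g. g \<in> carrier G \<Longrightarrow> \<sigma> g \<in> carrier H" "\<And>g. g \<in> carrier G \<Longrightarrow> \<pi> (\<sigma> g) = \<rho> g"
    "\<And>g h. \<lbrakk>g \<in> carrier G; h \<in> carrier G\<rbrakk> \<Longrightarrow> \<sigma> (g \<otimes>\<^bsub>G\<^esub> h) = \<sigma> g \<otimes> \<sigma> h"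
  shows "\<sigma> \<in> hlifts G \<rho>"
  using assms by (auto simp: hlifts_def hom_def)

lemma hlifts_eqI: "\<lbrakk>\<sigma> \<in> hlifts G \<rho>; \<tau> \<in> hlifts G \<rho>; \<And>g. g \<in> carrier G \<Longrightarrow> \<sigma> g = \<tau> g\<rbrakk> \<Longrightarrow> \<sigma> = \<tau>"
  using hliftsD(1) by (metis extensionalityI)

lemma hequivI:
  assumes "\<sigma> \<in> hlifts G \<rho>" "\<tau> \<in> hlifts G \<rho>" "\<gamma> \<in> ker" "\<And>g. g \<in> carrier G \<Longrightarrow> \<tau> g = \<gamma> \<otimes> \<sigma> g \<otimes> inv \<gamma>"
  shows "(\<sigma>, \<tau>) \<in> hequiv G \<rho>"
  using assms by (auto simp: hequiv_def)

lemma hequivE: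
  assumes "(\<sigma>, \<tau>) \<in> hequiv G \<rho>"
  obtains \<gamma> where "\<sigma> \<in> hlifts G \<rho>" "\<tau> \<in> hlifts G \<rho>" "\<gamma> \<in> ker" "\<And>g. g \<in> carrier G \<Longrightarrow> \<tau> g = \<gamma> \<otimes> \<sigma> g \<otimes> inv \<gamma>"
  using assms by (auto simp: hequiv_def)

lemma hequiv_equiv: "equiv (hlifts G \<rho>) (hequiv G \<rho>)"
proof (rule equivI)
  show "hequiv G \<rho> \<subseteq> hlifts G \<rho> \<times> hlifts G \<rho>" by (auto simp: hequiv_def)
  show "refl_on (hlifts G \<rho>) (hequiv G \<rho>)"
  proof (rule refl_onI)
    show "(\<sigma>, \<sigma>) \<in> hequiv G \<rho>" if "\<sigma> \<in> hlifts G \<rho>" for \<sigma>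
      by (rule hequivI[OF that that, of \<one>]) (use hliftsD(2)[OF that] in \<open>auto simp: ker_def\<close>)
  qed
  show "sym (hequiv G \<rho>)"
  proof (rule symI)
    fix \<sigma> \<tau> assume "(\<sigma>, \<tau>) \<in> hequiv G \<rho>"
    then obtain \<gamma> where a: "\<sigma> \<in> hlifts G \<rho>" "\<tau> \<in> hlifts G \<rho>" "\<gamma> \<in> ker" "\<And>g. g \<in> carrier G \<Longrightarrow> \<tau> g = \<gamma> \<otimes> \<sigma> g \<otimes> inv \<gamma>"
      by (rule hequivE) blast
    show "(\<tau>, \<sigma>) \<in> hequiv G \<rho>"
    proof (rule hequivI[OF a(2,1), of "inv \<gamma>"])
      show "inv \<gamma> \<in> ker" using a(3) by (simp add: ker_def)
      show "\<sigma> g = inv \<gamma> \<otimes> \<tau> g \<otimes> inv (inv \<gamma>)" if "g \<in> carrier G" for g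
        using a(4)[OF that] hliftsD(2)[OF a(1) that] ker_carrier[OF a(3)] by (simp add: H.m_assoc H.inv_mult_cancel)
    qed
  qed
  show "trans (hequiv G \<rho>)"
  proof (rule transI)
    fix \<sigma> \<tau> \<upsilon> assume st: "(\<sigma>, \<tau>) \<in> hequiv G \<rho>" and tu: "(\<tau>, \<upsilon>) \<in> hequiv G \<rho>"
    obtain \<gamma> where a: "\<sigma> \<in> hlifts G \<rho>" "\<gamma> \<in> ker" "\<And>g. g \<in> carrier G \<Longrightarrow> \<tau> g = \<gamma> \<otimes> \<sigma> g \<otimes> inv \<gamma>"
      using st by (rule hequivE) blast
    obtain \<delta> where b: "\<upsilon> \<in> hlifts G \<rho>" "\<delta> \<in> ker" "\<And>g. g \<in> carrier G \<Longrightarrow> \<upsilon> g = \<delta> \<otimes> \<tau> g \<otimes> inv \<delta>"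
      using tu by (rule hequivE) blast
    show "(\<sigma>, \<upsilon>) \<in> hequiv G \<rho>"
    proof (rule hequivI[OF a(1) b(1), of "\<delta> \<otimes> \<gamma>"])
      show "\<delta> \<otimes> \<gamma> \<in> ker" using a(2) b(2) by (simp add: ker_def)
      show "\<upsilon> g = \<delta> \<otimes> \<gamma> \<otimes> \<sigma> g \<otimes> inv (\<delta> \<otimes> \<gamma>)" if "g \<in> carrier G" for g
        using a(3)[OF that] b(3)[OF that] hliftsD(2)[OF a(1) that] ker_carrier[OF a(2)] ker_carrier[OF b(2)]
        by (simp add: H.m_assoc H.inv_mult_group)
    qed
  qed
qed

lemma conj_hlift:
  assumes \<sigma>: "\<sigma> \<in> hlifts G \<rho>" and \<gamma>: "\<gamma> \<in> ker" and G: "group G" and \<rho>: "\<And>g. g \<in> carrier G \<Longrightarrow> \<rho> g \<in> carrier Q"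
  shows "(\<sigma>, \<lambda>g\<in>carrier G. \<gamma> \<otimes> \<sigma> g \<otimes> inv \<gamma>) \<in> hequiv G \<rho>"
proof (rule hequivI[OF \<sigma> hliftsI \<gamma>])
  note c = hliftsD[OF \<sigma>] ker_carrier[OF \<gamma>]
  fix g h assume g: "g \<in> carrier G"
  show "(\<lambda>g\<in>carrier G. \<gamma> \<otimes> \<sigma> g \<otimes> inv \<gamma>) g \<in> carrier H" using c g by simp
  show "\<pi> ((\<lambda>g\<in>carrier G. \<gamma> \<otimes> \<sigma> g \<otimes> inv \<gamma>) g) = \<rho> g" using c g \<gamma> \<rho> by (simp add: ker_def)
  assume h: "h \<in> carrier G"
  then show "(\<lambda>g\<in>carrier G. \<gamma> \<otimes> \<sigma> g \<otimes> inv \<gamma>) (g \<otimes>\<^bsub>G\<^esub> h) =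
      (\<lambda>g\<in>carrier G. \<gamma> \<otimes> \<sigma> g \<otimes> inv \<gamma>) g \<otimes> (\<lambda>g\<in>carrier G. \<gamma> \<otimes> \<sigma> g \<otimes> inv \<gamma>) h"
    using c g monoid.m_closed[OF group.is_monoid[OF G]] by (simp add: H.m_assoc H.inv_mult_cancel)
qed simp_all

lemma restrict_hlift:
  assumes "\<sigma> \<in> hlifts G \<rho>" "N \<subseteq> carrier G" "\<And>m n. m \<in> N \<Longrightarrow> n \<in> N \<Longrightarrow> m \<otimes>\<^bsub>G\<^esub> n \<in> N"
  shows "restrict \<sigma> N \<in> hlifts (G\<lparr>carrier := N\<rparr>) \<rho>"
  by (rule hliftsI) (use assms hliftsD[OF assms(1)] subsetD[OF assms(2)] in auto)

lemma restrict_hequiv: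
  assumes st: "(\<sigma>, \<tau>) \<in> hequiv G \<rho>" and N: "N \<subseteq> carrier G" "\<And>m n. m \<in> N \<Longrightarrow> n \<in> N \<Longrightarrow> m \<otimes>\<^bsub>G\<^esub> n \<in> N"
  shows "(restrict \<sigma> N, restrict \<tau> N) \<in> hequiv (G\<lparr>carrier := N\<rparr>) \<rho>"
proof -
  obtain \<gamma> where a: "\<sigma> \<in> hlifts G \<rho>" "\<tau> \<in> hlifts G \<rho>" "\<gamma> \<in> ker" "\<And>g. g \<in> carrier G \<Longrightarrow> \<tau> g = \<gamma> \<otimes> \<sigma> g \<otimes> inv \<gamma>"
    using st by (rule hequivE) blast
  show ?thesis
    by (rule hequivI[OF restrict_hlift[OF a(1) N] restrict_hlift[OF a(2) N] a(3)]) (use N(1) a(4) in auto)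
qed

end

section \<open>Lifts on a normal subgroup and their conjugates\<close>

locale normal_lifting = lifting H Q \<pi> + N: normal N G
  for H :: "('h, 'n) monoid_scheme" (structure) and Q :: "('q, 'm) monoid_scheme" and \<pi>
    and G :: "('g, 'l) monoid_scheme" and N +
  fixes \<rho> :: "'g \<Rightarrow> 'q"
  assumes \<rho>: "\<rho> \<in> hom G Q"
begin

abbreviation "GN \<equiv> G\<lparr>carrier := N\<rparr>"

lemma G_group: "group G"
  by (rule N.is_group)

lemma \<rho>_closed [simp]: "g \<in> carrier G \<Longrightarrow> \<rho> g \<in> carrier Q"
  and \<rho>_mult: "\<lbrakk>g \<in> carrier G; h \<in> carrier G\<rbrakk> \<Longrightarrow> \<rho> (g \<otimes>\<^bsub>G\<^esub> h) = \<rho> g \<otimes>\<^bsub>Q\<^esub> \<rho> h"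
  using \<rho> by (auto simp: hom_def)

lemma \<rho>_group_hom: "group_hom G Q \<rho>"
  by (simp add: group_hom.intro group_hom_axioms.intro G_group Q.is_group \<rho>)

lemmas \<rho>_one = group_hom.hom_one[OF \<rho>_group_hom]
  and \<rho>_inv = group_hom.hom_inv[OF \<rho>_group_hom]

lemma N_mult: "\<lbrakk>m \<in> N; n \<in> N\<rbrakk> \<Longrightarrow> m \<otimes>\<^bsub>G\<^esub> n \<in> N"
  by (rule subgroup.m_closed[OF N.subgroup_axioms])

lemma N_conj: "\<lbrakk>g \<in> carrier G; n \<in> N\<rbrakk> \<Longrightarrow> inv\<^bsub>G\<^esub> g \<otimes>\<^bsub>G\<^esub> n \<otimes>\<^bsub>G\<^esub> g \<in> N"
  "\<lbrakk>g \<in> carrier G; n \<in> N\<rbrakk> \<Longrightarrow> g \<otimes>\<^bsub>G\<^esub> n \<otimes>\<^bsub>G\<^esub> inv\<^bsub>G\<^esub> g \<in> N"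
  by (rule N.inv_op_closed1 N.inv_op_closed2, assumption+)+

definition cj :: "'g \<Rightarrow> 'h \<Rightarrow> ('g \<Rightarrow> 'h) \<Rightarrow> 'g \<Rightarrow> 'h" where
  "cj g r \<sigma> = (\<lambda>n\<in>N. r \<otimes> \<sigma> (inv\<^bsub>G\<^esub> g \<otimes>\<^bsub>G\<^esub> n \<otimes>\<^bsub>G\<^esub> g) \<otimes> inv r)"

lemma cj_hlift:
  assumes g: "g \<in> carrier G" and r: "r \<in> carrier H" "\<pi> r = \<rho> g" and \<sigma>: "\<sigma> \<in> hlifts GN \<rho>"
  shows "cj g r \<sigma> \<in> hlifts GN \<rho>"
proof (rule hliftsI)
  have c: "\<sigma> n \<in> carrier H" "\<pi> (\<sigma> n) = \<rho> n" if "n \<in> N" for n using hliftsD(2,3)[OF \<sigma>] that by simp_all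
  fix m n assume m: "m \<in> carrier GN"
  have mN: "m \<in> N" and mG: "m \<in> carrier G" using m N.mem_carrier by simp_all
  show "cj g r \<sigma> m \<in> carrier H" using c N_conj(1)[OF g mN] r mN by (simp add: cj_def)
  show "\<pi> (cj g r \<sigma> m) = \<rho> m"
    using c N_conj(1)[OF g mN] r mN mG g
    by (simp add: cj_def \<rho>_mult \<rho>_inv Q.m_assoc) (simp flip: Q.m_assoc)
  assume n: "n \<in> carrier GN"
  have nN: "n \<in> N" and nG: "n \<in> carrier G" using n N.mem_carrier by simp_all
  have "inv\<^bsub>G\<^esub> g \<otimes>\<^bsub>G\<^esub> (m \<otimes>\<^bsub>G\<^esub> n) \<otimes>\<^bsub>G\<^esub> g =
      (inv\<^bsub>G\<^esub> g \<otimes>\<^bsub>G\<^esub> m \<otimes>\<^bsub>G\<^esub> g) \<otimes>\<^bsub>G\<^esub> (inv\<^bsub>G\<^esub> g \<otimes>\<^bsub>G\<^esub> n \<otimes>\<^bsub>G\<^esub> g)"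
    using g mG nG by (simp add: N.m_assoc N.inv_mult_cancel)
  then have "\<sigma> (inv\<^bsub>G\<^esub> g \<otimes>\<^bsub>G\<^esub> (m \<otimes>\<^bsub>G\<^esub> n) \<otimes>\<^bsub>G\<^esub> g) =
      \<sigma> (inv\<^bsub>G\<^esub> g \<otimes>\<^bsub>G\<^esub> m \<otimes>\<^bsub>G\<^esub> g) \<otimes> \<sigma> (inv\<^bsub>G\<^esub> g \<otimes>\<^bsub>G\<^esub> n \<otimes>\<^bsub>G\<^esub> g)"
    using hliftsD(4)[OF \<sigma>] N_conj(1)[OF g mN] N_conj(1)[OF g nN] by simp
  then show "cj g r \<sigma> (m \<otimes>\<^bsub>GN\<^esub> n) = cj g r \<sigma> m \<otimes> cj g r \<sigma> n"
    using c N_conj(1)[OF g mN] N_conj(1)[OF g nN] r(1) mN nN N_mult by (simp add: cj_def H.m_assoc H.inv_mult_cancel)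
qed (simp add: cj_def)

text \<open>Changing the element over \<rho> g and the representative is absorbed by the conjugator
  s \<gamma> r^-1, which lies in the kernel because r and s have the same image. Hence the action on
  classes is well defined.\<close>

lemma cj_hequiv:
  assumes g: "g \<in> carrier G" and r: "r \<in> carrier H" "\<pi> r = \<rho> g" and s: "s \<in> carrier H" "\<pi> s = \<rho> g"
    and st: "(\<sigma>, \<tau>) \<in> hequiv GN \<rho>"
  shows "(cj g r \<sigma>, cj g s \<tau>) \<in> hequiv GN \<rho>"
proof -
  obtain \<gamma> where a: "\<sigma> \<in> hlifts GN \<rho>" "\<tau> \<in> hlifts GN \<rho>" "\<gamma> \<in> ker" "\<And>g. g \<in> carrier GN \<Longrightarrow> \<tau> g = \<gamma> \<otimes> \<sigma> g \<otimes> inv \<gamma>"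
    using st by (rule hequivE) blast
  have \<gamma>: "\<gamma> \<in> carrier H" "\<pi> \<gamma> = \<one>\<^bsub>Q\<^esub>" using a(3) by (simp_all add: ker_def)
  show ?thesis
  proof (rule hequivI[OF cj_hlift[OF g r a(1)] cj_hlift[OF g s a(2)], of "s \<otimes> \<gamma> \<otimes> inv r"])
    show "s \<otimes> \<gamma> \<otimes> inv r \<in> ker" using \<gamma> r s g by (simp add: ker_def)
    fix n assume "n \<in> carrier GN"
    then have n: "n \<in> N" by simp
    show "cj g s \<tau> n = s \<otimes> \<gamma> \<otimes> inv r \<otimes> cj g r \<sigma> n \<otimes> inv (s \<otimes> \<gamma> \<otimes> inv r)"
      using a(4)[of "inv\<^bsub>G\<^esub> g \<otimes>\<^bsub>G\<^esub> n \<otimes>\<^bsub>G\<^esub> g"] hliftsD(2)[OF a(1), of "inv\<^bsub>G\<^esub> g \<otimes>\<^bsub>G\<^esub> n \<otimes>\<^bsub>G\<^esub> g"]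
        N_conj(1)[OF g n] n \<gamma>(1) r(1) s(1)
      by (simp add: cj_def H.m_assoc H.inv_mult_group H.inv_mult_cancel)
  qed
qed

lemma cj_cj_inv:
  assumes g: "g \<in> carrier G" and r: "r \<in> carrier H" and \<sigma>: "\<sigma> \<in> hlifts GN \<rho>"
  shows "cj (inv\<^bsub>G\<^esub> g) (inv r) (cj g r \<sigma>) = \<sigma>"
proof
  fix n
  show "cj (inv\<^bsub>G\<^esub> g) (inv r) (cj g r \<sigma>) n = \<sigma> n"
  proof (cases "n \<in> N")
    case True
    then have nG: "n \<in> carrier G" using N.mem_carrier by simp
    have "inv\<^bsub>G\<^esub> g \<otimes>\<^bsub>G\<^esub> (g \<otimes>\<^bsub>G\<^esub> n \<otimes>\<^bsub>G\<^esub> inv\<^bsub>G\<^esub> g) \<otimes>\<^bsub>G\<^esub> g = n"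
      using g nG by (simp add: N.m_assoc N.inv_mult_cancel)
    then show ?thesis
      using N_conj(2)[OF g True] True r hliftsD(2)[OF \<sigma>, of n] g by (simp add: cj_def H.m_assoc H.inv_mult_cancel)
  next
    case False
    then show ?thesis using hliftsD(1)[OF \<sigma>] by (simp add: cj_def extensional_def)
  qed
qed

definition invariant :: "('g \<Rightarrow> 'h) \<Rightarrow> bool" where
  "invariant \<sigma> \<longleftrightarrow> (\<forall>g\<in>carrier G. \<forall>r\<in>carrier H. \<pi> r = \<rho> g \<longrightarrow> (\<sigma>, cj g r \<sigma>) \<in> hequiv GN \<rho>)"

text \<open>The value of \<sigma> at g may serve as r, and conjugating with it reproduces the
  restriction literally; any other r gives an equivalent lift.\<close>

lemma restrict_invariant:
  assumes \<sigma>: "\<sigma> \<in> hlifts G \<rho>"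
  shows "invariant (restrict \<sigma> N)"
  unfolding invariant_def
proof (intro ballI impI)
  fix g r assume g: "g \<in> carrier G" and r: "r \<in> carrier H" "\<pi> r = \<rho> g"
  have res: "restrict \<sigma> N \<in> hlifts GN \<rho>" by (rule restrict_hlift[OF \<sigma> N.subset N_mult])
  have "cj g (\<sigma> g) (restrict \<sigma> N) = restrict \<sigma> N"
  proof (rule hlifts_eqI[OF cj_hlift[OF g hliftsD(2,3)[OF \<sigma> g] res] res])
    fix n assume "n \<in> carrier GN"
    then have n: "n \<in> N" "n \<in> carrier G" using N.mem_carrier by simp_all
    have "\<sigma> g \<otimes> \<sigma> (inv\<^bsub>G\<^esub> g \<otimes>\<^bsub>G\<^esub> n \<otimes>\<^bsub>G\<^esub> g) = \<sigma> (g \<otimes>\<^bsub>G\<^esub> (inv\<^bsub>G\<^esub> g \<otimes>\<^bsub>G\<^esub> n \<otimes>\<^bsub>G\<^esub> g))"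
      using hliftsD(4)[OF \<sigma>] g n by simp
    also have "\<dots> = \<sigma> n \<otimes> \<sigma> g"
      using hliftsD(4)[OF \<sigma>] g n by (simp add: N.m_assoc N.inv_mult_cancel)
    finally show "cj g (\<sigma> g) (restrict \<sigma> N) n = restrict \<sigma> N n"
      using hliftsD(2)[OF \<sigma>] g n N_conj(1)[OF g n(1)] by (simp add: cj_def H.m_assoc)
  qed
  moreover have "(restrict \<sigma> N, restrict \<sigma> N) \<in> hequiv GN \<rho>"
    using hequiv_equiv res by (auto simp: equiv_def refl_on_def)
  ultimately show "(restrict \<sigma> N, cj g r (restrict \<sigma> N)) \<in> hequiv GN \<rho>"
    using cj_hequiv[OF g hliftsD(2,3)[OF \<sigma> g] r, of "restrict \<sigma> N" "restrict \<sigma> N"] by simp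
qed

end

locale filtered_lifting = normal_lifting H Q \<pi> G N \<rho>
  for H :: "('h, 'n) monoid_scheme" (structure) and Q :: "('q, 'm) monoid_scheme" and \<pi>
    and G :: "('g, 'l) monoid_scheme" and N and \<rho> +
  fixes F :: "nat \<Rightarrow> 'h set" and p l :: nat
  assumes finG: "finite (carrier G)" and cop: "coprime (order (G Mod N)) p"
    and F_0: "F 0 = ker" and F_l: "F l = {\<one>}" and F_subgroup: "subgroup (F i) H" and F_Suc: "F (Suc i) \<subseteq> F i"
    and F_conj: "\<lbrakk>x \<in> carrier H; c \<in> F i\<rbrakk> \<Longrightarrow> x \<otimes> c \<otimes> inv x \<in> F i"
    and F_comm: "\<lbrakk>x \<in> F i; y \<in> F i\<rbrakk> \<Longrightarrow> x \<otimes> y \<otimes> inv (y \<otimes> x) \<in> F (Suc i)"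
    and F_pow: "x \<in> F i \<Longrightarrow> x [^] p \<in> F (Suc i)"
begin

text \<open>Over g = \<one> this is the centraliser of \<sigma>(N) in the kernel, the group in which
  the averaging takes place.\<close>

definition E where
  "E \<sigma> g = {s \<in> carrier H. \<pi> s = \<rho> g \<and> (\<forall>n\<in>N. s \<otimes> \<sigma> n = \<sigma> (g \<otimes>\<^bsub>G\<^esub> n \<otimes>\<^bsub>G\<^esub> inv\<^bsub>G\<^esub> g) \<otimes> s)}"

text \<open>Cutting the filtration of the kernel down to the centraliser keeps all its properties,
  because commutators, powers and conjugates by fibres stay in the centraliser.\<close>

lemma extension:
  assumes \<sigma>: "\<sigma> \<in> hlifts GN \<rho>"
  shows "coprime_extension G N H (E \<sigma>) \<sigma> (\<lambda>i. F i \<inter> E \<sigma> \<one>\<^bsub>G\<^esub>) p l"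
proof -
  have \<sigma>c: "\<sigma> n \<in> carrier H" "\<pi> (\<sigma> n) = \<rho> n" if "n \<in> N" for n using hliftsD(2,3)[OF \<sigma>] that by simp_all
  have \<sigma>m: "\<sigma> (m \<otimes>\<^bsub>G\<^esub> n) = \<sigma> m \<otimes> \<sigma> n" if "m \<in> N" "n \<in> N" for m n using hliftsD(4)[OF \<sigma>] that by simp
  have E_mult: "s \<otimes> t \<in> E \<sigma> (g \<otimes>\<^bsub>G\<^esub> h)" if a: "g \<in> carrier G" "h \<in> carrier G" "s \<in> E \<sigma> g" "t \<in> E \<sigma> h" for g h s t
  proof -
    have st: "s \<in> carrier H" "t \<in> carrier H" using a by (simp_all add: E_def)
    have "s \<otimes> t \<otimes> \<sigma> n = \<sigma> (g \<otimes>\<^bsub>G\<^esub> h \<otimes>\<^bsub>G\<^esub> n \<otimes>\<^bsub>G\<^esub> inv\<^bsub>G\<^esub> (g \<otimes>\<^bsub>G\<^esub> h)) \<otimes> (s \<otimes> t)" if n: "n \<in> N" for n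
    proof -
      have hn: "h \<otimes>\<^bsub>G\<^esub> n \<otimes>\<^bsub>G\<^esub> inv\<^bsub>G\<^esub> h \<in> N" by (rule N_conj(2)[OF a(2) n])
      have "s \<otimes> t \<otimes> \<sigma> n = s \<otimes> \<sigma> (h \<otimes>\<^bsub>G\<^esub> n \<otimes>\<^bsub>G\<^esub> inv\<^bsub>G\<^esub> h) \<otimes> t"
        using a(4) n st \<sigma>c hn by (simp add: E_def H.m_assoc)
      also have "\<dots> = \<sigma> (g \<otimes>\<^bsub>G\<^esub> (h \<otimes>\<^bsub>G\<^esub> n \<otimes>\<^bsub>G\<^esub> inv\<^bsub>G\<^esub> h) \<otimes>\<^bsub>G\<^esub> inv\<^bsub>G\<^esub> g) \<otimes> s \<otimes> t"
        using a(3) hn by (simp add: E_def)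
      also have "g \<otimes>\<^bsub>G\<^esub> (h \<otimes>\<^bsub>G\<^esub> n \<otimes>\<^bsub>G\<^esub> inv\<^bsub>G\<^esub> h) \<otimes>\<^bsub>G\<^esub> inv\<^bsub>G\<^esub> g = g \<otimes>\<^bsub>G\<^esub> h \<otimes>\<^bsub>G\<^esub> n \<otimes>\<^bsub>G\<^esub> inv\<^bsub>G\<^esub> (g \<otimes>\<^bsub>G\<^esub> h)"
        using a(1,2) N.mem_carrier[OF n] by (simp add: N.m_assoc N.inv_mult_group)
      finally show ?thesis
        using st \<sigma>c N_conj(2)[of "g \<otimes>\<^bsub>G\<^esub> h" n] a(1,2) n by (simp add: H.m_assoc)
    qed
    then show ?thesis using a by (simp add: E_def \<rho>_mult)
  qed
  have E_inv: "inv s \<in> E \<sigma> (inv\<^bsub>G\<^esub> g)" if a: "g \<in> carrier G" "s \<in> E \<sigma> g" for g s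
  proof -
    have s: "s \<in> carrier H" using a by (simp add: E_def)
    have "inv s \<otimes> \<sigma> n = \<sigma> (inv\<^bsub>G\<^esub> g \<otimes>\<^bsub>G\<^esub> n \<otimes>\<^bsub>G\<^esub> inv\<^bsub>G\<^esub> (inv\<^bsub>G\<^esub> g)) \<otimes> inv s" if n: "n \<in> N" for n
    proof -
      have gn: "inv\<^bsub>G\<^esub> g \<otimes>\<^bsub>G\<^esub> n \<otimes>\<^bsub>G\<^esub> g \<in> N" by (rule N_conj(1)[OF a(1) n])
      have "g \<otimes>\<^bsub>G\<^esub> (inv\<^bsub>G\<^esub> g \<otimes>\<^bsub>G\<^esub> n \<otimes>\<^bsub>G\<^esub> g) \<otimes>\<^bsub>G\<^esub> inv\<^bsub>G\<^esub> g = n"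
        using a(1) N.mem_carrier[OF n] by (simp add: N.m_assoc N.inv_mult_cancel)
      then have e: "s \<otimes> \<sigma> (inv\<^bsub>G\<^esub> g \<otimes>\<^bsub>G\<^esub> n \<otimes>\<^bsub>G\<^esub> g) = \<sigma> n \<otimes> s" using a(2) gn unfolding E_def by auto
      have "inv s \<otimes> \<sigma> n = inv s \<otimes> (\<sigma> n \<otimes> s) \<otimes> inv s" using s \<sigma>c[OF n] by (simp add: H.m_assoc)
      also have "\<dots> = \<sigma> (inv\<^bsub>G\<^esub> g \<otimes>\<^bsub>G\<^esub> n \<otimes>\<^bsub>G\<^esub> g) \<otimes> inv s"
        using s \<sigma>c[OF gn] by (simp flip: e add: H.m_assoc H.inv_mult_cancel)
      finally show ?thesis using a(1) by simp
    qed
    then show ?thesis using a by (simp add: E_def \<rho>_inv)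
  qed
  have E_conj: "s \<otimes> c \<otimes> inv s \<in> E \<sigma> \<one>\<^bsub>G\<^esub>" if "g \<in> carrier G" "s \<in> E \<sigma> g" "c \<in> E \<sigma> \<one>\<^bsub>G\<^esub>" for g s c
    using E_mult[OF _ _ E_mult[OF _ _ that(2,3)] E_inv[OF that(1,2)]] that(1) by simp
  have E_one: "\<one> \<in> E \<sigma> \<one>\<^bsub>G\<^esub>" using \<sigma>c N.mem_carrier by (simp add: E_def \<rho>_one)
  have E_sub: "subgroup (E \<sigma> \<one>\<^bsub>G\<^esub>) H"
    by (rule subgroup.intro) (use E_one E_mult[of "\<one>\<^bsub>G\<^esub>" "\<one>\<^bsub>G\<^esub>"] E_inv[of "\<one>\<^bsub>G\<^esub>"] in \<open>auto simp: E_def\<close>)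
  have E_ker: "E \<sigma> \<one>\<^bsub>G\<^esub> \<subseteq> ker" by (auto simp: E_def ker_def \<rho>_one)
  have E_pow: "x [^] (n::nat) \<in> E \<sigma> \<one>\<^bsub>G\<^esub>" if "x \<in> E \<sigma> \<one>\<^bsub>G\<^esub>" for x n
    using that subgroup.m_closed[OF E_sub] E_one by (induction n) auto
  show ?thesis
  proof (intro coprime_extension.intro coprime_extension_axioms.intro)
    show "group G" "normal N G" "group H" by (rule G_group N.normal_axioms H.is_group)+
    show "s \<in> carrier H" if "s \<in> E \<sigma> g" for g s using that by (simp add: E_def)
    show "\<sigma> n \<in> E \<sigma> n" if n: "n \<in> N" for n
    proof -
      have "\<sigma> n \<otimes> \<sigma> m = \<sigma> (n \<otimes>\<^bsub>G\<^esub> m \<otimes>\<^bsub>G\<^esub> inv\<^bsub>G\<^esub> n) \<otimes> \<sigma> n" if m: "m \<in> N" for m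
        using \<sigma>m[OF n m] \<sigma>m[OF N_conj(2)[OF N.mem_carrier[OF n] m] n] N.mem_carrier[OF n] N.mem_carrier[OF m]
        by (simp add: N.m_assoc)
      then show ?thesis using n \<sigma>c by (simp add: E_def)
    qed
    show "s \<otimes> \<sigma> n = \<sigma> (g \<otimes>\<^bsub>G\<^esub> n \<otimes>\<^bsub>G\<^esub> inv\<^bsub>G\<^esub> g) \<otimes> s" if "n \<in> N" "s \<in> E \<sigma> g" for g n s using that by (simp add: E_def)
    show "F 0 \<inter> E \<sigma> \<one>\<^bsub>G\<^esub> = E \<sigma> \<one>\<^bsub>G\<^esub>" using F_0 E_ker by blast
    show "F l \<inter> E \<sigma> \<one>\<^bsub>G\<^esub> = {\<one>}" using F_l E_one by auto
    show "subgroup (F i \<inter> E \<sigma> \<one>\<^bsub>G\<^esub>) H" for i by (rule H.subgroups_Inter_pair[OF F_subgroup E_sub])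
    show "F (Suc i) \<inter> E \<sigma> \<one>\<^bsub>G\<^esub> \<subseteq> F i \<inter> E \<sigma> \<one>\<^bsub>G\<^esub>" for i using F_Suc by blast
    show "s \<otimes> c \<otimes> inv s \<in> F i \<inter> E \<sigma> \<one>\<^bsub>G\<^esub>" if "g \<in> carrier G" "s \<in> E \<sigma> g" "c \<in> F i \<inter> E \<sigma> \<one>\<^bsub>G\<^esub>" for g s c i
      using that F_conj[of s c i] E_conj[of g s c] by (simp add: E_def)
    show "x \<otimes> y \<otimes> inv (y \<otimes> x) \<in> F (Suc i) \<inter> E \<sigma> \<one>\<^bsub>G\<^esub>" if "x \<in> F i \<inter> E \<sigma> \<one>\<^bsub>G\<^esub>" "y \<in> F i \<inter> E \<sigma> \<one>\<^bsub>G\<^esub>" for x y i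
      using that F_comm[of x i y] subgroup.m_closed[OF E_sub] subgroup.m_inv_closed[OF E_sub] by simp
    show "x [^] p \<in> F (Suc i) \<inter> E \<sigma> \<one>\<^bsub>G\<^esub>" if "x \<in> F i \<inter> E \<sigma> \<one>\<^bsub>G\<^esub>" for x i
      using that F_pow[of x i] E_pow by simp
  qed (fact finG cop E_mult E_inv \<sigma>m)+
qed

theorem invariant_lift_extends:
  assumes \<sigma>: "\<sigma> \<in> hlifts GN \<rho>" and inv: "invariant \<sigma>"
  obtains \<tau> where "\<tau> \<in> hlifts G \<rho>" "restrict \<tau> N = \<sigma>"
proof -
  interpret X: coprime_extension G N H "E \<sigma>" \<sigma> "\<lambda>i. F i \<inter> E \<sigma> \<one>\<^bsub>G\<^esub>" p l by (rule extension[OF \<sigma>])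
  have ne: "E \<sigma> g \<noteq> {}" if g: "g \<in> carrier G" for g
  proof -
    obtain r where r: "r \<in> carrier H" "\<pi> r = \<rho> g" using \<rho>_closed[OF g] \<pi>_surj by (metis imageE)
    then have "(\<sigma>, cj g r \<sigma>) \<in> hequiv GN \<rho>" using inv g by (simp add: invariant_def)
    \<comment> \<open>Invariance makes conjugation by r agree with conjugation by an element
      \<gamma> of the kernel, up to the twist by g; correcting r by the inverse of \<gamma> gives a
      point of the fibre.\<close>
    then obtain \<gamma> where \<gamma>: "\<gamma> \<in> ker" "\<And>n. n \<in> carrier GN \<Longrightarrow> cj g r \<sigma> n = \<gamma> \<otimes> \<sigma> n \<otimes> inv \<gamma>" by (rule hequivE) blast
    have \<gamma>H: "\<gamma> \<in> carrier H" by (rule ker_carrier[OF \<gamma>(1)])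
    have "inv \<gamma> \<otimes> r \<otimes> \<sigma> n = \<sigma> (g \<otimes>\<^bsub>G\<^esub> n \<otimes>\<^bsub>G\<^esub> inv\<^bsub>G\<^esub> g) \<otimes> (inv \<gamma> \<otimes> r)" if n: "n \<in> N" for n
    proof -
      have c: "\<sigma> n \<in> carrier H" "\<sigma> (g \<otimes>\<^bsub>G\<^esub> n \<otimes>\<^bsub>G\<^esub> inv\<^bsub>G\<^esub> g) \<in> carrier H"
        using hliftsD(2)[OF \<sigma>] n N_conj(2)[OF g n] by simp_all
      have "inv\<^bsub>G\<^esub> g \<otimes>\<^bsub>G\<^esub> (g \<otimes>\<^bsub>G\<^esub> n \<otimes>\<^bsub>G\<^esub> inv\<^bsub>G\<^esub> g) \<otimes>\<^bsub>G\<^esub> g = n"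
        using g N.mem_carrier[OF n] by (simp add: N.m_assoc N.inv_mult_cancel)
      then have e: "r \<otimes> \<sigma> n \<otimes> inv r = \<gamma> \<otimes> \<sigma> (g \<otimes>\<^bsub>G\<^esub> n \<otimes>\<^bsub>G\<^esub> inv\<^bsub>G\<^esub> g) \<otimes> inv \<gamma>"
        using \<gamma>(2)[of "g \<otimes>\<^bsub>G\<^esub> n \<otimes>\<^bsub>G\<^esub> inv\<^bsub>G\<^esub> g"] N_conj(2)[OF g n] by (simp add: cj_def)
      have "inv \<gamma> \<otimes> r \<otimes> \<sigma> n = inv \<gamma> \<otimes> (r \<otimes> \<sigma> n \<otimes> inv r) \<otimes> r" using c r(1) \<gamma>H by (simp add: H.m_assoc)
      also have "\<dots> = \<sigma> (g \<otimes>\<^bsub>G\<^esub> n \<otimes>\<^bsub>G\<^esub> inv\<^bsub>G\<^esub> g) \<otimes> (inv \<gamma> \<otimes> r)"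
        unfolding e using c r(1) \<gamma>H by (simp add: H.m_assoc H.inv_mult_cancel)
      finally show ?thesis .
    qed
    moreover have "\<pi> (inv \<gamma> \<otimes> r) = \<rho> g" using \<gamma>(1) r g by (simp add: ker_def)
    ultimately have "inv \<gamma> \<otimes> r \<in> E \<sigma> g" using \<gamma>H r(1) by (simp add: E_def)
    then show ?thesis by blast
  qed
  obtain s where s: "\<And>g. g \<in> carrier G \<Longrightarrow> s g \<in> E \<sigma> g" "\<And>n. n \<in> N \<Longrightarrow> s n = \<sigma> n"
    "\<And>g h. \<lbrakk>g \<in> carrier G; h \<in> carrier G\<rbrakk> \<Longrightarrow> s (g \<otimes>\<^bsub>G\<^esub> h) = s g \<otimes> s h"
    using X.split_section[OF ne] by blast
  have "restrict s (carrier G) \<in> hlifts G \<rho>"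
    by (rule hliftsI) (use s(1,3) in \<open>auto simp: E_def\<close>)
  moreover have "restrict (restrict s (carrier G)) N = \<sigma>"
  proof (rule extensionalityI[of _ N])
    show "\<sigma> \<in> extensional N" using hliftsD(1)[OF \<sigma>] by simp
  qed (use s(2) N.mem_carrier in auto)
  ultimately show thesis using that by blast
qed

text \<open>Conjugating \<sigma> by the element that relates the restrictions makes the two lifts
  equal on N. They are then sections of one and the same extension, and
  \<open>sections_conjugate\<close> applies.\<close>

theorem restrict_hequiv_reflect:
  assumes \<sigma>: "\<sigma> \<in> hlifts G \<rho>" and \<tau>: "\<tau> \<in> hlifts G \<rho>" and st: "(restrict \<sigma> N, restrict \<tau> N) \<in> hequiv GN \<rho>"
  shows "(\<sigma>, \<tau>) \<in> hequiv G \<rho>"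
proof -
  obtain \<gamma> where \<gamma>: "\<gamma> \<in> ker" "\<And>n. n \<in> carrier GN \<Longrightarrow> restrict \<tau> N n = \<gamma> \<otimes> restrict \<sigma> N n \<otimes> inv \<gamma>"
    using st by (rule hequivE) blast
  define \<sigma>' where "\<sigma>' = (\<lambda>g\<in>carrier G. \<gamma> \<otimes> \<sigma> g \<otimes> inv \<gamma>)"
  have e: "(\<sigma>, \<sigma>') \<in> hequiv G \<rho>" unfolding \<sigma>'_def by (rule conj_hlift[OF \<sigma> \<gamma>(1) G_group \<rho>_closed])
  then have \<sigma>': "\<sigma>' \<in> hlifts G \<rho>" by (auto simp: hequiv_def)
  have \<sigma>'N: "\<sigma>' n = \<tau> n" if "n \<in> N" for n using \<gamma>(2)[of n] that N.mem_carrier by (simp add: \<sigma>'_def)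
  let ?\<nu> = "restrict \<tau> N"
  have \<nu>: "?\<nu> \<in> hlifts GN \<rho>" by (rule restrict_hlift[OF \<tau> N.subset N_mult])
  have inE: "\<upsilon> g \<in> E ?\<nu> g" if \<upsilon>: "\<upsilon> \<in> hlifts G \<rho>" "\<And>n. n \<in> N \<Longrightarrow> \<upsilon> n = \<tau> n" and g: "g \<in> carrier G" for \<upsilon> g
  proof -
    have "\<upsilon> g \<otimes> \<tau> n = \<tau> (g \<otimes>\<^bsub>G\<^esub> n \<otimes>\<^bsub>G\<^esub> inv\<^bsub>G\<^esub> g) \<otimes> \<upsilon> g" if n: "n \<in> N" for n
      unfolding \<upsilon>(2)[OF n, symmetric] \<upsilon>(2)[OF N_conj(2)[OF g n], symmetric]
      using g N.mem_carrier[OF n] by (simp flip: hliftsD(4)[OF \<upsilon>(1)] add: N.m_assoc)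
    then show ?thesis
      using N_conj(2)[OF g] hliftsD(2,3)[OF \<upsilon>(1) g] by (simp add: E_def)
  qed
  interpret X: coprime_extension G N H "E ?\<nu>" ?\<nu> "\<lambda>i. F i \<inter> E ?\<nu> \<one>\<^bsub>G\<^esub>" p l by (rule extension[OF \<nu>])
  obtain \<delta> where \<delta>: "\<delta> \<in> E ?\<nu> \<one>\<^bsub>G\<^esub>" "\<And>g. g \<in> carrier G \<Longrightarrow> \<tau> g = \<delta> \<otimes> \<sigma>' g \<otimes> inv \<delta>"
  proof (rule X.sections_conjugate[of \<sigma>' \<tau>])
    show "\<sigma>' g \<in> E ?\<nu> g" "\<tau> g \<in> E ?\<nu> g" if "g \<in> carrier G" for g
      by (rule inE[OF \<sigma>' \<sigma>'N that] inE[OF \<tau> refl that], assumption?)+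
    show "\<sigma>' n = ?\<nu> n" "\<tau> n = ?\<nu> n" if "n \<in> N" for n using \<sigma>'N that by simp_all
  qed (use hliftsD(4)[OF \<sigma>'] hliftsD(4)[OF \<tau>] in blast)+
  have "\<delta> \<in> ker" using \<delta>(1) by (simp add: E_def ker_def \<rho>_one)
  then have "(\<sigma>', \<tau>) \<in> hequiv G \<rho>" by (rule hequivI[OF \<sigma>' \<tau> _ \<delta>(2)])
  with e show ?thesis using hequiv_equiv by (meson equivE transE)
qed

end

section \<open>Deformation functors and restriction\<close>

text \<open>Operations on classes are encoded as unions over representatives; this evaluates them
  once all representatives give the same result.\<close>

lemma UN_equiv_class_const:
  assumes "equiv S R" "x \<in> S" "\<And>y. (x, y) \<in> R \<Longrightarrow> f y = c"
  shows "(\<Union>y\<in>R `` {x}. f y) = c"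
  by (rule SUP_eq_const) (use assms(3) equiv_class_self[OF assms(1,2)] in auto)

lemma lies_over_cong:
  assumes "power_series A" "\<phi> \<in> carrier (Gam A)" "\<And>x. x \<in> carrier A \<Longrightarrow> f x = g x"
  shows "lies_over A f \<phi> \<psi> \<longleftrightarrow> lies_over A g \<phi> \<psi>"
proof -
  have "f \<circ> F = g \<circ> F" if "F \<in> carrier (ps_ring A)" for F
    using that assms(3) by (auto simp: ps_ring_def)
  moreover have "\<phi> F \<in> carrier (ps_ring A)" if "F \<in> carrier (ps_ring A)" for F
    by (rule power_series.Gam_closed[OF assms(1,2) that])
  ultimately show ?thesis by (simp add: lies_over_def)
qed

context coeff_field
begin

text \<open>The hypotheses of the base change lemmas for reduction to k, with the zero ideal on the
  side of k.\<close>

lemma red_base_change: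
  fixes A :: "('a, 'k) walg"
  assumes A: "A \<in> Art p k"
  shows "nil_local A (max_ideal k A)" "nil_local k {\<zero>\<^bsub>k\<^esub>}" "red A \<in> ring_hom A k" "red A ` max_ideal k A \<subseteq> {\<zero>\<^bsub>k\<^esub>}"
  using Art_nil_local[OF A] field_nil_local Art_local[OF A] by (auto simp: local_walg_def max_ideal_def a_kernel_def')

lemma lies_over_red_iff:
  fixes A :: "('a, 'k) walg"
  assumes A: "A \<in> Art p k" and "\<phi> \<in> carrier (Gam A)" "\<psi> \<in> carrier (Gam k)"
  shows "lies_over A (red A) \<phi> \<psi> \<longleftrightarrow> Gam_map A k (red A) \<phi> = \<psi>"
  using Gam_map(2)[OF red_base_change[OF A] assms(2)] Gam_map_eqI[OF red_base_change[OF A] assms(2,3)] by blast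

lemma Art_power_series:
  fixes A :: "('a, 'k) walg"
  assumes A: "A \<in> Art p k"
  shows "power_series A"
  using Art_nil_local[OF A] by (rule nil_local.axioms)

lemma Gam_lifting:
  fixes A :: "('a, 'k) walg"
  assumes A: "A \<in> Art p k"
  shows "lifting (Gam A) (Gam k) (Gam_map A k (red A))"
proof (intro lifting.intro lifting_axioms.intro)
  show "group (Gam A)" by (rule power_series.Gam_group[OF Art_power_series[OF A]])
  show "group (Gam k)" by (rule power_series.Gam_group[OF nil_local.axioms(1)[OF field_nil_local]])
  show "Gam_map A k (red A) \<in> hom (Gam A) (Gam k)" by (rule Gam_map_hom[OF red_base_change[OF A]])
  show "Gam_map A k (red A) ` carrier (Gam A) = carrier (Gam k)"
  proof
    show "Gam_map A k (red A) ` carrier (Gam A) \<subseteq> carrier (Gam k)" using Gam_map(1)[OF red_base_change[OF A]] by blast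
    show "carrier (Gam k) \<subseteq> Gam_map A k (red A) ` carrier (Gam A)"
    proof
      fix \<psi> assume \<psi>: "\<psi> \<in> carrier (Gam k)"
      have "\<exists>\<phi>\<in>carrier (Gam A). lies_over A (red A) \<phi> \<psi>"
        by (rule Gam_lift_ex[OF red_base_change[OF A] _ _ \<psi>])
           (use Art_local[OF A] in \<open>auto simp: local_walg_def mem_max_ideal\<close>)
      then obtain \<phi> where "\<phi> \<in> carrier (Gam A)" "lies_over A (red A) \<phi> \<psi>" by blast
      then show "\<psi> \<in> Gam_map A k (red A) ` carrier (Gam A)" using lies_over_red_iff[OF A _ \<psi>] by blast
    qed
  qed
qed

lemma Gam_ker_eq:
  fixes A :: "('a, 'k) walg"
  assumes A: "A \<in> Art p k"
  shows "Gam_ker k A = lifting.ker (Gam A) (Gam k) (Gam_map A k (red A))"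
proof -
  interpret L: lifting "Gam A" "Gam k" "Gam_map A k (red A)" by (rule Gam_lifting[OF A])
  show ?thesis using lies_over_red_iff[OF A] by (auto simp: Gam_ker_def L.ker_def)
qed

lemma Gam_fil_1:
  fixes A :: "('a, 'k) walg"
  assumes A: "A \<in> Art p k"
  shows "Gam_fil A (max_ideal k A) 1 = Gam_ker k A"
proof -
  interpret A: nil_local A "max_ideal k A" by (rule Art_nil_local[OF A])
  have "\<gamma> \<in> A.K 1 \<longleftrightarrow> lies_over A (red A) \<gamma> \<one>\<^bsub>Gam k\<^esub>" if "\<gamma> \<in> carrier (Gam A)" for \<gamma>
    by (rule A.K_1_iff[OF k.is_cring red_base_change(3)[OF A] _ that]) (simp add: mem_max_ideal)
  then show ?thesis using A.K_carrier by (auto simp: Gam_ker_def)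
qed

end

locale deformation = coeff_field p k + N: normal N G
  for p :: nat and k :: "'k ring" and N and G :: "'g monoid" (structure) +
  fixes \<rho> :: "('g, 'k) lift"
  assumes finG: "finite (carrier G)" and cop: "coprime (order (G Mod N)) p"
    and \<rho>: "\<rho> \<in> hom G (Gam k)" and p_zero: "[p] \<cdot>\<^bsub>k\<^esub> \<one>\<^bsub>k\<^esub> = \<zero>\<^bsub>k\<^esub>"

locale deformation_at = deformation p k N G \<rho>
  for p :: nat and k :: "'k ring" and N and G :: "'g monoid" (structure) and \<rho> +
  fixes A :: "('u, 'k) walg"
  assumes A: "A \<in> Art p k"

text \<open>\<open>Gam_fil\<close> is the whole group at index 0 and the kernel of reduction at
  index 1, hence the shift by one. The shift also provides the bound 1 \<le> i on which the
  commutator and p-th power estimates rest.\<close>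

sublocale deformation_at \<subseteq> L: filtered_lifting "Gam A" "Gam k" "Gam_map A k (red A)" G N \<rho>
  "\<lambda>i. Gam_fil A (max_ideal k A) (Suc i)" p "nil_local.nil_index A (max_ideal k A)"
proof -
  interpret A: nil_local A "max_ideal k A" by (rule Art_nil_local[OF A])
  interpret r: ring_hom_cring A k "red A" by (rule red_hom_ring[OF Art_local[OF A]])
  have red_pow: "red A ([n] \<cdot>\<^bsub>A\<^esub> \<one>\<^bsub>A\<^esub>) = [n] \<cdot>\<^bsub>k\<^esub> \<one>\<^bsub>k\<^esub>" for n :: nat
    by (induction n) (simp_all add: A.add.nat_pow_Suc k.add.nat_pow_Suc)
  show "filtered_lifting (Gam A) (Gam k) (Gam_map A k (red A)) G N \<rho> (\<lambda>i. A.K (Suc i)) p A.nil_index"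
  proof (intro filtered_lifting.intro filtered_lifting_axioms.intro normal_lifting.intro normal_lifting_axioms.intro)
    show "lifting (Gam A) (Gam k) (Gam_map A k (red A))" by (rule Gam_lifting[OF A])
    show "A.K (Suc 0) = lifting.ker (Gam A) (Gam k) (Gam_map A k (red A))"
      using Gam_fil_1[OF A] Gam_ker_eq[OF A] by simp
    show "A.K (Suc A.nil_index) = {\<one>\<^bsub>Gam A\<^esub>}" by (rule A.K_nil) simp
    fix i
    show "subgroup (A.K (Suc i)) (Gam A)" by (rule A.K_subgroup)
    show "A.K (Suc (Suc i)) \<subseteq> A.K (Suc i)" by (rule A.K_Suc)
    show "x \<otimes>\<^bsub>Gam A\<^esub> c \<otimes>\<^bsub>Gam A\<^esub> inv\<^bsub>Gam A\<^esub> x \<in> A.K (Suc i)" if "x \<in> carrier (Gam A)" "c \<in> A.K (Suc i)" for x c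
      by (rule A.K_conj[OF that])
    show "x \<otimes>\<^bsub>Gam A\<^esub> y \<otimes>\<^bsub>Gam A\<^esub> inv\<^bsub>Gam A\<^esub> (y \<otimes>\<^bsub>Gam A\<^esub> x) \<in> A.K (Suc (Suc i))" if "x \<in> A.K (Suc i)" "y \<in> A.K (Suc i)" for x y
      by (rule A.K_comm[OF _ that]) simp
    show "x [^]\<^bsub>Gam A\<^esub> p \<in> A.K (Suc (Suc i))" if "x \<in> A.K (Suc i)" for x
      by (rule A.K_pow[OF _ that]) (simp_all add: mem_max_ideal red_pow p_zero)
  qed (rule N.normal_axioms \<rho> finG cop)+
qed

context deformation_at
begin

abbreviation "rd \<equiv> Gam_map A k (red A)"

lemma over_iff: "\<lbrakk>\<phi> \<in> carrier (Gam A); g \<in> carrier G\<rbrakk> \<Longrightarrow> lies_over A (red A) \<phi> (\<rho> g) \<longleftrightarrow> rd \<phi> = \<rho> g"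
  by (rule lies_over_red_iff[OF A _ L.\<rho>_closed])

text \<open>For automorphisms over an object of \<open>Art\<close>, lying over \<rho> g means having
  it as base change to k; from here on the abstract lifting theory applies.\<close>

lemma lifts_eq: "carrier M \<subseteq> carrier G \<Longrightarrow> lifts M \<rho> A = L.hlifts M \<rho>"
  using over_iff unfolding lifts_def L.hlifts_def hom_def by (intro Collect_cong) blast

lemma lift_equiv_eq: "carrier M \<subseteq> carrier G \<Longrightarrow> lift_equiv k M \<rho> A = L.hequiv M \<rho>"
  unfolding lift_equiv_def L.hequiv_def by (simp add: lifts_eq Gam_ker_eq[OF A])

lemma def_obj: "carrier M \<subseteq> carrier G \<Longrightarrow> fobj (def_functor k M \<rho>) A = L.hlifts M \<rho> // L.hequiv M \<rho>"
  by (simp add: def_functor_def lifts_eq lift_equiv_eq)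

lemma GN_subset: "carrier (sub_group G N) \<subseteq> carrier G"
  using N.subset by simp

lemma class_eq: "(\<sigma>, \<tau>) \<in> L.hequiv M \<rho> \<Longrightarrow> L.hequiv M \<rho> `` {\<sigma>} = L.hequiv M \<rho> `` {\<tau>}"
  by (rule equiv_class_eq[OF L.hequiv_equiv])

lemma class_eq_iff:
  "\<lbrakk>\<sigma> \<in> L.hlifts M \<rho>; \<tau> \<in> L.hlifts M \<rho>\<rbrakk> \<Longrightarrow> L.hequiv M \<rho> `` {\<sigma>} = L.hequiv M \<rho> `` {\<tau>} \<longleftrightarrow> (\<sigma>, \<tau>) \<in> L.hequiv M \<rho>"
  by (rule eq_equiv_class_iff[OF L.hequiv_equiv])

lemma res_class:
  assumes "\<sigma> \<in> L.hlifts G \<rho>"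
  shows "res_map k G N \<rho> A (L.hequiv G \<rho> `` {\<sigma>}) = L.hequiv (sub_group G N) \<rho> `` {restrict \<sigma> N}"
  unfolding res_map_def lift_equiv_eq[OF GN_subset]
  by (rule UN_equiv_class_const[OF L.hequiv_equiv assms])
     (rule class_eq[OF L.restrict_hequiv[OF _ N.subset L.N_mult], symmetric])

lemma conj_class:
  assumes g: "g \<in> carrier G" and r: "r \<in> carrier (Gam A)" "rd r = \<rho> g" and \<sigma>: "\<sigma> \<in> L.hlifts (sub_group G N) \<rho>"
  shows "conj_act k G N \<rho> A g (L.hequiv (sub_group G N) \<rho> `` {\<sigma>}) = L.hequiv (sub_group G N) \<rho> `` {L.cj g r \<sigma>}"
  unfolding conj_act_def lift_equiv_eq[OF GN_subset] L.cj_def[symmetric]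
proof (rule UN_equiv_class_const[OF L.hequiv_equiv \<sigma>], rule SUP_eq_const)
  show "{r \<in> carrier (Gam A). lies_over A (red A) r (\<rho> g)} \<noteq> {}" using r over_iff[OF _ g] by blast
  fix \<tau> s assume \<tau>: "(\<sigma>, \<tau>) \<in> L.hequiv (sub_group G N) \<rho>" and "s \<in> {r \<in> carrier (Gam A). lies_over A (red A) r (\<rho> g)}"
  then have s: "s \<in> carrier (Gam A)" "rd s = \<rho> g" using over_iff[OF _ g] by blast+
  show "L.hequiv (sub_group G N) \<rho> `` {L.cj g s \<tau>} = L.hequiv (sub_group G N) \<rho> `` {L.cj g r \<sigma>}"
    by (rule class_eq[OF L.cj_hequiv[OF g r s \<tau>], symmetric])
qed

lemma over_ex:
  assumes g: "g \<in> carrier G"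
  obtains r where "r \<in> carrier (Gam A)" "rd r = \<rho> g"
  using L.\<rho>_closed[OF g] L.\<pi>_surj by (metis imageE)

lemma classE:
  assumes "\<kappa> \<in> fobj (def_functor k M \<rho>) A" "carrier M \<subseteq> carrier G"
  obtains \<sigma> where "\<sigma> \<in> L.hlifts M \<rho>" "\<kappa> = L.hequiv M \<rho> `` {\<sigma>}"
  using assms(1) unfolding def_obj[OF assms(2)] by (rule quotientE)

lemma class_mem: "\<lbrakk>\<sigma> \<in> L.hlifts M \<rho>; carrier M \<subseteq> carrier G\<rbrakk> \<Longrightarrow> L.hequiv M \<rho> `` {\<sigma>} \<in> fobj (def_functor k M \<rho>) A"
  unfolding def_obj by (rule quotientI)

lemma conj_act_closed:
  assumes g: "g \<in> carrier G" and \<kappa>: "\<kappa> \<in> fobj (def_functor k (sub_group G N) \<rho>) A"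
  shows "conj_act k G N \<rho> A g \<kappa> \<in> fobj (def_functor k (sub_group G N) \<rho>) A"
proof -
  obtain \<sigma> where \<sigma>: "\<sigma> \<in> L.hlifts (sub_group G N) \<rho>" "\<kappa> = L.hequiv (sub_group G N) \<rho> `` {\<sigma>}"
    using classE[OF \<kappa> GN_subset] by blast
  obtain r where r: "r \<in> carrier (Gam A)" "rd r = \<rho> g" using over_ex[OF g] by blast
  show ?thesis unfolding \<sigma>(2) conj_class[OF g r \<sigma>(1)] by (rule class_mem[OF L.cj_hlift[OF g r \<sigma>(1)] GN_subset])
qed

lemma conj_act_inv:
  assumes g: "g \<in> carrier G" and \<kappa>: "\<kappa> \<in> fobj (def_functor k (sub_group G N) \<rho>) A"
  shows "conj_act k G N \<rho> A (inv g) (conj_act k G N \<rho> A g \<kappa>) = \<kappa>"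
proof -
  obtain \<sigma> where \<sigma>: "\<sigma> \<in> L.hlifts (sub_group G N) \<rho>" "\<kappa> = L.hequiv (sub_group G N) \<rho> `` {\<sigma>}"
    using classE[OF \<kappa> GN_subset] by blast
  obtain r where r: "r \<in> carrier (Gam A)" "rd r = \<rho> g" using over_ex[OF g] by blast
  have r': "inv\<^bsub>Gam A\<^esub> r \<in> carrier (Gam A)" "rd (inv\<^bsub>Gam A\<^esub> r) = \<rho> (inv g)"
    using r g L.\<rho>_inv[OF g] by simp_all
  show ?thesis
    unfolding \<sigma>(2) conj_class[OF g r \<sigma>(1)] conj_class[OF N.inv_closed[OF g] r' L.cj_hlift[OF g r \<sigma>(1)]]
      L.cj_cj_inv[OF g r(1) \<sigma>(1)] ..
qed

lemma invariant_iff: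
  assumes \<sigma>: "\<sigma> \<in> L.hlifts (sub_group G N) \<rho>"
  shows "(\<forall>g\<in>carrier G. conj_act k G N \<rho> A g (L.hequiv (sub_group G N) \<rho> `` {\<sigma>}) = L.hequiv (sub_group G N) \<rho> `` {\<sigma>}) \<longleftrightarrow>
    L.invariant \<sigma>"
proof -
  have "conj_act k G N \<rho> A g (L.hequiv (sub_group G N) \<rho> `` {\<sigma>}) = L.hequiv (sub_group G N) \<rho> `` {\<sigma>} \<longleftrightarrow>
      (\<sigma>, L.cj g r \<sigma>) \<in> L.hequiv (sub_group G N) \<rho>" if g: "g \<in> carrier G" and r: "r \<in> carrier (Gam A)" "rd r = \<rho> g" for g r
    unfolding conj_class[OF g r \<sigma>] using class_eq_iff[OF \<sigma> L.cj_hlift[OF g r \<sigma>]] by blast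
  then show ?thesis unfolding L.invariant_def using over_ex by metis
qed

text \<open>Injectivity is \<open>L.restrict_hequiv_reflect\<close>. The image lies in the
  invariants by \<open>L.restrict_invariant\<close> and exhausts them by
  \<open>L.invariant_lift_extends\<close>.\<close>

lemma res_bij: "bij_betw (res_map k G N \<rho> A) (fobj (def_functor k G \<rho>) A) (fobj (inv_functor k G N \<rho>) A)"
  unfolding bij_betw_def
proof
  show "inj_on (res_map k G N \<rho> A) (fobj (def_functor k G \<rho>) A)"
  proof (rule inj_onI)
    fix \<kappa> \<kappa>' assume \<kappa>: "\<kappa> \<in> fobj (def_functor k G \<rho>) A" "\<kappa>' \<in> fobj (def_functor k G \<rho>) A"
      and eq: "res_map k G N \<rho> A \<kappa> = res_map k G N \<rho> A \<kappa>'"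
    obtain \<sigma> where \<sigma>: "\<sigma> \<in> L.hlifts G \<rho>" "\<kappa> = L.hequiv G \<rho> `` {\<sigma>}" using classE[OF \<kappa>(1) subset_refl] by blast
    obtain \<tau> where \<tau>: "\<tau> \<in> L.hlifts G \<rho>" "\<kappa>' = L.hequiv G \<rho> `` {\<tau>}" using classE[OF \<kappa>(2) subset_refl] by blast
    have "(restrict \<sigma> N, restrict \<tau> N) \<in> L.hequiv (sub_group G N) \<rho>"
      using eq class_eq_iff[OF L.restrict_hlift[OF \<sigma>(1) N.subset L.N_mult] L.restrict_hlift[OF \<tau>(1) N.subset L.N_mult]]
      unfolding \<sigma>(2) \<tau>(2) res_class[OF \<sigma>(1)] res_class[OF \<tau>(1)] by blast
    then show "\<kappa> = \<kappa>'" unfolding \<sigma>(2) \<tau>(2) by (intro class_eq L.restrict_hequiv_reflect[OF \<sigma>(1) \<tau>(1)])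
  qed
  show "res_map k G N \<rho> A ` fobj (def_functor k G \<rho>) A = fobj (inv_functor k G N \<rho>) A"
  proof (intro equalityI subsetI)
    fix \<kappa> assume "\<kappa> \<in> res_map k G N \<rho> A ` fobj (def_functor k G \<rho>) A"
    then obtain \<kappa>' where \<kappa>': "\<kappa>' \<in> fobj (def_functor k G \<rho>) A" "\<kappa> = res_map k G N \<rho> A \<kappa>'" by blast
    obtain \<sigma> where \<sigma>: "\<sigma> \<in> L.hlifts G \<rho>" "\<kappa>' = L.hequiv G \<rho> `` {\<sigma>}" using classE[OF \<kappa>'(1) subset_refl] by blast
    have rl: "restrict \<sigma> N \<in> L.hlifts (sub_group G N) \<rho>" by (rule L.restrict_hlift[OF \<sigma>(1) N.subset L.N_mult])
    show "\<kappa> \<in> fobj (inv_functor k G N \<rho>) A"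
      using class_mem[OF rl GN_subset] invariant_iff[OF rl] L.restrict_invariant[OF \<sigma>(1)]
      unfolding \<kappa>'(2) \<sigma>(2) res_class[OF \<sigma>(1)] inv_functor_def by simp
  next
    fix \<kappa> assume "\<kappa> \<in> fobj (inv_functor k G N \<rho>) A"
    then have \<kappa>: "\<kappa> \<in> fobj (def_functor k (sub_group G N) \<rho>) A" "\<forall>g\<in>carrier G. conj_act k G N \<rho> A g \<kappa> = \<kappa>"
      by (simp_all add: inv_functor_def)
    obtain \<sigma> where \<sigma>: "\<sigma> \<in> L.hlifts (sub_group G N) \<rho>" "\<kappa> = L.hequiv (sub_group G N) \<rho> `` {\<sigma>}"
      using classE[OF \<kappa>(1) GN_subset] by blast
    obtain \<tau> where \<tau>: "\<tau> \<in> L.hlifts G \<rho>" "restrict \<tau> N = \<sigma>"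
      using L.invariant_lift_extends[OF \<sigma>(1)] invariant_iff[OF \<sigma>(1)] \<kappa>(2) unfolding \<sigma>(2) by blast
    show "\<kappa> \<in> res_map k G N \<rho> A ` fobj (def_functor k G \<rho>) A"
      using res_class[OF \<tau>(1)] class_mem[OF \<tau>(1) subset_refl] unfolding \<sigma>(2) \<tau>(2) by (metis imageI)
  qed
qed

end

section \<open>Functoriality in the algebra\<close>

context deformation
begin

lemma at: "A \<in> Art p k \<Longrightarrow> deformation_at p k N G \<rho> A"
  by (simp add: deformation_at.intro deformation_at_axioms.intro deformation_axioms)

context
  fixes A B :: "('u, 'k) walg" and f
  assumes AB: "A \<in> Art p k" "B \<in> Art p k" and f: "f \<in> walg_hom p k A B"
begin

interpretation A: deformation_at p k N G \<rho> A by (rule at[OF AB(1)])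

interpretation B: deformation_at p k N G \<rho> B by (rule at[OF AB(2)])

lemmas fD = walg_homD[OF Art_local[OF AB(1)] Art_local[OF AB(2)] f]

lemma max_ideal_image: "f ` max_ideal k A \<subseteq> max_ideal k B"
  using f by (simp add: walg_hom_def)

lemmas base = Art_nil_local[OF AB(1)] Art_nil_local[OF AB(2)] fD(2) max_ideal_image

abbreviation "\<Gamma> \<equiv> Gam_map A B f"

lemma \<Gamma>_closed: "\<phi> \<in> carrier (Gam A) \<Longrightarrow> \<Gamma> \<phi> \<in> carrier (Gam B)"
  by (rule Gam_map(1)[OF base])

lemma \<Gamma>_mult: "\<lbrakk>\<phi> \<in> carrier (Gam A); \<psi> \<in> carrier (Gam A)\<rbrakk> \<Longrightarrow> \<Gamma> (\<phi> \<otimes>\<^bsub>Gam A\<^esub> \<psi>) = \<Gamma> \<phi> \<otimes>\<^bsub>Gam B\<^esub> \<Gamma> \<psi>"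
  using Gam_map_hom[OF base] by (auto simp: hom_def)

lemma \<Gamma>_inv: "\<phi> \<in> carrier (Gam A) \<Longrightarrow> \<Gamma> (inv\<^bsub>Gam A\<^esub> \<phi>) = inv\<^bsub>Gam B\<^esub> (\<Gamma> \<phi>)"
  by (rule group_hom.hom_inv[where h = \<Gamma>]) (simp_all add: group_hom.intro group_hom_axioms.intro A.L.H.is_group B.L.H.is_group Gam_map_hom[OF base])

text \<open>Base change is transitive, and red B after f is red A.\<close>

lemma \<Gamma>_red:
  assumes \<phi>: "\<phi> \<in> carrier (Gam A)"
  shows "Gam_map B k (red B) (\<Gamma> \<phi>) = Gam_map A k (red A) \<phi>"
proof -
  have "lies_over A (red B \<circ> f) \<phi> (Gam_map B k (red B) (\<Gamma> \<phi>))"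
    by (rule lies_over_comp[OF fD(2) Gam_map(2)[OF base \<phi>] Gam_map(2)[OF red_base_change[OF AB(2)] \<Gamma>_closed[OF \<phi>]]])
  then have "lies_over A (red A) \<phi> (Gam_map B k (red B) (\<Gamma> \<phi>))"
    using lies_over_cong[OF Art_power_series[OF AB(1)] \<phi>, of "red B \<circ> f" "red A"] fD(4) by simp
  then show ?thesis
    using lies_over_red_iff[OF AB(1) \<phi> B.L.\<pi>_closed[OF \<Gamma>_closed[OF \<phi>]]] by simp
qed

definition push :: "'g monoid \<Rightarrow> ('g, 'u) lift \<Rightarrow> ('g, 'u) lift" where
  "push M \<sigma> = (\<lambda>g\<in>carrier M. \<Gamma> (\<sigma> g))"

lemma push_hlift:
  assumes \<sigma>: "\<sigma> \<in> A.L.hlifts M \<rho>" and M: "group M"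
  shows "push M \<sigma> \<in> B.L.hlifts M \<rho>"
proof (rule B.L.hliftsI)
  note c = A.L.hliftsD[OF \<sigma>]
  fix g h assume g: "g \<in> carrier M"
  show "push M \<sigma> g \<in> carrier (Gam B)" using c(2)[OF g] \<Gamma>_closed g by (simp add: push_def)
  show "Gam_map B k (red B) (push M \<sigma> g) = \<rho> g" using c(2,3)[OF g] \<Gamma>_red g by (simp add: push_def)
  assume h: "h \<in> carrier M"
  show "push M \<sigma> (g \<otimes>\<^bsub>M\<^esub> h) = push M \<sigma> g \<otimes>\<^bsub>Gam B\<^esub> push M \<sigma> h"
    using c(2)[OF g] c(2)[OF h] c(4)[OF g h] monoid.m_closed[OF group.is_monoid[OF M]] g h \<Gamma>_mult by (simp add: push_def)
qed (simp add: push_def)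

text \<open>An element of the kernel that relates two lifts is pushed into the kernel over B, so
  equivalent lifts have equivalent images.\<close>

lemma fmap_class:
  assumes \<sigma>: "\<sigma> \<in> A.L.hlifts M \<rho>" and M: "group M"
    and MG: "carrier M \<subseteq> carrier G"
  shows "fmap (def_functor k M \<rho>) A B f (A.L.hequiv M \<rho> `` {\<sigma>}) = B.L.hequiv M \<rho> `` {push M \<sigma>}"
proof -
  have "(\<Union>\<sigma>\<in>A.L.hequiv M \<rho> `` {\<sigma>}. B.L.hequiv M \<rho> `` {push M \<sigma>}) = B.L.hequiv M \<rho> `` {push M \<sigma>}"
  proof (rule UN_equiv_class_const[OF A.L.hequiv_equiv \<sigma>])
    fix \<tau> assume "(\<sigma>, \<tau>) \<in> A.L.hequiv M \<rho>"
    then obtain \<gamma> where \<gamma>: "\<tau> \<in> A.L.hlifts M \<rho>" "\<gamma> \<in> A.L.ker"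
        "\<And>g. g \<in> carrier M \<Longrightarrow> \<tau> g = \<gamma> \<otimes>\<^bsub>Gam A\<^esub> \<sigma> g \<otimes>\<^bsub>Gam A\<^esub> inv\<^bsub>Gam A\<^esub> \<gamma>"
      by (rule A.L.hequivE) blast
    have "(push M \<sigma>, push M \<tau>) \<in> B.L.hequiv M \<rho>"
    proof (rule B.L.hequivI[OF push_hlift[OF \<sigma> M] push_hlift[OF \<gamma>(1) M], of "\<Gamma> \<gamma>"])
      show "\<Gamma> \<gamma> \<in> B.L.ker" using \<gamma>(2) \<Gamma>_red \<Gamma>_closed by (simp add: A.L.ker_def B.L.ker_def)
      show "push M \<tau> g = \<Gamma> \<gamma> \<otimes>\<^bsub>Gam B\<^esub> push M \<sigma> g \<otimes>\<^bsub>Gam B\<^esub> inv\<^bsub>Gam B\<^esub> \<Gamma> \<gamma>" if g: "g \<in> carrier M" for g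
        using \<gamma>(3)[OF g] g A.L.ker_carrier[OF \<gamma>(2)] A.L.hliftsD(2)[OF \<sigma> g] by (simp add: push_def \<Gamma>_mult \<Gamma>_inv)
    qed
    then show "B.L.hequiv M \<rho> `` {push M \<tau>} = B.L.hequiv M \<rho> `` {push M \<sigma>}" by (rule B.class_eq[symmetric])
  qed
  then show ?thesis
    unfolding def_functor_def set_functor.simps B.lift_equiv_eq[OF MG] push_def .
qed

lemma fmap_closed:
  assumes \<kappa>: "\<kappa> \<in> fobj (def_functor k M \<rho>) A" and M: "group M"
    and MG: "carrier M \<subseteq> carrier G"
  shows "fmap (def_functor k M \<rho>) A B f \<kappa> \<in> fobj (def_functor k M \<rho>) B"
proof -
  obtain \<sigma> where \<sigma>: "\<sigma> \<in> A.L.hlifts M \<rho>" "\<kappa> = A.L.hequiv M \<rho> `` {\<sigma>}" using A.classE[OF \<kappa> MG] by blast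
  thm fmap_class[OF \<sigma>(1) M MG] fmap_class
  show ?thesis unfolding \<sigma>(2) fmap_class[OF \<sigma>(1) M MG] by (rule B.class_mem[OF push_hlift[OF \<sigma>(1) M] MG])
qed

lemma GN_group: "group (sub_group G N)"
  by (rule subgroup.subgroup_is_group[OF N.subgroup_axioms N.is_group])

lemma res_natural:
  assumes \<kappa>: "\<kappa> \<in> fobj (def_functor k G \<rho>) A"
  shows "res_map k G N \<rho> B (fmap (def_functor k G \<rho>) A B f \<kappa>) = fmap (def_functor k (sub_group G N) \<rho>) A B f (res_map k G N \<rho> A \<kappa>)"
proof -
  obtain \<sigma> where \<sigma>: "\<sigma> \<in> A.L.hlifts G \<rho>" "\<kappa> = A.L.hequiv G \<rho> `` {\<sigma>}" using A.classE[OF \<kappa> subset_refl] by blast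
  have rl: "restrict \<sigma> N \<in> A.L.hlifts (sub_group G N) \<rho>" by (rule A.L.restrict_hlift[OF \<sigma>(1) N.subset A.L.N_mult])
  have "restrict (push G \<sigma>) N = push (sub_group G N) (restrict \<sigma> N)"
    using N.mem_carrier by (auto simp: push_def)
  then show ?thesis
    unfolding \<sigma>(2) fmap_class[OF \<sigma>(1) N.is_group subset_refl] A.res_class[OF \<sigma>(1)] B.res_class[OF push_hlift[OF \<sigma>(1) N.is_group]]
      fmap_class[OF rl GN_group A.GN_subset] by simp
qed

lemma conj_act_natural:
  assumes g: "g \<in> carrier G" and \<kappa>: "\<kappa> \<in> fobj (def_functor k (sub_group G N) \<rho>) A"
  shows "conj_act k G N \<rho> B g (fmap (def_functor k (sub_group G N) \<rho>) A B f \<kappa>) =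
    fmap (def_functor k (sub_group G N) \<rho>) A B f (conj_act k G N \<rho> A g \<kappa>)"
proof -
  obtain \<sigma> where \<sigma>: "\<sigma> \<in> A.L.hlifts (sub_group G N) \<rho>" "\<kappa> = A.L.hequiv (sub_group G N) \<rho> `` {\<sigma>}"
    using A.classE[OF \<kappa> A.GN_subset] by blast
  obtain r where r: "r \<in> carrier (Gam A)" "Gam_map A k (red A) r = \<rho> g" using A.over_ex[OF g] by blast
  have r': "\<Gamma> r \<in> carrier (Gam B)" "Gam_map B k (red B) (\<Gamma> r) = \<rho> g" using r \<Gamma>_closed \<Gamma>_red by simp_all
  have "B.L.cj g (\<Gamma> r) (push (sub_group G N) \<sigma>) = push (sub_group G N) (A.L.cj g r \<sigma>)"
    using A.L.N_conj(1)[OF g] A.L.hliftsD(2)[OF \<sigma>(1)] r(1)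
    by (auto simp: push_def A.L.cj_def B.L.cj_def \<Gamma>_mult \<Gamma>_inv)
  then show ?thesis
    unfolding \<sigma>(2) fmap_class[OF \<sigma>(1) GN_group A.GN_subset] A.conj_class[OF g r \<sigma>(1)]
      fmap_class[OF A.L.cj_hlift[OF g r \<sigma>(1)] GN_group A.GN_subset] B.conj_class[OF g r' push_hlift[OF \<sigma>(1) GN_group]] by simp
qed

end

theorem res_nat_iso:
  "nat_iso p k (def_functor k G \<rho> :: ('u, 'k, ('g, 'u) lift set) set_functor) (inv_functor k G N \<rho>) (res_map k G N \<rho>)"
  unfolding nat_iso_def nat_trans_def
proof (intro conjI ballI)
  fix A :: "('u, 'k) walg" assume A: "A \<in> Art p k"
  interpret A: deformation_at p k N G \<rho> A by (rule at[OF A])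
  show bij: "bij_betw (res_map k G N \<rho> A) (fobj (def_functor k G \<rho>) A) (fobj (inv_functor k G N \<rho>) A)" by (rule A.res_bij)
  show "res_map k G N \<rho> A \<kappa> \<in> fobj (inv_functor k G N \<rho>) A" if "\<kappa> \<in> fobj (def_functor k G \<rho>) A" for \<kappa>
    using bij that by (auto simp: bij_betw_def)
  fix B :: "('u, 'k) walg" and f \<kappa>
  assume "B \<in> Art p k" "f \<in> walg_hom p k A B" "\<kappa> \<in> fobj (def_functor k G \<rho>) A"
  then show "res_map k G N \<rho> B (fmap (def_functor k G \<rho>) A B f \<kappa>) = fmap (inv_functor k G N \<rho>) A B f (res_map k G N \<rho> A \<kappa>)"
    using res_natural[OF A] by (simp add: inv_functor_def)
qed

end

section \<open>Representing the invariant deformations\<close>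

context coeff_field
begin

lemma walg_iso_compose:
  fixes A :: "('a, 'k) walg" and B :: "('b, 'k) walg" and D :: "('c, 'k) walg"
  assumes A: "local_walg p k A" and B: "local_walg p k B" and D: "local_walg p k D"
    and f: "f \<in> walg_iso p k A B" and g: "g \<in> walg_iso p k B D"
  shows "compose (carrier A) g f \<in> walg_iso p k A D"
  using f g walg_hom_compose[OF A B D] bij_betw_compose by (auto simp: walg_iso_def)

lemma precompose_iso_bij:
  fixes R S A :: "('u, 'k) walg"
  assumes R: "local_walg p k R" and S: "local_walg p k S" and A: "local_walg p k A" and u: "u \<in> walg_iso p k S R"
  shows "bij_betw (\<lambda>f. compose (carrier S) f u) (walg_hom p k R A) (walg_hom p k S A)"
proof -
  let ?v = "\<lambda>y\<in>carrier R. inv_into (carrier S) u y"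
  have uh: "u \<in> walg_hom p k S R" and bij: "bij_betw u (carrier S) (carrier R)" using u by (simp_all add: walg_iso_def)
  have vh: "?v \<in> walg_hom p k R S" using walg_iso_inv[OF S R u] by (simp add: walg_iso_def)
  have uv: "u (?v y) = y" "?v y \<in> carrier S" if "y \<in> carrier R" for y
    using that bij by (auto simp: bij_betw_def f_inv_into_f inv_into_into)
  have vu: "?v (u x) = x" "u x \<in> carrier R" if "x \<in> carrier S" for x using that bij by (auto simp: bij_betw_def)
  show ?thesis
  proof (rule bij_betwI[where g = "\<lambda>f. compose (carrier R) f ?v"])
    show "(\<lambda>f. compose (carrier S) f u) \<in> walg_hom p k R A \<rightarrow> walg_hom p k S A" using walg_hom_compose[OF S R A uh] by blast
    show "(\<lambda>f. compose (carrier R) f ?v) \<in> walg_hom p k S A \<rightarrow> walg_hom p k R A" using walg_hom_compose[OF R S A vh] by blast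
    show "compose (carrier R) (compose (carrier S) f u) ?v = f" if f: "f \<in> walg_hom p k R A" for f
      by (rule walg_hom_eqI[OF walg_hom_compose[OF R S A vh walg_hom_compose[OF S R A uh f]] f]) (simp only: compose_apply uv)
    show "compose (carrier S) (compose (carrier R) f ?v) u = f" if f: "f \<in> walg_hom p k S A" for f
      by (rule walg_hom_eqI[OF walg_hom_compose[OF S R A uh walg_hom_compose[OF R S A vh f]] f]) (simp only: compose_apply vu)
  qed
qed

text \<open>The automorphisms \<open>yoneda_aut\<close> are formed with respect to the given hull,
  so \<xi> itself must be an isomorphism. It is \<eta> after precomposition with a ring
  isomorphism.\<close>

lemma hull_nat_iso:
  fixes R S :: "('u, 'k) walg" and D :: "('u, 'k, 'x) set_functor"
  assumes S: "S \<in> Art_hat p k" and \<eta>: "nat_iso p k (hom_functor p k S) D \<eta>" and \<xi>: "versal_hull p k R \<xi> D"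
  shows "nat_iso p k (hom_functor p k R) D \<xi>"
proof -
  have R: "R \<in> Art_hat p k" and nt: "nat_trans p k (hom_functor p k R) D \<xi>" using \<xi> by (simp_all add: versal_hull_def smooth_trans_def)
  obtain u where u: "u \<in> walg_iso p k S R"
    "\<And>(A :: ('u, 'k) walg) f. \<lbrakk>A \<in> Art p k; f \<in> walg_hom p k R A\<rbrakk> \<Longrightarrow> \<xi> A f = \<eta> A (compose (carrier S) f u)"
    by (rule hull_unique[OF S \<eta> \<xi>]) blast
  have "bij_betw (\<xi> A) (walg_hom p k R A) (fobj D A)" if A: "A \<in> Art p k" for A
  proof -
    have "bij_betw (\<eta> A \<circ> (\<lambda>f. compose (carrier S) f u)) (walg_hom p k R A) (fobj D A)"
      using bij_betw_trans[OF precompose_iso_bij[OF Art_hat_local[OF R] Art_hat_local[OF S] Art_local[OF A] u(1)]]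
        nat_isoD(1)[OF \<eta> A] by (simp add: hom_functor_simps)
    then show ?thesis by (rule bij_betw_cong[THEN iffD1, rotated]) (simp add: u(2)[OF A])
  qed
  with nt show ?thesis by (simp add: nat_iso_def hom_functor_simps)
qed

end

locale represented_deformation = deformation p k N G \<rho>
  for p :: nat and k :: "'k ring" and N and G :: "'g monoid" (structure) and \<rho> +
  fixes R :: "('u, 'k) walg" and \<xi> :: "('u, 'k) walg \<Rightarrow> ('u \<Rightarrow> 'u) \<Rightarrow> ('g, 'u) lift set"
  assumes R: "R \<in> Art_hat p k"
    and \<xi>: "nat_iso p k (hom_functor p k R) (def_functor k (sub_group G N) \<rho>) \<xi>"
begin

lemmas Rl = Art_hat_local[OF R]

abbreviation "act A g \<equiv> conj_act k G N \<rho> A g"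

lemma \<xi>_bij: "A \<in> Art p k \<Longrightarrow> bij_betw (\<xi> A) (walg_hom p k R A) (fobj (def_functor k (sub_group G N) \<rho>) A)"
  using nat_isoD(1)[OF \<xi>] by (simp add: hom_functor_simps)

lemma \<xi>_closed: "\<lbrakk>A \<in> Art p k; f \<in> walg_hom p k R A\<rbrakk> \<Longrightarrow> \<xi> A f \<in> fobj (def_functor k (sub_group G N) \<rho>) A"
  using \<xi>_bij by (auto simp: bij_betw_def)

lemma \<xi>_inj: "\<lbrakk>A \<in> Art p k; f \<in> walg_hom p k R A; f' \<in> walg_hom p k R A; \<xi> A f = \<xi> A f'\<rbrakk> \<Longrightarrow> f = f'"
  using \<xi>_bij[of A] by (auto simp: bij_betw_def inj_on_def)

lemma \<xi>_nat: "\<lbrakk>A \<in> Art p k; B \<in> Art p k; h \<in> walg_hom p k A B; f \<in> walg_hom p k R A\<rbrakk> \<Longrightarrow>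
    \<xi> B (compose (carrier R) h f) = fmap (def_functor k (sub_group G N) \<rho>) A B h (\<xi> A f)"
  using nat_isoD(2)[OF \<xi>, of A B h f] by (simp add: hom_functor_simps)

lemma act_closed: "\<lbrakk>A \<in> Art p k; g \<in> carrier G; \<kappa> \<in> fobj (def_functor k (sub_group G N) \<rho>) A\<rbrakk> \<Longrightarrow>
    act A g \<kappa> \<in> fobj (def_functor k (sub_group G N) \<rho>) A" for A :: "('u, 'k) walg"
  by (rule deformation_at.conj_act_closed[OF at])

text \<open>\<open>yoneda_aut\<close> also asks for bijectivity. Leaving it out here lets existence
  and uniqueness come straight from Yoneda; \<open>induces_iso\<close> recovers it.\<close>

definition induces :: "'g \<Rightarrow> ('u \<Rightarrow> 'u) \<Rightarrow> bool" where
  "induces g \<alpha> \<longleftrightarrow> \<alpha> \<in> walg_hom p k R R \<and>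
    (\<forall>A\<in>Art p k. \<forall>f\<in>walg_hom p k R A. \<xi> A (compose (carrier R) f \<alpha>) = act A g (\<xi> A f))"

lemma inducesD:
  assumes "induces g \<alpha>"
  shows "\<alpha> \<in> walg_hom p k R R"
    "\<And>A f. \<lbrakk>A \<in> Art p k; f \<in> walg_hom p k R A\<rbrakk> \<Longrightarrow> \<xi> A (compose (carrier R) f \<alpha>) = act A g (\<xi> A f)"
    "\<And>A f. \<lbrakk>A \<in> Art p k; f \<in> walg_hom p k R A\<rbrakk> \<Longrightarrow> compose (carrier R) f \<alpha> \<in> walg_hom p k R A"
  using assms walg_hom_compose[OF Rl Rl Art_local] by (auto simp: induces_def)

lemma induces_ex:
  assumes g: "g \<in> carrier G"
  shows "\<exists>\<alpha>. induces g \<alpha>"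
proof -
  define T where "T A f = inv_into (walg_hom p k R A) (\<xi> A) (act A g (\<xi> A f))" for A f
  have T: "T A f \<in> walg_hom p k R A" "\<xi> A (T A f) = act A g (\<xi> A f)" if "A \<in> Art p k" "f \<in> walg_hom p k R A" for A f
    using \<xi>_bij[OF that(1)] act_closed[OF that(1) g \<xi>_closed[OF that]]
    by (auto simp: T_def bij_betw_def inv_into_into f_inv_into_f)
  have T_nat: "T B (compose (carrier R) h f) = compose (carrier R) h (T A f)"
    if a: "A \<in> Art p k" "B \<in> Art p k" "h \<in> walg_hom p k A B" "f \<in> walg_hom p k R A" for A B f h
  proof (rule \<xi>_inj[OF a(2)])
    have hf: "compose (carrier R) h f \<in> walg_hom p k R B"
      by (rule walg_hom_compose[OF Rl Art_local[OF a(1)] Art_local[OF a(2)] a(4,3)])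
    show "T B (compose (carrier R) h f) \<in> walg_hom p k R B" by (rule T(1)[OF a(2) hf])
    show "compose (carrier R) h (T A f) \<in> walg_hom p k R B"
      by (rule walg_hom_compose[OF Rl Art_local[OF a(1)] Art_local[OF a(2)] T(1)[OF a(1,4)] a(3)])
    show "\<xi> B (T B (compose (carrier R) h f)) = \<xi> B (compose (carrier R) h (T A f))"
      using conj_act_natural[OF a(1-3) g \<xi>_closed[OF a(1,4)]]
      unfolding T(2)[OF a(2) hf] \<xi>_nat[OF a(1-3) T(1)[OF a(1,4)]] T(2)[OF a(1,4)] \<xi>_nat[OF a] .
  qed
  obtain \<alpha> where \<alpha>: "\<alpha> \<in> walg_hom p k R R" "\<And>A f. \<lbrakk>A \<in> Art p k; f \<in> walg_hom p k R A\<rbrakk> \<Longrightarrow> T A f = compose (carrier R) f \<alpha>"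
    by (rule yoneda[where T = T, OF R R T(1) T_nat]) blast+
  have "\<xi> A (compose (carrier R) f \<alpha>) = act A g (\<xi> A f)" if "A \<in> Art p k" "f \<in> walg_hom p k R A" for A f
    using T(2)[OF that] \<alpha>(2)[OF that] by simp
  then show ?thesis using \<alpha>(1) by (auto simp: induces_def)
qed

lemma induces_unique:
  assumes "induces g \<alpha>" "induces g \<beta>"
  shows "\<alpha> = \<beta>"
proof (rule yoneda_unique[OF R R inducesD(1)[OF assms(1)] inducesD(1)[OF assms(2)]])
  fix A :: "('u, 'k) walg" and f assume a: "A \<in> Art p k" "f \<in> walg_hom p k R A"
  show "compose (carrier R) f \<alpha> = compose (carrier R) f \<beta>"
    by (rule \<xi>_inj[OF a(1) inducesD(3)[OF assms(1) a] inducesD(3)[OF assms(2) a]])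
       (simp add: inducesD(2)[OF assms(1) a] inducesD(2)[OF assms(2) a])
qed

text \<open>The actions of g and its inverse cancel on classes, and Yoneda transfers this to
  R.\<close>

lemma induces_inverse:
  assumes g: "g \<in> carrier G" and \<alpha>: "induces g \<alpha>" and \<beta>: "induces (inv g) \<beta>" and x: "x \<in> carrier R"
  shows "\<alpha> (\<beta> x) = x"
proof -
  have "compose (carrier R) \<alpha> \<beta> = (\<lambda>x\<in>carrier R. x)"
  proof (rule yoneda_unique[OF R R walg_hom_compose[OF Rl Rl Rl inducesD(1)[OF \<beta>] inducesD(1)[OF \<alpha>]] walg_hom_id[OF Rl]])
    fix A :: "('u, 'k) walg" and f assume a: "A \<in> Art p k" "f \<in> walg_hom p k R A"
    note b = a(1) inducesD(3)[OF \<alpha> a]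
    have "\<xi> A (compose (carrier R) (compose (carrier R) f \<alpha>) \<beta>) = \<xi> A f"
      using deformation_at.conj_act_inv[OF at[OF a(1)] g \<xi>_closed[OF a]]
      unfolding inducesD(2)[OF \<beta> b] inducesD(2)[OF \<alpha> a] .
    then have "compose (carrier R) (compose (carrier R) f \<alpha>) \<beta> = f"
      by (rule \<xi>_inj[OF a(1) inducesD(3)[OF \<beta> b] a(2)])
    moreover have "compose (carrier R) f (compose (carrier R) \<alpha> \<beta>) = compose (carrier R) (compose (carrier R) f \<alpha>) \<beta>"
      using walg_homD(5)[OF Rl Rl inducesD(1)[OF \<beta>]] by (auto simp: compose_def fun_eq_iff)
    moreover have "compose (carrier R) f (\<lambda>x\<in>carrier R. x) = f"
      using walg_homD(1)[OF Rl Art_local[OF a(1)] a(2)] by (auto simp: compose_def fun_eq_iff extensional_def)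
    ultimately show "compose (carrier R) f (compose (carrier R) \<alpha> \<beta>) = compose (carrier R) f (\<lambda>x\<in>carrier R. x)" by simp
  qed
  from fun_cong[OF this, of x] show ?thesis using x by (simp add: compose_apply)
qed

text \<open>\<open>induces_inverse\<close> is used for g and again for its inverse, so that the
  cancellation holds on both sides.\<close>

lemma induces_iso:
  assumes g: "g \<in> carrier G" and \<alpha>: "induces g \<alpha>"
  shows "\<alpha> \<in> walg_iso p k R R"
proof -
  obtain \<beta> where \<beta>: "induces (inv g) \<beta>" using induces_ex[of "inv g"] g by auto
  have \<alpha>': "induces (inv (inv g)) \<alpha>" using \<alpha> g by simp
  have "bij_betw \<alpha> (carrier R) (carrier R)"
    using walg_homD(5)[OF Rl Rl inducesD(1)[OF \<alpha>]] walg_homD(5)[OF Rl Rl inducesD(1)[OF \<beta>]]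
      induces_inverse[OF g \<alpha> \<beta>] induces_inverse[OF N.inv_closed[OF g] \<beta> \<alpha>']
    by (intro bij_betwI[where g = \<beta>]) auto
  then show ?thesis using inducesD(1)[OF \<alpha>] by (simp add: walg_iso_def)
qed

abbreviation "aut g \<equiv> yoneda_aut p k G N \<rho> R \<xi> g"

lemma aut_induces:
  assumes g: "g \<in> carrier G"
  shows "induces g (aut g)"
proof -
  obtain \<alpha> where \<alpha>: "induces g \<alpha>" using induces_ex[OF g] by blast
  have "aut g = \<alpha>"
    unfolding yoneda_aut_def
  proof (rule the_equality)
    show "\<alpha> \<in> walg_iso p k R R \<and> (\<forall>A\<in>Art p k. \<forall>f\<in>walg_hom p k R A. \<xi> A (compose (carrier R) f \<alpha>) = act A g (\<xi> A f))"
      using induces_iso[OF g \<alpha>] inducesD(2)[OF \<alpha>] by blast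
    fix \<beta> assume "\<beta> \<in> walg_iso p k R R \<and> (\<forall>A\<in>Art p k. \<forall>f\<in>walg_hom p k R A. \<xi> A (compose (carrier R) f \<beta>) = act A g (\<xi> A f))"
    then have "induces g \<beta>" by (simp add: induces_def walg_iso_def)
    then show "\<beta> = \<alpha>" using induces_unique \<alpha> by blast
  qed
  then show ?thesis using \<alpha> by simp
qed

lemma aut_closed: "\<lbrakk>g \<in> carrier G; x \<in> carrier R\<rbrakk> \<Longrightarrow> aut g x \<in> carrier R"
  by (rule walg_homD(5)[OF Rl Rl inducesD(1)[OF aut_induces]])

abbreviation "I \<equiv> coinv_ideal p k G N \<rho> R \<xi>"

interpretation R: local_cring R "max_ideal k R"
  by (rule local_walg_local_cring[OF Rl])

interpretation r: ring_hom_cring R k "red R"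
  by (rule red_hom_ring[OF Rl])

lemma generators: "{aut g x \<ominus>\<^bsub>R\<^esub> x | g x. g \<in> carrier G \<and> x \<in> carrier R} \<subseteq> carrier R"
  using aut_closed by auto

lemma I_ideal: "ideal I R"
  unfolding coinv_ideal_def by (rule R.genideal_ideal[OF generators])

lemma I_generator: "\<lbrakk>g \<in> carrier G; x \<in> carrier R\<rbrakk> \<Longrightarrow> aut g x \<ominus>\<^bsub>R\<^esub> x \<in> I"
  unfolding coinv_ideal_def using R.genideal_self[OF generators] by blast

lemma I_minimal:
  assumes J: "ideal J R" and gen: "\<And>g x. \<lbrakk>g \<in> carrier G; x \<in> carrier R\<rbrakk> \<Longrightarrow> aut g x \<ominus>\<^bsub>R\<^esub> x \<in> J"
  shows "I \<subseteq> J"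
  unfolding coinv_ideal_def by (rule R.genideal_minimal[OF J]) (use gen in blast)

text \<open>Automorphisms over W(k) preserve residues. The containment keeps the quotient local with
  residue field k.\<close>

lemma I_max: "I \<subseteq> max_ideal k R"
proof (rule I_minimal[OF R.m_ideal])
  fix g x assume g: "g \<in> carrier G" and x: "x \<in> carrier R"
  show "aut g x \<ominus>\<^bsub>R\<^esub> x \<in> max_ideal k R"
    using x aut_closed[OF g x] walg_homD(4)[OF Rl Rl inducesD(1)[OF aut_induces[OF g]] x]
    by (simp add: mem_max_ideal R.minus_eq k.r_neg)
qed

lemma invariant_iff_kills:
  assumes A: "A \<in> Art p k" and f: "f \<in> walg_hom p k R A"
  shows "(\<forall>g\<in>carrier G. act A g (\<xi> A f) = \<xi> A f) \<longleftrightarrow> (\<forall>x\<in>I. f x = \<zero>\<^bsub>A\<^esub>)"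
proof -
  note Al = Art_local[OF A]
  interpret A: cring A by (rule local_walg_cring[OF Al])
  interpret f: ring_hom_cring R A f by (rule walg_homD(6)[OF Rl Al f])
  have fix_iff: "act A g (\<xi> A f) = \<xi> A f \<longleftrightarrow> (\<forall>x\<in>carrier R. f (aut g x) = f x)" if g: "g \<in> carrier G" for g
  proof -
    note ind = aut_induces[OF g]
    have "act A g (\<xi> A f) = \<xi> A f \<longleftrightarrow> compose (carrier R) f (aut g) = f"
      using \<xi>_inj[OF A inducesD(3)[OF ind A f] f] inducesD(2)[OF ind A f] by auto
    also have "\<dots> \<longleftrightarrow> (\<forall>x\<in>carrier R. f (aut g x) = f x)"
      using walg_hom_eqI[OF inducesD(3)[OF ind A f] f] by (metis compose_apply)
    finally show ?thesis .
  qed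
  have diff: "f (aut g x \<ominus>\<^bsub>R\<^esub> x) = \<zero>\<^bsub>A\<^esub> \<longleftrightarrow> f (aut g x) = f x" if "g \<in> carrier G" "x \<in> carrier R" for g x
  proof -
    have "f (aut g x \<ominus>\<^bsub>R\<^esub> x) = f (aut g x) \<ominus>\<^bsub>A\<^esub> f x" using that aut_closed by (simp add: R.minus_eq A.minus_eq)
    then show ?thesis using A.r_right_minus_eq[of "f (aut g x)" "f x"] that aut_closed by simp
  qed
  have "(\<forall>g\<in>carrier G. \<forall>x\<in>carrier R. f (aut g x) = f x) \<longleftrightarrow> (\<forall>x\<in>I. f x = \<zero>\<^bsub>A\<^esub>)"
  proof
    assume inv: "\<forall>g\<in>carrier G. \<forall>x\<in>carrier R. f (aut g x) = f x"
    \<comment> \<open>The kernel of f is an ideal, so it contains the generated ideal once it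
      contains the differences.\<close>
    have "I \<subseteq> {x \<in> carrier R. f x = \<zero>\<^bsub>A\<^esub>}"
    proof (rule I_minimal)
      show "ideal {x \<in> carrier R. f x = \<zero>\<^bsub>A\<^esub>} R" by (rule R.idealI_cring) auto
      show "aut g x \<ominus>\<^bsub>R\<^esub> x \<in> {x \<in> carrier R. f x = \<zero>\<^bsub>A\<^esub>}" if "g \<in> carrier G" "x \<in> carrier R" for g x
        using that inv diff aut_closed by simp
    qed
    then show "\<forall>x\<in>I. f x = \<zero>\<^bsub>A\<^esub>" by blast
  next
    assume "\<forall>x\<in>I. f x = \<zero>\<^bsub>A\<^esub>"
    then show "\<forall>g\<in>carrier G. \<forall>x\<in>carrier R. f (aut g x) = f x" using diff I_generator by blast
  qed
  then show ?thesis using fix_iff by simp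
qed

text \<open>Maps from the quotient are the maps on R that kill the ideal, and these correspond to
  invariant classes; the inverse of \<open>res_map\<close> then leads to deformations for G.\<close>

theorem invariants_represented:
  assumes q: "walg_quotient R I S \<pi>"
  shows "nat_iso p k (hom_functor p k S) (def_functor k G \<rho>)
    (\<lambda>A f. inv_into (fobj (def_functor k G \<rho>) A) (res_map k G N \<rho> A) (\<xi> A (compose (carrier R) f \<pi>)))"
    (is "nat_iso p k _ ?D ?\<zeta>")
proof -
  note qD = walg_quotientD[OF Rl q]
  have pull: "compose (carrier R) f \<pi> \<in> walg_hom p k R A" if "A \<in> Art p k" "f \<in> walg_hom p k S A" for A f
    by (rule walg_hom_compose[OF Rl qD(1) Art_local[OF that(1)] qD(2) that(2)])
  let ?inv = "\<lambda>A. fobj (inv_functor k G N \<rho>) A"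
  have pull_bij: "bij_betw (\<lambda>f. \<xi> A (compose (carrier R) f \<pi>)) (walg_hom p k S A) (?inv A)" if A: "A \<in> Art p k" for A
    unfolding bij_betw_def
  proof
    note Al = Art_local[OF A]
    show "inj_on (\<lambda>f. \<xi> A (compose (carrier R) f \<pi>)) (walg_hom p k S A)"
    proof (rule inj_onI)
      fix f h assume fh: "f \<in> walg_hom p k S A" "h \<in> walg_hom p k S A"
        and "\<xi> A (compose (carrier R) f \<pi>) = \<xi> A (compose (carrier R) h \<pi>)"
      then have eq: "compose (carrier R) f \<pi> = compose (carrier R) h \<pi>" by (intro \<xi>_inj[OF A pull[OF A] pull[OF A]])
      show "f = h"
      proof (rule walg_hom_eqI[OF fh])
        fix y assume "y \<in> carrier S"
        then obtain x where "x \<in> carrier R" "y = \<pi> x" using qD(4) by blast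
        then show "f y = h y" using fun_cong[OF eq, of x] by (simp add: compose_apply)
      qed
    qed
    show "(\<lambda>f. \<xi> A (compose (carrier R) f \<pi>)) ` walg_hom p k S A = ?inv A"
    proof (intro equalityI subsetI)
      fix \<kappa> assume "\<kappa> \<in> (\<lambda>f. \<xi> A (compose (carrier R) f \<pi>)) ` walg_hom p k S A"
      then obtain f where f: "f \<in> walg_hom p k S A" "\<kappa> = \<xi> A (compose (carrier R) f \<pi>)" by blast
      interpret f: ring_hom_cring S A f by (rule walg_homD(6)[OF qD(1) Al f(1)])
      have "compose (carrier R) f \<pi> x = \<zero>\<^bsub>A\<^esub>" if x: "x \<in> I" for x
      proof -
        have xR: "x \<in> carrier R" by (rule ideal.Icarr[OF I_ideal x])
        have "\<pi> x = \<zero>\<^bsub>S\<^esub>" using qD(5)[OF xR] x by blast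
        then show ?thesis using xR by (simp add: compose_apply)
      qed
      then have "\<forall>g\<in>carrier G. act A g \<kappa> = \<kappa>" using invariant_iff_kills[OF A pull[OF A f(1)]] f(2) by blast
      then show "\<kappa> \<in> ?inv A" using \<xi>_closed[OF A pull[OF A f(1)]] f(2) by (simp add: inv_functor_def)
    next
      fix \<kappa> assume "\<kappa> \<in> ?inv A"
      then have \<kappa>: "\<kappa> \<in> fobj (def_functor k (sub_group G N) \<rho>) A" "\<forall>g\<in>carrier G. act A g \<kappa> = \<kappa>"
        by (simp_all add: inv_functor_def)
      then obtain h where h: "h \<in> walg_hom p k R A" "\<kappa> = \<xi> A h" using \<xi>_bij[OF A] unfolding bij_betw_def by blast
      have kill: "h x = \<zero>\<^bsub>A\<^esub>" if "x \<in> I" "x \<in> carrier R" for x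
        using \<kappa>(2) invariant_iff_kills[OF A h(1)] that(1) unfolding h(2) by blast
      obtain f where f: "f \<in> walg_hom p k S A" "\<forall>x\<in>carrier R. f (\<pi> x) = h x"
        using walg_quotient_factor[OF Rl q Al h(1) kill] by blast
      have "compose (carrier R) f \<pi> = h"
        by (rule walg_hom_eqI[OF pull[OF A f(1)] h(1)]) (simp add: compose_apply f(2))
      then show "\<kappa> \<in> (\<lambda>f. \<xi> A (compose (carrier R) f \<pi>)) ` walg_hom p k S A" using f(1) h(2) by blast
    qed
  qed
  have res: "bij_betw (res_map k G N \<rho> A) (fobj ?D A) (?inv A)" if "A \<in> Art p k" for A :: "('u, 'k) walg"
    by (rule deformation_at.res_bij[OF at[OF that]])
  have bij: "bij_betw (?\<zeta> A) (walg_hom p k S A) (fobj ?D A)" if A: "A \<in> Art p k" for A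
    using bij_betw_trans[OF pull_bij[OF A] bij_betw_inv_into[OF res[OF A]]] by (simp add: comp_def)
  have \<zeta>: "?\<zeta> A f \<in> fobj ?D A" "res_map k G N \<rho> A (?\<zeta> A f) = \<xi> A (compose (carrier R) f \<pi>)"
    if a: "A \<in> Art p k" "f \<in> walg_hom p k S A" for A f
  proof -
    show "?\<zeta> A f \<in> fobj ?D A" by (rule bij_betw_apply[OF bij[OF a(1)] a(2)])
    show "res_map k G N \<rho> A (?\<zeta> A f) = \<xi> A (compose (carrier R) f \<pi>)"
      by (rule bij_betw_inv_into_right[OF res[OF a(1)] bij_betw_apply[OF pull_bij[OF a(1)] a(2)]])
  qed
  have natural: "?\<zeta> B (compose (carrier S) h f) = fmap ?D A B h (?\<zeta> A f)"
    if a: "A \<in> Art p k" "B \<in> Art p k" "h \<in> walg_hom p k A B" "f \<in> walg_hom p k S A" for A B h f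
  proof -
    have hf: "compose (carrier S) h f \<in> walg_hom p k S B"
      by (rule walg_hom_compose[OF qD(1) Art_local[OF a(1)] Art_local[OF a(2)] a(4,3)])
    \<comment> \<open>The inverse of \<open>res_map\<close> is a choice, so naturality is tested
      after applying \<open>res_map\<close>, which is natural and injective.\<close>
    have "res_map k G N \<rho> B (fmap ?D A B h (?\<zeta> A f)) =
        fmap (def_functor k (sub_group G N) \<rho>) A B h (\<xi> A (compose (carrier R) f \<pi>))"
      unfolding res_natural[OF a(1-3) \<zeta>(1)[OF a(1,4)]] \<zeta>(2)[OF a(1,4)] ..
    also have "\<dots> = \<xi> B (compose (carrier R) h (compose (carrier R) f \<pi>))"
      by (rule \<xi>_nat[OF a(1-3) pull[OF a(1,4)], symmetric])
    also have "compose (carrier R) h (compose (carrier R) f \<pi>) = compose (carrier R) (compose (carrier S) h f) \<pi>"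
      using qD(3) by (auto simp: compose_def fun_eq_iff)
    also have "\<xi> B \<dots> = res_map k G N \<rho> B (?\<zeta> B (compose (carrier S) h f))" by (rule \<zeta>(2)[OF a(2) hf, symmetric])
    finally have eq: "res_map k G N \<rho> B (fmap ?D A B h (?\<zeta> A f)) = res_map k G N \<rho> B (?\<zeta> B (compose (carrier S) h f))" .
    have "fmap ?D A B h (?\<zeta> A f) \<in> fobj ?D B"
      by (rule fmap_closed[OF a(1-3) \<zeta>(1)[OF a(1,4)] N.is_group subset_refl])
    from inj_onD[OF bij_betw_imp_inj_on[OF res[OF a(2)]] eq this \<zeta>(1)[OF a(2) hf]] show ?thesis by (rule sym)
  qed
  show ?thesis
    unfolding nat_iso_def nat_trans_def hom_functor_simps
  proof (intro conjI ballI)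
    show "?\<zeta> A f \<in> fobj ?D A" if "A \<in> Art p k" "f \<in> walg_hom p k S A" for A f by (rule \<zeta>(1)[OF that])
    show "?\<zeta> B (compose (carrier S) h f) = fmap ?D A B h (?\<zeta> A f)"
      if "A \<in> Art p k" "B \<in> Art p k" "h \<in> walg_hom p k A B" "f \<in> walg_hom p k S A" for A B h f by (rule natural[OF that])
    show "bij_betw (?\<zeta> A) (walg_hom p k S A) (fobj ?D A)" if "A \<in> Art p k" for A by (rule bij[OF that])
  qed
qed

end

theorem theorem2p8:
  fixes k :: "'k ring" and p :: nat
    and G :: "'g monoid" and N :: "'g set" and \<rho> :: "'g \<Rightarrow> (nat \<Rightarrow> 'k) \<Rightarrow> (nat \<Rightarrow> 'k)"
    and R\<^sub>G R\<^sub>N :: "('u, 'k) walg"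
    and \<xi>\<^sub>G \<xi>\<^sub>N :: "('u, 'k) walg \<Rightarrow> ('u \<Rightarrow> 'u) \<Rightarrow> ('g \<Rightarrow> (nat \<Rightarrow> 'u) \<Rightarrow> (nat \<Rightarrow> 'u)) set"
  defines "D\<^sub>G \<equiv> (def_functor k G \<rho> :: ('u, 'k, ('g, 'u) lift set) set_functor)"
    and "D\<^sub>N \<equiv> (def_functor k (sub_group G N) \<rho> :: ('u, 'k, ('g, 'u) lift set) set_functor)"
  assumes universe: "\<exists>e :: (nat \<Rightarrow> 'k) \<Rightarrow> 'u. inj_on e (carrier (witt p k))"
    and k: "perfect_field_of_char p k"
    and G: "group G" "finite (carrier G)"
    and \<rho>: "local_action k G \<rho>"
    and N: "N \<lhd> G" "coprime (order (G Mod N)) p"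
    and R\<^sub>G: "versal_hull p k R\<^sub>G \<xi>\<^sub>G D\<^sub>G"
    and R\<^sub>N: "versal_hull p k R\<^sub>N \<xi>\<^sub>N D\<^sub>N"
    and pro_rep: "pro_representable p k D\<^sub>N"
  shows "nat_iso p k D\<^sub>G (inv_functor k G N \<rho>) (res_map k G N \<rho>) \<and>
         pro_representable p k D\<^sub>G \<and>
         walg_iso p k R\<^sub>G (quot_walg R\<^sub>N (coinv_ideal p k G N \<rho> R\<^sub>N \<xi>\<^sub>N)) \<noteq> {}"
proof -
  interpret F: field k using k by (simp add: perfect_field_of_char_def)
  have p0: "[p] \<cdot>\<^bsub>k\<^esub> \<one>\<^bsub>k\<^esub> = \<zero>\<^bsub>k\<^esub>" using k by (simp add: perfect_field_of_char_def)
  interpret C: coeff_field p k by (intro coeff_field.intro F.field_axioms)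
  interpret D: deformation p k N G \<rho>
    by (intro deformation.intro deformation_axioms.intro C.coeff_field_axioms)
       (use G N \<rho> p0 in \<open>simp_all add: local_action_def\<close>)
  obtain R' :: "('u, 'k) walg" and \<eta> where R': "R' \<in> Art_hat p k" "nat_iso p k (hom_functor p k R') D\<^sub>N \<eta>"
    using pro_rep by (auto simp: pro_representable_def)
  have RN: "R\<^sub>N \<in> Art_hat p k" using R\<^sub>N by (simp add: versal_hull_def)
  have RG: "R\<^sub>G \<in> Art_hat p k" using R\<^sub>G by (simp add: versal_hull_def)
  note RNl = C.Art_hat_local[OF RN] and RGl = C.Art_hat_local[OF RG]
  \<comment> \<open>Pro-representability supplies some representing ring;
    \<open>hull_nat_iso\<close> moves the isomorphism to the given hull
    \<open>R\<^sub>N\<close>.\<close>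
  interpret E: represented_deformation p k N G \<rho> R\<^sub>N \<xi>\<^sub>N
    by (intro represented_deformation.intro represented_deformation_axioms.intro D.deformation_axioms RN)
       (use C.hull_nat_iso[OF R' R\<^sub>N] D\<^sub>N_def in simp)
  \<comment> \<open>The quotient is taken inside the type of \<open>R\<^sub>N\<close>, the only one
    over which \<open>pro_representable\<close> and \<open>hull_unique\<close> speak.\<close>
  obtain S \<pi> where q: "C.walg_quotient R\<^sub>N E.I S \<pi>"
    using C.walg_quotient_ex[OF RNl E.I_ideal E.I_max] by blast
  have S: "S \<in> Art_hat p k" by (rule C.Art_hat_quotient[OF RN q])
  note Sl = C.Art_hat_local[OF S]
  note iso = E.invariants_represented[OF q, folded D\<^sub>G_def]
  have pr: "pro_representable p k D\<^sub>G" unfolding pro_representable_def using S iso by blast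
  \<comment> \<open>S represents \<open>D\<^sub>G\<close>, and \<open>R\<^sub>G\<close> is a hull of
    it, so the two rings are isomorphic; what remains is the comparison of S with the quotient by
    cosets.\<close>
  obtain u where u: "u \<in> walg_iso p k S R\<^sub>G" by (rule C.hull_unique[OF S iso R\<^sub>G]) blast
  obtain w where w: "w \<in> walg_iso p k S (quot_walg R\<^sub>N E.I)" using C.walg_quotient_iso(2)[OF RNl E.I_ideal q] by blast
  have "walg_iso p k R\<^sub>G (quot_walg R\<^sub>N E.I) \<noteq> {}"
    using C.walg_iso_compose[OF RGl Sl C.walg_quotient_iso(1)[OF RNl E.I_ideal q] C.walg_iso_inv[OF Sl RGl u] w] by blast
  with pr D.res_nat_iso show ?thesis unfolding D\<^sub>G_def by blast
qed

end
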